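(* A left pointed double category $\mathbb{D}$ admits the structure of a CGW category if and only if it is local with respect to $$\{\mathsf{trcor},\ \mathsf{blcor},\ \mathbb{H}(\mathsf{mono}),\ \mathbb{V}(\mathsf{mono})\}$$ and strictly local with respect to $$\{\mathsf{trunc}_h,\ \mathsf{trunc}_v,\ \mathsf{hiso},\ \mathsf{viso},\ \mathsf{agree}(\mathsf{trcor}),\ \mathsf{agree}(\mathsf{blcor})\}.$$
   Context: A double category $\mathbb{D}$ has objects, horizontal morphisms (forming a category $\mathcal{H}(\mathbb{D})$), vertical morphisms (forming a category $\mathcal{V}(\mathbb{D})$ with the same objects), and squares; a square written (top $f$; left $h$; right $k$; bottom $g$) has boundary $f\colon A\to B$, $g\colon C\to D$ horizontal and $h\colon A\to C$, $k\colon B\to D$ vertical. Squares compose horizontally and vertically, with identities, subject to unit, associativity and interchange laws. $\mathbb{D}$ is left pointed if it has an object initial in both $\mathcal{H}(\mathbb{D})$ and $\mathcal{V}(\mathbb{D})$. For a double functor $i\colon\mathbb{A}\to\mathbb{B}$, $\mathbb{D}$ is $i$-local if every double functor $\mathbb{A}\to\mathbb{D}$ extends along $i$ to a double functor $\mathbb{B}\to\mathbb{D}$, and strictly $i$-local if the extension is always unique. (Locality is tested on the underlying double category; equivalently, one freely adjoins an initial object to $\mathbb{A}$ and $\mathbb{B}$ and works with left pointed double categories.) For a category $\mathcal{C}$, $\mathbb{H}(\mathcal{C})$ (resp. $\mathbb{V}(\mathcal{C})$) is the double category with the morphisms of $\mathcal{C}$ as horizontal (resp. vertical) morphisms and only identity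 vertical (resp. horizontal) morphisms and identity squares. $[1]=\{0\to1\}$; $[1]\boxtimes[1]$ is the free double category on one square; $\mathcal{E}$ is the walking isomorphism; $\mathcal{E}\rtimes_{\mathrm{id}}\mathcal{E}$ is the double category with both horizontal and vertical morphisms those of $\mathcal{E}$ and squares the commutative squares of $\mathcal{E}$. The double functors are: - $\mathsf{mono}$ is the identity-on-objects functor from the category freely generated by $f,f'\colon A\to B$, $g\colon B\to C$ with relation $gf=gf'$ to the category freely generated by $A\to B\to C$, sending $f,f'$ to the same morphism and $g$ to $g$. - $\mathsf{trcor}$ is the inclusion into $[1]\boxtimes[1]$ of its top and right edges; $\mathsf{blcor}$ is the inclusion of its left and bottom edges. - $\mathsf{trunc}_h$: from the double category freely generated by horizontal $\alpha,\beta\colon0\to1$ and a square (top $\alpha$; left $\mathrm{id}_0$; right $\mathrm{id}_1$; bottom $\beta$) to $\mathbb{H}([1])$, identity on objects; $\mathsf{trunc}_v$ is its transpose (exchange horizontal and vertical). - $\mathsf{hiso}\colon\mathbb{H}(\mathcal{E})\to\mathcal{E}\rtimes_{\mathrm{id}}\mathcal{E}$ and $\mathsf{viso}\colon\mathbb{V}(\mathcal{E})\to\mathcal{E}\rtimes_{\mathrm{id}}\mathcal{E}$ are the inclusions. - For $i\colon\mathbb{A}\to\mathbb{B}$, $\mathsf{agree}(i)\colon\mathsf{2copy}(i)\to\mathsf{isocopy}(i)$, where $\mathsf{2copy}(i)$ is the pushout of $\mathbb{B}\xleftarrow{i}\mathbb{A}\xrightarrow{i}\mathbb{B}$, $\mathsf{isocopy}(i)$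 is the pushout of $\mathbb{A}\leftarrow(\mathcal{E}\rtimes_{\mathrm{id}}\mathcal{E})\times\mathbb{A}\to(\mathcal{E}\rtimes_{\mathrm{id}}\mathcal{E})\times\mathbb{B}$ (projection and $\mathrm{id}\times i$), and $\mathsf{agree}(i)$ is induced by the inclusions of $\mathbb{B}$ at the objects $0$ and $1$. Thus $\mathsf{2copy}(\mathsf{trcor})$ consists of two squares with the same top and right morphisms and $\mathsf{isocopy}(\mathsf{trcor})$ additionally contains a natural shared isomorphism between them that is the identity on the three common objects. Shared isomorphism: a pair $(f,f')$ of a horizontal isomorphism $f\colon A\to B$ and a vertical isomorphism $f'\colon A\to B$ equipped with squares (top $f$; left $f'$; right $\mathrm{id}_B$; bottom $\mathrm{id}_B$), (top $\mathrm{id}_A$; left $\mathrm{id}_A$; right $f'$; bottom $f$), (top $f$; left $\mathrm{id}_A$; right $f'^{-1}$; bottom $\mathrm{id}_A$), (top $\mathrm{id}_A$; left $f'$; right $\mathrm{id}_A$; bottom $f^{-1}$). CGW structure. $\mathcal{H}(\mathbb{D}_v)$ is the category of vertical morphisms with squares as morphisms (composed horizontally), $\mathcal{V}(\mathbb{D}_h)$ the category of horizontal morphisms with squares as morphisms (composed vertically). $\mathcal{H}^\triangleleft(\mathbb{D}_h)$ has horizontal morphisms as objects and, as morphisms from $a\colon X\to Y$ to $b\colon X'\to Y'$, pairs $(s\colon X\to X',t\colon Y\to Y')$ of horizontal morphisms with $bs=ta$ and $s$ an isomorphism; $\mathcal{V}^\triangleleft(\mathbb{D}_v)$ is analogous for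 vertical morphisms. A CGW category is a double category $\mathbb{D}$ equipped with an identity-on-objects isomorphism $\varphi\colon\mathrm{iso}(\mathcal{H}(\mathbb{D}))\to\mathrm{iso}(\mathcal{V}(\mathbb{D}))$ and equivalences of categories $k\colon\mathcal{H}(\mathbb{D}_v)\to\mathcal{H}^\triangleleft(\mathbb{D}_h)$, $c\colon\mathcal{V}(\mathbb{D}_h)\to\mathcal{V}^\triangleleft(\mathbb{D}_v)$ such that: (Z) there is an object $\varnothing$ initial in both $\mathcal{H}(\mathbb{D})$ and $\mathcal{V}(\mathbb{D})$; (I) for every horizontal isomorphism $f$, $(f,\varphi(f))$ is a shared isomorphism; (M) every morphism of $\mathcal{H}(\mathbb{D})$ and of $\mathcal{V}(\mathbb{D})$ is a monomorphism; (K) for every vertical $g\colon A\to B$, the codomain of $k(g)\colon\ker(g)\to B$ is $B$ and there is a unique square with top $\varnothing\to A$, left $\varnothing\to\ker(g)$, right $g$, bottom $k(g)$; and for every horizontal $f\colon A\to B$, the codomain of $c(f)\colon\mathrm{coker}(f)\to B$ is $B$ and there is a unique square with top $\varnothing\to\mathrm{coker}(f)$, left $\varnothing\to A$, right $c(f)$, bottom $f$.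
   Formalization: In (K), the condition that k(g) and c(f) keep the codomain of g and f is required on morphisms too: k sends a square with bottom t to a pair (s,t), and c sends a square with right side t to a pair (s,t). With the condition on objects only, the stated equivalence is false. *)

theory Defs
  imports Main
begin

section \<open>Categories\<close>

text \<open>Composition is written in applicative order: \<open>Cmp C g f\<close> is \<open>g\<close> after \<open>f\<close>.\<close>

record ('o, 'm) cat =
  Obj :: "'o set"
  Mor :: "'m set"
  Dom :: "'m \<Rightarrow> 'o"
  Cod :: "'m \<Rightarrow> 'o"
  Idn :: "'o \<Rightarrow> 'm"
  Cmp :: "'m \<Rightarrow> 'm \<Rightarrow> 'm"

locale category =
  fixes C :: "('o, 'm) cat"
  assumes Dom_in: "f \<in> Mor C \<Longrightarrow> Dom C f \<in> Obj C"
    and Cod_in: "f \<in> Mor C \<Longrightarrow> Cod C f \<in> Obj C"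
    and Idn_in: "x \<in> Obj C \<Longrightarrow> Idn C x \<in> Mor C"
    and Dom_Idn: "x \<in> Obj C \<Longrightarrow> Dom C (Idn C x) = x"
    and Cod_Idn: "x \<in> Obj C \<Longrightarrow> Cod C (Idn C x) = x"
    and Cmp_in: "\<lbrakk>f \<in> Mor C; g \<in> Mor C; Cod C f = Dom C g\<rbrakk> \<Longrightarrow> Cmp C g f \<in> Mor C"
    and Dom_Cmp: "\<lbrakk>f \<in> Mor C; g \<in> Mor C; Cod C f = Dom C g\<rbrakk> \<Longrightarrow> Dom C (Cmp C g f) = Dom C f"
    and Cod_Cmp: "\<lbrakk>f \<in> Mor C; g \<in> Mor C; Cod C f = Dom C g\<rbrakk> \<Longrightarrow> Cod C (Cmp C g f) = Cod C g"
    and Cmp_Idn_right: "f \<in> Mor C \<Longrightarrow> Cmp C f (Idn C (Dom C f)) = f"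
    and Cmp_Idn_left: "f \<in> Mor C \<Longrightarrow> Cmp C (Idn C (Cod C f)) f = f"
    and Cmp_assoc: "\<lbrakk>f \<in> Mor C; g \<in> Mor C; h \<in> Mor C; Cod C f = Dom C g; Cod C g = Dom C h\<rbrakk>
      \<Longrightarrow> Cmp C h (Cmp C g f) = Cmp C (Cmp C h g) f"

definition inverse_arrows :: "('o, 'm) cat \<Rightarrow> 'm \<Rightarrow> 'm \<Rightarrow> bool" where
  "inverse_arrows C f g \<longleftrightarrow> f \<in> Mor C \<and> g \<in> Mor C \<and> Dom C g = Cod C f \<and> Cod C g = Dom C f
     \<and> Cmp C g f = Idn C (Dom C f) \<and> Cmp C f g = Idn C (Cod C f)"

definition iso_arrow :: "('o, 'm) cat \<Rightarrow> 'm \<Rightarrow> bool" where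
  "iso_arrow C f \<longleftrightarrow> (\<exists>g. inverse_arrows C f g)"

definition inv_arrow :: "('o, 'm) cat \<Rightarrow> 'm \<Rightarrow> 'm" where
  "inv_arrow C f = (THE g. inverse_arrows C f g)"

definition mono_arrow :: "('o, 'm) cat \<Rightarrow> 'm \<Rightarrow> bool" where
  "mono_arrow C m \<longleftrightarrow> m \<in> Mor C \<and>
     (\<forall>f \<in> Mor C. \<forall>g \<in> Mor C. Dom C f = Dom C g \<and> Cod C f = Dom C m \<and> Cod C g = Dom C m
        \<and> Cmp C m f = Cmp C m g \<longrightarrow> f = g)"

definition initial_obj :: "('o, 'm) cat \<Rightarrow> 'o \<Rightarrow> bool" where
  "initial_obj C z \<longleftrightarrow> z \<in> Obj C \<and>
     (\<forall>x \<in> Obj C. \<exists>!f. f \<in> Mor C \<and> Dom C f = z \<and> Cod C f = x)"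

definition initial_arrow :: "('o, 'm) cat \<Rightarrow> 'o \<Rightarrow> 'o \<Rightarrow> 'm" where
  "initial_arrow C z x = (THE f. f \<in> Mor C \<and> Dom C f = z \<and> Cod C f = x)"

text \<open>The category \<open>iso(C)\<close>.\<close>

definition iso_cat :: "('o, 'm) cat \<Rightarrow> ('o, 'm) cat" where
  "iso_cat C = C \<lparr>Mor := {f. iso_arrow C f}\<rparr>"

record ('o, 'm, 'p, 'n) cfun =
  csrc :: "('o, 'm) cat"
  ctgt :: "('p, 'n) cat"
  cobj :: "'o \<Rightarrow> 'p"
  cmor :: "'m \<Rightarrow> 'n"

locale cat_functor = source: category "csrc F" + target: category "ctgt F"
  for F :: "('o, 'm, 'p, 'n) cfun" +
  assumes cobj_in: "x \<in> Obj (csrc F) \<Longrightarrow> cobj F x \<in> Obj (ctgt F)"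
    and cmor_in: "f \<in> Mor (csrc F) \<Longrightarrow> cmor F f \<in> Mor (ctgt F)"
    and Dom_cmor: "f \<in> Mor (csrc F) \<Longrightarrow> Dom (ctgt F) (cmor F f) = cobj F (Dom (csrc F) f)"
    and Cod_cmor: "f \<in> Mor (csrc F) \<Longrightarrow> Cod (ctgt F) (cmor F f) = cobj F (Cod (csrc F) f)"
    and cmor_Idn: "x \<in> Obj (csrc F) \<Longrightarrow> cmor F (Idn (csrc F) x) = Idn (ctgt F) (cobj F x)"
    and cmor_Cmp: "\<lbrakk>f \<in> Mor (csrc F); g \<in> Mor (csrc F); Cod (csrc F) f = Dom (csrc F) g\<rbrakk>
      \<Longrightarrow> cmor F (Cmp (csrc F) g f) = Cmp (ctgt F) (cmor F g) (cmor F f)"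

definition id_cfun :: "('o, 'm) cat \<Rightarrow> ('o, 'm, 'o, 'm) cfun" where
  "id_cfun C = \<lparr>csrc = C, ctgt = C, cobj = (\<lambda>x. x), cmor = (\<lambda>f. f)\<rparr>"

definition comp_cfun ::
  "('p, 'n, 'q, 'l) cfun \<Rightarrow> ('o, 'm, 'p, 'n) cfun \<Rightarrow> ('o, 'm, 'q, 'l) cfun" where
  "comp_cfun G F = \<lparr>csrc = csrc F, ctgt = ctgt G,
     cobj = cobj G \<circ> cobj F, cmor = cmor G \<circ> cmor F\<rparr>"

definition naturally_iso ::
  "('o, 'm, 'p, 'n) cfun \<Rightarrow> ('o, 'm, 'p, 'n) cfun \<Rightarrow> bool" where
  "naturally_iso F G \<longleftrightarrow>
     (\<exists>\<eta>. (\<forall>x \<in> Obj (csrc F). iso_arrow (ctgt F) (\<eta> x)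
              \<and> Dom (ctgt F) (\<eta> x) = cobj F x \<and> Cod (ctgt F) (\<eta> x) = cobj G x)
        \<and> (\<forall>f \<in> Mor (csrc F). Cmp (ctgt F) (\<eta> (Cod (csrc F) f)) (cmor F f)
              = Cmp (ctgt F) (cmor G f) (\<eta> (Dom (csrc F) f))))"

definition cat_equivalence :: "('o, 'm, 'p, 'n) cfun \<Rightarrow> bool" where
  "cat_equivalence F \<longleftrightarrow> cat_functor F \<and>
     (\<exists>G. cat_functor G \<and> csrc G = ctgt F \<and> ctgt G = csrc F
        \<and> naturally_iso (comp_cfun G F) (id_cfun (csrc F))
        \<and> naturally_iso (comp_cfun F G) (id_cfun (ctgt F)))"

text \<open>For \<open>C = \<H>(D)\<close> this is the category \<open>\<H>\<^sup>\<triangleleft>(D\<^sub>h)\<close>, for \<open>C = \<V>(D)\<close> it is \<open>\<V>\<^sup>\<triangleleft>(D\<^sub>v)\<close>.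
  The tuple \<open>(a, b, s, t)\<close> is the morphism \<open>(s, t)\<close> from \<open>a\<close> to \<open>b\<close>.\<close>

definition tri_cat :: "('o, 'm) cat \<Rightarrow> ('m, 'm \<times> 'm \<times> 'm \<times> 'm) cat" where
  "tri_cat C = \<lparr>Obj = Mor C,
     Mor = {(a, b, s, t). a \<in> Mor C \<and> b \<in> Mor C \<and> iso_arrow C s \<and> t \<in> Mor C
              \<and> Dom C s = Dom C a \<and> Cod C s = Dom C b
              \<and> Dom C t = Cod C a \<and> Cod C t = Cod C b
              \<and> Cmp C b s = Cmp C t a},
     Dom = (\<lambda>(a, b, s, t). a),
     Cod = (\<lambda>(a, b, s, t). b),
     Idn = (\<lambda>a. (a, a, Idn C (Dom C a), Idn C (Cod C a))),
     Cmp = (\<lambda>(b', c, s', t') (a, b, s, t). (a, c, Cmp C s' s, Cmp C t' t))\<rparr>"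


section \<open>Double categories\<close>

text \<open>A square \<open>s\<close> has boundary \<open>(stop s; slft s; srgt s; sbot s)\<close>.
  \<open>sqhcmp D t s\<close> has \<open>t\<close> to the right of \<open>s\<close> and \<open>sqvcmp D t s\<close> has \<open>t\<close> below \<open>s\<close>;
  \<open>sqhid D v = (id; v; v; id)\<close> and \<open>sqvid D f = (f; id; id; f)\<close> are the units.\<close>

record ('o, 'h, 'v, 's) dblcat =
  Ob :: "'o set"
  Hor :: "'h set"
  hdom :: "'h \<Rightarrow> 'o"
  hcod :: "'h \<Rightarrow> 'o"
  hid :: "'o \<Rightarrow> 'h"
  hcmp :: "'h \<Rightarrow> 'h \<Rightarrow> 'h"
  Ver :: "'v set"
  vdom :: "'v \<Rightarrow> 'o"
  vcod :: "'v \<Rightarrow> 'o"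
  vid :: "'o \<Rightarrow> 'v"
  vcmp :: "'v \<Rightarrow> 'v \<Rightarrow> 'v"
  Sq :: "'s set"
  stop :: "'s \<Rightarrow> 'h"
  sbot :: "'s \<Rightarrow> 'h"
  slft :: "'s \<Rightarrow> 'v"
  srgt :: "'s \<Rightarrow> 'v"
  sqhid :: "'v \<Rightarrow> 's"
  sqhcmp :: "'s \<Rightarrow> 's \<Rightarrow> 's"
  sqvid :: "'h \<Rightarrow> 's"
  sqvcmp :: "'s \<Rightarrow> 's \<Rightarrow> 's"

text \<open>The categories \<open>\<H>(D)\<close>, \<open>\<V>(D)\<close>, \<open>\<H>(D\<^sub>v)\<close> and \<open>\<V>(D\<^sub>h)\<close>.\<close>

definition hcat :: "('o, 'h, 'v, 's) dblcat \<Rightarrow> ('o, 'h) cat" where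
  "hcat D = \<lparr>Obj = Ob D, Mor = Hor D, Dom = hdom D, Cod = hcod D, Idn = hid D, Cmp = hcmp D\<rparr>"

definition vcat :: "('o, 'h, 'v, 's) dblcat \<Rightarrow> ('o, 'v) cat" where
  "vcat D = \<lparr>Obj = Ob D, Mor = Ver D, Dom = vdom D, Cod = vcod D, Idn = vid D, Cmp = vcmp D\<rparr>"

definition hcat_ver :: "('o, 'h, 'v, 's) dblcat \<Rightarrow> ('v, 's) cat" where
  "hcat_ver D = \<lparr>Obj = Ver D, Mor = Sq D, Dom = slft D, Cod = srgt D,
     Idn = sqhid D, Cmp = sqhcmp D\<rparr>"

definition vcat_hor :: "('o, 'h, 'v, 's) dblcat \<Rightarrow> ('h, 's) cat" where
  "vcat_hor D = \<lparr>Obj = Hor D, Mor = Sq D, Dom = stop D, Cod = sbot D,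
     Idn = sqvid D, Cmp = sqvcmp D\<rparr>"

locale double_category =
  horizontal: category "hcat D" + vertical: category "vcat D" +
  squares_h: category "hcat_ver D" + squares_v: category "vcat_hor D"
  for D :: "('o, 'h, 'v, 's) dblcat" +
  assumes corner_tl: "s \<in> Sq D \<Longrightarrow> hdom D (stop D s) = vdom D (slft D s)"
    and corner_tr: "s \<in> Sq D \<Longrightarrow> hcod D (stop D s) = vdom D (srgt D s)"
    and corner_bl: "s \<in> Sq D \<Longrightarrow> hdom D (sbot D s) = vcod D (slft D s)"
    and corner_br: "s \<in> Sq D \<Longrightarrow> hcod D (sbot D s) = vcod D (srgt D s)"
    and stop_sqhid: "v \<in> Ver D \<Longrightarrow> stop D (sqhid D v) = hid D (vdom D v)"
    and sbot_sqhid: "v \<in> Ver D \<Longrightarrow> sbot D (sqhid D v) = hid D (vcod D v)"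
    and slft_sqvid: "f \<in> Hor D \<Longrightarrow> slft D (sqvid D f) = vid D (hdom D f)"
    and srgt_sqvid: "f \<in> Hor D \<Longrightarrow> srgt D (sqvid D f) = vid D (hcod D f)"
    and stop_sqhcmp: "\<lbrakk>s \<in> Sq D; t \<in> Sq D; srgt D s = slft D t\<rbrakk>
      \<Longrightarrow> stop D (sqhcmp D t s) = hcmp D (stop D t) (stop D s)"
    and sbot_sqhcmp: "\<lbrakk>s \<in> Sq D; t \<in> Sq D; srgt D s = slft D t\<rbrakk>
      \<Longrightarrow> sbot D (sqhcmp D t s) = hcmp D (sbot D t) (sbot D s)"
    and slft_sqvcmp: "\<lbrakk>s \<in> Sq D; t \<in> Sq D; sbot D s = stop D t\<rbrakk>
      \<Longrightarrow> slft D (sqvcmp D t s) = vcmp D (slft D t) (slft D s)"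
    and srgt_sqvcmp: "\<lbrakk>s \<in> Sq D; t \<in> Sq D; sbot D s = stop D t\<rbrakk>
      \<Longrightarrow> srgt D (sqvcmp D t s) = vcmp D (srgt D t) (srgt D s)"
    and sqvid_hcmp: "\<lbrakk>f \<in> Hor D; g \<in> Hor D; hcod D f = hdom D g\<rbrakk>
      \<Longrightarrow> sqvid D (hcmp D g f) = sqhcmp D (sqvid D g) (sqvid D f)"
    and sqhid_vcmp: "\<lbrakk>v \<in> Ver D; w \<in> Ver D; vcod D v = vdom D w\<rbrakk>
      \<Longrightarrow> sqhid D (vcmp D w v) = sqvcmp D (sqhid D w) (sqhid D v)"
    and sqvid_hid: "x \<in> Ob D \<Longrightarrow> sqvid D (hid D x) = sqhid D (vid D x)"
    and interchange: "\<lbrakk>a \<in> Sq D; b \<in> Sq D; c \<in> Sq D; d \<in> Sq D;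
        srgt D a = slft D b; srgt D c = slft D d; sbot D a = stop D c; sbot D b = stop D d\<rbrakk>
      \<Longrightarrow> sqvcmp D (sqhcmp D d c) (sqhcmp D b a) = sqhcmp D (sqvcmp D d b) (sqvcmp D c a)"

definition left_pointed :: "('o, 'h, 'v, 's) dblcat \<Rightarrow> bool" where
  "left_pointed D \<longleftrightarrow> (\<exists>z. initial_obj (hcat D) z \<and> initial_obj (vcat D) z)"

definition transpose :: "('o, 'h, 'v, 's) dblcat \<Rightarrow> ('o, 'v, 'h, 's) dblcat" where
  "transpose D = \<lparr>Ob = Ob D,
     Hor = Ver D, hdom = vdom D, hcod = vcod D, hid = vid D, hcmp = vcmp D,
     Ver = Hor D, vdom = hdom D, vcod = hcod D, vid = hid D, vcmp = hcmp D,
     Sq = Sq D, stop = slft D, sbot = srgt D, slft = stop D, srgt = sbot D,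
     sqhid = sqvid D, sqhcmp = sqvcmp D, sqvid = sqhid D, sqvcmp = sqhcmp D\<rparr>"

record ('o, 'h, 'v, 's, 'p, 'i, 'w, 't) dblfun =
  dsrc :: "('o, 'h, 'v, 's) dblcat"
  dtgt :: "('p, 'i, 'w, 't) dblcat"
  onob :: "'o \<Rightarrow> 'p"
  onhor :: "'h \<Rightarrow> 'i"
  onver :: "'v \<Rightarrow> 'w"
  onsq :: "'s \<Rightarrow> 't"

text \<open>A double functor is a map of cells which is a functor for each of the four category
  structures; preservation of the boundaries of squares and of all units is included in this.\<close>

definition hfun :: "('o, 'h, 'v, 's, 'p, 'i, 'w, 't) dblfun \<Rightarrow> ('o, 'h, 'p, 'i) cfun" where
  "hfun F = \<lparr>csrc = hcat (dsrc F), ctgt = hcat (dtgt F), cobj = onob F, cmor = onhor F\<rparr>"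

definition vfun :: "('o, 'h, 'v, 's, 'p, 'i, 'w, 't) dblfun \<Rightarrow> ('o, 'v, 'p, 'w) cfun" where
  "vfun F = \<lparr>csrc = vcat (dsrc F), ctgt = vcat (dtgt F), cobj = onob F, cmor = onver F\<rparr>"

definition hfun_ver :: "('o, 'h, 'v, 's, 'p, 'i, 'w, 't) dblfun \<Rightarrow> ('v, 's, 'w, 't) cfun" where
  "hfun_ver F = \<lparr>csrc = hcat_ver (dsrc F), ctgt = hcat_ver (dtgt F),
     cobj = onver F, cmor = onsq F\<rparr>"

definition vfun_hor :: "('o, 'h, 'v, 's, 'p, 'i, 'w, 't) dblfun \<Rightarrow> ('h, 's, 'i, 't) cfun" where
  "vfun_hor F = \<lparr>csrc = vcat_hor (dsrc F), ctgt = vcat_hor (dtgt F),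
     cobj = onhor F, cmor = onsq F\<rparr>"

definition double_functor :: "('o, 'h, 'v, 's, 'p, 'i, 'w, 't) dblfun \<Rightarrow> bool" where
  "double_functor F \<longleftrightarrow> double_category (dsrc F) \<and> double_category (dtgt F)
     \<and> cat_functor (hfun F) \<and> cat_functor (vfun F)
     \<and> cat_functor (hfun_ver F) \<and> cat_functor (vfun_hor F)"

definition id_dfun :: "('o, 'h, 'v, 's) dblcat \<Rightarrow> ('o, 'h, 'v, 's, 'o, 'h, 'v, 's) dblfun" where
  "id_dfun D = \<lparr>dsrc = D, dtgt = D, onob = (\<lambda>x. x), onhor = (\<lambda>f. f), onver = (\<lambda>v. v),
     onsq = (\<lambda>s. s)\<rparr>"

definition comp_dfun ::
  "('p, 'i, 'w, 't, 'q, 'j, 'u, 'r) dblfun \<Rightarrow> ('o, 'h, 'v, 's, 'p, 'i, 'w, 't) dblfun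
    \<Rightarrow> ('o, 'h, 'v, 's, 'q, 'j, 'u, 'r) dblfun" where
  "comp_dfun G F = \<lparr>dsrc = dsrc F, dtgt = dtgt G, onob = onob G \<circ> onob F,
     onhor = onhor G \<circ> onhor F, onver = onver G \<circ> onver F, onsq = onsq G \<circ> onsq F\<rparr>"

definition transpose_dfun ::
  "('o, 'h, 'v, 's, 'p, 'i, 'w, 't) dblfun \<Rightarrow> ('o, 'v, 'h, 's, 'p, 'w, 'i, 't) dblfun" where
  "transpose_dfun F = \<lparr>dsrc = transpose (dsrc F), dtgt = transpose (dtgt F), onob = onob F,
     onhor = onver F, onver = onhor F, onsq = onsq F\<rparr>"

text \<open>Equality of parallel double functors; values outside the carriers are irrelevant.\<close>

definition dfun_eq ::
  "('o, 'h, 'v, 's, 'p, 'i, 'w, 't) dblfun \<Rightarrow> ('o, 'h, 'v, 's, 'p, 'i, 'w, 't) dblfun \<Rightarrow> bool"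
  where
  "dfun_eq F G \<longleftrightarrow> dsrc F = dsrc G \<and> dtgt F = dtgt G
     \<and> (\<forall>x \<in> Ob (dsrc F). onob F x = onob G x) \<and> (\<forall>f \<in> Hor (dsrc F). onhor F f = onhor G f)
     \<and> (\<forall>v \<in> Ver (dsrc F). onver F v = onver G v) \<and> (\<forall>s \<in> Sq (dsrc F). onsq F s = onsq G s)"


section \<open>Locality\<close>

definition extends_along ::
  "('a, 'b, 'c, 'd, 'p, 'i, 'w, 't) dblfun \<Rightarrow> ('a, 'b, 'c, 'd, 'o, 'h, 'v, 's) dblfun
    \<Rightarrow> ('p, 'i, 'w, 't, 'o, 'h, 'v, 's) dblfun \<Rightarrow> bool" where
  "extends_along i F G \<longleftrightarrow> double_functor G \<and> dsrc G = dtgt i \<and> dfun_eq (comp_dfun G i) F"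

definition local_wrt ::
  "('o, 'h, 'v, 's) dblcat \<Rightarrow> ('a, 'b, 'c, 'd, 'p, 'i, 'w, 't) dblfun \<Rightarrow> bool" where
  "local_wrt D i \<longleftrightarrow>
     (\<forall>F. double_functor F \<and> dsrc F = dsrc i \<and> dtgt F = D \<longrightarrow> (\<exists>G. extends_along i F G))"

definition strictly_local_wrt ::
  "('o, 'h, 'v, 's) dblcat \<Rightarrow> ('a, 'b, 'c, 'd, 'p, 'i, 'w, 't) dblfun \<Rightarrow> bool" where
  "strictly_local_wrt D i \<longleftrightarrow> local_wrt D i \<and>
     (\<forall>F G G'. double_functor F \<and> dsrc F = dsrc i \<and> dtgt F = D
        \<and> extends_along i F G \<and> extends_along i F G' \<longrightarrow> dfun_eq G G')"


section \<open>Pushouts of double categories\<close>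

definition sum_op :: "('a \<Rightarrow> 'a \<Rightarrow> 'a) \<Rightarrow> ('b \<Rightarrow> 'b \<Rightarrow> 'b) \<Rightarrow> 'a + 'b \<Rightarrow> 'a + 'b \<Rightarrow> 'a + 'b" where
  "sum_op p q x y = (case (x, y) of (Inl a, Inl a') \<Rightarrow> Inl (p a a')
     | (Inr b, Inr b') \<Rightarrow> Inr (q b b') | _ \<Rightarrow> undefined)"

definition dbl_sum :: "('o, 'h, 'v, 's) dblcat \<Rightarrow> ('p, 'i, 'w, 't) dblcat
    \<Rightarrow> ('o + 'p, 'h + 'i, 'v + 'w, 's + 't) dblcat" where
  "dbl_sum B C = \<lparr>Ob = Ob B <+> Ob C,
     Hor = Hor B <+> Hor C, hdom = map_sum (hdom B) (hdom C), hcod = map_sum (hcod B) (hcod C),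
     hid = map_sum (hid B) (hid C), hcmp = sum_op (hcmp B) (hcmp C),
     Ver = Ver B <+> Ver C, vdom = map_sum (vdom B) (vdom C), vcod = map_sum (vcod B) (vcod C),
     vid = map_sum (vid B) (vid C), vcmp = sum_op (vcmp B) (vcmp C),
     Sq = Sq B <+> Sq C, stop = map_sum (stop B) (stop C), sbot = map_sum (sbot B) (sbot C),
     slft = map_sum (slft B) (slft C), srgt = map_sum (srgt B) (srgt C),
     sqhid = map_sum (sqhid B) (sqhid C), sqhcmp = sum_op (sqhcmp B) (sqhcmp C),
     sqvid = map_sum (sqvid B) (sqvid C), sqvcmp = sum_op (sqvcmp B) (sqvcmp C)\<rparr>"

text \<open>
  The quotient of a double category \<open>U\<close> by identifications \<open>Ro\<close>, \<open>Rh\<close>, \<open>Rv\<close>, \<open>Rs\<close> of its cells.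
  Identifying cells creates new composable pairs, so the cells of the quotient are classes of
  formal composites of cells of \<open>U\<close> under the least congruence which contains the given
  identifications and the composition of \<open>U\<close>, and for which the laws of a double category hold.
  The formal composites are composable only up to this congruence.
\<close>

datatype 'm expr = Gen 'm | Com "'m expr" "'m expr"

primrec esrc :: "('o, 'm) cat \<Rightarrow> 'm expr \<Rightarrow> 'o" where
  "esrc C (Gen f) = Dom C f"
| "esrc C (Com g f) = esrc C f"

primrec etgt :: "('o, 'm) cat \<Rightarrow> 'm expr \<Rightarrow> 'o" where
  "etgt C (Gen f) = Cod C f"
| "etgt C (Com g f) = etgt C g"

inductive obj_eq :: "('o, 'm) cat \<Rightarrow> ('o \<times> 'o) set \<Rightarrow> 'o \<Rightarrow> 'o \<Rightarrow> bool"
  for C :: "('o, 'm) cat" and Ro :: "('o \<times> 'o) set" where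
  refl: "x \<in> Obj C \<Longrightarrow> obj_eq C Ro x x"
| sym: "obj_eq C Ro x y \<Longrightarrow> obj_eq C Ro y x"
| trans: "obj_eq C Ro x y \<Longrightarrow> obj_eq C Ro y z \<Longrightarrow> obj_eq C Ro x z"
| rel: "(x, y) \<in> Ro \<Longrightarrow> obj_eq C Ro x y"

primrec expr_wf :: "('o, 'm) cat \<Rightarrow> ('o \<times> 'o) set \<Rightarrow> 'm expr \<Rightarrow> bool" where
  "expr_wf C Ro (Gen f) \<longleftrightarrow> f \<in> Mor C"
| "expr_wf C Ro (Com g f) \<longleftrightarrow> expr_wf C Ro g \<and> expr_wf C Ro f \<and> obj_eq C Ro (etgt C f) (esrc C g)"

inductive expr_eq :: "('o, 'm) cat \<Rightarrow> ('o \<times> 'o) set \<Rightarrow> ('m \<times> 'm) set \<Rightarrow> 'm expr \<Rightarrow> 'm expr \<Rightarrow> bool"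
  for C :: "('o, 'm) cat" and Ro :: "('o \<times> 'o) set" and Rm :: "('m \<times> 'm) set" where
  refl: "expr_wf C Ro e \<Longrightarrow> expr_eq C Ro Rm e e"
| sym: "expr_eq C Ro Rm e e' \<Longrightarrow> expr_eq C Ro Rm e' e"
| trans: "expr_eq C Ro Rm e e' \<Longrightarrow> expr_eq C Ro Rm e' e'' \<Longrightarrow> expr_eq C Ro Rm e e''"
| rel: "(f, f') \<in> Rm \<Longrightarrow> expr_eq C Ro Rm (Gen f) (Gen f')"
| cong: "\<lbrakk>expr_eq C Ro Rm g g'; expr_eq C Ro Rm f f'; expr_wf C Ro (Com g f)\<rbrakk>
    \<Longrightarrow> expr_eq C Ro Rm (Com g f) (Com g' f')"
| comp: "\<lbrakk>f \<in> Mor C; g \<in> Mor C; Cod C f = Dom C g\<rbrakk>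
    \<Longrightarrow> expr_eq C Ro Rm (Com (Gen g) (Gen f)) (Gen (Cmp C g f))"
| idr: "\<lbrakk>expr_wf C Ro e; obj_eq C Ro x (esrc C e)\<rbrakk>
    \<Longrightarrow> expr_eq C Ro Rm (Com e (Gen (Idn C x))) e"
| idl: "\<lbrakk>expr_wf C Ro e; obj_eq C Ro x (etgt C e)\<rbrakk>
    \<Longrightarrow> expr_eq C Ro Rm (Com (Gen (Idn C x)) e) e"
| assoc: "expr_wf C Ro (Com h (Com g f))
    \<Longrightarrow> expr_eq C Ro Rm (Com h (Com g f)) (Com (Com h g) f)"

datatype 's sexpr = SGen 's | HCom "'s sexpr" "'s sexpr" | VCom "'s sexpr" "'s sexpr"

primrec etop :: "('o, 'h, 'v, 's) dblcat \<Rightarrow> 's sexpr \<Rightarrow> 'h expr" where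
  "etop U (SGen s) = Gen (stop U s)"
| "etop U (HCom t s) = Com (etop U t) (etop U s)"
| "etop U (VCom t s) = etop U s"

primrec ebot :: "('o, 'h, 'v, 's) dblcat \<Rightarrow> 's sexpr \<Rightarrow> 'h expr" where
  "ebot U (SGen s) = Gen (sbot U s)"
| "ebot U (HCom t s) = Com (ebot U t) (ebot U s)"
| "ebot U (VCom t s) = ebot U t"

primrec elft :: "('o, 'h, 'v, 's) dblcat \<Rightarrow> 's sexpr \<Rightarrow> 'v expr" where
  "elft U (SGen s) = Gen (slft U s)"
| "elft U (HCom t s) = elft U s"
| "elft U (VCom t s) = Com (elft U t) (elft U s)"

primrec ergt :: "('o, 'h, 'v, 's) dblcat \<Rightarrow> 's sexpr \<Rightarrow> 'v expr" where
  "ergt U (SGen s) = Gen (srgt U s)"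
| "ergt U (HCom t s) = ergt U t"
| "ergt U (VCom t s) = Com (ergt U t) (ergt U s)"

primrec ehid :: "('o, 'h, 'v, 's) dblcat \<Rightarrow> 'v expr \<Rightarrow> 's sexpr" where
  "ehid U (Gen v) = SGen (sqhid U v)"
| "ehid U (Com w v) = VCom (ehid U w) (ehid U v)"

primrec evid :: "('o, 'h, 'v, 's) dblcat \<Rightarrow> 'h expr \<Rightarrow> 's sexpr" where
  "evid U (Gen f) = SGen (sqvid U f)"
| "evid U (Com g f) = HCom (evid U g) (evid U f)"

record ('o, 'h, 'v, 's) cellrel =
  relob :: "('o \<times> 'o) set"
  relhor :: "('h \<times> 'h) set"
  relver :: "('v \<times> 'v) set"
  relsq :: "('s \<times> 's) set"

abbreviation hexpr_eq where
  "hexpr_eq U R \<equiv> expr_eq (hcat U) (relob R) (relhor R)"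

abbreviation vexpr_eq where
  "vexpr_eq U R \<equiv> expr_eq (vcat U) (relob R) (relver R)"

primrec sexpr_wf ::
  "('o, 'h, 'v, 's) dblcat \<Rightarrow> ('o, 'h, 'v, 's) cellrel \<Rightarrow> 's sexpr \<Rightarrow> bool" where
  "sexpr_wf U R (SGen s) \<longleftrightarrow> s \<in> Sq U"
| "sexpr_wf U R (HCom t s) \<longleftrightarrow> sexpr_wf U R t \<and> sexpr_wf U R s \<and> vexpr_eq U R (ergt U s) (elft U t)"
| "sexpr_wf U R (VCom t s) \<longleftrightarrow> sexpr_wf U R t \<and> sexpr_wf U R s \<and> hexpr_eq U R (ebot U s) (etop U t)"

inductive sexpr_eq ::
  "('o, 'h, 'v, 's) dblcat \<Rightarrow> ('o, 'h, 'v, 's) cellrel \<Rightarrow> 's sexpr \<Rightarrow> 's sexpr \<Rightarrow> bool"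
  for U :: "('o, 'h, 'v, 's) dblcat" and R :: "('o, 'h, 'v, 's) cellrel" where
  refl: "sexpr_wf U R e \<Longrightarrow> sexpr_eq U R e e"
| sym: "sexpr_eq U R e e' \<Longrightarrow> sexpr_eq U R e' e"
| trans: "sexpr_eq U R e e' \<Longrightarrow> sexpr_eq U R e' e'' \<Longrightarrow> sexpr_eq U R e e''"
| rel: "(s, s') \<in> relsq R \<Longrightarrow> sexpr_eq U R (SGen s) (SGen s')"
| hcong: "\<lbrakk>sexpr_eq U R t t'; sexpr_eq U R s s'; sexpr_wf U R (HCom t s)\<rbrakk>
    \<Longrightarrow> sexpr_eq U R (HCom t s) (HCom t' s')"
| vcong: "\<lbrakk>sexpr_eq U R t t'; sexpr_eq U R s s'; sexpr_wf U R (VCom t s)\<rbrakk>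
    \<Longrightarrow> sexpr_eq U R (VCom t s) (VCom t' s')"
| ehid_cong: "vexpr_eq U R v v' \<Longrightarrow> sexpr_eq U R (ehid U v) (ehid U v')"
| evid_cong: "hexpr_eq U R f f' \<Longrightarrow> sexpr_eq U R (evid U f) (evid U f')"
| hcomp: "\<lbrakk>s \<in> Sq U; t \<in> Sq U; srgt U s = slft U t\<rbrakk>
    \<Longrightarrow> sexpr_eq U R (HCom (SGen t) (SGen s)) (SGen (sqhcmp U t s))"
| vcomp: "\<lbrakk>s \<in> Sq U; t \<in> Sq U; sbot U s = stop U t\<rbrakk>
    \<Longrightarrow> sexpr_eq U R (VCom (SGen t) (SGen s)) (SGen (sqvcmp U t s))"
| hidr: "\<lbrakk>sexpr_wf U R s; vexpr_eq U R v (elft U s)\<rbrakk> \<Longrightarrow> sexpr_eq U R (HCom s (ehid U v)) s"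
| hidl: "\<lbrakk>sexpr_wf U R s; vexpr_eq U R v (ergt U s)\<rbrakk> \<Longrightarrow> sexpr_eq U R (HCom (ehid U v) s) s"
| vidr: "\<lbrakk>sexpr_wf U R s; hexpr_eq U R f (etop U s)\<rbrakk> \<Longrightarrow> sexpr_eq U R (VCom s (evid U f)) s"
| vidl: "\<lbrakk>sexpr_wf U R s; hexpr_eq U R f (ebot U s)\<rbrakk> \<Longrightarrow> sexpr_eq U R (VCom (evid U f) s) s"
| hassoc: "sexpr_wf U R (HCom u (HCom t s))
    \<Longrightarrow> sexpr_eq U R (HCom u (HCom t s)) (HCom (HCom u t) s)"
| vassoc: "sexpr_wf U R (VCom u (VCom t s))
    \<Longrightarrow> sexpr_eq U R (VCom u (VCom t s)) (VCom (VCom u t) s)"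
| interchange:
    "\<lbrakk>sexpr_wf U R (VCom (HCom d c) (HCom b a)); sexpr_wf U R (HCom (VCom d b) (VCom c a))\<rbrakk>
    \<Longrightarrow> sexpr_eq U R (VCom (HCom d c) (HCom b a)) (HCom (VCom d b) (VCom c a))"

definition ocls where
  "ocls U R x = {y. obj_eq (hcat U) (relob R) x y}"

definition hcls where
  "hcls U R e = {e'. hexpr_eq U R e e'}"

definition vcls where
  "vcls U R e = {e'. vexpr_eq U R e e'}"

definition scls where
  "scls U R e = {e'. sexpr_eq U R e e'}"

definition repr :: "'a set \<Rightarrow> 'a" where
  "repr W = (SOME w. w \<in> W)"

definition dbl_quotient :: "('o, 'h, 'v, 's) dblcat \<Rightarrow> ('o, 'h, 'v, 's) cellrel
    \<Rightarrow> ('o set, 'h expr set, 'v expr set, 's sexpr set) dblcat" where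
  "dbl_quotient U R = \<lparr>
     Ob = ocls U R ` Ob U,
     Hor = hcls U R ` {e. expr_wf (hcat U) (relob R) e},
     hdom = (\<lambda>W. ocls U R (esrc (hcat U) (repr W))),
     hcod = (\<lambda>W. ocls U R (etgt (hcat U) (repr W))),
     hid = (\<lambda>X. hcls U R (Gen (hid U (repr X)))),
     hcmp = (\<lambda>W' W. hcls U R (Com (repr W') (repr W))),
     Ver = vcls U R ` {e. expr_wf (vcat U) (relob R) e},
     vdom = (\<lambda>W. ocls U R (esrc (vcat U) (repr W))),
     vcod = (\<lambda>W. ocls U R (etgt (vcat U) (repr W))),
     vid = (\<lambda>X. vcls U R (Gen (vid U (repr X)))),
     vcmp = (\<lambda>W' W. vcls U R (Com (repr W') (repr W))),
     Sq = scls U R ` {e. sexpr_wf U R e},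
     stop = (\<lambda>W. hcls U R (etop U (repr W))),
     sbot = (\<lambda>W. hcls U R (ebot U (repr W))),
     slft = (\<lambda>W. vcls U R (elft U (repr W))),
     srgt = (\<lambda>W. vcls U R (ergt U (repr W))),
     sqhid = (\<lambda>W. scls U R (ehid U (repr W))),
     sqhcmp = (\<lambda>W' W. scls U R (HCom (repr W') (repr W))),
     sqvid = (\<lambda>W. scls U R (evid U (repr W))),
     sqvcmp = (\<lambda>W' W. scls U R (VCom (repr W') (repr W)))\<rparr>"

definition pushout_rel :: "('a, 'b, 'c, 'd, 'o, 'h, 'v, 's) dblfun
    \<Rightarrow> ('a, 'b, 'c, 'd, 'p, 'i, 'w, 't) dblfun
    \<Rightarrow> ('o + 'p, 'h + 'i, 'v + 'w, 's + 't) cellrel" where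
  "pushout_rel F G = \<lparr>
     relob = (\<lambda>x. (Inl (onob F x), Inr (onob G x))) ` Ob (dsrc F),
     relhor = (\<lambda>f. (Inl (onhor F f), Inr (onhor G f))) ` Hor (dsrc F),
     relver = (\<lambda>v. (Inl (onver F v), Inr (onver G v))) ` Ver (dsrc F),
     relsq = (\<lambda>s. (Inl (onsq F s), Inr (onsq G s))) ` Sq (dsrc F)\<rparr>"

definition pushout where
  "pushout F G = dbl_quotient (dbl_sum (dtgt F) (dtgt G)) (pushout_rel F G)"

definition pushout_inr where
  "pushout_inr F G =
    (let U = dbl_sum (dtgt F) (dtgt G); R = pushout_rel F G in
     \<lparr>dsrc = dtgt G, dtgt = pushout F G, onob = (\<lambda>x. ocls U R (Inr x)),
      onhor = (\<lambda>f. hcls U R (Gen (Inr f))), onver = (\<lambda>v. vcls U R (Gen (Inr v))),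
      onsq = (\<lambda>s. scls U R (SGen (Inr s)))\<rparr>)"

primrec expr_eval :: "('p, 'n) cat \<Rightarrow> ('m \<Rightarrow> 'n) \<Rightarrow> 'm expr \<Rightarrow> 'n" where
  "expr_eval C p (Gen f) = p f"
| "expr_eval C p (Com g f) = Cmp C (expr_eval C p g) (expr_eval C p f)"

primrec sexpr_eval :: "('p, 'i, 'w, 't) dblcat \<Rightarrow> ('s \<Rightarrow> 't) \<Rightarrow> 's sexpr \<Rightarrow> 't" where
  "sexpr_eval D p (SGen s) = p s"
| "sexpr_eval D p (HCom t s) = sqhcmp D (sexpr_eval D p t) (sexpr_eval D p s)"
| "sexpr_eval D p (VCom t s) = sqvcmp D (sexpr_eval D p t) (sexpr_eval D p s)"

text \<open>The double functor out of \<open>pushout F G\<close> induced by \<open>H\<close> on \<open>dtgt F\<close> and \<open>K\<close> on \<open>dtgt G\<close>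
  with \<open>H F = K G\<close>.\<close>

definition pushout_copair where
  "pushout_copair F G H K = \<lparr>dsrc = pushout F G, dtgt = dtgt H,
     onob = (\<lambda>X. case_sum (onob H) (onob K) (repr X)),
     onhor = (\<lambda>W. expr_eval (hcat (dtgt H)) (case_sum (onhor H) (onhor K)) (repr W)),
     onver = (\<lambda>W. expr_eval (vcat (dtgt H)) (case_sum (onver H) (onver K)) (repr W)),
     onsq = (\<lambda>W. sexpr_eval (dtgt H) (case_sum (onsq H) (onsq K)) (repr W))\<rparr>"


section \<open>Products of double categories\<close>

definition prod_op :: "('a \<Rightarrow> 'a \<Rightarrow> 'a) \<Rightarrow> ('b \<Rightarrow> 'b \<Rightarrow> 'b) \<Rightarrow> 'a \<times> 'b \<Rightarrow> 'a \<times> 'b \<Rightarrow> 'a \<times> 'b" where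
  "prod_op p q x y = (p (fst x) (fst y), q (snd x) (snd y))"

definition dbl_prod :: "('o, 'h, 'v, 's) dblcat \<Rightarrow> ('p, 'i, 'w, 't) dblcat
    \<Rightarrow> ('o \<times> 'p, 'h \<times> 'i, 'v \<times> 'w, 's \<times> 't) dblcat" where
  "dbl_prod B C = \<lparr>Ob = Ob B \<times> Ob C,
     Hor = Hor B \<times> Hor C, hdom = map_prod (hdom B) (hdom C), hcod = map_prod (hcod B) (hcod C),
     hid = map_prod (hid B) (hid C), hcmp = prod_op (hcmp B) (hcmp C),
     Ver = Ver B \<times> Ver C, vdom = map_prod (vdom B) (vdom C), vcod = map_prod (vcod B) (vcod C),
     vid = map_prod (vid B) (vid C), vcmp = prod_op (vcmp B) (vcmp C),
     Sq = Sq B \<times> Sq C, stop = map_prod (stop B) (stop C), sbot = map_prod (sbot B) (sbot C),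
     slft = map_prod (slft B) (slft C), srgt = map_prod (srgt B) (srgt C),
     sqhid = map_prod (sqhid B) (sqhid C), sqhcmp = prod_op (sqhcmp B) (sqhcmp C),
     sqvid = map_prod (sqvid B) (sqvid C), sqvcmp = prod_op (sqvcmp B) (sqvcmp C)\<rparr>"

definition prod_proj2 where
  "prod_proj2 B C = \<lparr>dsrc = dbl_prod B C, dtgt = C, onob = snd, onhor = snd, onver = snd, onsq = snd\<rparr>"

definition prod_dfun where
  "prod_dfun F G = \<lparr>dsrc = dbl_prod (dsrc F) (dsrc G), dtgt = dbl_prod (dtgt F) (dtgt G),
     onob = map_prod (onob F) (onob G), onhor = map_prod (onhor F) (onhor G),
     onver = map_prod (onver F) (onver G), onsq = map_prod (onsq F) (onsq G)\<rparr>"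

text \<open>The inclusion of \<open>C\<close> into \<open>B \<times> C\<close> at an object \<open>x\<close> of \<open>B\<close>.\<close>

definition incl_at where
  "incl_at B C x = \<lparr>dsrc = C, dtgt = dbl_prod B C, onob = Pair x, onhor = Pair (hid B x),
     onver = Pair (vid B x), onsq = Pair (sqhid B (vid B x))\<rparr>"


section \<open>The test double functors\<close>

text \<open>In \<open>\<bbbH>(C)\<close> the object \<open>x\<close> also stands for its vertical identity, and the morphism \<open>f\<close> of \<open>C\<close>
  also stands for the identity square \<open>(f; id; id; f)\<close>.\<close>

definition HH :: "('o, 'm) cat \<Rightarrow> ('o, 'm, 'o, 'm) dblcat" where
  "HH C = \<lparr>Ob = Obj C,
     Hor = Mor C, hdom = Dom C, hcod = Cod C, hid = Idn C, hcmp = Cmp C,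
     Ver = Obj C, vdom = (\<lambda>x. x), vcod = (\<lambda>x. x), vid = (\<lambda>x. x), vcmp = (\<lambda>y x. x),
     Sq = Mor C, stop = (\<lambda>f. f), sbot = (\<lambda>f. f), slft = Dom C, srgt = Cod C,
     sqhid = Idn C, sqhcmp = Cmp C, sqvid = (\<lambda>f. f), sqvcmp = (\<lambda>g f. f)\<rparr>"

definition VV :: "('o, 'm) cat \<Rightarrow> ('o, 'o, 'm, 'm) dblcat" where
  "VV C = transpose (HH C)"

definition HH_fun :: "('o, 'm, 'p, 'n) cfun \<Rightarrow> ('o, 'm, 'o, 'm, 'p, 'n, 'p, 'n) dblfun" where
  "HH_fun F = \<lparr>dsrc = HH (csrc F), dtgt = HH (ctgt F), onob = cobj F, onhor = cmor F,
     onver = cobj F, onsq = cmor F\<rparr>"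

definition VV_fun :: "('o, 'm, 'p, 'n) cfun \<Rightarrow> ('o, 'o, 'm, 'm, 'p, 'p, 'n, 'n) dblfun" where
  "VV_fun F = transpose_dfun (HH_fun F)"

text \<open>The ordinal \<open>[n]\<close>, with \<open>(a, b)\<close> the unique morphism from \<open>a\<close> to \<open>b\<close>.\<close>

definition ordinal :: "nat \<Rightarrow> (nat, nat \<times> nat) cat" where
  "ordinal n = \<lparr>Obj = {..n}, Mor = {(a, b). a \<le> b \<and> b \<le> n}, Dom = fst, Cod = snd,
     Idn = (\<lambda>a. (a, a)), Cmp = (\<lambda>g f. (fst f, snd g))\<rparr>"

text \<open>The walking isomorphism.\<close>

definition EE :: "(nat, nat \<times> nat) cat" where
  "EE = \<lparr>Obj = {0, 1}, Mor = {0, 1} \<times> {0, 1}, Dom = fst, Cod = snd,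
     Idn = (\<lambda>a. (a, a)), Cmp = (\<lambda>g f. (fst f, snd g))\<rparr>"

text \<open>The category generated by \<open>f, f' : A \<rightarrow> B\<close> and \<open>g : B \<rightarrow> C\<close> with \<open>g f = g f'\<close>. Here
  \<open>A, B, C\<close> are \<open>0, 1, 2\<close>, and \<open>(a, b, p)\<close> is a morphism from \<open>a\<close> to \<open>b\<close>; the third component
  only serves to distinguish \<open>f = (0, 1, False)\<close> from \<open>f' = (0, 1, True)\<close>.\<close>

definition parallel_cat :: "(nat, nat \<times> nat \<times> bool) cat" where
  "parallel_cat = \<lparr>Obj = {..2},
     Mor = {(a, b, p). a \<le> b \<and> b \<le> 2 \<and> (p \<longrightarrow> a = 0 \<and> b = 1)},
     Dom = (\<lambda>(a, b, p). a), Cod = (\<lambda>(a, b, p). b), Idn = (\<lambda>a. (a, a, False)),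
     Cmp = (\<lambda>(b', c, q) (a, b, p). (a, c, (p \<or> q) \<and> a = 0 \<and> c = 1))\<rparr>"

definition mono_fun :: "(nat, nat \<times> nat \<times> bool, nat, nat \<times> nat) cfun" where
  "mono_fun = \<lparr>csrc = parallel_cat, ctgt = ordinal 2, cobj = (\<lambda>a. a),
     cmor = (\<lambda>(a, b, p). (a, b))\<rparr>"

text \<open>The external product of two categories: a pair of morphisms \<open>f : a \<rightarrow> b\<close> of \<open>C\<close> and
  \<open>g : x \<rightarrow> y\<close> of \<open>C'\<close> is a square with horizontal sides \<open>(f, x)\<close>, \<open>(f, y)\<close> and vertical sides
  \<open>(a, g)\<close>, \<open>(b, g)\<close>. In particular \<open>[1] \<boxtimes> [1]\<close> is free on the square \<open>(0 \<rightarrow> 1, 0 \<rightarrow> 1)\<close>.\<close>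

definition ext_prod :: "('o, 'm) cat \<Rightarrow> ('p, 'n) cat
    \<Rightarrow> ('o \<times> 'p, 'm \<times> 'p, 'o \<times> 'n, 'm \<times> 'n) dblcat" where
  "ext_prod C C' = \<lparr>Ob = Obj C \<times> Obj C',
     Hor = Mor C \<times> Obj C', hdom = apfst (Dom C), hcod = apfst (Cod C), hid = apfst (Idn C),
     hcmp = (\<lambda>g f. (Cmp C (fst g) (fst f), snd f)),
     Ver = Obj C \<times> Mor C', vdom = apsnd (Dom C'), vcod = apsnd (Cod C'), vid = apsnd (Idn C'),
     vcmp = (\<lambda>w v. (fst v, Cmp C' (snd w) (snd v))),
     Sq = Mor C \<times> Mor C',
     stop = apsnd (Dom C'), sbot = apsnd (Cod C'), slft = apfst (Dom C), srgt = apfst (Cod C),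
     sqhid = apfst (Idn C), sqhcmp = (\<lambda>t s. (Cmp C (fst t) (fst s), snd s)),
     sqvid = apsnd (Idn C'), sqvcmp = (\<lambda>t s. (fst s, Cmp C' (snd t) (snd s)))\<rparr>"

definition walking_square where
  "walking_square = ext_prod (ordinal 1) (ordinal 1)"

definition full_subdbl :: "('o, 'h, 'v, 's) dblcat \<Rightarrow> 'o set \<Rightarrow> ('o, 'h, 'v, 's) dblcat" where
  "full_subdbl D X = D \<lparr>Ob := Ob D \<inter> X,
     Hor := {f \<in> Hor D. hdom D f \<in> X \<and> hcod D f \<in> X},
     Ver := {v \<in> Ver D. vdom D v \<in> X \<and> vcod D v \<in> X},
     Sq := {s \<in> Sq D. {vdom D (slft D s), vcod D (slft D s), vdom D (srgt D s), vcod D (srgt D s)} \<subseteq> X}\<rparr>"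

text \<open>An object \<open>(a, b)\<close> of \<open>[1] \<boxtimes> [1]\<close> has horizontal position \<open>a\<close> and vertical position \<open>b\<close>.
  As \<open>[1] \<boxtimes> [1]\<close> has no composites except with units, omitting the bottom left (top right)
  object leaves exactly the top and right (left and bottom) edges and their units.\<close>

definition trcor where
  "trcor = (id_dfun walking_square)\<lparr>dsrc := full_subdbl walking_square {(0, 0), (1, 0), (1, 1)}\<rparr>"

definition blcor where
  "blcor = (id_dfun walking_square)\<lparr>dsrc := full_subdbl walking_square {(0, 0), (0, 1), (1, 1)}\<rparr>"

text \<open>The free double category on \<open>\<alpha>, \<beta> : 0 \<rightarrow> 1\<close> and a square \<open>(\<alpha>; id; id; \<beta>)\<close>. Here
  \<open>\<alpha> = (0, 1, False)\<close>, \<open>\<beta> = (0, 1, True)\<close>, \<open>x\<close> also stands for its vertical identity, and a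
  square is the pair of its top and its bottom; besides the pair \<open>(\<alpha>, \<beta>)\<close> there are only the
  units \<open>(f, f)\<close>.\<close>

definition globe_cat :: "(nat, nat \<times> nat \<times> bool) cat" where
  "globe_cat = \<lparr>Obj = {..1},
     Mor = {(a, b, p). a \<le> b \<and> b \<le> 1 \<and> (p \<longrightarrow> a = 0 \<and> b = 1)},
     Dom = (\<lambda>(a, b, p). a), Cod = (\<lambda>(a, b, p). b), Idn = (\<lambda>a. (a, a, False)),
     Cmp = (\<lambda>(b', c, q) (a, b, p). (a, c, p \<or> q))\<rparr>"

definition globe_dbl ::
  "(nat, nat \<times> nat \<times> bool, nat, (nat \<times> nat \<times> bool) \<times> (nat \<times> nat \<times> bool)) dblcat" where
  "globe_dbl = \<lparr>Ob = Obj globe_cat,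
     Hor = Mor globe_cat, hdom = Dom globe_cat, hcod = Cod globe_cat, hid = Idn globe_cat,
     hcmp = Cmp globe_cat,
     Ver = Obj globe_cat, vdom = (\<lambda>x. x), vcod = (\<lambda>x. x), vid = (\<lambda>x. x), vcmp = (\<lambda>y x. x),
     Sq = {(f, f) | f. f \<in> Mor globe_cat} \<union> {((0, 1, False), (0, 1, True))},
     stop = fst, sbot = snd, slft = (\<lambda>s. Dom globe_cat (fst s)),
     srgt = (\<lambda>s. Cod globe_cat (fst s)),
     sqhid = (\<lambda>x. (Idn globe_cat x, Idn globe_cat x)),
     sqhcmp = prod_op (Cmp globe_cat) (Cmp globe_cat),
     sqvid = (\<lambda>f. (f, f)), sqvcmp = (\<lambda>t s. (fst s, snd t))\<rparr>"

definition trunc_h where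
  "trunc_h = \<lparr>dsrc = globe_dbl, dtgt = HH (ordinal 1), onob = (\<lambda>x. x),
     onhor = (\<lambda>(a, b, p). (a, b)), onver = (\<lambda>x. x), onsq = (\<lambda>((a, b, p), f). (a, b))\<rparr>"

definition trunc_v where
  "trunc_v = transpose_dfun trunc_h"

text \<open>The double category of commutative squares in \<open>C\<close>, a square being the tuple
  \<open>(top, left, right, bottom)\<close>. For \<open>C = \<E>\<close> this is \<open>\<E> \<rtimes> \<E>\<close>.\<close>

definition comm_squares :: "('o, 'm) cat \<Rightarrow> ('o, 'm, 'm, 'm \<times> 'm \<times> 'm \<times> 'm) dblcat" where
  "comm_squares C = \<lparr>Ob = Obj C,
     Hor = Mor C, hdom = Dom C, hcod = Cod C, hid = Idn C, hcmp = Cmp C,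
     Ver = Mor C, vdom = Dom C, vcod = Cod C, vid = Idn C, vcmp = Cmp C,
     Sq = {(t, l, r, b). t \<in> Mor C \<and> l \<in> Mor C \<and> r \<in> Mor C \<and> b \<in> Mor C
             \<and> Dom C t = Dom C l \<and> Cod C t = Dom C r \<and> Dom C b = Cod C l \<and> Cod C b = Cod C r
             \<and> Cmp C r t = Cmp C b l},
     stop = (\<lambda>(t, l, r, b). t), sbot = (\<lambda>(t, l, r, b). b),
     slft = (\<lambda>(t, l, r, b). l), srgt = (\<lambda>(t, l, r, b). r),
     sqhid = (\<lambda>v. (Idn C (Dom C v), v, v, Idn C (Cod C v))),
     sqhcmp = (\<lambda>(t', l', r', b') (t, l, r, b). (Cmp C t' t, l, r', Cmp C b' b)),
     sqvid = (\<lambda>f. (f, Idn C (Dom C f), Idn C (Cod C f), f)),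
     sqvcmp = (\<lambda>(t', l', r', b') (t, l, r, b). (t, Cmp C l' l, Cmp C r' r, b'))\<rparr>"

definition hiso where
  "hiso = \<lparr>dsrc = HH EE, dtgt = comm_squares EE, onob = (\<lambda>x. x), onhor = (\<lambda>f. f),
     onver = vid (comm_squares EE), onsq = sqvid (comm_squares EE)\<rparr>"

definition viso where
  "viso = \<lparr>dsrc = VV EE, dtgt = comm_squares EE, onob = (\<lambda>x. x),
     onhor = hid (comm_squares EE), onver = (\<lambda>v. v), onsq = sqhid (comm_squares EE)\<rparr>"

definition twocopy where
  "twocopy i = pushout i i"

definition isocopy where
  "isocopy i = pushout (prod_proj2 (comm_squares EE) (dsrc i))
     (prod_dfun (id_dfun (comm_squares EE)) i)"

definition isocopy_at where
  "isocopy_at i x = comp_dfun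
     (pushout_inr (prod_proj2 (comm_squares EE) (dsrc i)) (prod_dfun (id_dfun (comm_squares EE)) i))
     (incl_at (comm_squares EE) (dtgt i) x)"

text \<open>The source and the target of \<open>agree i\<close> are \<open>twocopy i\<close> and \<open>isocopy i\<close>.\<close>

definition agree where
  "agree i = pushout_copair i i (isocopy_at i 0) (isocopy_at i 1)"


section \<open>CGW categories\<close>

definition square_with :: "('o, 'h, 'v, 's) dblcat \<Rightarrow> 'h \<Rightarrow> 'v \<Rightarrow> 'v \<Rightarrow> 'h \<Rightarrow> 's \<Rightarrow> bool" where
  "square_with D t l r b s \<longleftrightarrow>
     s \<in> Sq D \<and> stop D s = t \<and> slft D s = l \<and> srgt D s = r \<and> sbot D s = b"

definition shared_iso :: "('o, 'h, 'v, 's) dblcat \<Rightarrow> 'h \<Rightarrow> 'v \<Rightarrow> bool" where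
  "shared_iso D f f' \<longleftrightarrow> iso_arrow (hcat D) f \<and> iso_arrow (vcat D) f'
     \<and> hdom D f = vdom D f' \<and> hcod D f = vcod D f'
     \<and> (let A = hdom D f; B = hcod D f in
          (\<exists>s. square_with D f f' (vid D B) (hid D B) s)
        \<and> (\<exists>s. square_with D (hid D A) (vid D A) f' f s)
        \<and> (\<exists>s. square_with D f (vid D A) (inv_arrow (vcat D) f') (hid D A) s)
        \<and> (\<exists>s. square_with D (hid D A) f' (vid D A) (inv_arrow (hcat D) f) s))"

text \<open>
  The first conjunct of each half of (K) says that the codomain of \<open>k(g)\<close>, respectively of \<open>c(f)\<close>,
  is that of \<open>g\<close>, respectively of \<open>f\<close>. This is required functorially, that is, also for the
  morphisms: \<open>k\<close> sends a square with bottom \<open>t\<close> to a morphism \<open>(s, t)\<close> of \<open>\<H>\<^sup>\<triangleleft>(D\<^sub>h)\<close>, and \<open>c\<close> sends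
  a square with right side \<open>t\<close> to a morphism \<open>(s, t)\<close> of \<open>\<V>\<^sup>\<triangleleft>(D\<^sub>v)\<close>. Equalities between objects
  alone would leave \<open>k\<close> and \<open>c\<close> unrelated to the boundaries of squares.
\<close>

locale cgw_structure = double_category D
  for D :: "('o, 'h, 'v, 's) dblcat"
    and \<phi> :: "('o, 'h, 'o, 'v) cfun"
    and k :: "('v, 's, 'h, 'h \<times> 'h \<times> 'h \<times> 'h) cfun"
    and c :: "('h, 's, 'v, 'v \<times> 'v \<times> 'v \<times> 'v) cfun"
    and z :: 'o +
  assumes phi_boundary: "csrc \<phi> = iso_cat (hcat D)" "ctgt \<phi> = iso_cat (vcat D)"
    and phi_functor: "cat_functor \<phi>"
    and phi_obj: "x \<in> Ob D \<Longrightarrow> cobj \<phi> x = x"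
    and phi_bij: "bij_betw (cmor \<phi>) (Mor (csrc \<phi>)) (Mor (ctgt \<phi>))"
    and k_boundary: "csrc k = hcat_ver D" "ctgt k = tri_cat (hcat D)"
    and k_equivalence: "cat_equivalence k"
    and c_boundary: "csrc c = vcat_hor D" "ctgt c = tri_cat (vcat D)"
    and c_equivalence: "cat_equivalence c"
    and Z: "initial_obj (hcat D) z" "initial_obj (vcat D) z"
    and I: "iso_arrow (hcat D) f \<Longrightarrow> shared_iso D f (cmor \<phi> f)"
    and M: "f \<in> Hor D \<Longrightarrow> mono_arrow (hcat D) f" "g \<in> Ver D \<Longrightarrow> mono_arrow (vcat D) g"
    and K_cod: "g \<in> Ver D \<Longrightarrow> hcod D (cobj k g) = vcod D g"
      "\<lbrakk>q \<in> Sq D; cmor k q = (a, b, s, t)\<rbrakk> \<Longrightarrow> t = sbot D q"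
    and K_square: "g \<in> Ver D \<Longrightarrow>
      \<exists>!q. square_with D (initial_arrow (hcat D) z (vdom D g))
             (initial_arrow (vcat D) z (hdom D (cobj k g))) g (cobj k g) q"
    and C_cod: "f \<in> Hor D \<Longrightarrow> vcod D (cobj c f) = hcod D f"
      "\<lbrakk>q \<in> Sq D; cmor c q = (a', b', s', t')\<rbrakk> \<Longrightarrow> t' = srgt D q"
    and C_square: "f \<in> Hor D \<Longrightarrow>
      \<exists>!q. square_with D (initial_arrow (hcat D) z (vdom D (cobj c f)))
             (initial_arrow (vcat D) z (hdom D f)) (cobj c f) f q"

definition admits_cgw_structure :: "('o, 'h, 'v, 's) dblcat \<Rightarrow> bool" where
  "admits_cgw_structure D \<longleftrightarrow> (\<exists>\<phi> k c z. cgw_structure D \<phi> k c z)"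

end

theory Submission
  imports Defs
begin

text \<open>
  Call a vertical morphism \<open>v\<close> a companion of a horizontal \<open>f\<close> if there are squares \<open>(f; v; id; id)\<close>
  and \<open>(id; id; v; f)\<close>; a shared isomorphism is an invertible instance. Strict locality with respect to
  \<open>trunc\<^sub>h\<close> and \<open>trunc\<^sub>v\<close> says that squares with trivial vertical or horizontal sides are units. Then
  companions are unique, and a square whose left and right sides have companions \<open>l'\<close> and \<open>r'\<close>
  exists precisely if \<open>r' t = b l'\<close>, and is determined by its boundary.

  In a CGW category the functor \<open>k\<close> is faithful and \<open>k(g)\<close> is monic, so a square is determined by its
  left, right and bottom sides; dually for \<open>c\<close>. This gives the uniqueness statements. Fillers of
  corners come from essential surjectivity and fullness of \<open>k\<close> and \<open>c\<close>, and fullness also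
  produces the isomorphism between two fillers of a corner. A double functor into a double
  category in which squares are determined by their boundaries needs only existence of squares, which
  reduces the extension to \<open>isocopy(i)\<close> to a pasting of three squares.

  Conversely, \<open>c(f)\<close> is the right side of a chosen filler of the corner \<open>\<emptyset> \<rightarrow> A, f\<close>. Locality
  with respect to \<open>agree\<close> makes fillers unique up to a shared isomorphism, whence \<open>c\<close> is an
  equivalence, and \<open>k\<close> is the same construction in the transpose.
\<close>

text \<open>Both directions pass through the locale \<open>cgw_local\<close>, which states the
  locality conditions as conditions on cells. It is stable under \<open>transpose\<close>, so
  kernels, \<open>blcor\<close> and the vertical test functors reduce to cokernels,
  \<open>trcor\<close> and the horizontal ones.

  The obstacle is \<open>agree\<close>. Its source and target are pushouts whose cells are classes
  of formal composites, and identifying objects creates new composites, so these cells are not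
  listed but reached only through a universal property, proved for arbitrary quotients. That
  property turns an extension along \<open>agree i\<close> into a double functor on the product of
  \<open>comm_squares EE\<close> with \<open>dtgt i\<close>: a cylinder that is constant on the
  image of \<open>i\<close>. In a double category satisfying \<open>cgw_local\<close>, such a
  cylinder amounts to an isomorphism with a companion at each object, natural with respect to
  horizontal and vertical morphisms.

  Uniqueness of the cylinder rests on monomorphisms: the component at the one object outside the
  corner is fixed by naturality along an edge that leads into the corner, where the component is an
  identity.\<close>

lemma hcat_simps [simp]:
  "Obj (hcat D) = Ob D" "Mor (hcat D) = Hor D" "Dom (hcat D) = hdom D" "Cod (hcat D) = hcod D"
  "Idn (hcat D) = hid D" "Cmp (hcat D) = hcmp D"
  by (simp_all add: hcat_def)

lemma vcat_simps [simp]: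
  "Obj (vcat D) = Ob D" "Mor (vcat D) = Ver D" "Dom (vcat D) = vdom D" "Cod (vcat D) = vcod D"
  "Idn (vcat D) = vid D" "Cmp (vcat D) = vcmp D"
  by (simp_all add: vcat_def)

lemma hcat_ver_simps [simp]:
  "Obj (hcat_ver D) = Ver D" "Mor (hcat_ver D) = Sq D" "Dom (hcat_ver D) = slft D"
  "Cod (hcat_ver D) = srgt D" "Idn (hcat_ver D) = sqhid D" "Cmp (hcat_ver D) = sqhcmp D"
  by (simp_all add: hcat_ver_def)

lemma vcat_hor_simps [simp]:
  "Obj (vcat_hor D) = Hor D" "Mor (vcat_hor D) = Sq D" "Dom (vcat_hor D) = stop D"
  "Cod (vcat_hor D) = sbot D" "Idn (vcat_hor D) = sqvid D" "Cmp (vcat_hor D) = sqvcmp D"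
  by (simp_all add: vcat_hor_def)

section \<open>Categories and equivalences\<close>

context category begin

lemma inverse_arrows_unique:
  assumes "inverse_arrows C f g" "inverse_arrows C f g'"
  shows "g = g'"
proof -
  have "g = Cmp C g (Cmp C f g')"
    using assms unfolding inverse_arrows_def by (metis Cmp_Idn_right)
  also have "\<dots> = Cmp C (Cmp C g f) g'"
    using assms unfolding inverse_arrows_def by (intro Cmp_assoc) auto
  also have "\<dots> = g'"
    using assms unfolding inverse_arrows_def by (metis Cmp_Idn_left)
  finally show ?thesis .
qed

lemma inverse_inv_arrow: "iso_arrow C f \<Longrightarrow> inverse_arrows C f (inv_arrow C f)"
  unfolding inv_arrow_def iso_arrow_def
  by (rule theI') (metis inverse_arrows_unique)

lemma inv_arrow_eq: "inverse_arrows C f g \<Longrightarrow> inv_arrow C f = g"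
  using inverse_inv_arrow inverse_arrows_unique iso_arrow_def by metis

lemma inverse_arrows_sym: "inverse_arrows C f g \<Longrightarrow> inverse_arrows C g f"
  unfolding inverse_arrows_def by auto

lemma iso_inv_arrow: "iso_arrow C f \<Longrightarrow> iso_arrow C (inv_arrow C f)"
  using inverse_inv_arrow inverse_arrows_sym iso_arrow_def by metis

lemma inv_arrow_facts:
  assumes "iso_arrow C f"
  shows "f \<in> Mor C" "inv_arrow C f \<in> Mor C"
    "Dom C (inv_arrow C f) = Cod C f" "Cod C (inv_arrow C f) = Dom C f"
    "Cmp C (inv_arrow C f) f = Idn C (Dom C f)" "Cmp C f (inv_arrow C f) = Idn C (Cod C f)"
  using inverse_inv_arrow[OF assms] unfolding inverse_arrows_def by auto

lemma inverse_Idn: "x \<in> Obj C \<Longrightarrow> inverse_arrows C (Idn C x) (Idn C x)"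
  unfolding inverse_arrows_def
  by (simp add: Idn_in Dom_Idn Cod_Idn) (metis Cmp_Idn_right Idn_in Dom_Idn)

lemma iso_Idn: "x \<in> Obj C \<Longrightarrow> iso_arrow C (Idn C x)"
  using inverse_Idn iso_arrow_def by metis

lemma inverse_Cmp:
  assumes "inverse_arrows C f f'" "inverse_arrows C g g'" "Cod C f = Dom C g"
  shows "inverse_arrows C (Cmp C g f) (Cmp C f' g')"
proof -
  note * = assms[unfolded inverse_arrows_def]
  have "Cmp C (Cmp C f' g') (Cmp C g f) = Cmp C f' (Cmp C (Cmp C g' g) f)"
    using * by (metis Cmp_assoc Cmp_in Dom_Cmp Cod_Cmp)
  moreover have "\<dots> = Idn C (Dom C f)"
    using * by (metis Cmp_Idn_left)
  moreover have "Cmp C (Cmp C g f) (Cmp C f' g') = Cmp C g (Cmp C (Cmp C f f') g')"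
    using * by (metis Cmp_assoc Cmp_in Dom_Cmp Cod_Cmp)
  moreover have "\<dots> = Idn C (Cod C g)"
    using * by (metis Cmp_Idn_left)
  ultimately show ?thesis
    using * unfolding inverse_arrows_def by (auto simp: Cmp_in Dom_Cmp Cod_Cmp)
qed

lemma iso_Cmp:
  "\<lbrakk>iso_arrow C f; iso_arrow C g; Cod C f = Dom C g\<rbrakk> \<Longrightarrow> iso_arrow C (Cmp C g f)"
  using inverse_Cmp iso_arrow_def by metis

lemma Cmp_cancel_iso_left:
  assumes "iso_arrow C f" "g \<in> Mor C" "h \<in> Mor C" "Cod C g = Dom C f" "Cod C h = Dom C f"
    "Cmp C f g = Cmp C f h"
  shows "g = h"
proof -
  have "g = Cmp C (Cmp C (inv_arrow C f) f) g" "h = Cmp C (Cmp C (inv_arrow C f) f) h"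
    using assms inv_arrow_facts[OF assms(1)] Cmp_Idn_left by metis+
  then show ?thesis
    using assms inv_arrow_facts[OF assms(1)] by (metis Cmp_assoc)
qed

lemma Cmp_cancel_iso_right:
  assumes "iso_arrow C f" "g \<in> Mor C" "h \<in> Mor C" "Dom C g = Cod C f" "Dom C h = Cod C f"
    "Cmp C g f = Cmp C h f"
  shows "g = h"
proof -
  have "g = Cmp C g (Cmp C f (inv_arrow C f))" "h = Cmp C h (Cmp C f (inv_arrow C f))"
    using assms inv_arrow_facts[OF assms(1)] Cmp_Idn_right by metis+
  then show ?thesis
    using assms inv_arrow_facts[OF assms(1)] by (metis Cmp_assoc)
qed

lemma initial_arrow_facts:
  assumes "initial_obj C z" "x \<in> Obj C"
  shows "initial_arrow C z x \<in> Mor C" "Dom C (initial_arrow C z x) = z"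
    "Cod C (initial_arrow C z x) = x"
proof -
  have "\<exists>!f. f \<in> Mor C \<and> Dom C f = z \<and> Cod C f = x"
    using assms by (simp add: initial_obj_def)
  from theI'[OF this] show "initial_arrow C z x \<in> Mor C" "Dom C (initial_arrow C z x) = z"
    "Cod C (initial_arrow C z x) = x"
    by (simp_all add: initial_arrow_def)
qed

lemma initial_arrow_unique:
  assumes "initial_obj C z" "f \<in> Mor C" "Dom C f = z"
  shows "f = initial_arrow C z (Cod C f)"
proof -
  have "\<exists>!f'. f' \<in> Mor C \<and> Dom C f' = z \<and> Cod C f' = Cod C f"
    using assms Cod_in by (simp add: initial_obj_def)
  then show ?thesis
    using initial_arrow_facts[OF assms(1) Cod_in[OF assms(2)]] assms by metis
qed

lemma initial_obj_in: "initial_obj C z \<Longrightarrow> z \<in> Obj C"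
  by (simp add: initial_obj_def)

end

context cat_functor begin

lemma iso_cmor:
  assumes "inverse_arrows (csrc F) f g"
  shows "inverse_arrows (ctgt F) (cmor F f) (cmor F g)"
  using assms unfolding inverse_arrows_def
  by (auto simp: cmor_in Dom_cmor Cod_cmor simp flip: cmor_Cmp cmor_Idn source.Dom_in source.Cod_in)
    (metis cmor_Idn source.Dom_in source.Cod_in)+

end

text \<open>By naturality, \<open>f\<close> after \<eta> equals \<eta> after
  \<open>cmor F f\<close>. Equal images thus make \<open>f\<close> and \<open>g\<close> agree after
  precomposition with an isomorphism, which cancels.\<close>

lemma naturally_iso_id_faithful:
  assumes "category C" "naturally_iso F (id_cfun C)" "csrc F = C" "ctgt F = C" "cat_functor F"
    and "f \<in> Mor C" "g \<in> Mor C" "Dom C f = Dom C g" "Cod C f = Cod C g" "cmor F f = cmor F g"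
  shows "f = g"
proof -
  interpret category C by fact
  obtain \<eta> where iso: "\<And>x. x \<in> Obj C \<Longrightarrow> iso_arrow C (\<eta> x)"
    and dc: "\<And>x. x \<in> Obj C \<Longrightarrow> Dom C (\<eta> x) = cobj F x \<and> Cod C (\<eta> x) = x"
    and nat: "\<And>f. f \<in> Mor C \<Longrightarrow> Cmp C (\<eta> (Cod C f)) (cmor F f) = Cmp C f (\<eta> (Dom C f))"
    using assms unfolding naturally_iso_def by (auto simp: id_cfun_def)
  show ?thesis
    by (rule Cmp_cancel_iso_right[OF iso[of "Dom C f"]])
      (use nat[OF assms(6)] nat[OF assms(7)] assms(6-10) dc[of "Dom C f"] in \<open>simp_all add: Dom_in\<close>)
qed

text \<open>Uniqueness of squares will come from faithfulness, fillers of corners and comparison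
  squares from fullness and essential surjectivity. Hence \<open>cat_equivalence\<close> is traded
  for these three properties.\<close>

definition faithful_fun :: "('o, 'm, 'p, 'n) cfun \<Rightarrow> bool" where
  "faithful_fun F \<longleftrightarrow> (\<forall>f \<in> Mor (csrc F). \<forall>g \<in> Mor (csrc F).
     Dom (csrc F) f = Dom (csrc F) g \<and> Cod (csrc F) f = Cod (csrc F) g \<and> cmor F f = cmor F g
     \<longrightarrow> f = g)"

definition full_fun :: "('o, 'm, 'p, 'n) cfun \<Rightarrow> bool" where
  "full_fun F \<longleftrightarrow> (\<forall>x \<in> Obj (csrc F). \<forall>y \<in> Obj (csrc F). \<forall>h \<in> Mor (ctgt F).
     Dom (ctgt F) h = cobj F x \<and> Cod (ctgt F) h = cobj F y
     \<longrightarrow> (\<exists>f \<in> Mor (csrc F). Dom (csrc F) f = x \<and> Cod (csrc F) f = y \<and> cmor F f = h))"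

definition ess_surj :: "('o, 'm, 'p, 'n) cfun \<Rightarrow> bool" where
  "ess_surj F \<longleftrightarrow> (\<forall>y \<in> Obj (ctgt F). \<exists>x \<in> Obj (csrc F). \<exists>e.
     iso_arrow (ctgt F) e \<and> Dom (ctgt F) e = cobj F x \<and> Cod (ctgt F) e = y)"

lemma cat_functor_comp:
  assumes "cat_functor F" "cat_functor G" "csrc G = ctgt F"
  shows "cat_functor (comp_cfun G F)"
proof -
  interpret F: cat_functor F by fact
  interpret G: cat_functor G by fact
  note G_rules = G.cobj_in G.cmor_in G.Dom_cmor G.Cod_cmor G.cmor_Idn G.cmor_Cmp
  note rules = F.cobj_in F.cmor_in F.Dom_cmor F.Cod_cmor F.cmor_Idn F.cmor_Cmp
    G_rules[unfolded assms(3)]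
  have sel: "csrc (comp_cfun G F) = csrc F" "ctgt (comp_cfun G F) = ctgt G"
    "cobj (comp_cfun G F) x = cobj G (cobj F x)" "cmor (comp_cfun G F) f = cmor G (cmor F f)" for x f
    by (simp_all add: comp_cfun_def)
  show ?thesis
    by (unfold cat_functor_def cat_functor_axioms_def sel, intro conjI allI impI)
      (use F.source.category_axioms G.target.category_axioms in \<open>simp_all add: rules\<close>)
qed

text \<open>For a quasi-inverse \<open>G\<close>, both \<open>F\<close> and \<open>G\<close> are
  faithful, since \<open>G F\<close> and \<open>F G\<close> are naturally isomorphic to identities.
  Faithfulness of \<open>G\<close> is what gives fullness of \<open>F\<close>.\<close>

lemma cat_equivalence_imp:
  assumes "cat_equivalence F"
  shows "faithful_fun F" "full_fun F" "ess_surj F"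
proof -
  obtain G where F: "cat_functor F" and G: "cat_functor G" "csrc G = ctgt F" "ctgt G = csrc F"
    and GF: "naturally_iso (comp_cfun G F) (id_cfun (csrc F))"
    and FG: "naturally_iso (comp_cfun F G) (id_cfun (ctgt F))"
    using assms unfolding cat_equivalence_def by blast
  interpret F: cat_functor F by fact
  interpret G: cat_functor G by fact
  have GFf: "cat_functor (comp_cfun G F)" and FGf: "cat_functor (comp_cfun F G)"
    using cat_functor_comp F G by metis+
  show faithful: "faithful_fun F"
    unfolding faithful_fun_def
  proof (intro ballI impI, elim conjE)
    fix f g
    assume "f \<in> Mor (csrc F)" "g \<in> Mor (csrc F)" "Dom (csrc F) f = Dom (csrc F) g"
      "Cod (csrc F) f = Cod (csrc F) g" "cmor F f = cmor F g"
    then show "f = g"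
      using naturally_iso_id_faithful[OF F.source.category_axioms GF _ _ GFf, of f g]
      by (auto simp: comp_cfun_def G)
  qed
  have faithful': "f = g" if "f \<in> Mor (ctgt F)" "g \<in> Mor (ctgt F)"
      "Dom (ctgt F) f = Dom (ctgt F) g" "Cod (ctgt F) f = Cod (ctgt F) g" "cmor G f = cmor G g" for f g
    using naturally_iso_id_faithful[OF F.target.category_axioms FG _ _ FGf, of f g] that
    by (auto simp: comp_cfun_def G)
  obtain \<eta> where iso: "\<And>x. x \<in> Obj (csrc F) \<Longrightarrow> iso_arrow (csrc F) (\<eta> x)"
    and dc: "\<And>x. x \<in> Obj (csrc F) \<Longrightarrow> Dom (csrc F) (\<eta> x) = cobj G (cobj F x) \<and> Cod (csrc F) (\<eta> x) = x"
    and nat: "\<And>f. f \<in> Mor (csrc F) \<Longrightarrow>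
      Cmp (csrc F) (\<eta> (Cod (csrc F) f)) (cmor G (cmor F f)) = Cmp (csrc F) f (\<eta> (Dom (csrc F) f))"
    using GF unfolding naturally_iso_def by (auto simp: id_cfun_def comp_cfun_def G)
  show "full_fun F"
    unfolding full_fun_def
  proof (intro ballI impI, elim conjE)
    fix x y h
    assume x: "x \<in> Obj (csrc F)" and y: "y \<in> Obj (csrc F)" and h: "h \<in> Mor (ctgt F)"
      "Dom (ctgt F) h = cobj F x" "Cod (ctgt F) h = cobj F y"
    let ?C = "csrc F"
    let ?f' = "Cmp ?C (\<eta> y) (cmor G h)"
    \<comment> \<open>The candidate preimage is \<open>cmor G h\<close> conjugated by \<eta>.
      Naturality makes \<open>cmor G (cmor F f)\<close> and \<open>cmor G h\<close> agree after
      \<eta>, and faithfulness of \<open>G\<close> then gives \<open>cmor F f = h\<close>.\<close>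
    define f where "f = Cmp ?C ?f' (inv_arrow ?C (\<eta> x))"
    note ix = F.source.inv_arrow_facts[OF iso[OF x]] and iy = F.source.inv_arrow_facts[OF iso[OF y]]
    have Gh: "cmor G h \<in> Mor ?C" "Dom ?C (cmor G h) = cobj G (cobj F x)"
      "Cod ?C (cmor G h) = cobj G (cobj F y)"
      using G.cmor_in[of h] G.Dom_cmor[of h] G.Cod_cmor[of h] h G by auto
    have f': "?f' \<in> Mor ?C" "Dom ?C ?f' = cobj G (cobj F x)" "Cod ?C ?f' = y"
      using Gh iy dc[OF y] by (simp_all add: F.source.Cmp_in F.source.Dom_Cmp F.source.Cod_Cmp)
    have f: "f \<in> Mor ?C" "Dom ?C f = x" "Cod ?C f = y"
      using f' ix dc[OF x] by (simp_all add: f_def F.source.Cmp_in F.source.Dom_Cmp F.source.Cod_Cmp)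
    have "Cmp ?C f (\<eta> x) = Cmp ?C ?f' (Cmp ?C (inv_arrow ?C (\<eta> x)) (\<eta> x))"
      using f' ix dc[OF x] F.source.Cmp_assoc[of "\<eta> x" "inv_arrow ?C (\<eta> x)" ?f'] by (simp add: f_def)
    also have "\<dots> = ?f'"
      using f' ix dc[OF x] by (metis F.source.Cmp_Idn_right)
    finally have "Cmp ?C (\<eta> y) (cmor G (cmor F f)) = Cmp ?C (\<eta> y) (cmor G h)"
      using nat[OF f(1)] f by simp
    moreover have Ff: "cmor F f \<in> Mor (ctgt F)" "Dom (ctgt F) (cmor F f) = cobj F x"
      "Cod (ctgt F) (cmor F f) = cobj F y"
      using f F.cmor_in F.Dom_cmor F.Cod_cmor by auto
    moreover have "cmor G (cmor F f) \<in> Mor ?C" "Cod ?C (cmor G (cmor F f)) = cobj G (cobj F y)"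
      using Ff G.cmor_in[of "cmor F f"] G.Cod_cmor[of "cmor F f"] G by auto
    ultimately have "cmor G (cmor F f) = cmor G h"
      using F.source.Cmp_cancel_iso_left[OF iso[OF y]] Gh dc[OF y] by metis
    then have "cmor F f = h"
      using faithful' Ff h by simp
    then show "\<exists>f\<in>Mor (csrc F). Dom (csrc F) f = x \<and> Cod (csrc F) f = y \<and> cmor F f = h"
      using f by blast
  qed
  show "ess_surj F"
    unfolding ess_surj_def
  proof
    fix y assume y: "y \<in> Obj (ctgt F)"
    obtain \<epsilon> where "iso_arrow (ctgt F) (\<epsilon> y) \<and> Dom (ctgt F) (\<epsilon> y) = cobj F (cobj G y) \<and> Cod (ctgt F) (\<epsilon> y) = y"
      using FG y unfolding naturally_iso_def by (auto simp: id_cfun_def comp_cfun_def G)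
    moreover have "cobj G y \<in> Obj (csrc F)"
      using G.cobj_in[of y] y G by simp
    ultimately show "\<exists>x\<in>Obj (csrc F). \<exists>e. iso_arrow (ctgt F) e \<and> Dom (ctgt F) e = cobj F x \<and> Cod (ctgt F) e = y"
      by blast
  qed
qed

text \<open>The quasi-inverse chooses for each \<open>y\<close> an object \<open>g y\<close> and an
  isomorphism \<open>e y\<close> from its image to \<open>y\<close>. On morphisms it has to be the
  lift of the conjugate by \<open>e\<close>, and its laws are checked after applying
  \<open>F\<close>.\<close>

lemma cat_equivalenceI:
  assumes F: "cat_functor F" and faithful: "faithful_fun F" and full: "full_fun F"
    and ess: "ess_surj F"
  shows "cat_equivalence F"
proof -
  interpret F: cat_functor F by fact
  let ?C = "csrc F" and ?D = "ctgt F"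
  have "\<forall>y. \<exists>x e. y \<in> Obj ?D \<longrightarrow> x \<in> Obj ?C \<and> iso_arrow ?D e \<and> Dom ?D e = cobj F x \<and> Cod ?D e = y"
    using ess unfolding ess_surj_def by blast
  then obtain g e where g: "\<And>y. y \<in> Obj ?D \<Longrightarrow> g y \<in> Obj ?C"
    and e: "\<And>y. y \<in> Obj ?D \<Longrightarrow> iso_arrow ?D (e y)"
      "\<And>y. y \<in> Obj ?D \<Longrightarrow> Dom ?D (e y) = cobj F (g y)" "\<And>y. y \<in> Obj ?D \<Longrightarrow> Cod ?D (e y) = y"
    by metis
  note einv = F.target.inv_arrow_facts[OF e(1)]
  define lift where "lift x y h = (SOME f. f \<in> Mor ?C \<and> Dom ?C f = x \<and> Cod ?C f = y \<and> cmor F f = h)" for x y h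
  have lift: "lift x y h \<in> Mor ?C \<and> Dom ?C (lift x y h) = x \<and> Cod ?C (lift x y h) = y \<and> cmor F (lift x y h) = h"
    if "x \<in> Obj ?C" "y \<in> Obj ?C" "h \<in> Mor ?D" "Dom ?D h = cobj F x" "Cod ?D h = cobj F y" for x y h
    unfolding lift_def by (rule someI_ex) (use full that in \<open>fastforce simp: full_fun_def\<close>)
  have eqI: "f = f'" if "f \<in> Mor ?C" "f' \<in> Mor ?C" "Dom ?C f = Dom ?C f'" "Cod ?C f = Cod ?C f'"
    "cmor F f = cmor F f'" for f f'
    using faithful that by (auto simp: faithful_fun_def)
  define conj where "conj h = Cmp ?D (inv_arrow ?D (e (Cod ?D h))) (Cmp ?D h (e (Dom ?D h)))" for h
  have conj: "conj h \<in> Mor ?D" "Dom ?D (conj h) = cobj F (g (Dom ?D h))"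
    "Cod ?D (conj h) = cobj F (g (Cod ?D h))" "Cmp ?D (e (Cod ?D h)) (conj h) = Cmp ?D h (e (Dom ?D h))"
    if h: "h \<in> Mor ?D" for h
  proof -
    have d: "Dom ?D h \<in> Obj ?D" "Cod ?D h \<in> Obj ?D"
      using h F.target.Dom_in F.target.Cod_in by auto
    have he: "Cmp ?D h (e (Dom ?D h)) \<in> Mor ?D" "Dom ?D (Cmp ?D h (e (Dom ?D h))) = cobj F (g (Dom ?D h))"
      "Cod ?D (Cmp ?D h (e (Dom ?D h))) = Cod ?D h"
      using h d e einv by (simp_all add: F.target.Cmp_in F.target.Dom_Cmp F.target.Cod_Cmp)
    show "conj h \<in> Mor ?D" "Dom ?D (conj h) = cobj F (g (Dom ?D h))"
      "Cod ?D (conj h) = cobj F (g (Cod ?D h))"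
      using he d e einv by (simp_all add: conj_def F.target.Cmp_in F.target.Dom_Cmp F.target.Cod_Cmp)
    show "Cmp ?D (e (Cod ?D h)) (conj h) = Cmp ?D h (e (Dom ?D h))"
      using he d e einv unfolding conj_def
      by (simp add: F.target.Cmp_assoc) (metis F.target.Cmp_Idn_left)
  qed
  \<comment> \<open>The conjugate is characterised by its composite with the isomorphism
    \<open>e\<close>, so its functoriality follows by cancelling \<open>e\<close>.\<close>
  have conj_eqI: "conj h = k" if "h \<in> Mor ?D" "k \<in> Mor ?D" "Cod ?D k = cobj F (g (Cod ?D h))"
    "Cmp ?D (e (Cod ?D h)) k = Cmp ?D h (e (Dom ?D h))" for h k
    using F.target.Cmp_cancel_iso_left[OF e(1), of "Cod ?D h" "conj h" k] that conj
    by (simp add: F.target.Cod_in e)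
  define G where "G = \<lparr>csrc = ?D, ctgt = ?C, cobj = g, cmor = (\<lambda>h. lift (g (Dom ?D h)) (g (Cod ?D h)) (conj h))\<rparr>"
  have Gm: "cmor G h \<in> Mor ?C" "Dom ?C (cmor G h) = g (Dom ?D h)" "Cod ?C (cmor G h) = g (Cod ?D h)"
    "cmor F (cmor G h) = conj h" if "h \<in> Mor ?D" for h
    using lift[of "g (Dom ?D h)" "g (Cod ?D h)" "conj h"] conj[OF that] g F.target.Dom_in[OF that]
      F.target.Cod_in[OF that]
    by (simp_all add: G_def)
  have Gs: "csrc G = ?D" "ctgt G = ?C" "cobj G = g"
    by (simp_all add: G_def)
  have "cat_functor G"
  proof (unfold cat_functor_def cat_functor_axioms_def Gs, intro conjI allI impI)
    fix y assume y: "y \<in> Obj ?D"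
    have "conj (Idn ?D y) = Idn ?D (cobj F (g y))"
      using y e einv[OF y] g F.cobj_in F.target.Cmp_Idn_left[of "e y"] F.target.Cmp_Idn_right[of "e y"]
      by (intro conj_eqI) (simp_all add: F.target.Idn_in F.target.Dom_Idn F.target.Cod_Idn)
    then show "cmor G (Idn ?D y) = Idn ?C (g y)"
      using Gm[of "Idn ?D y"] y g
      by (intro eqI) (simp_all add: F.target.Idn_in F.target.Dom_Idn F.target.Cod_Idn
          F.source.Idn_in F.source.Dom_Idn F.source.Cod_Idn F.cmor_Idn)
  next
    fix h h' assume h: "h \<in> Mor ?D" "h' \<in> Mor ?D" "Cod ?D h = Dom ?D h'"
    have hh: "Cmp ?D h' h \<in> Mor ?D" "Dom ?D (Cmp ?D h' h) = Dom ?D h" "Cod ?D (Cmp ?D h' h) = Cod ?D h'"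
      using h by (simp_all add: F.target.Cmp_in F.target.Dom_Cmp F.target.Cod_Cmp)
    have d: "Dom ?D h \<in> Obj ?D" "Cod ?D h \<in> Obj ?D" "Cod ?D h' \<in> Obj ?D"
      using h F.target.Dom_in F.target.Cod_in by auto
    have "Cmp ?D (e (Cod ?D h')) (Cmp ?D (conj h') (conj h))
      = Cmp ?D (Cmp ?D (e (Cod ?D h')) (conj h')) (conj h)"
      using h d conj e einv by (simp add: F.target.Cmp_assoc)
    also have "\<dots> = Cmp ?D (Cmp ?D h' (e (Cod ?D h))) (conj h)"
      using h conj by simp
    also have "\<dots> = Cmp ?D h' (Cmp ?D (e (Cod ?D h)) (conj h))"
      using h d conj(1-3) e einv by (simp add: F.target.Cmp_assoc)
    also have "\<dots> = Cmp ?D h' (Cmp ?D h (e (Dom ?D h)))"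
      using conj(4)[OF h(1)] by simp
    also have "\<dots> = Cmp ?D (Cmp ?D h' h) (e (Dom ?D h))"
      using h d conj(1-3) e einv by (simp add: F.target.Cmp_assoc)
    finally have "conj (Cmp ?D h' h) = Cmp ?D (conj h') (conj h)"
      using h hh conj by (intro conj_eqI) (simp_all add: F.target.Cmp_in F.target.Cod_Cmp)
    then show "cmor G (Cmp ?D h' h) = Cmp ?C (cmor G h') (cmor G h)"
      using h hh Gm by (intro eqI)
        (simp_all add: F.source.Cmp_in F.source.Dom_Cmp F.source.Cod_Cmp F.cmor_Cmp)
  qed (use Gm g F.source.category_axioms F.target.category_axioms in auto)
  moreover have "naturally_iso (comp_cfun F G) (id_cfun ?D)"
    unfolding naturally_iso_def
    using Gm conj e by (intro exI[of _ e]) (simp add: comp_cfun_def id_cfun_def Gs)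
  moreover have "naturally_iso (comp_cfun G F) (id_cfun ?C)"
  proof -
    \<comment> \<open>The component at \<open>x\<close> is the lift of \<open>e (cobj F x)\<close>
      and its inverse the lift of the inverse, so all identities needed are reflected from those of
      \<open>e\<close> by faithfulness.\<close>
    define n where "n x = lift (g (cobj F x)) x (e (cobj F x))" for x
    define n' where "n' x = lift x (g (cobj F x)) (inv_arrow ?D (e (cobj F x)))" for x
    have n: "n x \<in> Mor ?C" "Dom ?C (n x) = g (cobj F x)" "Cod ?C (n x) = x" "cmor F (n x) = e (cobj F x)"
      and n': "n' x \<in> Mor ?C" "Cod ?C (n' x) = g (cobj F x)" "Dom ?C (n' x) = x"
        "cmor F (n' x) = inv_arrow ?D (e (cobj F x))"
      if x: "x \<in> Obj ?C" for x
      using lift[of "g (cobj F x)" x "e (cobj F x)"] lift[of x "g (cobj F x)" "inv_arrow ?D (e (cobj F x))"]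
        x g e einv F.cobj_in by (simp_all add: n_def n'_def)
    have "inverse_arrows ?C (n x) (n' x)" if x: "x \<in> Obj ?C" for x
      unfolding inverse_arrows_def using n[OF x] n'[OF x] x g F.cobj_in e einv
      by (auto intro!: eqI simp: F.source.Cmp_in F.source.Dom_Cmp F.source.Cod_Cmp F.cmor_Cmp
          F.source.Idn_in F.source.Dom_Idn F.source.Cod_Idn F.cmor_Idn)
    moreover have "Cmp ?C (n (Cod ?C f)) (cmor G (cmor F f)) = Cmp ?C f (n (Dom ?C f))"
      if f: "f \<in> Mor ?C" for f
      using f n[OF F.source.Cod_in[OF f]] n[OF F.source.Dom_in[OF f]] Gm[OF F.cmor_in[OF f]]
        conj(4)[OF F.cmor_in[OF f]]
      by (intro eqI) (simp_all add: F.source.Cmp_in F.source.Dom_Cmp F.source.Cod_Cmp F.cmor_Cmp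
          F.Dom_cmor F.Cod_cmor F.cmor_in)
    ultimately show ?thesis
      unfolding naturally_iso_def using n
      by (intro exI[of _ n]) (auto simp: comp_cfun_def id_cfun_def Gs iso_arrow_def)
  qed
  ultimately show ?thesis
    unfolding cat_equivalence_def using F Gs by blast
qed

section \<open>Double categories and double functors\<close>

context double_category begin

lemmas hdom_in = horizontal.Dom_in[simplified]
lemmas hcod_in = horizontal.Cod_in[simplified]
lemmas hid_in = horizontal.Idn_in[simplified]
lemmas hdom_hid = horizontal.Dom_Idn[simplified]
lemmas hcod_hid = horizontal.Cod_Idn[simplified]
lemmas hcmp_in = horizontal.Cmp_in[simplified]
lemmas hdom_hcmp = horizontal.Dom_Cmp[simplified]
lemmas hcod_hcmp = horizontal.Cod_Cmp[simplified]
lemmas hcmp_assoc = horizontal.Cmp_assoc[simplified]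

lemmas vdom_in = vertical.Dom_in[simplified]
lemmas vcod_in = vertical.Cod_in[simplified]
lemmas vid_in = vertical.Idn_in[simplified]
lemmas vdom_vid = vertical.Dom_Idn[simplified]
lemmas vcod_vid = vertical.Cod_Idn[simplified]
lemmas vcmp_in = vertical.Cmp_in[simplified]
lemmas vdom_vcmp = vertical.Dom_Cmp[simplified]
lemmas vcod_vcmp = vertical.Cod_Cmp[simplified]
lemmas vcmp_assoc = vertical.Cmp_assoc[simplified]

lemmas slft_in = squares_h.Dom_in[simplified]
lemmas srgt_in = squares_h.Cod_in[simplified]
lemmas sqhid_in = squares_h.Idn_in[simplified]
lemmas slft_sqhid = squares_h.Dom_Idn[simplified]
lemmas srgt_sqhid = squares_h.Cod_Idn[simplified]
lemmas sqhcmp_in = squares_h.Cmp_in[simplified]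
lemmas slft_sqhcmp = squares_h.Dom_Cmp[simplified]
lemmas srgt_sqhcmp = squares_h.Cod_Cmp[simplified]
lemmas sqhcmp_assoc = squares_h.Cmp_assoc[simplified]

lemmas stop_in = squares_v.Dom_in[simplified]
lemmas sbot_in = squares_v.Cod_in[simplified]
lemmas sqvid_in = squares_v.Idn_in[simplified]
lemmas stop_sqvid = squares_v.Dom_Idn[simplified]
lemmas sbot_sqvid = squares_v.Cod_Idn[simplified]
lemmas sqvcmp_in = squares_v.Cmp_in[simplified]
lemmas stop_sqvcmp = squares_v.Dom_Cmp[simplified]
lemmas sbot_sqvcmp = squares_v.Cod_Cmp[simplified]
lemmas sqvcmp_assoc = squares_v.Cmp_assoc[simplified]

lemma hcmp_hid_right: "\<lbrakk>f \<in> Hor D; hdom D f = x\<rbrakk> \<Longrightarrow> hcmp D f (hid D x) = f"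
  using horizontal.Cmp_Idn_right[of f] by auto
lemma hcmp_hid_left: "\<lbrakk>f \<in> Hor D; hcod D f = x\<rbrakk> \<Longrightarrow> hcmp D (hid D x) f = f"
  using horizontal.Cmp_Idn_left[of f] by auto
lemma vcmp_vid_right: "\<lbrakk>f \<in> Ver D; vdom D f = x\<rbrakk> \<Longrightarrow> vcmp D f (vid D x) = f"
  using vertical.Cmp_Idn_right[of f] by auto
lemma vcmp_vid_left: "\<lbrakk>f \<in> Ver D; vcod D f = x\<rbrakk> \<Longrightarrow> vcmp D (vid D x) f = f"
  using vertical.Cmp_Idn_left[of f] by auto
lemma sqhcmp_sqhid_right: "\<lbrakk>s \<in> Sq D; slft D s = v\<rbrakk> \<Longrightarrow> sqhcmp D s (sqhid D v) = s"
  using squares_h.Cmp_Idn_right[of s] by auto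
lemma sqhcmp_sqhid_left: "\<lbrakk>s \<in> Sq D; srgt D s = v\<rbrakk> \<Longrightarrow> sqhcmp D (sqhid D v) s = s"
  using squares_h.Cmp_Idn_left[of s] by auto
lemma sqvcmp_sqvid_right: "\<lbrakk>s \<in> Sq D; stop D s = f\<rbrakk> \<Longrightarrow> sqvcmp D s (sqvid D f) = s"
  using squares_v.Cmp_Idn_right[of s] by auto
lemma sqvcmp_sqvid_left: "\<lbrakk>s \<in> Sq D; sbot D s = f\<rbrakk> \<Longrightarrow> sqvcmp D (sqvid D f) s = s"
  using squares_v.Cmp_Idn_left[of s] by auto

text \<open>The corner equations are oriented so that ends of horizontal sides become ends of
  vertical ones. Rewriting with them does not detect that vertical sides of vertically composable
  squares compose; the detour through the common horizontal side is made here.\<close>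

lemma edge_vcmp:
  assumes "s \<in> Sq D" "t \<in> Sq D" "sbot D s = stop D t"
  shows "vcod D (slft D s) = vdom D (slft D t)" "vcod D (srgt D s) = vdom D (srgt D t)"
    "vdom D (vcmp D (slft D t) (slft D s)) = vdom D (slft D s)"
    "vcod D (vcmp D (slft D t) (slft D s)) = vcod D (slft D t)"
    "vdom D (vcmp D (srgt D t) (srgt D s)) = vdom D (srgt D s)"
    "vcod D (vcmp D (srgt D t) (srgt D s)) = vcod D (srgt D t)"
proof -
  show 1: "vcod D (slft D s) = vdom D (slft D t)" "vcod D (srgt D s) = vdom D (srgt D t)"
    using assms by (metis corner_tl corner_bl, metis corner_tr corner_br)
  show "vdom D (vcmp D (slft D t) (slft D s)) = vdom D (slft D s)"
    "vcod D (vcmp D (slft D t) (slft D s)) = vcod D (slft D t)"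
    "vdom D (vcmp D (srgt D t) (srgt D s)) = vdom D (srgt D s)"
    "vcod D (vcmp D (srgt D t) (srgt D s)) = vcod D (srgt D t)"
    using assms 1 by (simp_all add: vdom_vcmp vcod_vcmp slft_in srgt_in)
qed

lemmas cell_simps =
  hdom_in hcod_in hid_in hdom_hid hcod_hid hcmp_in hdom_hcmp hcod_hcmp hcmp_hid_right hcmp_hid_left
  vdom_in vcod_in vid_in vdom_vid vcod_vid vcmp_in vdom_vcmp vcod_vcmp vcmp_vid_right vcmp_vid_left
  slft_in srgt_in sqhid_in slft_sqhid srgt_sqhid sqhcmp_in slft_sqhcmp srgt_sqhcmp
  sqhcmp_sqhid_right sqhcmp_sqhid_left
  stop_in sbot_in sqvid_in stop_sqvid sbot_sqvid sqvcmp_in stop_sqvcmp sbot_sqvcmp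
  sqvcmp_sqvid_right sqvcmp_sqvid_left
  stop_sqhid sbot_sqhid slft_sqvid srgt_sqvid stop_sqhcmp sbot_sqhcmp slft_sqvcmp srgt_sqvcmp
  corner_tl corner_tr corner_bl corner_br

end

lemma double_categoryI:
  assumes "category (hcat D)" "category (vcat D)" "category (hcat_ver D)" "category (vcat_hor D)"
    and "double_category_axioms D"
  shows "double_category D"
  using assms by (simp add: double_category_def)

lemma double_functorD:
  assumes "double_functor F"
  shows "double_category (dsrc F)" "double_category (dtgt F)"
    "x \<in> Ob (dsrc F) \<Longrightarrow> onob F x \<in> Ob (dtgt F)"
    "f \<in> Hor (dsrc F) \<Longrightarrow> onhor F f \<in> Hor (dtgt F)"
    "f \<in> Hor (dsrc F) \<Longrightarrow> hdom (dtgt F) (onhor F f) = onob F (hdom (dsrc F) f)"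
    "f \<in> Hor (dsrc F) \<Longrightarrow> hcod (dtgt F) (onhor F f) = onob F (hcod (dsrc F) f)"
    "x \<in> Ob (dsrc F) \<Longrightarrow> onhor F (hid (dsrc F) x) = hid (dtgt F) (onob F x)"
    "\<lbrakk>f \<in> Hor (dsrc F); g \<in> Hor (dsrc F); hcod (dsrc F) f = hdom (dsrc F) g\<rbrakk>
      \<Longrightarrow> onhor F (hcmp (dsrc F) g f) = hcmp (dtgt F) (onhor F g) (onhor F f)"
    "v \<in> Ver (dsrc F) \<Longrightarrow> onver F v \<in> Ver (dtgt F)"
    "v \<in> Ver (dsrc F) \<Longrightarrow> vdom (dtgt F) (onver F v) = onob F (vdom (dsrc F) v)"
    "v \<in> Ver (dsrc F) \<Longrightarrow> vcod (dtgt F) (onver F v) = onob F (vcod (dsrc F) v)"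
    "x \<in> Ob (dsrc F) \<Longrightarrow> onver F (vid (dsrc F) x) = vid (dtgt F) (onob F x)"
    "\<lbrakk>v \<in> Ver (dsrc F); w \<in> Ver (dsrc F); vcod (dsrc F) v = vdom (dsrc F) w\<rbrakk>
      \<Longrightarrow> onver F (vcmp (dsrc F) w v) = vcmp (dtgt F) (onver F w) (onver F v)"
    "s \<in> Sq (dsrc F) \<Longrightarrow> onsq F s \<in> Sq (dtgt F)"
    "s \<in> Sq (dsrc F) \<Longrightarrow> stop (dtgt F) (onsq F s) = onhor F (stop (dsrc F) s)"
    "s \<in> Sq (dsrc F) \<Longrightarrow> sbot (dtgt F) (onsq F s) = onhor F (sbot (dsrc F) s)"
    "s \<in> Sq (dsrc F) \<Longrightarrow> slft (dtgt F) (onsq F s) = onver F (slft (dsrc F) s)"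
    "s \<in> Sq (dsrc F) \<Longrightarrow> srgt (dtgt F) (onsq F s) = onver F (srgt (dsrc F) s)"
    "v \<in> Ver (dsrc F) \<Longrightarrow> onsq F (sqhid (dsrc F) v) = sqhid (dtgt F) (onver F v)"
    "f \<in> Hor (dsrc F) \<Longrightarrow> onsq F (sqvid (dsrc F) f) = sqvid (dtgt F) (onhor F f)"
    "\<lbrakk>s \<in> Sq (dsrc F); t \<in> Sq (dsrc F); srgt (dsrc F) s = slft (dsrc F) t\<rbrakk>
      \<Longrightarrow> onsq F (sqhcmp (dsrc F) t s) = sqhcmp (dtgt F) (onsq F t) (onsq F s)"
    "\<lbrakk>s \<in> Sq (dsrc F); t \<in> Sq (dsrc F); sbot (dsrc F) s = stop (dsrc F) t\<rbrakk>
      \<Longrightarrow> onsq F (sqvcmp (dsrc F) t s) = sqvcmp (dtgt F) (onsq F t) (onsq F s)"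
  using assms
  by (simp_all add: double_functor_def cat_functor_def cat_functor_axioms_def hfun_def vfun_def
      hfun_ver_def vfun_hor_def)

lemma double_functorI:
  assumes "double_category (dsrc F)" "double_category (dtgt F)"
    "\<And>x. x \<in> Ob (dsrc F) \<Longrightarrow> onob F x \<in> Ob (dtgt F)"
    "\<And>f. f \<in> Hor (dsrc F) \<Longrightarrow> onhor F f \<in> Hor (dtgt F)"
    "\<And>f. f \<in> Hor (dsrc F) \<Longrightarrow> hdom (dtgt F) (onhor F f) = onob F (hdom (dsrc F) f)"
    "\<And>f. f \<in> Hor (dsrc F) \<Longrightarrow> hcod (dtgt F) (onhor F f) = onob F (hcod (dsrc F) f)"
    "\<And>x. x \<in> Ob (dsrc F) \<Longrightarrow> onhor F (hid (dsrc F) x) = hid (dtgt F) (onob F x)"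
    "\<And>f g. \<lbrakk>f \<in> Hor (dsrc F); g \<in> Hor (dsrc F); hcod (dsrc F) f = hdom (dsrc F) g\<rbrakk>
      \<Longrightarrow> onhor F (hcmp (dsrc F) g f) = hcmp (dtgt F) (onhor F g) (onhor F f)"
    "\<And>v. v \<in> Ver (dsrc F) \<Longrightarrow> onver F v \<in> Ver (dtgt F)"
    "\<And>v. v \<in> Ver (dsrc F) \<Longrightarrow> vdom (dtgt F) (onver F v) = onob F (vdom (dsrc F) v)"
    "\<And>v. v \<in> Ver (dsrc F) \<Longrightarrow> vcod (dtgt F) (onver F v) = onob F (vcod (dsrc F) v)"
    "\<And>x. x \<in> Ob (dsrc F) \<Longrightarrow> onver F (vid (dsrc F) x) = vid (dtgt F) (onob F x)"
    "\<And>v w. \<lbrakk>v \<in> Ver (dsrc F); w \<in> Ver (dsrc F); vcod (dsrc F) v = vdom (dsrc F) w\<rbrakk>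
      \<Longrightarrow> onver F (vcmp (dsrc F) w v) = vcmp (dtgt F) (onver F w) (onver F v)"
    "\<And>s. s \<in> Sq (dsrc F) \<Longrightarrow> onsq F s \<in> Sq (dtgt F)"
    "\<And>s. s \<in> Sq (dsrc F) \<Longrightarrow> stop (dtgt F) (onsq F s) = onhor F (stop (dsrc F) s)"
    "\<And>s. s \<in> Sq (dsrc F) \<Longrightarrow> sbot (dtgt F) (onsq F s) = onhor F (sbot (dsrc F) s)"
    "\<And>s. s \<in> Sq (dsrc F) \<Longrightarrow> slft (dtgt F) (onsq F s) = onver F (slft (dsrc F) s)"
    "\<And>s. s \<in> Sq (dsrc F) \<Longrightarrow> srgt (dtgt F) (onsq F s) = onver F (srgt (dsrc F) s)"
    "\<And>v. v \<in> Ver (dsrc F) \<Longrightarrow> onsq F (sqhid (dsrc F) v) = sqhid (dtgt F) (onver F v)"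
    "\<And>f. f \<in> Hor (dsrc F) \<Longrightarrow> onsq F (sqvid (dsrc F) f) = sqvid (dtgt F) (onhor F f)"
    "\<And>s t. \<lbrakk>s \<in> Sq (dsrc F); t \<in> Sq (dsrc F); srgt (dsrc F) s = slft (dsrc F) t\<rbrakk>
      \<Longrightarrow> onsq F (sqhcmp (dsrc F) t s) = sqhcmp (dtgt F) (onsq F t) (onsq F s)"
    "\<And>s t. \<lbrakk>s \<in> Sq (dsrc F); t \<in> Sq (dsrc F); sbot (dsrc F) s = stop (dsrc F) t\<rbrakk>
      \<Longrightarrow> onsq F (sqvcmp (dsrc F) t s) = sqvcmp (dtgt F) (onsq F t) (onsq F s)"
  shows "double_functor F"
  using assms
  by (simp add: double_functor_def cat_functor_def cat_functor_axioms_def hfun_def vfun_def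
      hfun_ver_def vfun_hor_def double_category_def)

lemma double_functor_comp:
  assumes "double_functor F" "double_functor G" "dsrc G = dtgt F"
  shows "double_functor (comp_dfun G F)"
proof -
  note rules = double_functorD[OF assms(1)] double_functorD[OF assms(2), unfolded assms(3)]
  have sel: "dsrc (comp_dfun G F) = dsrc F" "dtgt (comp_dfun G F) = dtgt G"
    "onob (comp_dfun G F) x = onob G (onob F x)" "onhor (comp_dfun G F) f = onhor G (onhor F f)"
    "onver (comp_dfun G F) v = onver G (onver F v)" "onsq (comp_dfun G F) s = onsq G (onsq F s)"
    for x f v s
    by (simp_all add: comp_dfun_def)
  show ?thesis
    by (rule double_functorI; unfold sel) (simp_all add: rules)
qed

lemma double_functor_id: "double_category D \<Longrightarrow> double_functor (id_dfun D)"
  by (rule double_functorI) (simp_all add: id_dfun_def)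

lemma transpose_simps [simp]:
  "Ob (transpose D) = Ob D" "Hor (transpose D) = Ver D" "Ver (transpose D) = Hor D"
  "Sq (transpose D) = Sq D"
  "hdom (transpose D) = vdom D" "hcod (transpose D) = vcod D" "hid (transpose D) = vid D"
  "hcmp (transpose D) = vcmp D" "vdom (transpose D) = hdom D" "vcod (transpose D) = hcod D"
  "vid (transpose D) = hid D" "vcmp (transpose D) = hcmp D"
  "stop (transpose D) = slft D" "sbot (transpose D) = srgt D"
  "slft (transpose D) = stop D" "srgt (transpose D) = sbot D"
  "sqhid (transpose D) = sqvid D" "sqhcmp (transpose D) = sqvcmp D"
  "sqvid (transpose D) = sqhid D" "sqvcmp (transpose D) = sqhcmp D"
  by (simp_all add: transpose_def)

lemma transpose_transpose [simp]: "transpose (transpose D) = D"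
  by (simp add: transpose_def)

lemma transpose_cats [simp]:
  "hcat (transpose D) = vcat D" "vcat (transpose D) = hcat D"
  "hcat_ver (transpose D) = vcat_hor D" "vcat_hor (transpose D) = hcat_ver D"
  by (simp_all add: hcat_def vcat_def hcat_ver_def vcat_hor_def)

lemma double_category_transpose: "double_category D \<Longrightarrow> double_category (transpose D)"
  by (simp add: double_category_def double_category_axioms_def)

lemma transpose_dfun_simps [simp]:
  "dsrc (transpose_dfun F) = transpose (dsrc F)" "dtgt (transpose_dfun F) = transpose (dtgt F)"
  "onob (transpose_dfun F) = onob F" "onhor (transpose_dfun F) = onver F"
  "onver (transpose_dfun F) = onhor F" "onsq (transpose_dfun F) = onsq F"
  by (simp_all add: transpose_dfun_def)

lemma transpose_dfun_transpose [simp]: "transpose_dfun (transpose_dfun F) = F"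
  by (simp add: transpose_dfun_def)

lemma transpose_eq_iff [simp]: "transpose A = transpose B \<longleftrightarrow> A = B"
  by (metis transpose_transpose)

lemma double_category_transpose_iff [simp]:
  "double_category (transpose D) \<longleftrightarrow> double_category D"
  using double_category_transpose transpose_transpose by metis

lemma double_functor_transpose [simp]:
  "double_functor (transpose_dfun F) \<longleftrightarrow> double_functor F"
  by (auto simp: double_functor_def hfun_def vfun_def hfun_ver_def vfun_hor_def)

lemma dfun_eq_transpose [simp]: "dfun_eq (transpose_dfun F) (transpose_dfun G) \<longleftrightarrow> dfun_eq F G"
  by (auto simp: dfun_eq_def)

lemma comp_dfun_transpose:
  "comp_dfun (transpose_dfun G) (transpose_dfun F) = transpose_dfun (comp_dfun G F)"
  by (simp add: comp_dfun_def transpose_dfun_def)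

lemma extends_along_transpose [simp]:
  "extends_along (transpose_dfun i) (transpose_dfun F) (transpose_dfun G) \<longleftrightarrow> extends_along i F G"
  by (simp add: extends_along_def comp_dfun_transpose)

lemma local_wrt_transposeI:
  assumes "local_wrt D i"
  shows "local_wrt (transpose D) (transpose_dfun i)"
  unfolding local_wrt_def
proof (intro allI impI, elim conjE)
  fix F assume F: "double_functor F" "dsrc F = dsrc (transpose_dfun i)" "dtgt F = transpose D"
  have "double_functor (transpose_dfun F)" "dsrc (transpose_dfun F) = dsrc i"
    "dtgt (transpose_dfun F) = D"
    using F by simp_all
  with assms obtain G where "extends_along i (transpose_dfun F) G"
    unfolding local_wrt_def by blast
  then have "extends_along (transpose_dfun i) F (transpose_dfun G)"
    by (metis extends_along_transpose transpose_dfun_transpose)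
  then show "\<exists>G. extends_along (transpose_dfun i) F G" ..
qed

lemma local_wrt_transpose: "local_wrt (transpose D) (transpose_dfun i) \<longleftrightarrow> local_wrt D i"
  using local_wrt_transposeI transpose_transpose transpose_dfun_transpose by metis

lemma strictly_local_wrtI:
  assumes "\<And>F. \<lbrakk>double_functor F; dsrc F = dsrc i; dtgt F = D\<rbrakk> \<Longrightarrow> \<exists>G. extends_along i F G"
    and "\<And>F G G'. \<lbrakk>double_functor F; dsrc F = dsrc i; dtgt F = D; extends_along i F G;
      extends_along i F G'\<rbrakk> \<Longrightarrow> dfun_eq G G'"
  shows "strictly_local_wrt D i"
  unfolding strictly_local_wrt_def local_wrt_def
proof (intro conjI allI impI, goal_cases)
  case (1 F)
  then show ?case using assms(1) by simp
next
  case (2 F G G')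
  then show ?case using assms(2)[of F G G'] by simp
qed

lemma strictly_local_wrt_transposeI:
  assumes "strictly_local_wrt D i"
  shows "strictly_local_wrt (transpose D) (transpose_dfun i)"
proof (rule strictly_local_wrtI)
  fix F assume "double_functor F" "dsrc F = dsrc (transpose_dfun i)" "dtgt F = transpose D"
  then show "\<exists>G. extends_along (transpose_dfun i) F G"
    using assms local_wrt_transposeI unfolding strictly_local_wrt_def local_wrt_def by blast
next
  fix F G G'
  assume F: "double_functor F" "dsrc F = dsrc (transpose_dfun i)" "dtgt F = transpose D"
    and G: "extends_along (transpose_dfun i) F G" "extends_along (transpose_dfun i) F G'"
  have "double_functor (transpose_dfun F)" "dsrc (transpose_dfun F) = dsrc i"
    "dtgt (transpose_dfun F) = D"
    using F by simp_all
  moreover have "extends_along i (transpose_dfun F) (transpose_dfun G)"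
    "extends_along i (transpose_dfun F) (transpose_dfun G')"
    using G extends_along_transpose transpose_dfun_transpose by metis+
  ultimately have "dfun_eq (transpose_dfun G) (transpose_dfun G')"
    using assms unfolding strictly_local_wrt_def by blast
  then show "dfun_eq G G'" by simp
qed

lemma strictly_local_wrt_transpose:
  "strictly_local_wrt (transpose D) (transpose_dfun i) \<longleftrightarrow> strictly_local_wrt D i"
  using strictly_local_wrt_transposeI transpose_transpose transpose_dfun_transpose by metis

section \<open>Quotients of double categories\<close>

lemma obj_eq_mono: "obj_eq C Ro x y \<Longrightarrow> Obj C = Obj C' \<Longrightarrow> obj_eq C' Ro x y"
  by (induction rule: obj_eq.induct) (auto intro: obj_eq.intros)

text \<open>The congruence \<open>obj_eq\<close> looks only at the objects, which are shared, so the
  horizontal and the vertical quotient have the same objects.\<close>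

lemma obj_eq_vcat: "obj_eq (vcat U) Ro = obj_eq (hcat U) Ro"
  by (intro ext iffI) (auto intro: obj_eq_mono)

section \<open>Quotient of a category by a congruence on formal composites\<close>

locale category_quotient = category C for C :: "('o, 'm) cat" +
  fixes Ro :: "('o \<times> 'o) set" and Rm :: "('m \<times> 'm) set"
  assumes Ro_in: "(x, y) \<in> Ro \<Longrightarrow> x \<in> Obj C \<and> y \<in> Obj C"
    and Rm_in: "(f, f') \<in> Rm \<Longrightarrow> f \<in> Mor C \<and> f' \<in> Mor C
      \<and> obj_eq C Ro (Dom C f) (Dom C f') \<and> obj_eq C Ro (Cod C f) (Cod C f')"
begin

abbreviation oeq where "oeq \<equiv> obj_eq C Ro"
abbreviation meq where "meq \<equiv> expr_eq C Ro Rm"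
abbreviation mwf where "mwf \<equiv> expr_wf C Ro"

lemma oeq_in: "oeq x y \<Longrightarrow> x \<in> Obj C \<and> y \<in> Obj C"
  by (induction rule: obj_eq.induct) (use Ro_in in auto)

lemma mwf_in: "mwf e \<Longrightarrow> esrc C e \<in> Obj C \<and> etgt C e \<in> Obj C"
  by (induction e) (auto simp: Dom_in Cod_in)

text \<open>The rule \<open>cong\<close> requires only the unprimed composite to be well formed. The
  primed one is so too, because congruent composites have congruent ends.\<close>

lemma meq_wf: "meq e e' \<Longrightarrow> mwf e \<and> mwf e' \<and> oeq (esrc C e) (esrc C e') \<and> oeq (etgt C e) (etgt C e')"
proof (induction rule: expr_eq.induct)
  case (cong g g' f f')
  then have "oeq (etgt C f') (etgt C f)" "oeq (etgt C f) (esrc C g)" "oeq (esrc C g) (esrc C g')"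
    by (auto intro: obj_eq.sym)
  then show ?case
    using cong by (auto intro: obj_eq.trans)
next
  case (comp f g)
  then show ?case
    by (auto intro!: obj_eq.refl simp: Dom_in Cod_in Cmp_in Dom_Cmp Cod_Cmp)
next
  case (idr e x)
  then show ?case
    using oeq_in[OF idr(2)] mwf_in[of e] by (auto intro: obj_eq.refl simp: Idn_in Dom_Idn Cod_Idn)
next
  case (idl e x)
  then show ?case
    using oeq_in[OF idl(2)] mwf_in[of e]
    by (auto intro: obj_eq.refl obj_eq.sym simp: Idn_in Dom_Idn Cod_Idn)
next
  case (assoc h g f)
  then show ?case
    using mwf_in[of f] mwf_in[of h] by (auto intro: obj_eq.refl)
qed (use Rm_in mwf_in in \<open>auto intro: obj_eq.intros\<close>)

text \<open>The composite of the two identities reduces to the one by \<open>idr\<close> and to the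
  other by \<open>idl\<close>.\<close>

lemma meq_Idn: "oeq x y \<Longrightarrow> meq (Gen (Idn C x)) (Gen (Idn C y))"
proof -
  assume *: "oeq x y"
  note in' = oeq_in[OF *]
  have "meq (Com (Gen (Idn C x)) (Gen (Idn C y))) (Gen (Idn C x))"
    using * in' by (intro expr_eq.idr) (auto simp: Idn_in Dom_Idn intro: obj_eq.sym)
  moreover have "meq (Com (Gen (Idn C x)) (Gen (Idn C y))) (Gen (Idn C y))"
    using * in' by (intro expr_eq.idl) (auto simp: Idn_in Cod_Idn)
  ultimately show ?thesis
    by (blast intro: expr_eq.intros)
qed

text \<open>The sides of unit squares on formal composites are known to be identities only up to
  congruence, so the unit laws must allow any composite congruent to an identity.\<close>

lemma meq_idr: "\<lbrakk>mwf e; meq i (Gen (Idn C x)); oeq x (esrc C e)\<rbrakk> \<Longrightarrow> meq (Com e i) e"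
proof -
  assume *: "mwf e" "meq i (Gen (Idn C x))" "oeq x (esrc C e)"
  have "oeq (etgt C i) x"
    using meq_wf[OF *(2)] oeq_in[OF *(3)] by (simp add: Cod_Idn)
  then have "meq (Com e i) (Com e (Gen (Idn C x)))"
    using * meq_wf[OF *(2)] by (intro expr_eq.cong) (auto intro: expr_eq.refl obj_eq.trans)
  then show ?thesis
    using * expr_eq.idr expr_eq.trans by metis
qed

lemma meq_idl: "\<lbrakk>mwf e; meq i (Gen (Idn C x)); oeq x (etgt C e)\<rbrakk> \<Longrightarrow> meq (Com i e) e"
proof -
  assume *: "mwf e" "meq i (Gen (Idn C x))" "oeq x (etgt C e)"
  have "oeq (esrc C i) x"
    using meq_wf[OF *(2)] oeq_in[OF *(3)] by (simp add: Dom_Idn)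
  then have "meq (Com i e) (Com (Gen (Idn C x)) e)"
    using * meq_wf[OF *(2)] by (intro expr_eq.cong)
      (auto intro: expr_eq.refl obj_eq.trans obj_eq.sym)
  then show ?thesis
    using * expr_eq.idl expr_eq.trans by metis
qed

definition ocl where "ocl x = {y. oeq x y}"
definition mcl where "mcl e = {e'. meq e e'}"

lemma ocl_eqI: "oeq x y \<Longrightarrow> ocl x = ocl y"
  unfolding ocl_def by (auto intro: obj_eq.trans obj_eq.sym)

lemma ocl_eq_iff: "x \<in> Obj C \<Longrightarrow> ocl x = ocl y \<longleftrightarrow> oeq x y"
proof
  assume "x \<in> Obj C" "ocl x = ocl y"
  then have "oeq y x" unfolding ocl_def by (auto intro: obj_eq.refl)
  then show "oeq x y" by (rule obj_eq.sym)
qed (rule ocl_eqI)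

lemma mcl_eqI: "meq e e' \<Longrightarrow> mcl e = mcl e'"
  unfolding mcl_def by (auto intro: expr_eq.trans expr_eq.sym)

lemma repr_ocl: "x \<in> Obj C \<Longrightarrow> oeq x (repr (ocl x))"
  unfolding repr_def ocl_def mem_Collect_eq by (rule someI[of _ x]) (rule obj_eq.refl)

lemma repr_mcl: "mwf e \<Longrightarrow> meq e (repr (mcl e))"
  unfolding repr_def mcl_def mem_Collect_eq by (rule someI[of _ e]) (rule expr_eq.refl)

definition quot where
  "quot = \<lparr>Obj = ocl ` Obj C, Mor = mcl ` {e. mwf e},
     Dom = (\<lambda>W. ocl (esrc C (repr W))), Cod = (\<lambda>W. ocl (etgt C (repr W))),
     Idn = (\<lambda>X. mcl (Gen (Idn C (repr X)))),
     Cmp = (\<lambda>W' W. mcl (Com (repr W') (repr W)))\<rparr>"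

text \<open>The operations of \<open>quot\<close> use a representative picked by
  \<open>repr\<close>. It is congruent to any given one, and all operations respect the
  congruence.\<close>

lemma quot_simps:
  "Obj quot = ocl ` Obj C" "Mor quot = mcl ` {e. mwf e}"
  "mwf e \<Longrightarrow> Dom quot (mcl e) = ocl (esrc C e)"
  "mwf e \<Longrightarrow> Cod quot (mcl e) = ocl (etgt C e)"
  "x \<in> Obj C \<Longrightarrow> Idn quot (ocl x) = mcl (Gen (Idn C x))"
  "mwf (Com g f) \<Longrightarrow> Cmp quot (mcl g) (mcl f) = mcl (Com g f)"
proof -
  show "Obj quot = ocl ` Obj C" "Mor quot = mcl ` {e. mwf e}"
    by (simp_all add: quot_def)
  show "Dom quot (mcl e) = ocl (esrc C e)" "Cod quot (mcl e) = ocl (etgt C e)" if "mwf e"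
    using meq_wf[OF repr_mcl[OF that]] by (simp_all add: quot_def obj_eq.sym ocl_eqI)
  show "Idn quot (ocl x) = mcl (Gen (Idn C x))" if "x \<in> Obj C"
    using mcl_eqI[OF meq_Idn[OF repr_ocl[OF that]]] by (simp add: quot_def)
  show "Cmp quot (mcl g) (mcl f) = mcl (Com g f)" if "mwf (Com g f)"
    unfolding quot_def cat.simps
    using that repr_mcl[of g] repr_mcl[of f]
    by (intro mcl_eqI expr_eq.sym[OF expr_eq.cong]) simp_all
qed

text \<open>The laws are the rules \<open>idr\<close>, \<open>idl\<close> and \<open>assoc\<close>.
  Equality of the classes of the ends is exactly composability in the sense of
  \<open>expr_wf\<close>.\<close>

lemma category_quot: "category quot"
proof
  fix W assume "W \<in> Mor quot"
  then obtain e where e: "W = mcl e" "mwf e"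
    by (auto simp: quot_simps)
  then show "Dom quot W \<in> Obj quot" "Cod quot W \<in> Obj quot"
    using mwf_in by (auto simp: quot_simps)
  have "mwf (Com e (Gen (Idn C (esrc C e))))" "mwf (Com (Gen (Idn C (etgt C e))) e)"
    using e mwf_in[of e] by (auto simp: Idn_in Dom_Idn Cod_Idn intro: obj_eq.refl)
  note comps = quot_simps(6)[OF this(1)] quot_simps(6)[OF this(2)]
  show "Cmp quot W (Idn quot (Dom quot W)) = W"
    using e mwf_in[of e] comps
    by (simp add: quot_simps(1-5)) (auto intro!: mcl_eqI expr_eq.idr obj_eq.refl)
  show "Cmp quot (Idn quot (Cod quot W)) W = W"
    using e mwf_in[of e] comps
    by (simp add: quot_simps(1-5)) (auto intro!: mcl_eqI expr_eq.idl obj_eq.refl)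
next
  fix X assume "X \<in> Obj quot"
  then show "Idn quot X \<in> Mor quot" "Dom quot (Idn quot X) = X" "Cod quot (Idn quot X) = X"
    by (auto simp: quot_simps Idn_in Dom_Idn Cod_Idn)
next
  fix W W' assume *: "W \<in> Mor quot" "W' \<in> Mor quot" "Cod quot W = Dom quot W'"
  then obtain e e' where e: "W = mcl e" "W' = mcl e'" "mwf e" "mwf e'"
    by (auto simp: quot_simps)
  then have wf: "mwf (Com e' e)"
    using * mwf_in by (simp add: quot_simps ocl_eq_iff)
  then show "Cmp quot W' W \<in> Mor quot" "Dom quot (Cmp quot W' W) = Dom quot W"
    "Cod quot (Cmp quot W' W) = Cod quot W'"
    using e quot_simps(3,4)[OF wf] by (auto simp add: quot_simps simp del: expr_wf.simps)
  fix W'' assume **: "W'' \<in> Mor quot" "Cod quot W' = Dom quot W''"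
  then obtain e'' where e'': "W'' = mcl e''" "mwf e''"
    by (auto simp: quot_simps)
  then have wf': "mwf (Com e'' e')"
    using ** e mwf_in by (simp add: quot_simps ocl_eq_iff)
  have "mwf (Com e'' (Com e' e))" "mwf (Com (Com e'' e') e)"
    using wf wf' by simp_all
  then show "Cmp quot W'' (Cmp quot W' W) = Cmp quot (Cmp quot W'' W') W"
    using e e'' wf wf' quot_simps(6)
    by (simp add: quot_simps del: expr_wf.simps) (auto intro!: mcl_eqI expr_eq.assoc)
qed

end

section \<open>Formal composites of squares and their boundaries\<close>

locale dbl_quotient_rel = double_category U for U :: "('o, 'h, 'v, 's) dblcat" +
  fixes R :: "('o, 'h, 'v, 's) cellrel"
  assumes relob_in: "(x, y) \<in> relob R \<Longrightarrow> x \<in> Ob U \<and> y \<in> Ob U"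
    and relhor_in: "(f, f') \<in> relhor R \<Longrightarrow> f \<in> Hor U \<and> f' \<in> Hor U
      \<and> obj_eq (hcat U) (relob R) (hdom U f) (hdom U f')
      \<and> obj_eq (hcat U) (relob R) (hcod U f) (hcod U f')"
    and relver_in: "(v, v') \<in> relver R \<Longrightarrow> v \<in> Ver U \<and> v' \<in> Ver U
      \<and> obj_eq (hcat U) (relob R) (vdom U v) (vdom U v')
      \<and> obj_eq (hcat U) (relob R) (vcod U v) (vcod U v')"
    and relsq_in: "(s, s') \<in> relsq R \<Longrightarrow> s \<in> Sq U \<and> s' \<in> Sq U
      \<and> hexpr_eq U R (Gen (stop U s)) (Gen (stop U s'))
      \<and> hexpr_eq U R (Gen (sbot U s)) (Gen (sbot U s'))
      \<and> vexpr_eq U R (Gen (slft U s)) (Gen (slft U s'))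
      \<and> vexpr_eq U R (Gen (srgt U s)) (Gen (srgt U s'))"
begin

sublocale h: category_quotient "hcat U" "relob R" "relhor R"
  by unfold_locales (use relob_in relhor_in in auto)

sublocale v: category_quotient "vcat U" "relob R" "relver R"
  by unfold_locales (use relob_in relver_in in \<open>auto simp: obj_eq_vcat\<close>)

abbreviation Q where "Q \<equiv> dbl_quotient U R"

lemma voeq: "v.oeq = h.oeq"
  by (rule obj_eq_vcat)

abbreviation swf where "swf \<equiv> sexpr_wf U R"
abbreviation seq where "seq \<equiv> sexpr_eq U R"

lemmas oeq_trans = obj_eq.trans[of "hcat U" "relob R"]
lemmas oeq_sym = obj_eq.sym[of "hcat U" "relob R"]
lemmas meq_trans = expr_eq.trans
lemmas meq_sym = expr_eq.sym

lemma vmeq_wf: "v.meq e e' \<Longrightarrow> v.mwf e \<and> v.mwf e' \<and> h.oeq (esrc (vcat U) e) (esrc (vcat U) e')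
  \<and> h.oeq (etgt (vcat U) e) (etgt (vcat U) e')"
  using v.meq_wf by (simp add: voeq)

text \<open>A formal composite of squares records only that the common side matches. The outer sides
  are composable because congruent sides have congruent ends, and corners match up to
  \<open>obj_eq\<close>.\<close>

lemma swf_facts:
  assumes "swf e"
  shows "h.mwf (etop U e) \<and> h.mwf (ebot U e) \<and> v.mwf (elft U e) \<and> v.mwf (ergt U e)
    \<and> h.oeq (esrc (hcat U) (etop U e)) (esrc (vcat U) (elft U e))
    \<and> h.oeq (etgt (hcat U) (etop U e)) (esrc (vcat U) (ergt U e))
    \<and> h.oeq (esrc (hcat U) (ebot U e)) (etgt (vcat U) (elft U e))
    \<and> h.oeq (etgt (hcat U) (ebot U e)) (etgt (vcat U) (ergt U e))"
  using assms
proof (induction e)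
  case (SGen s)
  then show ?case
    by (auto simp: cell_simps intro!: obj_eq.refl)
next
  case (HCom t s)
  then have *: "v.meq (ergt U s) (elft U t)" by simp
  have "h.oeq (etgt (hcat U) (etop U s)) (esrc (hcat U) (etop U t))"
    "h.oeq (etgt (hcat U) (ebot U s)) (esrc (hcat U) (ebot U t))"
    using HCom vmeq_wf[OF *] by (auto intro: oeq_trans oeq_sym)
  then show ?case using HCom by simp
next
  case (VCom t s)
  then have *: "h.meq (ebot U s) (etop U t)" by simp
  have "v.oeq (etgt (vcat U) (elft U s)) (esrc (vcat U) (elft U t))"
    "v.oeq (etgt (vcat U) (ergt U s)) (esrc (vcat U) (ergt U t))"
    using VCom h.meq_wf[OF *] unfolding voeq by (auto intro: oeq_trans oeq_sym)
  then show ?case using VCom by simp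
qed

lemma hmeq_hid: "h.oeq x y \<Longrightarrow> h.meq (Gen (hid U x)) (Gen (hid U y))"
  using h.meq_Idn by simp

lemma vmeq_vid: "h.oeq x y \<Longrightarrow> v.meq (Gen (vid U x)) (Gen (vid U y))"
  using v.meq_Idn by (simp add: voeq)

lemma ehid_facts:
  assumes "v.mwf e"
  shows "swf (ehid U e) \<and> h.meq (etop U (ehid U e)) (Gen (hid U (esrc (vcat U) e)))
    \<and> h.meq (ebot U (ehid U e)) (Gen (hid U (etgt (vcat U) e)))
    \<and> elft U (ehid U e) = e \<and> ergt U (ehid U e) = e"
  using assms
proof (induction e)
  case (Gen v)
  then show ?case by (auto simp: cell_simps intro!: expr_eq.refl)
next
  case (Com w v)
  then have "h.meq (Gen (hid U (etgt (vcat U) v))) (Gen (hid U (esrc (vcat U) w)))"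
    by (auto simp: voeq intro: hmeq_hid)
  then have "h.meq (ebot U (ehid U v)) (etop U (ehid U w))"
    using Com by (auto intro: meq_trans meq_sym)
  then show ?case using Com by simp
qed

lemma evid_facts:
  assumes "h.mwf e"
  shows "swf (evid U e) \<and> v.meq (elft U (evid U e)) (Gen (vid U (esrc (hcat U) e)))
    \<and> v.meq (ergt U (evid U e)) (Gen (vid U (etgt (hcat U) e)))
    \<and> etop U (evid U e) = e \<and> ebot U (evid U e) = e"
  using assms
proof (induction e)
  case (Gen v)
  then show ?case by (auto simp: cell_simps intro!: expr_eq.refl)
next
  case (Com w v)
  then have "v.meq (Gen (vid U (etgt (hcat U) v))) (Gen (vid U (esrc (hcat U) w)))"
    by (auto simp: voeq intro: vmeq_vid)
  then have "v.meq (ergt U (evid U v)) (elft U (evid U w))"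
    using Com by (auto intro: meq_trans meq_sym)
  then show ?case using Com by simp
qed

lemma vmeq_idr: "\<lbrakk>v.mwf e; v.meq i (Gen (vid U x)); h.oeq x (esrc (vcat U) e)\<rbrakk> \<Longrightarrow> v.meq (Com e i) e"
  using v.meq_idr by (simp add: voeq)
lemma vmeq_idl: "\<lbrakk>v.mwf e; v.meq i (Gen (vid U x)); h.oeq x (etgt (vcat U) e)\<rbrakk> \<Longrightarrow> v.meq (Com i e) e"
  using v.meq_idl by (simp add: voeq)
lemma hmeq_idr: "\<lbrakk>h.mwf e; h.meq i (Gen (hid U x)); h.oeq x (esrc (hcat U) e)\<rbrakk> \<Longrightarrow> h.meq (Com e i) e"
  using h.meq_idr by simp
lemma hmeq_idl: "\<lbrakk>h.mwf e; h.meq i (Gen (hid U x)); h.oeq x (etgt (hcat U) e)\<rbrakk> \<Longrightarrow> h.meq (Com i e) e"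
  using h.meq_idl by simp

definition sbd where
  "sbd e e' \<longleftrightarrow> swf e \<and> swf e' \<and> h.meq (etop U e) (etop U e') \<and> h.meq (ebot U e) (ebot U e')
    \<and> v.meq (elft U e) (elft U e') \<and> v.meq (ergt U e) (ergt U e')"

text \<open>This makes the sides of a class of squares well defined. The unit rules change two sides
  by composites with identities, associativity rebrackets two sides, and interchange leaves all four
  boundary expressions literally unchanged.\<close>

lemma seq_boundary: "seq e e' \<Longrightarrow> sbd e e'"
proof (induction rule: sexpr_eq.induct)
  case (refl e)
  then show ?case
    using swf_facts[of e] by (auto simp: sbd_def intro: expr_eq.refl)
next
  case (sym e e')
  then show ?case by (auto simp: sbd_def intro: meq_sym)
next
  case (trans e e' e'')
  then show ?case unfolding sbd_def by (blast intro: meq_trans)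
next
  case (rel s s')
  then show ?case using relsq_in by (auto simp: sbd_def)
next
  case (hcong t t' s s')
  then have *: "v.meq (ergt U s') (elft U t')"
    by (auto simp: sbd_def intro: meq_sym meq_trans)
  have "h.mwf (etop U (HCom t s))" "h.mwf (ebot U (HCom t s))"
    using swf_facts[OF \<open>swf (HCom t s)\<close>] by auto
  then show ?case
    using hcong * by (auto simp: sbd_def intro!: expr_eq.cong)
next
  case (vcong t t' s s')
  then have *: "h.meq (ebot U s') (etop U t')"
    by (auto simp: sbd_def intro: meq_sym meq_trans)
  have "v.mwf (elft U (VCom t s))" "v.mwf (ergt U (VCom t s))"
    using swf_facts[OF \<open>swf (VCom t s)\<close>] by auto
  then show ?case
    using vcong * by (auto simp: sbd_def intro!: expr_eq.cong)
next
  case (ehid_cong v v')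
  then have wf: "v.mwf v" "v.mwf v'" and eq: "h.oeq (esrc (vcat U) v) (esrc (vcat U) v')"
    "h.oeq (etgt (vcat U) v) (etgt (vcat U) v')"
    using vmeq_wf by auto
  have "h.meq (etop U (ehid U v)) (etop U (ehid U v'))" "h.meq (ebot U (ehid U v)) (ebot U (ehid U v'))"
    using ehid_facts[OF wf(1)] ehid_facts[OF wf(2)] hmeq_hid[OF eq(1)] hmeq_hid[OF eq(2)]
    by (meson meq_trans meq_sym)+
  then show ?case
    using ehid_facts[OF wf(1)] ehid_facts[OF wf(2)] ehid_cong by (simp add: sbd_def)
next
  case (evid_cong v v')
  then have wf: "h.mwf v" "h.mwf v'" and eq: "h.oeq (esrc (hcat U) v) (esrc (hcat U) v')"
    "h.oeq (etgt (hcat U) v) (etgt (hcat U) v')"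
    using h.meq_wf by auto
  have "v.meq (elft U (evid U v)) (elft U (evid U v'))" "v.meq (ergt U (evid U v)) (ergt U (evid U v'))"
    using evid_facts[OF wf(1)] evid_facts[OF wf(2)] vmeq_vid[OF eq(1)] vmeq_vid[OF eq(2)]
    by (meson meq_trans meq_sym)+
  then show ?case
    using evid_facts[OF wf(1)] evid_facts[OF wf(2)] evid_cong by (simp add: sbd_def)
next
  case (hcomp s t)
  then have "h.meq (Com (Gen (stop U t)) (Gen (stop U s))) (Gen (hcmp U (stop U t) (stop U s)))"
    "h.meq (Com (Gen (sbot U t)) (Gen (sbot U s))) (Gen (hcmp U (sbot U t) (sbot U s)))"
    using expr_eq.comp[of "stop U s" "hcat U" "stop U t"] expr_eq.comp[of "sbot U s" "hcat U" "sbot U t"]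
    by (auto simp: cell_simps)
  with hcomp show ?case
    by (auto simp: sbd_def cell_simps intro: expr_eq.refl)
next
  case (vcomp s t)
  then have "v.meq (Com (Gen (slft U t)) (Gen (slft U s))) (Gen (vcmp U (slft U t) (slft U s)))"
    "v.meq (Com (Gen (srgt U t)) (Gen (srgt U s))) (Gen (vcmp U (srgt U t) (srgt U s)))"
    using expr_eq.comp[of "slft U s" "vcat U" "slft U t"] expr_eq.comp[of "srgt U s" "vcat U" "srgt U t"]
    by (auto simp: cell_simps simp flip: corner_tl corner_bl corner_tr corner_br)
  with vcomp show ?case
    by (auto simp: sbd_def cell_simps intro: expr_eq.refl)
next
  case (hidr s v)
  note b = swf_facts[OF hidr(1)] and w = vmeq_wf[OF hidr(2)]
  note e = ehid_facts[OF conjunct1[OF w]]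
  have "h.oeq (esrc (vcat U) v) (esrc (hcat U) (etop U s))"
    "h.oeq (etgt (vcat U) v) (esrc (hcat U) (ebot U s))"
    using b w by (meson oeq_trans oeq_sym)+
  then have "h.meq (etop U (HCom s (ehid U v))) (etop U s)" "h.meq (ebot U (HCom s (ehid U v))) (ebot U s)"
    using b e by (auto intro!: hmeq_idr)
  then show ?case
    using hidr b e by (auto simp: sbd_def intro: expr_eq.refl)
next
  case (hidl s v)
  note b = swf_facts[OF hidl(1)] and w = vmeq_wf[OF hidl(2)]
  note e = ehid_facts[OF conjunct1[OF w]]
  have "h.oeq (esrc (vcat U) v) (etgt (hcat U) (etop U s))"
    "h.oeq (etgt (vcat U) v) (etgt (hcat U) (ebot U s))"
    using b w by (meson oeq_trans oeq_sym)+
  then have "h.meq (etop U (HCom (ehid U v) s)) (etop U s)" "h.meq (ebot U (HCom (ehid U v) s)) (ebot U s)"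
    using b e by (auto intro!: hmeq_idl)
  then show ?case
    using hidl b e by (auto simp: sbd_def intro: expr_eq.refl meq_sym)
next
  case (vidr s f)
  note b = swf_facts[OF vidr(1)] and w = h.meq_wf[OF vidr(2)]
  note e = evid_facts[OF conjunct1[OF w]]
  have "h.oeq (esrc (hcat U) f) (esrc (vcat U) (elft U s))"
    "h.oeq (etgt (hcat U) f) (esrc (vcat U) (ergt U s))"
    using b w by (meson oeq_trans oeq_sym)+
  then have "v.meq (elft U (VCom s (evid U f))) (elft U s)" "v.meq (ergt U (VCom s (evid U f))) (ergt U s)"
    using b e by (auto intro!: vmeq_idr)
  then show ?case
    using vidr b e by (auto simp: sbd_def intro: expr_eq.refl)
next
  case (vidl s f)
  note b = swf_facts[OF vidl(1)] and w = h.meq_wf[OF vidl(2)]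
  note e = evid_facts[OF conjunct1[OF w]]
  have "h.oeq (esrc (hcat U) f) (etgt (vcat U) (elft U s))"
    "h.oeq (etgt (hcat U) f) (etgt (vcat U) (ergt U s))"
    using b w by (meson oeq_trans oeq_sym)+
  then have "v.meq (elft U (VCom (evid U f) s)) (elft U s)" "v.meq (ergt U (VCom (evid U f) s)) (ergt U s)"
    using b e by (auto intro!: vmeq_idl)
  then show ?case
    using vidl b e by (auto simp: sbd_def intro: expr_eq.refl meq_sym)
next
  case (hassoc u t s)
  note b = swf_facts[OF hassoc]
  from b have "h.meq (etop U (HCom u (HCom t s))) (etop U (HCom (HCom u t) s))"
    "h.meq (ebot U (HCom u (HCom t s))) (ebot U (HCom (HCom u t) s))"
    unfolding etop.simps ebot.simps by (auto intro!: expr_eq.assoc simp del: expr_wf.simps)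
  then show ?case
    using hassoc b by (auto simp: sbd_def intro: expr_eq.refl)
next
  case (vassoc u t s)
  note b = swf_facts[OF vassoc]
  from b have "v.meq (elft U (VCom u (VCom t s))) (elft U (VCom (VCom u t) s))"
    "v.meq (ergt U (VCom u (VCom t s))) (ergt U (VCom (VCom u t) s))"
    unfolding elft.simps ergt.simps by (auto intro!: expr_eq.assoc simp del: expr_wf.simps)
  then show ?case
    using vassoc b by (auto simp: sbd_def intro: expr_eq.refl)
next
  case (interchange d c b a)
  then show ?case
    using swf_facts[OF interchange(1)] swf_facts[OF interchange(2)]
    by (auto simp: sbd_def intro: expr_eq.refl)
qed

end

section \<open>The quotient is a double category\<close>

context dbl_quotient_rel begin

lemma classes [simp]: "ocls U R = h.ocl" "hcls U R = h.mcl" "vcls U R = v.mcl" "v.ocl = h.ocl"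
  by (intro ext; simp add: ocls_def hcls_def vcls_def h.ocl_def h.mcl_def v.mcl_def v.ocl_def voeq)+

lemma hcat_Q: "hcat Q = h.quot"
  by (simp add: hcat_def[of Q] dbl_quotient_def h.quot_def)

lemma vcat_Q: "vcat Q = v.quot"
  by (simp add: vcat_def[of Q] dbl_quotient_def v.quot_def)

abbreviation scl where "scl \<equiv> scls U R"

lemma scl_eqI: "seq e e' \<Longrightarrow> scl e = scl e'"
  unfolding scls_def by (auto intro: sexpr_eq.trans sexpr_eq.sym)

lemma repr_scl: "swf e \<Longrightarrow> seq e (repr (scl e))"
  unfolding repr_def scls_def mem_Collect_eq by (rule someI[of _ e]) (rule sexpr_eq.refl)

lemma mcl_eq_iff: "h.mwf e \<Longrightarrow> h.mcl e = h.mcl e' \<longleftrightarrow> h.meq e e'"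
proof
  assume "h.mwf e" "h.mcl e = h.mcl e'"
  then have "h.meq e' e" unfolding h.mcl_def by (auto intro: expr_eq.refl)
  then show "h.meq e e'" by (rule expr_eq.sym)
qed (rule h.mcl_eqI)

lemma vmcl_eq_iff: "v.mwf e \<Longrightarrow> v.mcl e = v.mcl e' \<longleftrightarrow> v.meq e e'"
proof
  assume "v.mwf e" "v.mcl e = v.mcl e'"
  then have "v.meq e' e" unfolding v.mcl_def by (auto intro: expr_eq.refl)
  then show "v.meq e e'" by (rule expr_eq.sym)
qed (rule v.mcl_eqI)

lemma Q_sets:
  "Ob Q = h.ocl ` Ob U" "Hor Q = h.mcl ` {e. h.mwf e}" "Ver Q = v.mcl ` {e. v.mwf e}"
  "Sq Q = scl ` {e. swf e}"
  by (simp_all add: dbl_quotient_def)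

lemma Q_hor:
  "h.mwf e \<Longrightarrow> hdom Q (h.mcl e) = h.ocl (esrc (hcat U) e)"
  "h.mwf e \<Longrightarrow> hcod Q (h.mcl e) = h.ocl (etgt (hcat U) e)"
  "x \<in> Ob U \<Longrightarrow> hid Q (h.ocl x) = h.mcl (Gen (hid U x))"
  "h.mwf (Com g f) \<Longrightarrow> hcmp Q (h.mcl g) (h.mcl f) = h.mcl (Com g f)"
  using h.quot_simps(3,4)[of e] h.quot_simps(5)[of x] h.quot_simps(6)[of g f]
  by (simp_all flip: hcat_Q)

lemma Q_ver:
  "v.mwf e \<Longrightarrow> vdom Q (v.mcl e) = h.ocl (esrc (vcat U) e)"
  "v.mwf e \<Longrightarrow> vcod Q (v.mcl e) = h.ocl (etgt (vcat U) e)"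
  "x \<in> Ob U \<Longrightarrow> vid Q (h.ocl x) = v.mcl (Gen (vid U x))"
  "v.mwf (Com g f) \<Longrightarrow> vcmp Q (v.mcl g) (v.mcl f) = v.mcl (Com g f)"
  using v.quot_simps(3,4)[of e] v.quot_simps(5)[of x] v.quot_simps(6)[of g f]
  by (simp_all flip: vcat_Q)

text \<open>Sides are independent of the representative by \<open>seq_boundary\<close>, composites
  by \<open>hcong\<close> and \<open>vcong\<close>. Units on classes are well defined because
  \<open>ehid_cong\<close> and \<open>evid_cong\<close> are among the generating rules.\<close>

lemma Q_sq:
  "swf s \<Longrightarrow> stop Q (scl s) = h.mcl (etop U s)"
  "swf s \<Longrightarrow> sbot Q (scl s) = h.mcl (ebot U s)"
  "swf s \<Longrightarrow> slft Q (scl s) = v.mcl (elft U s)"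
  "swf s \<Longrightarrow> srgt Q (scl s) = v.mcl (ergt U s)"
  "v.mwf v \<Longrightarrow> sqhid Q (v.mcl v) = scl (ehid U v)"
  "h.mwf f \<Longrightarrow> sqvid Q (h.mcl f) = scl (evid U f)"
  "swf (HCom t s) \<Longrightarrow> sqhcmp Q (scl t) (scl s) = scl (HCom t s)"
  "swf (VCom t s) \<Longrightarrow> sqvcmp Q (scl t) (scl s) = scl (VCom t s)"
proof -
  show "stop Q (scl s) = h.mcl (etop U s)" "sbot Q (scl s) = h.mcl (ebot U s)"
    "slft Q (scl s) = v.mcl (elft U s)" "srgt Q (scl s) = v.mcl (ergt U s)" if "swf s"
    using seq_boundary[OF repr_scl[OF that]]
    by (simp_all add: dbl_quotient_def sbd_def expr_eq.sym h.mcl_eqI v.mcl_eqI)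
  show "sqhid Q (v.mcl v) = scl (ehid U v)" if "v.mwf v"
    using scl_eqI[OF sexpr_eq.ehid_cong[OF v.repr_mcl[OF that]]] by (simp add: dbl_quotient_def)
  show "sqvid Q (h.mcl f) = scl (evid U f)" if "h.mwf f"
    using scl_eqI[OF sexpr_eq.evid_cong[OF h.repr_mcl[OF that]]] by (simp add: dbl_quotient_def)
  show "sqhcmp Q (scl t) (scl s) = scl (HCom t s)" if "swf (HCom t s)"
    using scl_eqI[OF sexpr_eq.hcong[of U R t "repr (scl t)" s "repr (scl s)"]] that repr_scl
    by (simp add: dbl_quotient_def)
  show "sqvcmp Q (scl t) (scl s) = scl (VCom t s)" if "swf (VCom t s)"
    using scl_eqI[OF sexpr_eq.vcong[of U R t "repr (scl t)" s "repr (scl s)"]] that repr_scl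
    by (simp add: dbl_quotient_def)
qed

lemma category_hcat_ver_Q: "category (hcat_ver Q)"
proof
  fix W assume "W \<in> Mor (hcat_ver Q)"
  then obtain e where e: "W = scl e" "swf e"
    by (auto simp: Q_sets)
  note b = swf_facts[OF e(2)]
  show "Dom (hcat_ver Q) W \<in> Obj (hcat_ver Q)" "Cod (hcat_ver Q) W \<in> Obj (hcat_ver Q)"
    using e b by (simp_all add: Q_sets Q_sq)
  have *: "v.meq (elft U e) (elft U e)" "v.meq (ergt U e) (ergt U e)"
    using b by (simp_all add: expr_eq.refl)
  have wf: "swf (HCom e (ehid U (elft U e)))" "swf (HCom (ehid U (ergt U e)) e)"
    using e * b ehid_facts[of "elft U e"] ehid_facts[of "ergt U e"] by auto
  show "Cmp (hcat_ver Q) W (Idn (hcat_ver Q) (Dom (hcat_ver Q) W)) = W"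
    using e b wf(1) Q_sq(7)[OF wf(1)] scl_eqI[OF sexpr_eq.hidr[OF e(2) *(1)]] by (simp add: Q_sq(1-6))
  show "Cmp (hcat_ver Q) (Idn (hcat_ver Q) (Cod (hcat_ver Q) W)) W = W"
    using e b wf(2) Q_sq(7)[OF wf(2)] scl_eqI[OF sexpr_eq.hidl[OF e(2) *(2)]] by (simp add: Q_sq(1-6))
next
  fix X assume "X \<in> Obj (hcat_ver Q)"
  then obtain v where "X = v.mcl v" "v.mwf v" by (auto simp: Q_sets)
  then show "Idn (hcat_ver Q) X \<in> Mor (hcat_ver Q)" "Dom (hcat_ver Q) (Idn (hcat_ver Q) X) = X"
    "Cod (hcat_ver Q) (Idn (hcat_ver Q) X) = X"
    using ehid_facts[of v] by (simp_all add: Q_sets Q_sq)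
next
  fix W W'
  assume *: "W \<in> Mor (hcat_ver Q)" "W' \<in> Mor (hcat_ver Q)" "Cod (hcat_ver Q) W = Dom (hcat_ver Q) W'"
  then obtain s t where e: "W = scl s" "swf s" "W' = scl t" "swf t"
    by (auto simp: Q_sets)
  have "v.meq (ergt U s) (elft U t)"
    using * e swf_facts[OF e(2)] by (simp add: Q_sq vmcl_eq_iff)
  then have wf: "swf (HCom t s)" using e by simp
  then show "Cmp (hcat_ver Q) W' W \<in> Mor (hcat_ver Q)"
    "Dom (hcat_ver Q) (Cmp (hcat_ver Q) W' W) = Dom (hcat_ver Q) W"
    "Cod (hcat_ver Q) (Cmp (hcat_ver Q) W' W) = Cod (hcat_ver Q) W'"
    using e Q_sq(3,4)[OF wf] by (auto simp add: Q_sets Q_sq simp del: sexpr_wf.simps)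
  fix W'' assume **: "W'' \<in> Mor (hcat_ver Q)" "Cod (hcat_ver Q) W' = Dom (hcat_ver Q) W''"
  then obtain u where u: "W'' = scl u" "swf u" by (auto simp: Q_sets)
  have "v.meq (ergt U t) (elft U u)"
    using ** e u swf_facts[OF e(4)] by (simp add: Q_sq vmcl_eq_iff)
  then have wf': "swf (HCom u t)" "swf (HCom u (HCom t s))" "swf (HCom (HCom u t) s)"
    using wf u by simp_all
  show "Cmp (hcat_ver Q) W'' (Cmp (hcat_ver Q) W' W) = Cmp (hcat_ver Q) (Cmp (hcat_ver Q) W'' W') W"
    using e u Q_sq(7)[OF wf] Q_sq(7)[OF wf'(1)] Q_sq(7)[OF wf'(2)] Q_sq(7)[OF wf'(3)]
      scl_eqI[OF sexpr_eq.hassoc[OF wf'(2)]] by simp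
qed

lemma category_vcat_hor_Q: "category (vcat_hor Q)"
proof
  fix W assume "W \<in> Mor (vcat_hor Q)"
  then obtain e where e: "W = scl e" "swf e"
    by (auto simp: Q_sets)
  note b = swf_facts[OF e(2)]
  show "Dom (vcat_hor Q) W \<in> Obj (vcat_hor Q)" "Cod (vcat_hor Q) W \<in> Obj (vcat_hor Q)"
    using e b by (simp_all add: Q_sets Q_sq)
  have *: "h.meq (etop U e) (etop U e)" "h.meq (ebot U e) (ebot U e)"
    using b by (simp_all add: expr_eq.refl)
  have wf: "swf (VCom e (evid U (etop U e)))" "swf (VCom (evid U (ebot U e)) e)"
    using e * b evid_facts[of "etop U e"] evid_facts[of "ebot U e"] by auto
  show "Cmp (vcat_hor Q) W (Idn (vcat_hor Q) (Dom (vcat_hor Q) W)) = W"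
    using e b wf(1) Q_sq(8)[OF wf(1)] scl_eqI[OF sexpr_eq.vidr[OF e(2) *(1)]] by (simp add: Q_sq(1-6))
  show "Cmp (vcat_hor Q) (Idn (vcat_hor Q) (Cod (vcat_hor Q) W)) W = W"
    using e b wf(2) Q_sq(8)[OF wf(2)] scl_eqI[OF sexpr_eq.vidl[OF e(2) *(2)]] by (simp add: Q_sq(1-6))
next
  fix X assume "X \<in> Obj (vcat_hor Q)"
  then obtain v where "X = h.mcl v" "h.mwf v" by (auto simp: Q_sets)
  then show "Idn (vcat_hor Q) X \<in> Mor (vcat_hor Q)" "Dom (vcat_hor Q) (Idn (vcat_hor Q) X) = X"
    "Cod (vcat_hor Q) (Idn (vcat_hor Q) X) = X"
    using evid_facts[of v] by (simp_all add: Q_sets Q_sq)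
next
  fix W W'
  assume *: "W \<in> Mor (vcat_hor Q)" "W' \<in> Mor (vcat_hor Q)" "Cod (vcat_hor Q) W = Dom (vcat_hor Q) W'"
  then obtain s t where e: "W = scl s" "swf s" "W' = scl t" "swf t"
    by (auto simp: Q_sets)
  have "h.meq (ebot U s) (etop U t)"
    using * e swf_facts[OF e(2)] by (simp add: Q_sq mcl_eq_iff)
  then have wf: "swf (VCom t s)" using e by simp
  then show "Cmp (vcat_hor Q) W' W \<in> Mor (vcat_hor Q)"
    "Dom (vcat_hor Q) (Cmp (vcat_hor Q) W' W) = Dom (vcat_hor Q) W"
    "Cod (vcat_hor Q) (Cmp (vcat_hor Q) W' W) = Cod (vcat_hor Q) W'"
    using e Q_sq(1,2)[OF wf] by (auto simp add: Q_sets Q_sq simp del: sexpr_wf.simps)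
  fix W'' assume **: "W'' \<in> Mor (vcat_hor Q)" "Cod (vcat_hor Q) W' = Dom (vcat_hor Q) W''"
  then obtain u where u: "W'' = scl u" "swf u" by (auto simp: Q_sets)
  have "h.meq (ebot U t) (etop U u)"
    using ** e u swf_facts[OF e(4)] by (simp add: Q_sq mcl_eq_iff)
  then have wf': "swf (VCom u t)" "swf (VCom u (VCom t s))" "swf (VCom (VCom u t) s)"
    using wf u by simp_all
  show "Cmp (vcat_hor Q) W'' (Cmp (vcat_hor Q) W' W) = Cmp (vcat_hor Q) (Cmp (vcat_hor Q) W'' W') W"
    using e u Q_sq(8)[OF wf] Q_sq(8)[OF wf'(1)] Q_sq(8)[OF wf'(2)] Q_sq(8)[OF wf'(3)]
      scl_eqI[OF sexpr_eq.vassoc[OF wf'(2)]] by simp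
qed

text \<open>Once classes are represented by formal composites, matching sides of classes become
  congruences, hence well-formedness of the composite, and interchange is a generating rule of
  \<open>sexpr_eq\<close>.\<close>

lemma double_category_Q: "double_category Q"
proof (rule double_categoryI)
  show "category (hcat Q)" "category (vcat Q)"
    using h.category_quot v.category_quot by (simp_all add: hcat_Q vcat_Q)
  show "category (hcat_ver Q)" "category (vcat_hor Q)"
    by (rule category_hcat_ver_Q category_vcat_hor_Q)+
  show "double_category_axioms Q"
  proof
    fix W assume "W \<in> Sq Q"
    then obtain e where e: "W = scl e" "swf e" by (auto simp: Q_sets)
    note b = swf_facts[OF e(2)]
    show "hdom Q (stop Q W) = vdom Q (slft Q W)" "hcod Q (stop Q W) = vdom Q (srgt Q W)"
      "hdom Q (sbot Q W) = vcod Q (slft Q W)" "hcod Q (sbot Q W) = vcod Q (srgt Q W)"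
      using e b by (simp_all add: Q_sq Q_hor Q_ver h.ocl_eqI)
  next
    fix V assume "V \<in> Ver Q"
    then obtain e where e: "V = v.mcl e" "v.mwf e" by (auto simp: Q_sets)
    show "stop Q (sqhid Q V) = hid Q (vdom Q V)" "sbot Q (sqhid Q V) = hid Q (vcod Q V)"
      using e ehid_facts[OF e(2)] v.mwf_in[OF e(2)] by (simp_all add: Q_sq Q_hor Q_ver h.mcl_eqI)
  next
    fix V assume "V \<in> Hor Q"
    then obtain e where e: "V = h.mcl e" "h.mwf e" by (auto simp: Q_sets)
    show "slft Q (sqvid Q V) = vid Q (hdom Q V)" "srgt Q (sqvid Q V) = vid Q (hcod Q V)"
      using e evid_facts[OF e(2)] h.mwf_in[OF e(2)] by (simp_all add: Q_sq Q_hor Q_ver v.mcl_eqI)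
  next
    fix W W' assume *: "W \<in> Sq Q" "W' \<in> Sq Q" "srgt Q W = slft Q W'"
    then obtain s t where e: "W = scl s" "swf s" "W' = scl t" "swf t"
      by (auto simp: Q_sets)
    have "v.meq (ergt U s) (elft U t)"
      using * e swf_facts[OF e(2)] by (simp add: Q_sq vmcl_eq_iff)
    then have wf: "swf (HCom t s)" using e by simp
    note b = swf_facts[OF wf, unfolded etop.simps ebot.simps]
    show "stop Q (sqhcmp Q W' W) = hcmp Q (stop Q W') (stop Q W)"
      "sbot Q (sqhcmp Q W' W) = hcmp Q (sbot Q W') (sbot Q W)"
      using e Q_sq(1,2,7)[OF wf] b Q_hor(4)[of "etop U t" "etop U s"] Q_hor(4)[of "ebot U t" "ebot U s"]
      by (simp_all add: Q_sq(1,2))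
  next
    fix W W' assume *: "W \<in> Sq Q" "W' \<in> Sq Q" "sbot Q W = stop Q W'"
    then obtain s t where e: "W = scl s" "swf s" "W' = scl t" "swf t"
      by (auto simp: Q_sets)
    have "h.meq (ebot U s) (etop U t)"
      using * e swf_facts[OF e(2)] by (simp add: Q_sq mcl_eq_iff)
    then have wf: "swf (VCom t s)" using e by simp
    note b = swf_facts[OF wf, unfolded elft.simps ergt.simps]
    show "slft Q (sqvcmp Q W' W) = vcmp Q (slft Q W') (slft Q W)"
      "srgt Q (sqvcmp Q W' W) = vcmp Q (srgt Q W') (srgt Q W)"
      using e Q_sq(3,4,8)[OF wf] b Q_ver(4)[of "elft U t" "elft U s"] Q_ver(4)[of "ergt U t" "ergt U s"]
      by (simp_all add: Q_sq(3,4))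
  next
    fix F G assume *: "F \<in> Hor Q" "G \<in> Hor Q" "hcod Q F = hdom Q G"
    then obtain f g where e: "F = h.mcl f" "h.mwf f" "G = h.mcl g" "h.mwf g"
      by (auto simp: Q_sets)
    then have wf: "h.mwf (Com g f)"
      using * h.mwf_in[of f] by (simp add: Q_hor h.ocl_eq_iff)
    then have "swf (evid U (Com g f))" using evid_facts by blast
    then show "sqvid Q (hcmp Q G F) = sqhcmp Q (sqvid Q G) (sqvid Q F)"
      using e Q_hor(4)[OF wf] Q_sq(6)[OF wf] Q_sq(6)[of f] Q_sq(6)[of g]
        Q_sq(7)[of "evid U g" "evid U f"] by (simp del: sexpr_wf.simps)
  next
    fix F G assume *: "F \<in> Ver Q" "G \<in> Ver Q" "vcod Q F = vdom Q G"
    then obtain f g where e: "F = v.mcl f" "v.mwf f" "G = v.mcl g" "v.mwf g"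
      by (auto simp: Q_sets)
    then have wf: "v.mwf (Com g f)"
      using * v.mwf_in[of f] by (simp add: Q_ver h.ocl_eq_iff voeq)
    then have "swf (ehid U (Com g f))" using ehid_facts by blast
    then show "sqhid Q (vcmp Q G F) = sqvcmp Q (sqhid Q G) (sqhid Q F)"
      using e Q_ver(4)[OF wf] Q_sq(5)[OF wf] Q_sq(5)[of f] Q_sq(5)[of g]
        Q_sq(8)[of "ehid U g" "ehid U f"] by (simp del: sexpr_wf.simps)
  next
    fix X assume "X \<in> Ob Q"
    then show "sqvid Q (hid Q X) = sqhid Q (vid Q X)"
      by (auto simp: Q_sets Q_hor Q_ver Q_sq cell_simps sqvid_hid)
  next
    fix A B C D
    assume *: "A \<in> Sq Q" "B \<in> Sq Q" "C \<in> Sq Q" "D \<in> Sq Q" "srgt Q A = slft Q B" "srgt Q C = slft Q D"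
      "sbot Q A = stop Q C" "sbot Q B = stop Q D"
    then obtain a b c d where e: "A = scl a" "swf a" "B = scl b" "swf b" "C = scl c" "swf c"
      "D = scl d" "swf d"
      by (auto simp: Q_sets)
    have eqs: "v.meq (ergt U a) (elft U b)" "v.meq (ergt U c) (elft U d)"
      "h.meq (ebot U a) (etop U c)" "h.meq (ebot U b) (etop U d)"
      using * e swf_facts by (simp_all add: Q_sq vmcl_eq_iff mcl_eq_iff)
    then have wf: "swf (HCom b a)" "swf (HCom d c)" "swf (VCom c a)" "swf (VCom d b)"
      using e by simp_all
    have "h.meq (ebot U (HCom b a)) (etop U (HCom d c))"
      "v.meq (ergt U (VCom c a)) (elft U (VCom d b))"
      using eqs swf_facts[OF wf(1)] swf_facts[OF wf(3)] by (auto intro!: expr_eq.cong)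
    then have wf': "swf (VCom (HCom d c) (HCom b a))" "swf (HCom (VCom d b) (VCom c a))"
      using wf by simp_all
    show "sqvcmp Q (sqhcmp Q D C) (sqhcmp Q B A) = sqhcmp Q (sqvcmp Q D B) (sqvcmp Q C A)"
      using e Q_sq(7)[OF wf(1)] Q_sq(7)[OF wf(2)] Q_sq(8)[OF wf(3)] Q_sq(8)[OF wf(4)]
        Q_sq(8)[OF wf'(1)] Q_sq(7)[OF wf'(2)] scl_eqI[OF sexpr_eq.interchange[OF wf']]
      by simp
  qed
qed

end

section \<open>Double functors out of the quotient\<close>

locale dbl_quotient_functor = dbl_quotient_rel U R
  for U :: "('o, 'h, 'v, 's) dblcat" and R +
  fixes P :: "('o, 'h, 'v, 's, 'p, 'i, 'w, 't) dblfun"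
  assumes P_functor: "double_functor P" and P_src: "dsrc P = U"
    and relob_resp: "(x, y) \<in> relob R \<Longrightarrow> onob P x = onob P y"
    and relhor_resp: "(f, f') \<in> relhor R \<Longrightarrow> onhor P f = onhor P f'"
    and relver_resp: "(v, v') \<in> relver R \<Longrightarrow> onver P v = onver P v'"
    and relsq_resp: "(s, s') \<in> relsq R \<Longrightarrow> onsq P s = onsq P s'"
begin

abbreviation T where "T \<equiv> dtgt P"
sublocale T: double_category T
  by (rule double_functorD(2)[OF P_functor])

lemmas PD = double_functorD(3-)[OF P_functor, unfolded P_src]

abbreviation heval where "heval \<equiv> expr_eval (hcat T) (onhor P)"
abbreviation veval where "veval \<equiv> expr_eval (vcat T) (onver P)"
abbreviation seval where "seval \<equiv> sexpr_eval T (onsq P)"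

lemma oeq_resp: "h.oeq x y \<Longrightarrow> onob P x = onob P y"
  by (induction rule: obj_eq.induct) (use relob_resp in auto)

lemma heval_in:
  "h.mwf e \<Longrightarrow> heval e \<in> Hor T \<and> hdom T (heval e) = onob P (esrc (hcat U) e)
    \<and> hcod T (heval e) = onob P (etgt (hcat U) e)"
  by (induction e) (auto simp: PD T.cell_simps dest: oeq_resp)

lemma veval_in:
  "v.mwf e \<Longrightarrow> veval e \<in> Ver T \<and> vdom T (veval e) = onob P (esrc (vcat U) e)
    \<and> vcod T (veval e) = onob P (etgt (vcat U) e)"
  by (induction e) (auto simp: PD T.cell_simps voeq dest: oeq_resp)

lemma heval_resp: "h.meq e e' \<Longrightarrow> heval e = heval e'"
proof (induction rule: expr_eq.induct)
  case (idr e x)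
  then show ?case
    using heval_in[OF idr(1)] oeq_resp[OF idr(2)] h.oeq_in[OF idr(2)] by (simp add: PD T.cell_simps)
next
  case (idl e x)
  then show ?case
    using heval_in[OF idl(1)] oeq_resp[OF idl(2)] h.oeq_in[OF idl(2)] by (simp add: PD T.cell_simps)
next
  case (assoc h g f)
  then show ?case
    using heval_in[of f] heval_in[of g] heval_in[of h] by (simp add: T.hcmp_assoc oeq_resp)
qed (use relhor_resp in \<open>simp_all add: PD\<close>)

lemma veval_resp: "v.meq e e' \<Longrightarrow> veval e = veval e'"
proof (induction rule: expr_eq.induct)
  case (idr e x)
  then show ?case
    using veval_in[OF idr(1)] oeq_resp[of x] v.oeq_in[OF idr(2)] by (simp add: PD T.cell_simps voeq)
next
  case (idl e x)
  then show ?case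
    using veval_in[OF idl(1)] oeq_resp[of x] v.oeq_in[OF idl(2)] by (simp add: PD T.cell_simps voeq)
next
  case (assoc h g f)
  then show ?case
    using veval_in[of f] veval_in[of g] veval_in[of h] by (simp add: T.vcmp_assoc oeq_resp voeq)
qed (use relver_resp in \<open>simp_all add: PD\<close>)

lemma seval_in:
  "swf e \<Longrightarrow> seval e \<in> Sq T \<and> stop T (seval e) = heval (etop U e) \<and> sbot T (seval e) = heval (ebot U e)
    \<and> slft T (seval e) = veval (elft U e) \<and> srgt T (seval e) = veval (ergt U e)"
  by (induction e) (auto simp: PD T.cell_simps heval_resp veval_resp)

lemma seval_ehid: "v.mwf v \<Longrightarrow> seval (ehid U v) = sqhid T (veval v)"
proof (induction v)
  case (Com w v)
  then show ?case
    using veval_in[of v] veval_in[of w] by (simp add: T.sqhid_vcmp oeq_resp voeq)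
qed (simp add: PD)

lemma seval_evid: "h.mwf f \<Longrightarrow> seval (evid U f) = sqvid T (heval f)"
proof (induction f)
  case (Com g f)
  then show ?case
    using heval_in[of f] heval_in[of g] by (simp add: T.sqvid_hcmp oeq_resp)
qed (simp add: PD)

text \<open>Every rule evaluates to a law of the double category \<open>T\<close> or to an
  identification that \<open>P\<close> respects. For the rules with \<open>ehid\<close> and
  \<open>evid\<close>, a unit square on a composite must first be recognised as a unit after
  evaluation.\<close>

lemma seval_resp: "seq e e' \<Longrightarrow> seval e = seval e'"
proof (induction rule: sexpr_eq.induct)
  case (ehid_cong v v')
  then show ?case using vmeq_wf[OF ehid_cong] veval_resp[OF ehid_cong] by (simp add: seval_ehid)
next
  case (evid_cong v v')
  then show ?case using h.meq_wf[OF evid_cong] heval_resp[OF evid_cong] by (simp add: seval_evid)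
next
  case (hidr s v)
  then show ?case
    using vmeq_wf[OF hidr(2)] veval_resp[OF hidr(2)] seval_in[OF hidr(1)]
    by (simp add: seval_ehid T.cell_simps)
next
  case (hidl s v)
  then show ?case
    using vmeq_wf[OF hidl(2)] veval_resp[OF hidl(2)] seval_in[OF hidl(1)]
    by (simp add: seval_ehid T.cell_simps)
next
  case (vidr s v)
  then show ?case
    using h.meq_wf[OF vidr(2)] heval_resp[OF vidr(2)] seval_in[OF vidr(1)]
    by (simp add: seval_evid T.cell_simps)
next
  case (vidl s v)
  then show ?case
    using h.meq_wf[OF vidl(2)] heval_resp[OF vidl(2)] seval_in[OF vidl(1)]
    by (simp add: seval_evid T.cell_simps)
next
  case (hassoc u t s)
  then show ?case
    using seval_in[of u] seval_in[of t] seval_in[of s] by (simp add: T.sqhcmp_assoc veval_resp)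
next
  case (vassoc u t s)
  then show ?case
    using seval_in[of u] seval_in[of t] seval_in[of s] by (simp add: T.sqvcmp_assoc heval_resp)
next
  case (interchange d c b a)
  then show ?case
    using seval_in[of a] seval_in[of b] seval_in[of c] seval_in[of d]
    by (simp add: T.interchange veval_resp heval_resp)
qed (use relsq_resp in \<open>simp_all add: PD\<close>)

definition ind where
  "ind = \<lparr>dsrc = Q, dtgt = T, onob = (\<lambda>X. onob P (repr X)), onhor = (\<lambda>W. heval (repr W)),
    onver = (\<lambda>W. veval (repr W)), onsq = (\<lambda>W. seval (repr W))\<rparr>"

lemma ind_simps:
  "dsrc ind = Q" "dtgt ind = T" "x \<in> Ob U \<Longrightarrow> onob ind (h.ocl x) = onob P x"
  "h.mwf e \<Longrightarrow> onhor ind (h.mcl e) = heval e" "v.mwf w \<Longrightarrow> onver ind (v.mcl w) = veval w"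
  "swf s \<Longrightarrow> onsq ind (scl s) = seval s"
  by (simp_all add: ind_def oeq_resp[OF h.repr_ocl] heval_resp[OF h.repr_mcl]
      veval_resp[OF v.repr_mcl] seval_resp[OF repr_scl])

lemma double_functor_ind: "double_functor ind"
proof (rule double_functorI; unfold ind_simps(1,2))
  show "double_category Q" by (rule double_category_Q)
  show "double_category T" by (rule T.double_category_axioms)
  note wf = h.mwf_in[simplified] v.mwf_in[simplified]
  fix X assume "X \<in> Ob Q"
  then obtain x where "X = h.ocl x" "x \<in> Ob U" by (auto simp: Q_sets)
  then show "onob ind X \<in> Ob T" "onhor ind (hid Q X) = hid T (onob ind X)"
    "onver ind (vid Q X) = vid T (onob ind X)"
    by (simp_all add: Q_hor Q_ver ind_simps PD cell_simps)
next
  fix F assume "F \<in> Hor Q"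
  then obtain f where f: "F = h.mcl f" "h.mwf f" by (auto simp: Q_sets)
  then show "onhor ind F \<in> Hor T" "hdom T (onhor ind F) = onob ind (hdom Q F)"
    "hcod T (onhor ind F) = onob ind (hcod Q F)" "onsq ind (sqvid Q F) = sqvid T (onhor ind F)"
    using h.mwf_in[OF f(2)] heval_in[OF f(2)] evid_facts[OF f(2)]
    by (simp_all add: Q_hor Q_sq ind_simps seval_evid)
  fix G assume *: "G \<in> Hor Q" "hcod Q F = hdom Q G"
  then obtain g where g: "G = h.mcl g" "h.mwf g" by (auto simp: Q_sets)
  then have wf: "h.mwf (Com g f)"
    using * f h.mwf_in[of f] by (simp add: Q_hor h.ocl_eq_iff)
  then show "onhor ind (hcmp Q G F) = hcmp T (onhor ind G) (onhor ind F)"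
    using f g Q_hor(4)[OF wf] ind_simps(4)[OF wf] by (simp add: ind_simps)
next
  fix F assume "F \<in> Ver Q"
  then obtain f where f: "F = v.mcl f" "v.mwf f" by (auto simp: Q_sets)
  then show "onver ind F \<in> Ver T" "vdom T (onver ind F) = onob ind (vdom Q F)"
    "vcod T (onver ind F) = onob ind (vcod Q F)" "onsq ind (sqhid Q F) = sqhid T (onver ind F)"
    using v.mwf_in[OF f(2)] veval_in[OF f(2)] ehid_facts[OF f(2)]
    by (simp_all add: Q_ver Q_sq ind_simps seval_ehid)
  fix G assume *: "G \<in> Ver Q" "vcod Q F = vdom Q G"
  then obtain g where g: "G = v.mcl g" "v.mwf g" by (auto simp: Q_sets)
  then have wf: "v.mwf (Com g f)"
    using * f v.mwf_in[of f] by (simp add: Q_ver h.ocl_eq_iff voeq)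
  then show "onver ind (vcmp Q G F) = vcmp T (onver ind G) (onver ind F)"
    using f g Q_ver(4)[OF wf] ind_simps(5)[OF wf] by (simp add: ind_simps)
next
  fix W assume "W \<in> Sq Q"
  then obtain s where s: "W = scl s" "swf s" by (auto simp: Q_sets)
  then show "onsq ind W \<in> Sq T" "stop T (onsq ind W) = onhor ind (stop Q W)"
    "sbot T (onsq ind W) = onhor ind (sbot Q W)" "slft T (onsq ind W) = onver ind (slft Q W)"
    "srgt T (onsq ind W) = onver ind (srgt Q W)"
    using swf_facts[OF s(2)] seval_in[OF s(2)] by (simp_all add: Q_sq ind_simps)
  fix V assume "V \<in> Sq Q"
  then obtain t where t: "V = scl t" "swf t" by (auto simp: Q_sets)
  show "onsq ind (sqhcmp Q V W) = sqhcmp T (onsq ind V) (onsq ind W)" if "srgt Q W = slft Q V"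
  proof -
    have wf: "swf (HCom t s)"
      using that s t swf_facts[OF s(2)] by (simp add: Q_sq vmcl_eq_iff)
    show ?thesis
      using s t Q_sq(7)[OF wf] ind_simps(6)[OF wf] by (simp add: ind_simps)
  qed
  show "onsq ind (sqvcmp Q V W) = sqvcmp T (onsq ind V) (onsq ind W)" if "sbot Q W = stop Q V"
  proof -
    have wf: "swf (VCom t s)"
      using that s t swf_facts[OF s(2)] by (simp add: Q_sq mcl_eq_iff)
    show ?thesis
      using s t Q_sq(8)[OF wf] ind_simps(6)[OF wf] by (simp add: ind_simps)
  qed
qed

end

context dbl_quotient_rel begin

text \<open>Every class is a composite of classes of generators, so a double functor on the quotient
  is determined by its values on generators, even though generators need not be composable before
  the identification.\<close>

lemma quotient_functor_eval:
  assumes L: "double_functor L" "dsrc L = Q"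
  shows "h.mwf e \<Longrightarrow> onhor L (h.mcl e) = expr_eval (hcat (dtgt L)) (\<lambda>f. onhor L (h.mcl (Gen f))) e"
    "v.mwf w \<Longrightarrow> onver L (v.mcl w) = expr_eval (vcat (dtgt L)) (\<lambda>f. onver L (v.mcl (Gen f))) w"
    "swf s \<Longrightarrow> onsq L (scl s) = sexpr_eval (dtgt L) (\<lambda>s. onsq L (scl (SGen s))) s"
proof -
  note LD = double_functorD(3-)[OF L(1), unfolded L(2)]
  show "h.mwf e \<Longrightarrow> onhor L (h.mcl e) = expr_eval (hcat (dtgt L)) (\<lambda>f. onhor L (h.mcl (Gen f))) e"
  proof (induction e)
    case (Com g f)
    then show ?case
      using LD(6)[of "h.mcl f" "h.mcl g"] Q_hor(4)[of g f]
      by (simp add: Q_sets Q_hor(1,2) h.ocl_eqI)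
  qed simp
  show "v.mwf w \<Longrightarrow> onver L (v.mcl w) = expr_eval (vcat (dtgt L)) (\<lambda>f. onver L (v.mcl (Gen f))) w"
  proof (induction w)
    case (Com g f)
    then show ?case
      using LD(11)[of "v.mcl f" "v.mcl g"] Q_ver(4)[of g f]
      by (simp add: Q_sets Q_ver(1,2) h.ocl_eqI voeq)
  qed simp
  show "swf s \<Longrightarrow> onsq L (scl s) = sexpr_eval (dtgt L) (\<lambda>s. onsq L (scl (SGen s))) s"
  proof (induction s)
    case (HCom t s)
    then show ?case
      using LD(19)[of "scl s" "scl t"] Q_sq(7)[of t s]
      by (simp add: Q_sets Q_sq(1-4) v.mcl_eqI)
  next
    case (VCom t s)
    then show ?case
      using LD(20)[of "scl s" "scl t"] Q_sq(8)[of t s]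
      by (simp add: Q_sets Q_sq(1-4) h.mcl_eqI)
  qed simp
qed

lemma expr_eval_cong: "expr_wf C Ro e \<Longrightarrow> (\<And>f. f \<in> Mor C \<Longrightarrow> p f = q f) \<Longrightarrow> expr_eval T p e = expr_eval T q e"
  by (induction e) auto

lemma sexpr_eval_cong: "swf e \<Longrightarrow> (\<And>s. s \<in> Sq U \<Longrightarrow> p s = q s) \<Longrightarrow> sexpr_eval T p e = sexpr_eval T q e"
  by (induction e) auto

lemma quotient_functor_eqI:
  assumes L: "double_functor L" "dsrc L = Q" and L': "double_functor L'" "dsrc L' = Q"
    and tgt: "dtgt L = dtgt L'"
    and "\<And>x. x \<in> Ob U \<Longrightarrow> onob L (h.ocl x) = onob L' (h.ocl x)"
    and "\<And>f. f \<in> Hor U \<Longrightarrow> onhor L (h.mcl (Gen f)) = onhor L' (h.mcl (Gen f))"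
    and "\<And>v. v \<in> Ver U \<Longrightarrow> onver L (v.mcl (Gen v)) = onver L' (v.mcl (Gen v))"
    and "\<And>s. s \<in> Sq U \<Longrightarrow> onsq L (scl (SGen s)) = onsq L' (scl (SGen s))"
  shows "dfun_eq L L'"
  unfolding dfun_eq_def L(2) L'(2)
proof (intro conjI ballI)
  show "dtgt L = dtgt L'" by fact
  show "onob L X = onob L' X" if "X \<in> Ob Q" for X
    using that assms(6) by (auto simp: Q_sets)
  show "onhor L X = onhor L' X" if "X \<in> Hor Q" for X
  proof -
    from that obtain e where e: "X = h.mcl e" "h.mwf e" by (auto simp: Q_sets)
    show ?thesis
      using quotient_functor_eval(1)[OF L e(2)] quotient_functor_eval(1)[OF L' e(2)] e(1) tgt
        expr_eval_cong[OF e(2), of "\<lambda>f. onhor L (h.mcl (Gen f))" "\<lambda>f. onhor L' (h.mcl (Gen f))"]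
        assms(7) by simp
  qed
  show "onver L X = onver L' X" if "X \<in> Ver Q" for X
  proof -
    from that obtain e where e: "X = v.mcl e" "v.mwf e" by (auto simp: Q_sets)
    show ?thesis
      using quotient_functor_eval(2)[OF L e(2)] quotient_functor_eval(2)[OF L' e(2)] e(1) tgt
        expr_eval_cong[OF e(2), of "\<lambda>f. onver L (v.mcl (Gen f))" "\<lambda>f. onver L' (v.mcl (Gen f))"]
        assms(8) by simp
  qed
  show "onsq L X = onsq L' X" if "X \<in> Sq Q" for X
  proof -
    from that obtain e where e: "X = scl e" "swf e" by (auto simp: Q_sets)
    show ?thesis
      using quotient_functor_eval(3)[OF L e(2)] quotient_functor_eval(3)[OF L' e(2)] e(1) tgt
        sexpr_eval_cong[OF e(2), of "\<lambda>s. onsq L (scl (SGen s))" "\<lambda>s. onsq L' (scl (SGen s))"]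
        assms(9) by simp
  qed
qed simp

end

section \<open>Sums, products and pushouts\<close>

text \<open>All four categories underlying \<open>dbl_sum\<close> are sums of this form, so the
  category laws are checked once; \<open>cat_prod\<close> serves \<open>dbl_prod\<close> in the same
  way.\<close>

definition cat_sum :: "('o, 'm) cat \<Rightarrow> ('p, 'n) cat \<Rightarrow> ('o + 'p, 'm + 'n) cat" where
  "cat_sum C C' = \<lparr>Obj = Obj C <+> Obj C', Mor = Mor C <+> Mor C',
     Dom = map_sum (Dom C) (Dom C'), Cod = map_sum (Cod C) (Cod C'),
     Idn = map_sum (Idn C) (Idn C'), Cmp = sum_op (Cmp C) (Cmp C')\<rparr>"

lemma sum_op_simps [simp]:
  "sum_op p q (Inl a) (Inl b) = Inl (p a b)" "sum_op p q (Inr x) (Inr y) = Inr (q x y)"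
  by (simp_all add: sum_op_def)

lemma category_cat_sum:
  assumes "category C" "category C'"
  shows "category (cat_sum C C')"
proof -
  interpret C: category C by fact
  interpret C': category C' by fact
  show ?thesis
    by unfold_locales
      (auto simp: cat_sum_def C.Dom_in C'.Dom_in C.Cod_in C'.Cod_in C.Idn_in C'.Idn_in
        C.Dom_Idn C'.Dom_Idn C.Cod_Idn C'.Cod_Idn C.Cmp_in C'.Cmp_in C.Dom_Cmp C'.Dom_Cmp
        C.Cod_Cmp C'.Cod_Cmp C.Cmp_Idn_right C'.Cmp_Idn_right C.Cmp_Idn_left C'.Cmp_Idn_left
        C.Cmp_assoc C'.Cmp_assoc)
qed

lemma double_category_dbl_sum:
  assumes "double_category B" "double_category C"
  shows "double_category (dbl_sum B C)"
proof -
  interpret B: double_category B by fact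
  interpret C: double_category C by fact
  have cats: "hcat (dbl_sum B C) = cat_sum (hcat B) (hcat C)"
    "vcat (dbl_sum B C) = cat_sum (vcat B) (vcat C)"
    "hcat_ver (dbl_sum B C) = cat_sum (hcat_ver B) (hcat_ver C)"
    "vcat_hor (dbl_sum B C) = cat_sum (vcat_hor B) (vcat_hor C)"
    by (simp_all add: hcat_def vcat_def hcat_ver_def vcat_hor_def cat_sum_def dbl_sum_def)
  show ?thesis
  proof (rule double_categoryI)
    show "category (hcat (dbl_sum B C))" "category (vcat (dbl_sum B C))"
      "category (hcat_ver (dbl_sum B C))" "category (vcat_hor (dbl_sum B C))"
      unfolding cats by (intro category_cat_sum B.horizontal.category_axioms
          C.horizontal.category_axioms B.vertical.category_axioms C.vertical.category_axioms
          B.squares_h.category_axioms C.squares_h.category_axioms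
          B.squares_v.category_axioms C.squares_v.category_axioms)+
    show "double_category_axioms (dbl_sum B C)"
      unfolding double_category_axioms_def
      by (auto simp: dbl_sum_def B.cell_simps C.cell_simps B.sqvid_hcmp C.sqvid_hcmp
          B.sqhid_vcmp C.sqhid_vcmp B.sqvid_hid C.sqvid_hid B.interchange C.interchange)
  qed
qed

definition cat_prod :: "('o, 'm) cat \<Rightarrow> ('p, 'n) cat \<Rightarrow> ('o \<times> 'p, 'm \<times> 'n) cat" where
  "cat_prod C C' = \<lparr>Obj = Obj C \<times> Obj C', Mor = Mor C \<times> Mor C',
     Dom = map_prod (Dom C) (Dom C'), Cod = map_prod (Cod C) (Cod C'),
     Idn = map_prod (Idn C) (Idn C'), Cmp = prod_op (Cmp C) (Cmp C')\<rparr>"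

lemma category_cat_prod:
  assumes "category C" "category C'"
  shows "category (cat_prod C C')"
proof -
  interpret C: category C by fact
  interpret C': category C' by fact
  show ?thesis
    by unfold_locales
      (auto simp: cat_prod_def prod_op_def C.Dom_in C'.Dom_in C.Cod_in C'.Cod_in C.Idn_in C'.Idn_in
        C.Dom_Idn C'.Dom_Idn C.Cod_Idn C'.Cod_Idn C.Cmp_in C'.Cmp_in C.Dom_Cmp C'.Dom_Cmp
        C.Cod_Cmp C'.Cod_Cmp C.Cmp_Idn_right C'.Cmp_Idn_right C.Cmp_Idn_left C'.Cmp_Idn_left
        C.Cmp_assoc C'.Cmp_assoc)
qed

lemma dbl_prod_simps [simp]:
  "Ob (dbl_prod B C) = Ob B \<times> Ob C" "Hor (dbl_prod B C) = Hor B \<times> Hor C"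
  "Ver (dbl_prod B C) = Ver B \<times> Ver C" "Sq (dbl_prod B C) = Sq B \<times> Sq C"
  "hdom (dbl_prod B C) (f, g) = (hdom B f, hdom C g)" "hcod (dbl_prod B C) (f, g) = (hcod B f, hcod C g)"
  "vdom (dbl_prod B C) (v, w) = (vdom B v, vdom C w)" "vcod (dbl_prod B C) (v, w) = (vcod B v, vcod C w)"
  "hid (dbl_prod B C) (x, y) = (hid B x, hid C y)" "vid (dbl_prod B C) (x, y) = (vid B x, vid C y)"
  "hcmp (dbl_prod B C) (f', g') (f, g) = (hcmp B f' f, hcmp C g' g)"
  "vcmp (dbl_prod B C) (v', w') (v, w) = (vcmp B v' v, vcmp C w' w)"
  "stop (dbl_prod B C) (s, t) = (stop B s, stop C t)" "sbot (dbl_prod B C) (s, t) = (sbot B s, sbot C t)"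
  "slft (dbl_prod B C) (s, t) = (slft B s, slft C t)" "srgt (dbl_prod B C) (s, t) = (srgt B s, srgt C t)"
  "sqhid (dbl_prod B C) (v, w) = (sqhid B v, sqhid C w)"
  "sqvid (dbl_prod B C) (f, g) = (sqvid B f, sqvid C g)"
  "sqhcmp (dbl_prod B C) (s', t') (s, t) = (sqhcmp B s' s, sqhcmp C t' t)"
  "sqvcmp (dbl_prod B C) (s', t') (s, t) = (sqvcmp B s' s, sqvcmp C t' t)"
  by (simp_all add: dbl_prod_def prod_op_def)

lemma double_category_dbl_prod:
  assumes "double_category B" "double_category C"
  shows "double_category (dbl_prod B C)"
proof -
  interpret B: double_category B by fact
  interpret C: double_category C by fact
  have cats: "hcat (dbl_prod B C) = cat_prod (hcat B) (hcat C)"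
    "vcat (dbl_prod B C) = cat_prod (vcat B) (vcat C)"
    "hcat_ver (dbl_prod B C) = cat_prod (hcat_ver B) (hcat_ver C)"
    "vcat_hor (dbl_prod B C) = cat_prod (vcat_hor B) (vcat_hor C)"
    by (simp_all add: hcat_def vcat_def hcat_ver_def vcat_hor_def cat_prod_def dbl_prod_def)
  show ?thesis
  proof (rule double_categoryI)
    show "category (hcat (dbl_prod B C))" "category (vcat (dbl_prod B C))"
      "category (hcat_ver (dbl_prod B C))" "category (vcat_hor (dbl_prod B C))"
      unfolding cats by (intro category_cat_prod B.horizontal.category_axioms
          C.horizontal.category_axioms B.vertical.category_axioms C.vertical.category_axioms
          B.squares_h.category_axioms C.squares_h.category_axioms
          B.squares_v.category_axioms C.squares_v.category_axioms)+
    show "double_category_axioms (dbl_prod B C)"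
      unfolding double_category_axioms_def
      by (auto simp: B.cell_simps C.cell_simps B.sqvid_hcmp C.sqvid_hcmp
          B.sqhid_vcmp C.sqhid_vcmp B.sqvid_hid C.sqvid_hid B.interchange C.interchange)
  qed
qed

lemma double_functor_prod_proj2:
  assumes "double_category B" "double_category C"
  shows "double_functor (prod_proj2 B C)"
  by (rule double_functorI)
    (use assms in \<open>auto simp: prod_proj2_def intro: double_category_dbl_prod\<close>)

lemma double_functor_prod_dfun:
  assumes "double_functor F" "double_functor G"
  shows "double_functor (prod_dfun F G)"
  by (rule double_functorI)
    (use double_functorD[OF assms(1)] double_functorD[OF assms(2)] in
      \<open>auto simp: prod_dfun_def intro!: double_category_dbl_prod\<close>)

lemma double_functor_incl_at:
  assumes "double_category B" "double_category C" "x \<in> Ob B"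
  shows "double_functor (incl_at B C x)"
proof -
  interpret B: double_category B by fact
  interpret C: double_category C by fact
  \<comment> \<open>The inclusion pairs every square with the unit square at \<open>x\<close>. For
    vertical composition this square must be idempotent, which holds because it is also
    \<open>sqvid B (hid B x)\<close>.\<close>
  have "sqvcmp B (sqhid B (vid B x)) (sqhid B (vid B x)) = sqhid B (vid B x)"
    using assms(3) B.sqvid_hid[OF assms(3)] B.sqvcmp_sqvid_left[of "sqhid B (vid B x)" "hid B x"]
    by (simp add: B.cell_simps)
  then show ?thesis
    using assms(3)
    by (intro double_functorI)
      (auto simp: incl_at_def B.cell_simps B.sqvid_hid intro!: double_category_dbl_prod assms(1,2))
qed

lemma dfun_eqD:
  assumes "dfun_eq F G"
  shows "dsrc F = dsrc G" "dtgt F = dtgt G" "x \<in> Ob (dsrc F) \<Longrightarrow> onob F x = onob G x"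
    "f \<in> Hor (dsrc F) \<Longrightarrow> onhor F f = onhor G f" "v \<in> Ver (dsrc F) \<Longrightarrow> onver F v = onver G v"
    "s \<in> Sq (dsrc F) \<Longrightarrow> onsq F s = onsq G s"
  using assms by (auto simp: dfun_eq_def)

lemma comp_dfun_simps [simp]:
  "dsrc (comp_dfun G F) = dsrc F" "dtgt (comp_dfun G F) = dtgt G"
  "onob (comp_dfun G F) x = onob G (onob F x)" "onhor (comp_dfun G F) f = onhor G (onhor F f)"
  "onver (comp_dfun G F) v = onver G (onver F v)" "onsq (comp_dfun G F) s = onsq G (onsq F s)"
  by (simp_all add: comp_dfun_def)

definition pushout_inl where
  "pushout_inl F G =
    (let U = dbl_sum (dtgt F) (dtgt G); R = pushout_rel F G in
     \<lparr>dsrc = dtgt F, dtgt = pushout F G, onob = (\<lambda>x. ocls U R (Inl x)),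
      onhor = (\<lambda>f. hcls U R (Gen (Inl f))), onver = (\<lambda>v. vcls U R (Gen (Inl v))),
      onsq = (\<lambda>s. scls U R (SGen (Inl s)))\<rparr>)"

lemma dbl_sum_simps [simp]:
  "Ob (dbl_sum B C) = Ob B <+> Ob C" "Hor (dbl_sum B C) = Hor B <+> Hor C"
  "Ver (dbl_sum B C) = Ver B <+> Ver C" "Sq (dbl_sum B C) = Sq B <+> Sq C"
  "hdom (dbl_sum B C) = map_sum (hdom B) (hdom C)" "hcod (dbl_sum B C) = map_sum (hcod B) (hcod C)"
  "vdom (dbl_sum B C) = map_sum (vdom B) (vdom C)" "vcod (dbl_sum B C) = map_sum (vcod B) (vcod C)"
  "hid (dbl_sum B C) = map_sum (hid B) (hid C)" "vid (dbl_sum B C) = map_sum (vid B) (vid C)"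
  "hcmp (dbl_sum B C) = sum_op (hcmp B) (hcmp C)" "vcmp (dbl_sum B C) = sum_op (vcmp B) (vcmp C)"
  "stop (dbl_sum B C) = map_sum (stop B) (stop C)" "sbot (dbl_sum B C) = map_sum (sbot B) (sbot C)"
  "slft (dbl_sum B C) = map_sum (slft B) (slft C)" "srgt (dbl_sum B C) = map_sum (srgt B) (srgt C)"
  "sqhid (dbl_sum B C) = map_sum (sqhid B) (sqhid C)"
  "sqvid (dbl_sum B C) = map_sum (sqvid B) (sqvid C)"
  "sqhcmp (dbl_sum B C) = sum_op (sqhcmp B) (sqhcmp C)"
  "sqvcmp (dbl_sum B C) = sum_op (sqvcmp B) (sqvcmp C)"
  by (simp_all add: dbl_sum_def)

section \<open>Pushouts and their universal property\<close>

locale dbl_span =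
  fixes F :: "('a, 'b, 'c, 'd, 'o, 'h, 'v, 's) dblfun"
    and G :: "('a, 'b, 'c, 'd, 'p, 'i, 'w, 't) dblfun"
  assumes F: "double_functor F" and G: "double_functor G" and src: "dsrc G = dsrc F"
begin

abbreviation U where "U \<equiv> dbl_sum (dtgt F) (dtgt G)"
abbreviation R where "R \<equiv> pushout_rel F G"

lemmas FD = double_functorD[OF F]
lemmas GD = double_functorD[OF G, unfolded src]

lemma rel_gens:
  "x \<in> Ob (dsrc F) \<Longrightarrow> obj_eq (hcat U) (relob R) (Inl (onob F x)) (Inr (onob G x))"
  "f \<in> Hor (dsrc F) \<Longrightarrow> hexpr_eq U R (Gen (Inl (onhor F f))) (Gen (Inr (onhor G f)))"
  "v \<in> Ver (dsrc F) \<Longrightarrow> vexpr_eq U R (Gen (Inl (onver F v))) (Gen (Inr (onver G v)))"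
  "s \<in> Sq (dsrc F) \<Longrightarrow> sexpr_eq U R (SGen (Inl (onsq F s))) (SGen (Inr (onsq G s)))"
  by (auto simp: pushout_rel_def intro!: obj_eq.rel expr_eq.rel sexpr_eq.rel)

lemma rel_sets:
  "relob R = (\<lambda>x. (Inl (onob F x), Inr (onob G x))) ` Ob (dsrc F)"
  "relhor R = (\<lambda>f. (Inl (onhor F f), Inr (onhor G f))) ` Hor (dsrc F)"
  "relver R = (\<lambda>v. (Inl (onver F v), Inr (onver G v))) ` Ver (dsrc F)"
  "relsq R = (\<lambda>s. (Inl (onsq F s), Inr (onsq G s))) ` Sq (dsrc F)"
  by (simp_all add: pushout_rel_def)

text \<open>Double functors preserve boundaries, so the sides of two identified cells are themselves
  identified, being the images of one side in the source of the span.\<close>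

lemma dbl_quotient_rel: "dbl_quotient_rel U R"
proof -
  interpret A: double_category "dsrc F" by (rule FD(1))
  interpret U: double_category U by (rule double_category_dbl_sum[OF FD(2) GD(2)])
  show ?thesis
  proof
    show "x \<in> Ob U \<and> y \<in> Ob U" if "(x, y) \<in> relob R" for x y
      using that by (auto simp: rel_sets FD GD)
    show "f \<in> Hor U \<and> f' \<in> Hor U \<and> obj_eq (hcat U) (relob R) (hdom U f) (hdom U f')
      \<and> obj_eq (hcat U) (relob R) (hcod U f) (hcod U f')" if "(f, f') \<in> relhor R" for f f'
    proof -
      from that obtain g where "g \<in> Hor (dsrc F)" "f = Inl (onhor F g)" "f' = Inr (onhor G g)"
        by (auto simp: rel_sets(2))
      then show ?thesis
        using rel_gens(1)[of "hdom (dsrc F) g"] rel_gens(1)[of "hcod (dsrc F) g"]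
        by (simp add: FD GD A.cell_simps InlI InrI)
    qed
    show "f \<in> Ver U \<and> f' \<in> Ver U \<and> obj_eq (hcat U) (relob R) (vdom U f) (vdom U f')
      \<and> obj_eq (hcat U) (relob R) (vcod U f) (vcod U f')" if "(f, f') \<in> relver R" for f f'
    proof -
      from that obtain g where "g \<in> Ver (dsrc F)" "f = Inl (onver F g)" "f' = Inr (onver G g)"
        by (auto simp: rel_sets(3))
      then show ?thesis
        using rel_gens(1)[of "vdom (dsrc F) g"] rel_gens(1)[of "vcod (dsrc F) g"]
        by (simp add: FD GD A.cell_simps InlI InrI)
    qed
    show "s \<in> Sq U \<and> s' \<in> Sq U
      \<and> hexpr_eq U R (Gen (stop U s)) (Gen (stop U s')) \<and> hexpr_eq U R (Gen (sbot U s)) (Gen (sbot U s'))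
      \<and> vexpr_eq U R (Gen (slft U s)) (Gen (slft U s')) \<and> vexpr_eq U R (Gen (srgt U s)) (Gen (srgt U s'))"
      if "(s, s') \<in> relsq R" for s s'
    proof -
      from that obtain q where "q \<in> Sq (dsrc F)" "s = Inl (onsq F q)" "s' = Inr (onsq G q)"
        by (auto simp: rel_sets(4))
      then show ?thesis
        using rel_gens(2)[of "stop (dsrc F) q"] rel_gens(2)[of "sbot (dsrc F) q"]
          rel_gens(3)[of "slft (dsrc F) q"] rel_gens(3)[of "srgt (dsrc F) q"]
        by (simp add: FD GD A.cell_simps InlI InrI)
    qed
  qed
qed

sublocale quotient: dbl_quotient_rel U R
  by (rule dbl_quotient_rel)

lemma double_category_pushout: "double_category (pushout F G)"
  unfolding pushout_def by (rule quotient.double_category_Q)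

lemma inj_simps [simp]:
  "dsrc (pushout_inl F G) = dtgt F" "dtgt (pushout_inl F G) = pushout F G"
  "onob (pushout_inl F G) x = quotient.h.ocl (Inl x)"
  "onhor (pushout_inl F G) f = quotient.h.mcl (Gen (Inl f))"
  "onver (pushout_inl F G) v = quotient.v.mcl (Gen (Inl v))"
  "onsq (pushout_inl F G) s = scls U R (SGen (Inl s))"
  "dsrc (pushout_inr F G) = dtgt G" "dtgt (pushout_inr F G) = pushout F G"
  "onob (pushout_inr F G) x' = quotient.h.ocl (Inr x')"
  "onhor (pushout_inr F G) f' = quotient.h.mcl (Gen (Inr f'))"
  "onver (pushout_inr F G) v' = quotient.v.mcl (Gen (Inr v'))"
  "onsq (pushout_inr F G) s' = scls U R (SGen (Inr s'))"
  by (simp_all add: pushout_inl_def pushout_inr_def Let_def)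

lemma quot_gens:
  "f \<in> Hor U \<Longrightarrow> quotient.h.mcl (Gen f) \<in> Hor quotient.Q"
  "v \<in> Ver U \<Longrightarrow> quotient.v.mcl (Gen v) \<in> Ver quotient.Q"
  "s \<in> Sq U \<Longrightarrow> scls U R (SGen s) \<in> Sq quotient.Q"
  by (auto simp: quotient.Q_sets simp del: dbl_sum_simps)

lemma quot_ops:
  "\<lbrakk>f \<in> Hor U; g \<in> Hor U; hcod U f = hdom U g\<rbrakk> \<Longrightarrow>
    hcmp quotient.Q (quotient.h.mcl (Gen g)) (quotient.h.mcl (Gen f)) = quotient.h.mcl (Gen (hcmp U g f))"
  "\<lbrakk>v \<in> Ver U; w \<in> Ver U; vcod U v = vdom U w\<rbrakk> \<Longrightarrow>
    vcmp quotient.Q (quotient.v.mcl (Gen w)) (quotient.v.mcl (Gen v)) = quotient.v.mcl (Gen (vcmp U w v))"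
  "\<lbrakk>s \<in> Sq U; t \<in> Sq U; srgt U s = slft U t\<rbrakk> \<Longrightarrow>
    sqhcmp quotient.Q (scls U R (SGen t)) (scls U R (SGen s)) = scls U R (SGen (sqhcmp U t s))"
  "\<lbrakk>s \<in> Sq U; t \<in> Sq U; sbot U s = stop U t\<rbrakk> \<Longrightarrow>
    sqvcmp quotient.Q (scls U R (SGen t)) (scls U R (SGen s)) = scls U R (SGen (sqvcmp U t s))"
proof -
  show "hcmp quotient.Q (quotient.h.mcl (Gen g)) (quotient.h.mcl (Gen f)) = quotient.h.mcl (Gen (hcmp U g f))"
    if "f \<in> Hor U" "g \<in> Hor U" "hcod U f = hdom U g"
    using that quotient.Q_hor(4)[of "Gen g" "Gen f"] quotient.h.mcl_eqI[OF expr_eq.comp[of f "hcat U" g]]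
    by (simp add: obj_eq.refl quotient.cell_simps del: dbl_sum_simps)
  show "vcmp quotient.Q (quotient.v.mcl (Gen w)) (quotient.v.mcl (Gen v)) = quotient.v.mcl (Gen (vcmp U w v))"
    if "v \<in> Ver U" "w \<in> Ver U" "vcod U v = vdom U w"
    using that quotient.Q_ver(4)[of "Gen w" "Gen v"] quotient.v.mcl_eqI[OF expr_eq.comp[of v "vcat U" w]]
    by (simp add: obj_eq.refl quotient.cell_simps del: dbl_sum_simps)
  show "sqhcmp quotient.Q (scls U R (SGen t)) (scls U R (SGen s)) = scls U R (SGen (sqhcmp U t s))"
    if "s \<in> Sq U" "t \<in> Sq U" "srgt U s = slft U t"
    using that quotient.Q_sq(7)[of "SGen t" "SGen s"] quotient.scl_eqI[OF sexpr_eq.hcomp[OF that]]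
    by (simp add: expr_eq.refl quotient.cell_simps del: dbl_sum_simps)
  show "sqvcmp quotient.Q (scls U R (SGen t)) (scls U R (SGen s)) = scls U R (SGen (sqvcmp U t s))"
    if "s \<in> Sq U" "t \<in> Sq U" "sbot U s = stop U t"
    using that quotient.Q_sq(8)[of "SGen t" "SGen s"] quotient.scl_eqI[OF sexpr_eq.vcomp[OF that]]
    by (simp add: expr_eq.refl quotient.cell_simps del: dbl_sum_simps)
qed

lemma double_functor_inl: "double_functor (pushout_inl F G)"
  using double_category_pushout FD(2)
  by (intro double_functorI; unfold inj_simps pushout_def)
    (auto simp: quot_gens InlI quotient.Q_sets(1) quotient.Q_hor(1-3) quotient.Q_ver(1-3)
      quotient.Q_sq(1-6) quot_ops)

lemma double_functor_inr: "double_functor (pushout_inr F G)"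
  using double_category_pushout GD(2)
  by (intro double_functorI; unfold inj_simps pushout_def)
    (auto simp: quot_gens InrI quotient.Q_sets(1) quotient.Q_hor(1-3) quotient.Q_ver(1-3)
      quotient.Q_sq(1-6) quot_ops)

lemma pushout_commutes:
  "dfun_eq (comp_dfun (pushout_inl F G) F) (comp_dfun (pushout_inr F G) G)"
  using rel_gens src
  by (auto simp: dfun_eq_def intro!: quotient.h.ocl_eqI quotient.h.mcl_eqI quotient.v.mcl_eqI
      quotient.scl_eqI)

text \<open>The generators of the quotient are the cells of the two summands, that is, the images of
  the two coprojections.\<close>

lemma pushout_functor_eqI:
  assumes "double_functor L" "dsrc L = pushout F G" "double_functor L'" "dsrc L' = pushout F G"
    and l: "dfun_eq (comp_dfun L (pushout_inl F G)) (comp_dfun L' (pushout_inl F G))"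
    and r: "dfun_eq (comp_dfun L (pushout_inr F G)) (comp_dfun L' (pushout_inr F G))"
  shows "dfun_eq L L'"
  using assms(1-4) dfun_eqD(2-6)[OF l] dfun_eqD(2-6)[OF r]
  by (intro quotient.quotient_functor_eqI) (auto simp: pushout_def)

end

text \<open>Existence half of the universal property: commutativity on the source of the span is
  what makes the case distinction on the sum respect the identifications.\<close>

locale dbl_cocone = dbl_span F G
  for F :: "('a, 'b, 'c, 'd, 'o, 'h, 'v, 's) dblfun"
    and G :: "('a, 'b, 'c, 'd, 'p, 'i, 'w, 't) dblfun" +
  fixes H :: "('o, 'h, 'v, 's, 'x, 'y, 'z, 'q) dblfun"
    and K :: "('p, 'i, 'w, 't, 'x, 'y, 'z, 'q) dblfun"
  assumes H: "double_functor H" "dsrc H = dtgt F" and K: "double_functor K" "dsrc K = dtgt G"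
    and commutes: "dfun_eq (comp_dfun H F) (comp_dfun K G)"
begin

definition P where
  "P = \<lparr>dsrc = U, dtgt = dtgt H, onob = case_sum (onob H) (onob K),
    onhor = case_sum (onhor H) (onhor K), onver = case_sum (onver H) (onver K),
    onsq = case_sum (onsq H) (onsq K)\<rparr>"

lemma tgt: "dtgt K = dtgt H"
  using dfun_eqD(2)[OF commutes] by simp

lemma P_simps [simp]:
  "dsrc P = U" "dtgt P = dtgt H" "onob P = case_sum (onob H) (onob K)"
  "onhor P = case_sum (onhor H) (onhor K)" "onver P = case_sum (onver H) (onver K)"
  "onsq P = case_sum (onsq H) (onsq K)"
  by (simp_all add: P_def)

lemmas HD = double_functorD[OF H(1), unfolded H(2)]
lemmas KD = double_functorD[OF K(1), unfolded K(2) tgt]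

lemma double_functor_P: "double_functor P"
  by (rule double_functorI; unfold P_simps)
    (auto simp: HD(2-) KD(3-) quotient.double_category_axioms)

sublocale quotient: dbl_quotient_functor U R P
  by unfold_locales (use double_functor_P dfun_eqD(3-6)[OF commutes] in
      \<open>auto simp: rel_sets\<close>)

lemma copair_eq: "pushout_copair F G H K = quotient.ind"
  by (simp add: pushout_copair_def quotient.ind_def pushout_def)

lemma copair_simps [simp]:
  "dsrc (pushout_copair F G H K) = pushout F G" "dtgt (pushout_copair F G H K) = dtgt H"
  by (simp_all add: pushout_copair_def)

lemma double_functor_copair: "double_functor (pushout_copair F G H K)"
  unfolding copair_eq by (rule quotient.double_functor_ind)

lemma copair_inl: "dfun_eq (comp_dfun (pushout_copair F G H K) (pushout_inl F G)) H"
  unfolding copair_eq dfun_eq_def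
  by (auto simp: quotient.ind_simps H InlI)

lemma copair_inr: "dfun_eq (comp_dfun (pushout_copair F G H K) (pushout_inr F G)) K"
  unfolding copair_eq dfun_eq_def
  by (auto simp: quotient.ind_simps K InrI tgt)

end

section \<open>The test double categories\<close>

lemma category_EE: "category EE"
  by unfold_locales (auto simp: EE_def)

lemma category_ordinal: "category (ordinal n)"
  by unfold_locales (auto simp: ordinal_def)

lemma category_parallel_cat: "category parallel_cat"
  by unfold_locales (auto simp: parallel_cat_def)

lemma double_category_HH:
  assumes "category C"
  shows "double_category (HH C)"
proof -
  interpret category C by fact
  note rules = Dom_in Cod_in Idn_in Dom_Idn Cod_Idn Cmp_in Dom_Cmp Cod_Cmp
    Cmp_Idn_right Cmp_Idn_left Cmp_assoc
  show ?thesis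
    by (rule double_categoryI; unfold_locales) (auto simp: HH_def rules)
qed

lemma HH_simps [simp]:
  "Ob (HH C) = Obj C" "Hor (HH C) = Mor C" "hdom (HH C) = Dom C" "hcod (HH C) = Cod C"
  "hid (HH C) = Idn C" "hcmp (HH C) = Cmp C" "Ver (HH C) = Obj C" "vdom (HH C) x = x"
  "vcod (HH C) x = x" "vid (HH C) x = x" "vcmp (HH C) y x = x" "Sq (HH C) = Mor C"
  "stop (HH C) f = f" "sbot (HH C) f = f" "slft (HH C) = Dom C" "srgt (HH C) = Cod C"
  "sqhid (HH C) = Idn C" "sqhcmp (HH C) = Cmp C" "sqvid (HH C) f = f" "sqvcmp (HH C) g f = f"
  by (simp_all add: HH_def)

text \<open>\<open>HH\<close> is left adjoint to \<open>hcat\<close>: a functor into the horizontal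
  category has a canonical extension, as the other cells of \<open>HH C\<close> are units.\<close>

lemma double_functor_from_HH:
  assumes "category C" "double_category D" "cat_functor G" "csrc G = C" "ctgt G = hcat D"
  shows "double_functor \<lparr>dsrc = HH C, dtgt = D, onob = cobj G, onhor = cmor G,
    onver = (\<lambda>x. vid D (cobj G x)), onsq = (\<lambda>f. sqvid D (cmor G f))\<rparr>"
proof -
  interpret C: category C by fact
  interpret D: double_category D by fact
  interpret G: cat_functor G by fact
  note rules = C.Dom_in C.Cod_in C.Idn_in C.Dom_Idn C.Cod_Idn C.Cmp_in C.Dom_Cmp C.Cod_Cmp
    G.cobj_in G.cmor_in G.Dom_cmor G.Cod_cmor G.cmor_Idn G.cmor_Cmp
  note rules' = rules[unfolded assms(4,5) hcat_simps]
  show ?thesis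
    by (rule double_functorI)
      (simp_all add: rules' D.cell_simps D.sqvid_hid D.sqvid_hcmp assms double_category_HH)
qed

lemma globe_dbl_simps:
  "Ob globe_dbl = {..1}" "Hor globe_dbl = Mor globe_cat" "hdom globe_dbl = fst"
  "hcod globe_dbl (a, b, p) = b" "hid globe_dbl a = (a, a, False)"
  "hcmp globe_dbl (b', c, q) (a, b, p) = (a, c, p \<or> q)"
  "Ver globe_dbl = {..1}" "vdom globe_dbl x = x" "vcod globe_dbl x = x" "vid globe_dbl x = x"
  "vcmp globe_dbl y x = x"
  "Sq globe_dbl = {(f, f) | f. f \<in> Mor globe_cat} \<union> {((0, 1, False), (0, 1, True))}"
  "stop globe_dbl = fst" "sbot globe_dbl = snd" "slft globe_dbl s = fst (fst s)"
  "srgt globe_dbl s = fst (snd (fst s))"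
  "sqhid globe_dbl x = ((x, x, False), (x, x, False))"
  "sqhcmp globe_dbl (g, g') (f, f') = (Cmp globe_cat g f, Cmp globe_cat g' f')"
  "sqvid globe_dbl f = (f, f)" "sqvcmp globe_dbl t s = (fst s, snd t)"
  by (auto simp: globe_dbl_def globe_cat_def prod_op_def fun_eq_iff split: prod.splits)

lemma double_category_globe: "double_category globe_dbl"
  by (rule double_categoryI; unfold_locales; auto simp: globe_dbl_def globe_cat_def prod_op_def)

lemma double_category_ext_prod:
  assumes "category C" "category C'"
  shows "double_category (ext_prod C C')"
proof -
  interpret C: category C by fact
  interpret C': category C' by fact
  show ?thesis
    by (rule double_categoryI; unfold_locales)
      (auto simp: ext_prod_def C.Dom_in C'.Dom_in C.Cod_in C'.Cod_in C.Idn_in C'.Idn_in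
        C.Dom_Idn C'.Dom_Idn C.Cod_Idn C'.Cod_Idn C.Cmp_in C'.Cmp_in C.Dom_Cmp C'.Dom_Cmp
        C.Cod_Cmp C'.Cod_Cmp C.Cmp_Idn_right C'.Cmp_Idn_right C.Cmp_Idn_left C'.Cmp_Idn_left
        C.Cmp_assoc C'.Cmp_assoc)
qed

lemma full_subdbl_simps [simp]:
  "Ob (full_subdbl D X) = Ob D \<inter> X"
  "Hor (full_subdbl D X) = {f \<in> Hor D. hdom D f \<in> X \<and> hcod D f \<in> X}"
  "Ver (full_subdbl D X) = {v \<in> Ver D. vdom D v \<in> X \<and> vcod D v \<in> X}"
  "Sq (full_subdbl D X) = {s \<in> Sq D.
     {vdom D (slft D s), vcod D (slft D s), vdom D (srgt D s), vcod D (srgt D s)} \<subseteq> X}"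
  "hdom (full_subdbl D X) = hdom D" "hcod (full_subdbl D X) = hcod D"
  "hid (full_subdbl D X) = hid D" "hcmp (full_subdbl D X) = hcmp D"
  "vdom (full_subdbl D X) = vdom D" "vcod (full_subdbl D X) = vcod D"
  "vid (full_subdbl D X) = vid D" "vcmp (full_subdbl D X) = vcmp D"
  "stop (full_subdbl D X) = stop D" "sbot (full_subdbl D X) = sbot D"
  "slft (full_subdbl D X) = slft D" "srgt (full_subdbl D X) = srgt D"
  "sqhid (full_subdbl D X) = sqhid D" "sqhcmp (full_subdbl D X) = sqhcmp D"
  "sqvid (full_subdbl D X) = sqvid D" "sqvcmp (full_subdbl D X) = sqvcmp D"
  by (simp_all add: full_subdbl_def)

lemma double_category_full_subdbl:
  assumes "double_category D"
  shows "double_category (full_subdbl D X)"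
proof -
  interpret D: double_category D by fact
  show ?thesis
    by (rule double_categoryI; unfold_locales)
      (auto simp: D.cell_simps D.hcmp_assoc D.vcmp_assoc D.sqhcmp_assoc D.sqvcmp_assoc
        D.sqvid_hcmp D.sqhid_vcmp D.sqvid_hid D.interchange D.edge_vcmp(3-))
qed

lemma double_functor_full_incl:
  assumes "double_category D"
  shows "double_functor ((id_dfun D)\<lparr>dsrc := full_subdbl D X\<rparr>)"
  by (rule double_functorI) (use assms in \<open>auto simp: id_dfun_def double_category_full_subdbl\<close>)

lemma walking_square_simps:
  "Ob walking_square = {..1} \<times> {..1}"
  "Hor walking_square = {(a, b). a \<le> b \<and> b \<le> 1} \<times> {..1}"
  "Ver walking_square = {..1} \<times> {(a, b). a \<le> b \<and> b \<le> 1}"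
  "Sq walking_square = {(a, b). a \<le> b \<and> b \<le> 1} \<times> {(a, b). a \<le> b \<and> b \<le> 1}"
  "hdom walking_square ((a, b), y) = (a, y)" "hcod walking_square ((a, b), y) = (b, y)"
  "hid walking_square (a, y) = ((a, a), y)" "hcmp walking_square (g, y') (f, y) = ((fst f, snd g), y)"
  "vdom walking_square (x, a, b) = (x, a)" "vcod walking_square (x, a, b) = (x, b)"
  "vid walking_square (x, a) = (x, a, a)" "vcmp walking_square (x', g) (x, f) = (x, fst f, snd g)"
  "stop walking_square (f, c, d) = (f, c)" "sbot walking_square (f, c, d) = (f, d)"
  "slft walking_square ((a, b), g) = (a, g)" "srgt walking_square ((a, b), g) = (b, g)"
  "sqhid walking_square (x, g) = ((x, x), g)" "sqvid walking_square (f, y) = (f, y, y)"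
  "sqhcmp walking_square (f', g') (f, g) = ((fst f, snd f'), g)"
  "sqvcmp walking_square (f', g') (f, g) = (f, fst g, snd g')"
  by (auto simp: walking_square_def ext_prod_def ordinal_def)

lemma double_category_walking_square: "double_category walking_square"
  unfolding walking_square_def by (intro double_category_ext_prod category_ordinal)

lemma corner_simps [simp]:
  "dsrc trcor = full_subdbl walking_square {(0, 0), (1, 0), (1, 1)}" "dtgt trcor = walking_square"
  "onob trcor x = x" "onhor trcor f = f" "onver trcor v = v" "onsq trcor s = s"
  "dsrc blcor = full_subdbl walking_square {(0, 0), (0, 1), (1, 1)}" "dtgt blcor = walking_square"
  "onob blcor x = x" "onhor blcor f = f" "onver blcor v = v" "onsq blcor s = s"
  by (simp_all add: trcor_def blcor_def id_dfun_def)

lemma double_functor_corners: "double_functor trcor" "double_functor blcor"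
  unfolding trcor_def blcor_def
  by (intro double_functor_full_incl double_category_walking_square)+

abbreviation "EEsq \<equiv> comm_squares EE"

lemma EE_simps:
  "Obj EE = {..1}" "Mor EE = {..1} \<times> {..1}" "Dom EE = fst" "Cod EE = snd" "Idn EE x = (x, x)"
  "Cmp EE g f = (fst f, snd g)"
  by (auto simp: EE_def)

lemma EEsq_simps:
  "Ob EEsq = {..1}" "Hor EEsq = {..1} \<times> {..1}" "Ver EEsq = {..1} \<times> {..1}"
  "hdom EEsq = fst" "hcod EEsq = snd" "hid EEsq x = (x, x)" "hcmp EEsq g f = (fst f, snd g)"
  "vdom EEsq = fst" "vcod EEsq = snd" "vid EEsq x = (x, x)" "vcmp EEsq g f = (fst f, snd g)"
  "Sq EEsq = {(t, l, r, b). t \<in> {..1} \<times> {..1} \<and> b \<in> {..1} \<times> {..1}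
     \<and> l = (fst t, fst b) \<and> r = (snd t, snd b)}"
  "stop EEsq (t, l, r, b) = t" "sbot EEsq (t, l, r, b) = b"
  "slft EEsq (t, l, r, b) = l" "srgt EEsq (t, l, r, b) = r"
  "sqhid EEsq v = ((fst v, fst v), v, v, (snd v, snd v))"
  "sqvid EEsq f = (f, (fst f, fst f), (snd f, snd f), f)"
  "sqhcmp EEsq (t', l', r', b') (t, l, r, b) = ((fst t, snd t'), l, r', (fst b, snd b'))"
  "sqvcmp EEsq (t', l', r', b') (t, l, r, b) = (t, (fst l, snd l'), (fst r, snd r'), b')"
  by (auto simp: comm_squares_def EE_simps)

lemma double_category_EEsq: "double_category EEsq"
  by (rule double_categoryI; unfold_locales) (auto simp: EEsq_simps)

section \<open>Locality with respect to \<open>agree(i)\<close>\<close>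

text \<open>The condition on a double functor \<open>\<Phi>\<close> on \<open>(\<E> \<rtimes> \<E>) \<times> \<bbbB>\<close> to induce a double functor on
  \<open>isocopy(i)\<close> whose restrictions to the two copies of \<open>\<bbbB>\<close> are \<open>H\<close> and \<open>K\<close>.\<close>

definition agree_ext where
  "agree_ext i H K \<Phi> \<longleftrightarrow> double_functor \<Phi> \<and> dsrc \<Phi> = dbl_prod EEsq (dtgt i) \<and>
     dfun_eq (comp_dfun \<Phi> (incl_at EEsq (dtgt i) 0)) H \<and>
     dfun_eq (comp_dfun \<Phi> (incl_at EEsq (dtgt i) 1)) K \<and>
     dfun_eq (comp_dfun \<Phi> (prod_dfun (id_dfun EEsq) i)) (comp_dfun (comp_dfun H i) (prod_proj2 EEsq (dsrc i)))"

lemma incl_at_simps [simp]: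
  "dsrc (incl_at B C x) = C" "dtgt (incl_at B C x) = dbl_prod B C" "onob (incl_at B C x) y = (x, y)"
  "onhor (incl_at B C x) f = (hid B x, f)" "onver (incl_at B C x) v = (vid B x, v)"
  "onsq (incl_at B C x) s = (sqhid B (vid B x), s)"
  by (simp_all add: incl_at_def)

lemma prod_dfun_simps [simp]:
  "dsrc (prod_dfun F G) = dbl_prod (dsrc F) (dsrc G)" "dtgt (prod_dfun F G) = dbl_prod (dtgt F) (dtgt G)"
  "onob (prod_dfun F G) (x, y) = (onob F x, onob G y)"
  "onhor (prod_dfun F G) (f, g) = (onhor F f, onhor G g)"
  "onver (prod_dfun F G) (v, w) = (onver F v, onver G w)"
  "onsq (prod_dfun F G) (s, t) = (onsq F s, onsq G t)"
  by (simp_all add: prod_dfun_def)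

lemma prod_proj2_simps [simp]:
  "dsrc (prod_proj2 B C) = dbl_prod B C" "dtgt (prod_proj2 B C) = C"
  "onob (prod_proj2 B C) = snd" "onhor (prod_proj2 B C) = snd"
  "onver (prod_proj2 B C) = snd" "onsq (prod_proj2 B C) = snd"
  by (simp_all add: prod_proj2_def)

lemma id_dfun_simps [simp]:
  "dsrc (id_dfun D) = D" "dtgt (id_dfun D) = D" "onob (id_dfun D) x = x"
  "onhor (id_dfun D) f = f" "onver (id_dfun D) v = v" "onsq (id_dfun D) s = s"
  by (simp_all add: id_dfun_def)

lemma dfun_eq_refl: "dfun_eq F F"
  by (simp add: dfun_eq_def)

lemma dfun_eq_sym: "dfun_eq F G \<Longrightarrow> dfun_eq G F"
  by (simp add: dfun_eq_def)

lemma dfun_eq_trans: "\<lbrakk>dfun_eq F G; dfun_eq G H\<rbrakk> \<Longrightarrow> dfun_eq F H"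
  by (simp add: dfun_eq_def)

lemma dfun_eq_comp:
  "\<lbrakk>double_functor F; dfun_eq F F'; dfun_eq G G'; dsrc G = dtgt F\<rbrakk>
    \<Longrightarrow> dfun_eq (comp_dfun G F) (comp_dfun G' F')"
  using double_functorD(3,4,9,14)[of F] by (simp add: dfun_eq_def)

lemma comp_dfun_assoc: "comp_dfun (comp_dfun H G) F = comp_dfun H (comp_dfun G F)"
  by (simp add: comp_dfun_def comp_assoc)

locale agree_fun =
  fixes i :: "('a, 'b, 'c, 'd, 'o, 'h, 'v, 's) dblfun"
  assumes i: "double_functor i"
begin

abbreviation "A \<equiv> dsrc i"
abbreviation "B \<equiv> dtgt i"
abbreviation "p2 \<equiv> prod_proj2 EEsq A"
abbreviation "ii \<equiv> prod_dfun (id_dfun EEsq) i"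

lemmas iD = double_functorD[OF i]

lemma span_copy: "dbl_span i i"
  by unfold_locales (use i in auto)

lemma span_iso: "dbl_span p2 ii"
  by unfold_locales
    (use i double_category_EEsq in
      \<open>auto intro: double_functor_prod_proj2 double_functor_prod_dfun double_functor_id iD(1)\<close>)

sublocale copy: dbl_span i i by (rule span_copy)
sublocale iso: dbl_span p2 ii by (rule span_iso)

abbreviation "inl \<equiv> pushout_inl p2 ii"
abbreviation "inr \<equiv> pushout_inr p2 ii"

lemma isocopy_at_eq: "isocopy_at i x = comp_dfun inr (incl_at EEsq B x)"
  by (simp add: isocopy_at_def)

lemma double_functor_isocopy_at: "x \<in> {0, 1} \<Longrightarrow> double_functor (isocopy_at i x)"
  unfolding isocopy_at_eq
  by (intro double_functor_comp iso.double_functor_inr double_functor_incl_at double_category_EEsq iD(2))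
    (auto simp: EEsq_simps)

text \<open>In the pushout the cylinder over \<open>A\<close> is collapsed onto \<open>A\<close>, so
  the component in \<open>EEsq\<close> no longer matters.\<close>

lemma inr_ii:
  "\<lbrakk>e \<in> Ob EEsq; x \<in> Ob A\<rbrakk> \<Longrightarrow> onob inr (e, onob i x) = onob inl x"
  "\<lbrakk>e' \<in> Hor EEsq; f \<in> Hor A\<rbrakk> \<Longrightarrow> onhor inr (e', onhor i f) = onhor inl f"
  "\<lbrakk>e' \<in> Ver EEsq; v \<in> Ver A\<rbrakk> \<Longrightarrow> onver inr (e', onver i v) = onver inl v"
  "\<lbrakk>q \<in> Sq EEsq; s \<in> Sq A\<rbrakk> \<Longrightarrow> onsq inr (q, onsq i s) = onsq inl s"
  using dfun_eqD(3)[OF iso.pushout_commutes, of "(e, x)"] dfun_eqD(4)[OF iso.pushout_commutes, of "(e', f)"]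
    dfun_eqD(5)[OF iso.pushout_commutes, of "(e', v)"] dfun_eqD(6)[OF iso.pushout_commutes, of "(q, s)"]
  by (simp_all del: iso.inj_simps)

text \<open>The restriction to \<open>A\<close> does not depend on the end \<open>x\<close>. This is
  the compatibility that lets the two inclusions of \<open>B\<close> induce
  \<open>agree i\<close>.\<close>

lemma isocopy_at_i:
  assumes "x \<in> {0, 1}"
  shows "dfun_eq (comp_dfun (isocopy_at i x) i) inl"
proof -
  have *: "x \<in> Ob EEsq" "hid EEsq x \<in> Hor EEsq" "vid EEsq x \<in> Ver EEsq" "sqhid EEsq (vid EEsq x) \<in> Sq EEsq"
    using assms by (auto simp: EEsq_simps)
  show ?thesis
    unfolding isocopy_at_eq dfun_eq_def comp_dfun_simps incl_at_simps
    using inr_ii(1)[OF *(1)] inr_ii(2)[OF *(2)] inr_ii(3)[OF *(3)] inr_ii(4)[OF *(4)]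
    by (simp del: iso.inj_simps(3-6) iso.inj_simps(9-12))
qed

lemma cocone_agree: "dbl_cocone i i (isocopy_at i 0) (isocopy_at i 1)"
proof
  show "double_functor (isocopy_at i 0)" "double_functor (isocopy_at i 1)"
    by (simp_all add: double_functor_isocopy_at)
  show "dsrc (isocopy_at i 0) = B" "dsrc (isocopy_at i 1) = B"
    by (simp_all add: isocopy_at_eq)
  show "dfun_eq (comp_dfun (isocopy_at i 0) i) (comp_dfun (isocopy_at i 1) i)"
    using isocopy_at_i[of 0] isocopy_at_i[of 1] dfun_eq_trans dfun_eq_sym by blast
qed

lemma agree_simps:
  "dsrc (agree i) = pushout i i" "dtgt (agree i) = pushout p2 ii"
  by (simp_all add: agree_def pushout_copair_def isocopy_at_eq)

lemma double_functor_agree: "double_functor (agree i)"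
  unfolding agree_def by (rule dbl_cocone.double_functor_copair[OF cocone_agree])

lemma agree_inl: "dfun_eq (comp_dfun (agree i) (pushout_inl i i)) (isocopy_at i 0)"
  unfolding agree_def by (rule dbl_cocone.copair_inl[OF cocone_agree])

lemma agree_inr: "dfun_eq (comp_dfun (agree i) (pushout_inr i i)) (isocopy_at i 1)"
  unfolding agree_def by (rule dbl_cocone.copair_inr[OF cocone_agree])

text \<open>Dictionary between restrictions of \<open>G\<close> along \<open>agree i\<close> and
  restrictions of its pullback to the cylinder, the form in which \<open>agree_ext\<close> is
  phrased.\<close>

lemma restrict_agree:
  assumes G: "double_functor G" "dsrc G = pushout p2 ii"
  shows "dfun_eq (comp_dfun (comp_dfun G (agree i)) (pushout_inl i i)) (comp_dfun (comp_dfun G inr) (incl_at EEsq B 0))"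
    "dfun_eq (comp_dfun (comp_dfun G (agree i)) (pushout_inr i i)) (comp_dfun (comp_dfun G inr) (incl_at EEsq B 1))"
    "dfun_eq (comp_dfun (comp_dfun G inr) ii) (comp_dfun (comp_dfun G inl) p2)"
    "dfun_eq (comp_dfun (comp_dfun (comp_dfun G inr) (incl_at EEsq B 0)) i) (comp_dfun G inl)"
proof -
  have c: "double_functor (comp_dfun (agree i) (pushout_inl i i))"
    "double_functor (comp_dfun (agree i) (pushout_inr i i))"
    by (intro double_functor_comp copy.double_functor_inl copy.double_functor_inr double_functor_agree;
        simp add: agree_simps)+
  show "dfun_eq (comp_dfun (comp_dfun G (agree i)) (pushout_inl i i)) (comp_dfun (comp_dfun G inr) (incl_at EEsq B 0))"
    "dfun_eq (comp_dfun (comp_dfun G (agree i)) (pushout_inr i i)) (comp_dfun (comp_dfun G inr) (incl_at EEsq B 1))"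
    using dfun_eq_comp[OF c(1) agree_inl dfun_eq_refl, of G] dfun_eq_comp[OF c(2) agree_inr dfun_eq_refl, of G] G
    by (simp_all add: comp_dfun_assoc isocopy_at_eq agree_simps)
  have ii: "double_functor ii" "double_functor p2"
    using iso.F iso.G by auto
  have c': "double_functor (comp_dfun inl p2)"
    using double_functor_comp[OF ii(2) iso.double_functor_inl] by simp
  show "dfun_eq (comp_dfun (comp_dfun G inr) ii) (comp_dfun (comp_dfun G inl) p2)"
    using dfun_eq_sym[OF dfun_eq_comp[OF c' iso.pushout_commutes dfun_eq_refl, of G]] G
    by (simp add: comp_dfun_assoc)
  have "double_functor (comp_dfun (isocopy_at i 0) i)"
    using double_functor_comp[OF i double_functor_isocopy_at[of 0]] by (simp add: isocopy_at_eq)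
  from dfun_eq_comp[OF this isocopy_at_i dfun_eq_refl, of G] G
  show "dfun_eq (comp_dfun (comp_dfun (comp_dfun G inr) (incl_at EEsq B 0)) i) (comp_dfun G inl)"
    by (simp add: comp_dfun_assoc isocopy_at_eq)
qed

text \<open>\<open>H\<close> and \<open>K\<close> glue to a double functor on
  \<open>twocopy i\<close>. Its extension along \<open>agree i\<close> is pulled back to the
  cylinder along the second coprojection of \<open>isocopy i\<close>.\<close>

lemma agree_ext_if_local:
  assumes loc: "local_wrt D (agree i)"
    and H: "double_functor H" "dsrc H = B" "dtgt H = D" and K: "double_functor K" "dsrc K = B"
    and HK: "dfun_eq (comp_dfun H i) (comp_dfun K i)"
  shows "\<exists>\<Phi>. agree_ext i H K \<Phi> \<and> dtgt \<Phi> = D"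
proof -
  interpret c: dbl_cocone i i H K
    by unfold_locales (use assms in auto)
  let ?F = "pushout_copair i i H K"
  have "double_functor ?F" "dsrc ?F = dsrc (agree i)" "dtgt ?F = D"
    using c.double_functor_copair H by (simp_all add: agree_simps)
  then obtain G where "extends_along (agree i) ?F G"
    using loc unfolding local_wrt_def by blast
  then have G: "double_functor G" "dsrc G = pushout p2 ii" "dfun_eq (comp_dfun G (agree i)) ?F"
    by (simp_all add: extends_along_def agree_simps)
  have GD: "dtgt G = D"
    using dfun_eqD(2)[OF G(3)] H by simp
  let ?\<Phi> = "comp_dfun G inr"
  note r = restrict_agree[OF G(1,2)]
  have \<Phi>: "double_functor ?\<Phi>"
    by (rule double_functor_comp[OF iso.double_functor_inr G(1)]) (simp add: G)
  have 1: "dfun_eq (comp_dfun (comp_dfun G (agree i)) (pushout_inl i i)) H"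
    by (rule dfun_eq_trans[OF dfun_eq_comp[OF copy.double_functor_inl dfun_eq_refl G(3)] c.copair_inl])
      (simp add: agree_simps)
  have 2: "dfun_eq (comp_dfun (comp_dfun G (agree i)) (pushout_inr i i)) K"
    by (rule dfun_eq_trans[OF dfun_eq_comp[OF copy.double_functor_inr dfun_eq_refl G(3)] c.copair_inr])
      (simp add: agree_simps)
  have 3: "dfun_eq (comp_dfun ?\<Phi> (incl_at EEsq B 0)) H" "dfun_eq (comp_dfun ?\<Phi> (incl_at EEsq B 1)) K"
    using 1 2 r(1,2) dfun_eq_sym dfun_eq_trans by blast+
  have "dfun_eq (comp_dfun G inl) (comp_dfun H i)"
    by (rule dfun_eq_trans[OF dfun_eq_sym[OF r(4)] dfun_eq_comp[OF i dfun_eq_refl 3(1)]]) simp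
  from dfun_eq_comp[OF _ dfun_eq_refl this, of p2]
  have "dfun_eq (comp_dfun ?\<Phi> ii) (comp_dfun (comp_dfun H i) p2)"
    using r(3) dfun_eq_trans iso.F by auto
  then show ?thesis
    using \<Phi> 3 GD unfolding agree_ext_def by (intro exI[of _ ?\<Phi>]) simp
qed

text \<open>For existence, \<Phi> and the restriction of \<open>H\<close> to \<open>A\<close> glue
  to a double functor on \<open>isocopy i\<close>, compared with the given one on both copies of
  \<open>B\<close>. For uniqueness, an extension is fixed by its values on the cylinder and on
  \<open>A\<close>, and the latter are those of \<open>H\<close>.\<close>

lemma strictly_local_if_agree_ext:
  assumes ex: "\<And>H K. \<lbrakk>double_functor H; dsrc H = B; dtgt H = D; double_functor K; dsrc K = B; dtgt K = D;
      dfun_eq (comp_dfun H i) (comp_dfun K i)\<rbrakk> \<Longrightarrow> \<exists>\<Phi>. agree_ext i H K \<Phi>"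
    and uniq: "\<And>H K \<Phi> \<Phi>'. \<lbrakk>double_functor H; dsrc H = B; dtgt H = D; double_functor K; dsrc K = B; dtgt K = D;
      dfun_eq (comp_dfun H i) (comp_dfun K i); agree_ext i H K \<Phi>; agree_ext i H K \<Phi>'\<rbrakk> \<Longrightarrow> dfun_eq \<Phi> \<Phi>'"
  shows "strictly_local_wrt D (agree i)"
proof (rule strictly_local_wrtI)
  fix F assume F: "double_functor F" "dsrc F = dsrc (agree i)" "dtgt F = D"
  then have Fsrc: "dsrc F = pushout i i" by (simp add: agree_simps)
  let ?H = "comp_dfun F (pushout_inl i i)" and ?K = "comp_dfun F (pushout_inr i i)"
  have HK: "double_functor ?H" "dsrc ?H = B" "dtgt ?H = D" "double_functor ?K" "dsrc ?K = B" "dtgt ?K = D"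
    using F Fsrc by (auto intro!: double_functor_comp copy.double_functor_inl copy.double_functor_inr)
  have "double_functor (comp_dfun (pushout_inl i i) i)"
    by (rule double_functor_comp[OF i copy.double_functor_inl]) simp
  from dfun_eq_comp[OF this copy.pushout_commutes dfun_eq_refl, of F] Fsrc
  have eq: "dfun_eq (comp_dfun ?H i) (comp_dfun ?K i)"
    by (simp add: comp_dfun_assoc)
  note HKe = HK eq
  {
    obtain \<Phi> where "agree_ext i ?H ?K \<Phi>" using ex[OF HKe] by blast
    then have \<Phi>: "double_functor \<Phi>" "dsrc \<Phi> = dbl_prod EEsq B" "dfun_eq (comp_dfun \<Phi> (incl_at EEsq B 0)) ?H"
      "dfun_eq (comp_dfun \<Phi> (incl_at EEsq B 1)) ?K" "dfun_eq (comp_dfun \<Phi> ii) (comp_dfun (comp_dfun ?H i) p2)"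
      unfolding agree_ext_def by blast+
    interpret c: dbl_cocone p2 ii "comp_dfun ?H i" \<Phi>
    proof
      show "double_functor (comp_dfun ?H i)"
        by (rule double_functor_comp[OF i HK(1)]) simp
      show "dfun_eq (comp_dfun (comp_dfun ?H i) p2) (comp_dfun \<Phi> ii)"
        using \<Phi>(5) dfun_eq_sym by blast
    qed (use \<Phi> in simp_all)
    let ?G = "pushout_copair p2 ii (comp_dfun ?H i) \<Phi>"
    have G: "double_functor ?G" "dsrc ?G = pushout p2 ii"
      using c.double_functor_copair by simp_all
    note r = restrict_agree[OF G]
    have at: "dfun_eq (comp_dfun (comp_dfun ?G inr) (incl_at EEsq B e)) (comp_dfun \<Phi> (incl_at EEsq B e))"
      if "e \<in> {0, 1}" for e
      using dfun_eq_comp[OF double_functor_incl_at[OF double_category_EEsq iD(2)] dfun_eq_refl c.copair_inr, of e] that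
      by (auto simp: EEsq_simps)
    have "dfun_eq (comp_dfun (comp_dfun ?G (agree i)) (pushout_inl i i)) ?H"
      "dfun_eq (comp_dfun (comp_dfun ?G (agree i)) (pushout_inr i i)) ?K"
      using dfun_eq_trans[OF dfun_eq_trans[OF r(1) at[of 0]] \<Phi>(3)]
        dfun_eq_trans[OF dfun_eq_trans[OF r(2) at[of 1]] \<Phi>(4)] by simp_all
    then have "dfun_eq (comp_dfun ?G (agree i)) F"
      by (intro copy.pushout_functor_eqI)
        (use F Fsrc G double_functor_comp[OF double_functor_agree G(1)] in \<open>simp_all add: agree_simps\<close>)
    then show "\<exists>G. extends_along (agree i) F G"
      using G by (intro exI[of _ ?G]) (simp add: extends_along_def agree_simps)
  }
  {
    fix G G' assume "extends_along (agree i) F G" "extends_along (agree i) F G'"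
    then have G: "double_functor G" "dsrc G = pushout p2 ii" "dfun_eq (comp_dfun G (agree i)) F"
      and G': "double_functor G'" "dsrc G' = pushout p2 ii" "dfun_eq (comp_dfun G' (agree i)) F"
      by (simp_all add: extends_along_def agree_simps)
    have *: "agree_ext i ?H ?K (comp_dfun G inr) \<and> dfun_eq (comp_dfun G inl) (comp_dfun ?H i)"
      if G: "double_functor G" "dsrc G = pushout p2 ii" "dfun_eq (comp_dfun G (agree i)) F" for G
    proof -
      note r = restrict_agree[OF G(1,2)]
      have "dfun_eq (comp_dfun (comp_dfun G (agree i)) (pushout_inl i i)) ?H"
        "dfun_eq (comp_dfun (comp_dfun G (agree i)) (pushout_inr i i)) ?K"
        by (intro dfun_eq_comp copy.double_functor_inl copy.double_functor_inr dfun_eq_refl G(3);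
            simp add: agree_simps)+
      then have 1: "dfun_eq (comp_dfun (comp_dfun G inr) (incl_at EEsq B 0)) ?H"
        "dfun_eq (comp_dfun (comp_dfun G inr) (incl_at EEsq B 1)) ?K"
        using r(1,2) dfun_eq_trans dfun_eq_sym by blast+
      have 2: "dfun_eq (comp_dfun G inl) (comp_dfun ?H i)"
        by (rule dfun_eq_trans[OF dfun_eq_sym[OF r(4)] dfun_eq_comp[OF i dfun_eq_refl 1(1)]]) simp
      from dfun_eq_comp[OF iso.F dfun_eq_refl this]
      have "dfun_eq (comp_dfun (comp_dfun G inr) ii) (comp_dfun (comp_dfun ?H i) p2)"
        using r(3) dfun_eq_trans by auto
      then show ?thesis
        using 1 2 double_functor_comp[OF iso.double_functor_inr G(1)] G(2)
        by (simp add: agree_ext_def)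
    qed
    from *[OF G] *[OF G'] have "dfun_eq (comp_dfun G inr) (comp_dfun G' inr)"
      using uniq[OF HKe] by blast
    moreover from *[OF G] *[OF G'] have "dfun_eq (comp_dfun G inl) (comp_dfun G' inl)"
      using dfun_eq_trans dfun_eq_sym by blast
    ultimately show "dfun_eq G G'"
      using iso.pushout_functor_eqI[OF G(1,2) G'(1,2)] by blast
  }
qed

end

text \<open>Reflection along the diagonal interchanges the two corners of \<open>[1] \<boxtimes> [1]\<close>.\<close>

definition swap_square where
  "swap_square = \<lparr>dsrc = walking_square, dtgt = transpose walking_square, onob = prod.swap,
     onhor = prod.swap, onver = prod.swap, onsq = prod.swap\<rparr>"

definition swap_EEsq where
  "swap_EEsq = \<lparr>dsrc = EEsq, dtgt = transpose EEsq, onob = (\<lambda>x. x), onhor = (\<lambda>f. f), onver = (\<lambda>v. v),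
     onsq = (\<lambda>(t, l, r, b). (l, t, b, r))\<rparr>"

lemma swap_simps [simp]:
  "dsrc swap_square = walking_square" "dtgt swap_square = transpose walking_square"
  "onob swap_square = prod.swap" "onhor swap_square = prod.swap"
  "onver swap_square = prod.swap" "onsq swap_square = prod.swap"
  "dsrc swap_EEsq = EEsq" "dtgt swap_EEsq = transpose EEsq" "onob swap_EEsq x = x"
  "onhor swap_EEsq f = f" "onver swap_EEsq v = v" "onsq swap_EEsq (t, l, r, b) = (l, t, b, r)"
  by (simp_all add: swap_square_def swap_EEsq_def)

lemma double_functor_swap: "double_functor swap_square" "double_functor swap_EEsq"
  by (rule double_functorI; auto simp: walking_square_simps double_category_walking_square)
    (rule double_functorI; auto simp: EEsq_simps double_category_EEsq)

lemma transpose_dbl_prod: "transpose (dbl_prod B C) = dbl_prod (transpose B) (transpose C)"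
  by (simp add: transpose_def dbl_prod_def)

definition flip where "flip F = comp_dfun (transpose_dfun F) swap_square"
text \<open>The first factor is reflected as well, since transposition exchanges the roles of
  horizontal and vertical isomorphisms in \<open>EEsq\<close>; a square \<open>(t, l, r, b)\<close>
  there becomes \<open>(l, t, b, r)\<close>.\<close>

definition flip_cyl where "flip_cyl \<Phi> = comp_dfun (transpose_dfun \<Phi>) (prod_dfun swap_EEsq swap_square)"

lemma flip_simps [simp]:
  "dsrc (flip F) = walking_square" "dtgt (flip F) = transpose (dtgt F)"
  "onob (flip F) x = onob F (prod.swap x)" "onhor (flip F) f = onver F (prod.swap f)"
  "onver (flip F) v = onhor F (prod.swap v)" "onsq (flip F) s = onsq F (prod.swap s)"
  "dsrc (flip_cyl \<Phi>) = dbl_prod EEsq walking_square" "dtgt (flip_cyl \<Phi>) = transpose (dtgt \<Phi>)"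
  "onob (flip_cyl \<Phi>) (e, x) = onob \<Phi> (e, prod.swap x)"
  "onhor (flip_cyl \<Phi>) (e', f) = onver \<Phi> (e', prod.swap f)"
  "onver (flip_cyl \<Phi>) (e', v) = onhor \<Phi> (e', prod.swap v)"
  "onsq (flip_cyl \<Phi>) (q, s) = onsq \<Phi> (onsq swap_EEsq q, prod.swap s)"
  by (simp_all add: flip_def flip_cyl_def)

lemma flip_flip: "dsrc F = walking_square \<Longrightarrow> flip (flip F) = F"
  by (cases F) (simp add: flip_def comp_dfun_def transpose_dfun_def swap_square_def fun_eq_iff)

lemma flip_cyl_flip_cyl: "dsrc \<Phi> = dbl_prod EEsq walking_square \<Longrightarrow> flip_cyl (flip_cyl \<Phi>) = \<Phi>"
  by (cases \<Phi>) (simp add: flip_cyl_def comp_dfun_def transpose_dfun_def swap_square_def swap_EEsq_def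
      prod_dfun_def fun_eq_iff)

lemma double_functor_flip:
  "\<lbrakk>double_functor F; dsrc F = walking_square\<rbrakk> \<Longrightarrow> double_functor (flip F)"
  unfolding flip_def by (rule double_functor_comp[OF double_functor_swap(1)]) simp_all

lemma double_functor_flip_cyl:
  "\<lbrakk>double_functor \<Phi>; dsrc \<Phi> = dbl_prod EEsq walking_square\<rbrakk> \<Longrightarrow> double_functor (flip_cyl \<Phi>)"
  unfolding flip_cyl_def
  by (rule double_functor_comp[OF double_functor_prod_dfun[OF double_functor_swap(2,1)]])
    (simp_all add: transpose_dbl_prod)

lemma swap_cells [simp]:
  "prod.swap x \<in> Ob walking_square \<longleftrightarrow> x \<in> Ob walking_square"
  "prod.swap f \<in> Ver walking_square \<longleftrightarrow> f \<in> Hor walking_square"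
  "prod.swap v \<in> Hor walking_square \<longleftrightarrow> v \<in> Ver walking_square"
  "prod.swap s \<in> Sq walking_square \<longleftrightarrow> s \<in> Sq walking_square"
  by (cases x, cases f, cases v, cases s, auto simp: walking_square_simps)+

lemma swap_corner_cells:
  assumes X: "\<And>x y. (x, y) \<in> X' \<longleftrightarrow> (y, x) \<in> X"
  shows "x \<in> Ob (full_subdbl walking_square X') \<Longrightarrow> prod.swap x \<in> Ob (full_subdbl walking_square X)"
    "f \<in> Hor (full_subdbl walking_square X') \<Longrightarrow> prod.swap f \<in> Ver (full_subdbl walking_square X)"
    "v \<in> Ver (full_subdbl walking_square X') \<Longrightarrow> prod.swap v \<in> Hor (full_subdbl walking_square X)"
    "s \<in> Sq (full_subdbl walking_square X') \<Longrightarrow> prod.swap s \<in> Sq (full_subdbl walking_square X)"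
  using X by (auto simp: walking_square_simps)

lemma flip_restrict:
  assumes i: "i = (id_dfun walking_square)\<lparr>dsrc := full_subdbl walking_square X\<rparr>"
    and j: "j = (id_dfun walking_square)\<lparr>dsrc := full_subdbl walking_square X'\<rparr>"
    and X: "\<And>x y. (x, y) \<in> X' \<longleftrightarrow> (y, x) \<in> X"
    and HK: "dfun_eq (comp_dfun H i) (comp_dfun K i)"
  shows "dfun_eq (comp_dfun (flip H) j) (comp_dfun (flip K) j)"
  using dfun_eqD[OF HK] swap_corner_cells[OF X] by (simp add: dfun_eq_def i j id_dfun_def)

text \<open>With \<open>X\<close> and \<open>X'\<close> mirror images, cylinders for one corner
  inclusion in a double category become cylinders for the other corner inclusion in its
  transpose.\<close>

lemma flip_agree_ext:
  assumes i: "i = (id_dfun walking_square)\<lparr>dsrc := full_subdbl walking_square X\<rparr>"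
    and j: "j = (id_dfun walking_square)\<lparr>dsrc := full_subdbl walking_square X'\<rparr>"
    and X: "\<And>x y. (x, y) \<in> X' \<longleftrightarrow> (y, x) \<in> X"
    and H: "dsrc H = walking_square" and K: "dsrc K = walking_square" and \<Phi>: "agree_ext i H K \<Phi>"
  shows "agree_ext j (flip H) (flip K) (flip_cyl \<Phi>)"
proof -
  have i': "dsrc i = full_subdbl walking_square X" "dtgt i = walking_square" "onob i x = x" "onhor i f = f"
    "onver i v = v" "onsq i s = s" for x f v s by (simp_all add: i id_dfun_def)
  have j': "dsrc j = full_subdbl walking_square X'" "dtgt j = walking_square" "onob j x = x" "onhor j f = f"
    "onver j v = v" "onsq j s = s" for x f v s by (simp_all add: j id_dfun_def)
  have \<Phi>': "double_functor \<Phi>" "dsrc \<Phi> = dbl_prod EEsq walking_square"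
    and 0: "dfun_eq (comp_dfun \<Phi> (incl_at EEsq walking_square 0)) H"
    and 1: "dfun_eq (comp_dfun \<Phi> (incl_at EEsq walking_square 1)) K"
    and A: "dfun_eq (comp_dfun \<Phi> (prod_dfun (id_dfun EEsq) i)) (comp_dfun (comp_dfun H i) (prod_proj2 EEsq (dsrc i)))"
    using \<Phi> by (simp_all add: agree_ext_def i')
  have "dfun_eq (comp_dfun (flip_cyl \<Phi>) (incl_at EEsq walking_square 0)) (flip H)"
    "dfun_eq (comp_dfun (flip_cyl \<Phi>) (incl_at EEsq walking_square 1)) (flip K)"
    using dfun_eqD[OF 0] dfun_eqD[OF 1] by (simp_all add: dfun_eq_def EEsq_simps)
  moreover have "dfun_eq (comp_dfun (flip_cyl \<Phi>) (prod_dfun (id_dfun EEsq) j))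
      (comp_dfun (comp_dfun (flip H) j) (prod_proj2 EEsq (dsrc j)))"
  proof -
    have q: "onsq swap_EEsq q \<in> Sq EEsq" if "q \<in> Sq EEsq" for q
      using that by (auto simp: EEsq_simps)
    note c = swap_corner_cells[OF X]
    have "onob \<Phi> (e, prod.swap x) = onob H (prod.swap x)"
      if "e \<in> Ob EEsq" "x \<in> Ob (full_subdbl walking_square X')" for e x
      using dfun_eqD(3)[OF A, of "(e, prod.swap x)"] c(1)[OF that(2)] that(1) by (simp add: i')
    moreover have "onver \<Phi> (e, prod.swap f) = onver H (prod.swap f)"
      if "e \<in> Ver EEsq" "f \<in> Hor (full_subdbl walking_square X')" for e f
      using dfun_eqD(5)[OF A, of "(e, prod.swap f)"] c(2)[OF that(2)] that(1) by (simp add: i')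
    moreover have "onhor \<Phi> (e, prod.swap v) = onhor H (prod.swap v)"
      if "e \<in> Hor EEsq" "v \<in> Ver (full_subdbl walking_square X')" for e v
      using dfun_eqD(4)[OF A, of "(e, prod.swap v)"] c(3)[OF that(2)] that(1) by (simp add: i')
    moreover have "onsq \<Phi> (onsq swap_EEsq q', prod.swap s) = onsq H (prod.swap s)"
      if "q' \<in> Sq EEsq" "s \<in> Sq (full_subdbl walking_square X')" for q' s
      using dfun_eqD(6)[OF A, of "(onsq swap_EEsq q', prod.swap s)"] c(4)[OF that(2)] q[OF that(1)]
      by (simp add: i')
    moreover have "Hor EEsq = Ver EEsq" by (simp add: EEsq_simps)
    ultimately show ?thesis
      using dfun_eqD(2)[OF A] by (auto simp: dfun_eq_def j' simp del: full_subdbl_simps)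
  qed
  ultimately show ?thesis
    using \<Phi>' double_functor_flip_cyl by (simp add: agree_ext_def j')
qed

section \<open>Companions\<close>

lemma square_with_transpose [simp]:
  "square_with (transpose D) t l r b s \<longleftrightarrow> square_with D l t b r s"
  by (auto simp: square_with_def)

definition companion :: "('o, 'h, 'v, 's) dblcat \<Rightarrow> 'h \<Rightarrow> 'v \<Rightarrow> bool" where
  "companion D f v \<longleftrightarrow> f \<in> Hor D \<and> v \<in> Ver D \<and> hdom D f = vdom D v \<and> hcod D f = vcod D v \<and>
     (\<exists>s. square_with D f v (vid D (hcod D f)) (hid D (hcod D f)) s) \<and>
     (\<exists>s. square_with D (hid D (hdom D f)) (vid D (hdom D f)) v f s)"

lemma companion_transpose [simp]: "companion (transpose D) v f \<longleftrightarrow> companion D f v"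
  by (auto simp: companion_def)

context double_category begin

abbreviation sq where "sq \<equiv> square_with D"
abbreviation hc (infixr "\<cdot>h" 70) where "g \<cdot>h f \<equiv> hcmp D g f"
abbreviation vc (infixr "\<cdot>v" 70) where "g \<cdot>v f \<equiv> vcmp D g f"

lemma sq_boundary:
  assumes "sq t l r b s"
  shows "t \<in> Hor D" "l \<in> Ver D" "r \<in> Ver D" "b \<in> Hor D"
    "hdom D t = vdom D l" "hcod D t = vdom D r" "hdom D b = vcod D l" "hcod D b = vcod D r"
  using assms by (auto simp: square_with_def cell_simps)

lemma sq_hcmp: "\<lbrakk>sq t l m b s; sq t' m r b' s'\<rbrakk> \<Longrightarrow> sq (t' \<cdot>h t) l r (b' \<cdot>h b) (sqhcmp D s' s)"
  by (auto simp: square_with_def cell_simps)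

lemma sq_vcmp: "\<lbrakk>sq t l r m s; sq m l' r' b s'\<rbrakk> \<Longrightarrow> sq t (l' \<cdot>v l) (r' \<cdot>v r) b (sqvcmp D s' s)"
  by (auto simp: square_with_def cell_simps)

lemma sq_sqhid: "v \<in> Ver D \<Longrightarrow> sq (hid D (vdom D v)) v v (hid D (vcod D v)) (sqhid D v)"
  by (auto simp: square_with_def cell_simps)

lemma sq_sqvid: "f \<in> Hor D \<Longrightarrow> sq f (vid D (hdom D f)) (vid D (hcod D f)) f (sqvid D f)"
  by (auto simp: square_with_def cell_simps)

lemma sq_self: "s \<in> Sq D \<Longrightarrow> sq (stop D s) (slft D s) (srgt D s) (sbot D s) s"
  by (simp add: square_with_def)

lemma companion_hid: "x \<in> Ob D \<Longrightarrow> companion D (hid D x) (vid D x)"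
  using sq_sqhid[of "vid D x"] by (auto simp: companion_def cell_simps)

text \<open>Each of the two squares for the composite is pasted from the corresponding squares for
  \<open>f\<close> and \<open>g\<close> in a staircase, the gap being filled by a unit square on
  \<open>g\<close> or on \<open>f\<close>.\<close>

lemma companion_cmp:
  assumes "companion D f v" "companion D g w" "hcod D f = hdom D g"
  shows "companion D (g \<cdot>h f) (w \<cdot>v v)"
proof -
  let ?A = "hdom D f" and ?B = "hcod D f" and ?C = "hcod D g"
  obtain s t where s: "sq f v (vid D ?B) (hid D ?B) s" and t: "sq (hid D ?A) (vid D ?A) v f t"
    using assms(1) unfolding companion_def by blast
  obtain s' t' where s': "sq g w (vid D ?C) (hid D ?C) s'"
    and t': "sq (hid D (hdom D g)) (vid D (hdom D g)) w g t'"
    using assms(2) unfolding companion_def by blast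
  have fg: "f \<in> Hor D" "g \<in> Hor D" "v \<in> Ver D" "w \<in> Ver D" "?A \<in> Ob D" "?B \<in> Ob D" "?C \<in> Ob D"
    using assms by (auto simp: companion_def cell_simps)
  have 1: "sq (g \<cdot>h f) v (vid D ?C) g (sqhcmp D (sqvid D g) s)"
    using sq_hcmp[OF s, of g "vid D ?C" g "sqvid D g"] sq_sqvid[OF fg(2)] fg assms(3) by (simp add: cell_simps)
  have 2: "sq (hid D (hcod D f) \<cdot>h f) (vid D ?A) w (g \<cdot>h f) (sqhcmp D t' (sqvid D f))"
    using sq_hcmp[OF sq_sqvid[OF fg(1)], of "hid D (hdom D g)" w g] t' fg assms(3) by simp
  have 3: "sq (g \<cdot>h f) (w \<cdot>v v) (vid D ?C) (hid D ?C) (sqvcmp D s' (sqhcmp D (sqvid D g) s))"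
    using sq_vcmp[OF 1 s'] fg by (simp add: cell_simps)
  have 4: "sq (hid D ?A) (vid D ?A) (w \<cdot>v v) (g \<cdot>h f) (sqvcmp D (sqhcmp D t' (sqvid D f)) t)"
    using sq_vcmp[OF t, of "vid D ?A" w "g \<cdot>h f"] 2 fg by (simp add: cell_simps)
  show ?thesis
    using 3 4 assms fg by (auto simp: companion_def cell_simps)
qed

end

locale trunc_dbl = double_category +
  assumes trunc_h: "\<lbrakk>s \<in> Sq D; x \<in> Ob D; y \<in> Ob D; slft D s = vid D x; srgt D s = vid D y\<rbrakk>
      \<Longrightarrow> s = sqvid D (stop D s)"
    and trunc_v: "\<lbrakk>s \<in> Sq D; x \<in> Ob D; y \<in> Ob D; stop D s = hid D x; sbot D s = hid D y\<rbrakk>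
      \<Longrightarrow> s = sqhid D (slft D s)"
begin

lemma trunc_dbl_transpose: "trunc_dbl (transpose D)"
  by (simp add: trunc_dbl_def trunc_dbl_axioms_def double_category_axioms)
    (blast intro: trunc_h trunc_v)

lemma sq_trunc_h: "\<lbrakk>sq t (vid D x) (vid D y) b s; x \<in> Ob D; y \<in> Ob D\<rbrakk> \<Longrightarrow> t = b \<and> s = sqvid D t"
  using trunc_h[of s x y] sbot_sqvid[of t] sq_boundary(1)[of t "vid D x" "vid D y" b s]
  by (auto simp: square_with_def)

lemma sq_trunc_v: "\<lbrakk>sq (hid D x) l r (hid D y) s; x \<in> Ob D; y \<in> Ob D\<rbrakk> \<Longrightarrow> l = r \<and> s = sqhid D l"
  using trunc_v[of s x y] srgt_sqhid[of l] sq_boundary(2)[of "hid D x" l r "hid D y" s]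
  by (auto simp: square_with_def)

text \<open>The two binding equations of a companion come for free: the pasted squares have trivial
  horizontal, respectively vertical, sides and so are units by truncation.\<close>

lemma companion_squares:
  assumes "companion D f v"
  obtains s t where "sq f v (vid D (hcod D f)) (hid D (hcod D f)) s"
    "sq (hid D (hdom D f)) (vid D (hdom D f)) v f t"
    "sqvcmp D s t = sqhid D v" "sqhcmp D s t = sqvid D f"
proof -
  obtain s t where s: "sq f v (vid D (hcod D f)) (hid D (hcod D f)) s"
    and t: "sq (hid D (hdom D f)) (vid D (hdom D f)) v f t"
    using assms unfolding companion_def by blast
  have fv: "f \<in> Hor D" "v \<in> Ver D" "hdom D f = vdom D v" "hcod D f = vcod D v" "vdom D v \<in> Ob D" "vcod D v \<in> Ob D"
    using assms by (auto simp: companion_def cell_simps)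
  have "sq (hid D (hdom D f)) v v (hid D (hcod D f)) (sqvcmp D s t)"
    using sq_vcmp[OF t s] fv by (simp add: cell_simps)
  moreover have "sq f (vid D (hdom D f)) (vid D (hcod D f)) f (sqhcmp D s t)"
    using sq_hcmp[OF t s] fv by (simp add: cell_simps)
  ultimately show thesis
    using that[OF s t] sq_trunc_v sq_trunc_h fv by simp
qed

text \<open>Putting \<open>(id; id; v'; f)\<close> above \<open>(f; v; id; id)\<close> gives a
  square with trivial top and bottom, left side \<open>v\<close> and right side \<open>v'\<close>;
  truncation makes it a unit.\<close>

lemma companion_unique:
  assumes "companion D f v" "companion D f v'"
  shows "v = v'"
proof -
  obtain s where "sq f v (vid D (hcod D f)) (hid D (hcod D f)) s"
    using assms(1) unfolding companion_def by blast
  moreover obtain t where "sq (hid D (hdom D f)) (vid D (hdom D f)) v' f t"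
    using assms(2) unfolding companion_def by blast
  moreover have fv: "f \<in> Hor D" "v \<in> Ver D" "v' \<in> Ver D" "hdom D f = vdom D v" "hcod D f = vcod D v'"
    "hdom D f \<in> Ob D" "hcod D f \<in> Ob D"
    using assms by (auto simp: companion_def cell_simps)
  ultimately show ?thesis
    using sq_vcmp[of "hid D (hdom D f)" "vid D (hdom D f)" v' f t v "vid D (hcod D f)" "hid D (hcod D f)" s]
      sq_trunc_v[of "hdom D f" v v' "hcod D f"] by (simp add: cell_simps)
qed

lemma companion_unique':
  assumes "companion D f v" "companion D f' v"
  shows "f = f'"
  using trunc_dbl.companion_unique[OF trunc_dbl_transpose, of v f f'] assms by simp

text \<open>A square amounts to a square with trivial vertical sides once its sides are bent
  into horizontal morphisms, so it is determined by its boundary.\<close>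

lemma companion_square_bend:
  assumes s: "sq t l r b s" and l: "companion D l' l" and r: "companion D r' r"
  shows "r' \<cdot>h t = b \<cdot>h l'" and "sq t l r b s' \<Longrightarrow> s' = s"
proof -
  note bd = sq_boundary[OF s]
  have lr: "l' \<in> Hor D" "r' \<in> Hor D" "hdom D l' = vdom D l" "hcod D l' = vcod D l"
    "hdom D r' = vdom D r" "hcod D r' = vcod D r"
    using l r by (auto simp: companion_def)
  have ob: "vdom D l \<in> Ob D" "vcod D l \<in> Ob D" "vdom D r \<in> Ob D" "vcod D r \<in> Ob D"
    using bd by (auto simp: cell_simps)
  obtain \<sigma>l \<tau>l where L: "sq l' l (vid D (vcod D l)) (hid D (vcod D l)) \<sigma>l"
    "sq (hid D (vdom D l)) (vid D (vdom D l)) l l' \<tau>l" "sqvcmp D \<sigma>l \<tau>l = sqhid D l"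
    using companion_squares[OF l] lr by metis
  obtain \<sigma>r \<tau>r where R: "sq r' r (vid D (vcod D r)) (hid D (vcod D r)) \<sigma>r"
    "sq (hid D (vdom D r)) (vid D (vdom D r)) r r' \<tau>r" "sqvcmp D \<sigma>r \<tau>r = sqhid D r"
    using companion_squares[OF r] lr by metis
  have bend: "r' \<cdot>h t = b \<cdot>h l' \<and> s = sqvcmp D (sqhcmp D (sqvid D b) \<sigma>l)
      (sqvcmp D (sqvid D (r' \<cdot>h t)) (sqhcmp D \<tau>r (sqvid D t)))" if s: "sq t l r b s" for s
  proof -
    \<comment> \<open>Attaching \<tau>l on the left and \<sigma>r on the right bends both sides
      away: \<open>s2\<close> has vertical identities on both sides and is therefore a unit, which
      yields the equation of tops and bottoms.\<close>
    define s1 where "s1 = sqhcmp D s \<tau>l"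
    define s2 where "s2 = sqhcmp D \<sigma>r s1"
    have s1: "sq t (vid D (vdom D l)) r (b \<cdot>h l') s1"
      unfolding s1_def using sq_hcmp[OF L(2) s] bd lr ob by (simp add: cell_simps)
    have s2: "sq (r' \<cdot>h t) (vid D (vdom D l)) (vid D (vcod D r)) (b \<cdot>h l') s2"
      unfolding s2_def using sq_hcmp[OF s1 R(1)] bd lr ob by (simp add: cell_simps)
    have eq: "r' \<cdot>h t = b \<cdot>h l'" "s2 = sqvid D (r' \<cdot>h t)"
      using sq_trunc_h[OF s2] ob by auto
    \<comment> \<open>Bending is undone by pasting the complementary companion squares: interchange
      brings each pair together and the binding equation turns it into a unit. The resulting formula
      for \<open>s\<close> involves only its boundary and the companion squares.\<close>
    have "sqvcmp D (sqhcmp D (sqvid D b) \<sigma>l) s1 = sqhcmp D (sqvcmp D (sqvid D b) s) (sqvcmp D \<sigma>l \<tau>l)"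
      unfolding s1_def using L s bd
      by (intro interchange) (auto simp: square_with_def cell_simps)
    also have "\<dots> = s"
      using s bd L(3) by (auto simp: square_with_def cell_simps)
    finally have 1: "sqvcmp D (sqhcmp D (sqvid D b) \<sigma>l) s1 = s" .
    have "sqvcmp D s2 (sqhcmp D \<tau>r (sqvid D t)) = sqhcmp D (sqvcmp D \<sigma>r \<tau>r) (sqvcmp D s1 (sqvid D t))"
      unfolding s2_def using R s1 bd
      by (intro interchange) (auto simp: square_with_def cell_simps)
    also have "\<dots> = s1"
      using s1 bd R(3) by (auto simp: square_with_def cell_simps)
    finally show ?thesis
      using eq 1 by simp
  qed
  show "r' \<cdot>h t = b \<cdot>h l'"
    using bend[OF s] by blast
  show "s' = s" if "sq t l r b s'"
    using bend[OF s] bend[OF that] by metis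
qed

text \<open>The square is stacked from \<open>(t; id; r; r' t)\<close> and
  \<open>(b l'; l; id; b)\<close>, obtained by widening a companion square with a unit; the
  hypothesis \<open>eq\<close> makes the two fit.\<close>

lemma companion_square_exists:
  assumes l: "companion D l' l" and r: "companion D r' r"
    and t: "t \<in> Hor D" "hdom D t = vdom D l" "hcod D t = vdom D r"
    and b: "b \<in> Hor D" "hdom D b = vcod D l" "hcod D b = vcod D r"
    and eq: "r' \<cdot>h t = b \<cdot>h l'"
  shows "\<exists>s. sq t l r b s"
proof -
  have lr: "l' \<in> Hor D" "r' \<in> Hor D" "hdom D l' = vdom D l" "hcod D l' = vcod D l"
    "hdom D r' = vdom D r" "hcod D r' = vcod D r" "l \<in> Ver D" "r \<in> Ver D"
    using l r by (auto simp: companion_def)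
  obtain \<sigma> where S: "sq l' l (vid D (vcod D l)) (hid D (vcod D l)) \<sigma>"
    using companion_squares[OF l] lr by metis
  obtain \<tau> where T: "sq (hid D (vdom D r)) (vid D (vdom D r)) r r' \<tau>"
    using companion_squares[OF r] lr by metis
  have "sq t (vid D (vdom D l)) r (r' \<cdot>h t) (sqhcmp D \<tau> (sqvid D t))"
    using sq_hcmp[OF sq_sqvid[OF t(1)], of "hid D (vdom D r)" r r'] T t by (simp add: cell_simps)
  moreover have "sq (b \<cdot>h l') l (vid D (vcod D r)) b (sqhcmp D (sqvid D b) \<sigma>)"
    using sq_hcmp[OF S, of b "vid D (vcod D r)" b "sqvid D b"] sq_sqvid[OF b(1)] b by (simp add: cell_simps)
  ultimately show ?thesis
    using sq_vcmp eq lr by (fastforce simp: cell_simps)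
qed

lemma companion_square_bend_v:
  assumes s: "sq t l r b s" and t: "companion D t t'" and b: "companion D b b'"
  shows "b' \<cdot>v l = r \<cdot>v t'"
  using trunc_dbl.companion_square_bend(1)[OF trunc_dbl_transpose, of l t b r s t' b'] assms by simp

end

locale iso_dbl = trunc_dbl +
  assumes hor_iso_companion: "iso_arrow (hcat D) f \<Longrightarrow> \<exists>v. companion D f v"
    and ver_iso_companion: "iso_arrow (vcat D) v \<Longrightarrow> \<exists>f. companion D f v"
begin

lemma iso_dbl_transpose: "iso_dbl (transpose D)"
  using trunc_dbl_transpose hor_iso_companion ver_iso_companion
  by (simp add: iso_dbl_def iso_dbl_axioms_def)

text \<open>Companions compose and are unique, and the companion of an identity is an identity. So
  the companion of the inverse is inverse to the companion.\<close>

lemma companion_inverse: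
  assumes fv: "companion D f v" and fg: "inverse_arrows (hcat D) f g"
  obtains w where "companion D g w" "inverse_arrows (vcat D) v w"
proof -
  have g: "inverse_arrows (hcat D) g f"
    using fg by (rule horizontal.inverse_arrows_sym)
  then obtain w where w: "companion D g w"
    using hor_iso_companion iso_arrow_def by metis
  have *: "f \<in> Hor D" "g \<in> Hor D" "v \<in> Ver D" "w \<in> Ver D" "hdom D f \<in> Ob D" "hcod D f \<in> Ob D"
    "hdom D f = vdom D v" "hcod D f = vcod D v" "hdom D g = vdom D w" "hcod D g = vcod D w"
    "hdom D g = hcod D f" "hcod D g = hdom D f" "g \<cdot>h f = hid D (hdom D f)" "f \<cdot>h g = hid D (hcod D f)"
    using fv w fg by (auto simp: companion_def inverse_arrows_def cell_simps)
  have "companion D (hid D (hdom D f)) (w \<cdot>v v)" "companion D (hid D (hcod D f)) (v \<cdot>v w)"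
    using companion_cmp[OF fv w] companion_cmp[OF w fv] * by simp_all
  then have "w \<cdot>v v = vid D (hdom D f)" "v \<cdot>v w = vid D (hcod D f)"
    using companion_unique companion_hid * by blast+
  then show thesis
    using that[OF w] * by (simp add: inverse_arrows_def)
qed

lemma companion_iso: "companion D f v \<Longrightarrow> iso_arrow (hcat D) f \<Longrightarrow> iso_arrow (vcat D) v"
  using companion_inverse unfolding iso_arrow_def by metis

lemma companion_iso': "companion D f v \<Longrightarrow> iso_arrow (vcat D) v \<Longrightarrow> iso_arrow (hcat D) f"
  using iso_dbl.companion_iso[OF iso_dbl_transpose, of v f] by simp

definition phi where
  "phi = \<lparr>csrc = iso_cat (hcat D), ctgt = iso_cat (vcat D), cobj = (\<lambda>x. x),
     cmor = (\<lambda>f. THE v. companion D f v)\<rparr>"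

lemma phi_eq: "companion D f v \<Longrightarrow> cmor phi f = v"
  unfolding phi_def using companion_unique by (auto intro: the_equality)

lemma phi_companion: "iso_arrow (hcat D) f \<Longrightarrow> companion D f (cmor phi f)"
  using hor_iso_companion phi_eq by blast

end

lemma iso_cat_simps [simp]:
  "Obj (iso_cat C) = Obj C" "Mor (iso_cat C) = {f. iso_arrow C f}" "Dom (iso_cat C) = Dom C"
  "Cod (iso_cat C) = Cod C" "Idn (iso_cat C) = Idn C" "Cmp (iso_cat C) = Cmp C"
  by (simp_all add: iso_cat_def)

lemma (in category) category_iso_cat: "category (iso_cat C)"
  by unfold_locales
    (auto simp: inv_arrow_facts(1) Dom_in Cod_in iso_Idn Dom_Idn Cod_Idn iso_Cmp Dom_Cmp Cod_Cmp
      Cmp_Idn_right Cmp_Idn_left Cmp_assoc)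

context iso_dbl begin

lemma phi_functor: "cat_functor phi"
proof -
  have sel: "csrc phi = iso_cat (hcat D)" "ctgt phi = iso_cat (vcat D)" "cobj phi = (\<lambda>x. x)"
    by (simp_all add: phi_def)
  show ?thesis
  proof (unfold cat_functor_def cat_functor_axioms_def sel, intro conjI allI impI)
    show "category (iso_cat (hcat D))" "category (iso_cat (vcat D))"
      by (rule horizontal.category_iso_cat vertical.category_iso_cat)+
    fix f assume "f \<in> Mor (iso_cat (hcat D))"
    then have "companion D f (cmor phi f)" "iso_arrow (hcat D) f"
      using phi_companion by simp_all
    then show "cmor phi f \<in> Mor (iso_cat (vcat D))"
      "Dom (iso_cat (vcat D)) (cmor phi f) = Dom (iso_cat (hcat D)) f"
      "Cod (iso_cat (vcat D)) (cmor phi f) = Cod (iso_cat (hcat D)) f"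
      using companion_iso by (simp_all add: companion_def)
  next
    fix x assume "x \<in> Obj (iso_cat (hcat D))"
    then show "cmor phi (Idn (iso_cat (hcat D)) x) = Idn (iso_cat (vcat D)) x"
      by (simp add: phi_eq companion_hid)
  next
    fix f g assume "f \<in> Mor (iso_cat (hcat D))" "g \<in> Mor (iso_cat (hcat D))"
      "Cod (iso_cat (hcat D)) f = Dom (iso_cat (hcat D)) g"
    then show "cmor phi (Cmp (iso_cat (hcat D)) g f) = Cmp (iso_cat (vcat D)) (cmor phi g) (cmor phi f)"
      using companion_cmp[OF phi_companion phi_companion] by (simp add: phi_eq)
  qed auto
qed

lemma phi_bij: "bij_betw (cmor phi) {f. iso_arrow (hcat D) f} {v. iso_arrow (vcat D) v}"
proof (rule bij_betwI')
  show "cmor phi f = cmor phi g \<longleftrightarrow> f = g"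
    if "f \<in> {f. iso_arrow (hcat D) f}" "g \<in> {f. iso_arrow (hcat D) f}" for f g
    using that phi_companion companion_unique' by (metis mem_Collect_eq)
  show "cmor phi f \<in> {v. iso_arrow (vcat D) v}" if "f \<in> {f. iso_arrow (hcat D) f}" for f
    using that phi_companion companion_iso by blast
  show "\<exists>f \<in> {f. iso_arrow (hcat D) f}. v = cmor phi f" if "v \<in> {v. iso_arrow (vcat D) v}" for v
    using that ver_iso_companion companion_iso' phi_eq by blast
qed

text \<open>Two of the four squares are the companion squares. The other two exist because the
  inverse of \<open>cmor phi f\<close> is the companion of the inverse of \<open>f\<close>, so their
  bent boundaries commute.\<close>

lemma phi_shared_iso:
  assumes "iso_arrow (hcat D) f"
  shows "shared_iso D f (cmor phi f)"
proof -
  let ?v = "cmor phi f"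
  have c: "companion D f ?v" by (rule phi_companion[OF assms])
  have fg: "inverse_arrows (hcat D) f (inv_arrow (hcat D) f)"
    by (rule horizontal.inverse_inv_arrow[OF assms])
  from companion_inverse[OF c fg] obtain w where w: "companion D (inv_arrow (hcat D) f) w"
    "inverse_arrows (vcat D) ?v w" .
  have wv: "inv_arrow (vcat D) ?v = w"
    by (rule vertical.inv_arrow_eq[OF w(2)])
  let ?g = "inv_arrow (hcat D) f"
  note i = horizontal.inv_arrow_facts[OF assms, simplified]
  have ob: "hdom D f \<in> Ob D" "hcod D f \<in> Ob D"
    using i by (simp_all add: cell_simps)
  have vd: "?v \<in> Ver D" "vdom D ?v = hdom D f" "vcod D ?v = hcod D f" "w \<in> Ver D" "vdom D w = hcod D f"
    "vcod D w = hdom D f"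
    using c w i by (auto simp: companion_def)
  have "\<exists>s. sq f (vid D (hdom D f)) w (hid D (hdom D f)) s"
    by (rule companion_square_exists[OF companion_hid w(1)]) (use i vd ob in \<open>simp_all add: cell_simps\<close>)
  moreover have "\<exists>s. sq (hid D (hdom D f)) ?v (vid D (hdom D f)) ?g s"
    by (rule companion_square_exists[OF c companion_hid]) (use i vd ob in \<open>simp_all add: cell_simps\<close>)
  ultimately show ?thesis
    using c assms companion_iso[OF c assms] unfolding shared_iso_def companion_def Let_def wv by blast
qed

end

section \<open>CGW categories\<close>

lemma tri_cat_simps [simp]:
  "Obj (tri_cat C) = Mor C"
  "Dom (tri_cat C) (a, b, s, t) = a" "Cod (tri_cat C) (a, b, s, t) = b"
  "Idn (tri_cat C) a = (a, a, Idn C (Dom C a), Idn C (Cod C a))"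
  "Cmp (tri_cat C) (b', c, s', t') (a, b, s, t) = (a, c, Cmp C s' s, Cmp C t' t)"
  by (simp_all add: tri_cat_def)

lemma in_tri_cat [simp]:
  "(a, b, s, t) \<in> Mor (tri_cat C) \<longleftrightarrow> a \<in> Mor C \<and> b \<in> Mor C \<and> iso_arrow C s \<and> t \<in> Mor C
     \<and> Dom C s = Dom C a \<and> Cod C s = Dom C b \<and> Dom C t = Cod C a \<and> Cod C t = Cod C b
     \<and> Cmp C b s = Cmp C t a"
  by (simp add: tri_cat_def)

context category begin

lemma category_tri_cat: "category (tri_cat C)"
proof
  fix m assume m: "m \<in> Mor (tri_cat C)"
  obtain a b s t where [simp]: "m = (a, b, s, t)" by (cases m) auto
  note * = m[simplified] and s = inv_arrow_facts(1)[of s]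
  show "Dom (tri_cat C) m \<in> Obj (tri_cat C)" "Cod (tri_cat C) m \<in> Obj (tri_cat C)"
    using * by simp_all
  show "Cmp (tri_cat C) m (Idn (tri_cat C) (Dom (tri_cat C) m)) = m"
    "Cmp (tri_cat C) (Idn (tri_cat C) (Cod (tri_cat C) m)) m = m"
    using * s Cmp_Idn_right[of s] Cmp_Idn_right[of t] Cmp_Idn_left[of s] Cmp_Idn_left[of t] by simp_all
next
  fix x assume "x \<in> Obj (tri_cat C)"
  then show "Idn (tri_cat C) x \<in> Mor (tri_cat C)" "Dom (tri_cat C) (Idn (tri_cat C) x) = x"
    "Cod (tri_cat C) (Idn (tri_cat C) x) = x"
    by (simp_all add: iso_Idn Dom_in Cod_in Idn_in Dom_Idn Cod_Idn Cmp_Idn_right Cmp_Idn_left)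
next
  fix m n assume m: "m \<in> Mor (tri_cat C)" and n: "n \<in> Mor (tri_cat C)" and eq: "Cod (tri_cat C) m = Dom (tri_cat C) n"
  obtain a b s t where [simp]: "m = (a, b, s, t)" by (cases m) auto
  obtain b' c s' t' where [simp]: "n = (b', c, s', t')" by (cases n) auto
  note * = m[simplified] n[simplified] eq[simplified] and s = inv_arrow_facts(1)[of s] inv_arrow_facts(1)[of s']
  have "Cmp C c (Cmp C s' s) = Cmp C (Cmp C t' t) a"
    using * s by (metis Cmp_assoc)
  then show "Cmp (tri_cat C) n m \<in> Mor (tri_cat C)"
    using * s by (simp add: iso_Cmp Cmp_in Dom_Cmp Cod_Cmp)
  show "Dom (tri_cat C) (Cmp (tri_cat C) n m) = Dom (tri_cat C) m"
    "Cod (tri_cat C) (Cmp (tri_cat C) n m) = Cod (tri_cat C) n"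
    by simp_all
  fix k assume k: "k \<in> Mor (tri_cat C)" and eq': "Cod (tri_cat C) n = Dom (tri_cat C) k"
  obtain c' d s'' t'' where [simp]: "k = (c', d, s'', t'')" by (cases k) auto
  note ** = k[simplified] eq'[simplified] and s'' = inv_arrow_facts(1)[of s'']
  show "Cmp (tri_cat C) k (Cmp (tri_cat C) n m) = Cmp (tri_cat C) (Cmp (tri_cat C) k n) m"
    using * ** s s'' by (simp add: Cmp_assoc)
qed

lemma inverse_tri_cat:
  assumes "inverse_arrows (tri_cat C) (a, b, s, t) (b', a', s', t')"
  shows "b' = b" "a' = a" "inverse_arrows C s s'" "inverse_arrows C t t'"
  using assms inv_arrow_facts(1)[of s] inv_arrow_facts(1)[of s']
  unfolding inverse_arrows_def by auto

text \<open>The component \<open>s\<close> is invertible by the definition of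
  \<open>tri_cat\<close>, so invertibility of \<open>t\<close> suffices; the inverse triangle
  commutes by conjugating the equation of the given one.\<close>

lemma iso_tri_cat:
  assumes m: "(a, b, s, t) \<in> Mor (tri_cat C)" and t: "iso_arrow C t"
  shows "iso_arrow (tri_cat C) (a, b, s, t)"
proof -
  note * = m[simplified]
  note s = inv_arrow_facts[of s] and t' = inv_arrow_facts[OF t]
  have iso: "iso_arrow C s" using * by simp
  note s = inv_arrow_facts[OF iso]
  let ?s = "inv_arrow C s" and ?t = "inv_arrow C t"
  have "Cmp C ?t b = Cmp C ?t (Cmp C b (Cmp C s ?s))"
    using * s Cmp_Idn_right[of b] by simp
  also have "\<dots> = Cmp C ?t (Cmp C (Cmp C b s) ?s)"
    using * s Cmp_assoc[of ?s s b] by simp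
  also have "\<dots> = Cmp C ?t (Cmp C (Cmp C t a) ?s)"
    using * by simp
  also have "\<dots> = Cmp C (Cmp C (Cmp C ?t t) a) ?s"
    using * s t' by (simp add: Cmp_assoc Cmp_in Dom_Cmp Cod_Cmp)
  also have "\<dots> = Cmp C a ?s"
    using * t' Cmp_Idn_left[of a] by simp
  finally have "(b, a, ?s, ?t) \<in> Mor (tri_cat C)"
    using * s t' iso_inv_arrow[OF iso] by simp
  then have "inverse_arrows (tri_cat C) (a, b, s, t) (b, a, ?s, ?t)"
    using m * s t' unfolding inverse_arrows_def by simp
  then show ?thesis unfolding iso_arrow_def by blast
qed

lemma mono_cancel:
  assumes "mono_arrow C m" "f \<in> Mor C" "g \<in> Mor C" "Dom C f = Dom C g" "Cod C f = Dom C m"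
    "Cod C g = Dom C m" "Cmp C m f = Cmp C m g"
  shows "f = g"
  using assms unfolding mono_arrow_def by blast

end

text \<open>The locality conditions of the theorem, spelled out in \<open>D\<close>.\<close>

locale cgw_local = iso_dbl +
  assumes mono_hor: "f \<in> Hor D \<Longrightarrow> mono_arrow (hcat D) f"
    and mono_ver: "v \<in> Ver D \<Longrightarrow> mono_arrow (vcat D) v"
    and fill_tr: "\<lbrakk>f \<in> Hor D; v \<in> Ver D; hcod D f = vdom D v\<rbrakk> \<Longrightarrow> \<exists>s\<in>Sq D. stop D s = f \<and> srgt D s = v"
    and fill_bl: "\<lbrakk>v \<in> Ver D; f \<in> Hor D; vcod D v = hdom D f\<rbrakk> \<Longrightarrow> \<exists>s\<in>Sq D. slft D s = v \<and> sbot D s = f"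
    and agree_tr: "\<lbrakk>s \<in> Sq D; s' \<in> Sq D; stop D s = stop D s'; srgt D s = srgt D s'\<rbrakk> \<Longrightarrow>
      \<exists>w\<in>Sq D. stop D w = sbot D s \<and> sbot D w = sbot D s' \<and> srgt D w = vid D (vcod D (srgt D s))
        \<and> iso_arrow (vcat D) (slft D w) \<and> sqvcmp D w s = s'"
    and agree_bl: "\<lbrakk>s \<in> Sq D; s' \<in> Sq D; slft D s = slft D s'; sbot D s = sbot D s'\<rbrakk> \<Longrightarrow>
      \<exists>w\<in>Sq D. slft D w = srgt D s \<and> srgt D w = srgt D s' \<and> sbot D w = hid D (hcod D (sbot D s))
        \<and> iso_arrow (hcat D) (stop D w) \<and> sqhcmp D w s = s'"
begin

lemma cgw_local_transpose: "cgw_local (transpose D)"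
proof -
  interpret T: iso_dbl "transpose D" by (rule iso_dbl_transpose)
  show ?thesis
  proof (unfold_locales, unfold transpose_simps transpose_cats)
  qed (use mono_hor mono_ver fill_tr fill_bl agree_tr agree_bl in blast)+
qed

text \<open>The comparison square \<open>w\<close> runs from the bottom \<open>b\<close> to itself
  and has trivial right side. Bending its left side gives \<open>u\<close> with
  \<open>b u = b\<close>; since \<open>b\<close> is monic, \<open>u\<close> is an identity, and
  truncation then makes \<open>w\<close> a unit.\<close>

lemma square_eqI:
  assumes "s \<in> Sq D" "s' \<in> Sq D" "stop D s = stop D s'" "srgt D s = srgt D s'" "sbot D s = sbot D s'"
  shows "s = s'"
proof -
  obtain w where w: "w \<in> Sq D" "stop D w = sbot D s" "sbot D w = sbot D s'"
    "srgt D w = vid D (vcod D (srgt D s))" "iso_arrow (vcat D) (slft D w)" "sqvcmp D w s = s'"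
    using agree_tr[OF assms(1-4)] by blast
  let ?b = "sbot D s" and ?u = "slft D w"
  obtain u where u: "companion D u ?u" using ver_iso_companion w by blast
  have ws: "sq ?b ?u (vid D (vcod D (srgt D s))) ?b w"
    using w assms by (simp add: square_with_def)
  note bd = sq_boundary[OF ws]
  have ob: "vcod D (srgt D s) \<in> Ob D" "hdom D ?b \<in> Ob D" "hcod D ?b = vcod D (srgt D s)"
    using assms by (simp_all add: cell_simps)
  have u': "u \<in> Hor D" "hdom D u = hdom D ?b" "hcod D u = hdom D ?b"
    using u bd by (simp_all add: companion_def)
  have "?b \<cdot>h u = ?b \<cdot>h hid D (hdom D ?b)"
    using companion_square_bend(1)[OF ws u companion_hid[OF ob(1)]] bd ob by (simp add: cell_simps)
  then have "u = hid D (hdom D ?b)"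
    using horizontal.mono_cancel[OF mono_hor[OF bd(1)], of u "hid D (hdom D ?b)"] u' ob by (simp add: cell_simps)
  then have "?u = vid D (hdom D ?b)"
    using u companion_unique companion_hid ob by blast
  then have "w = sqvid D ?b"
    using sq_trunc_h[of ?b "hdom D ?b" "vcod D (srgt D s)" ?b w] ws ob by simp
  then show ?thesis
    using w(6) assms by (simp add: cell_simps)
qed

section \<open>The cokernel functor\<close>

definition cokersq where
  "cokersq z f = (SOME s. s \<in> Sq D \<and> slft D s = initial_arrow (vcat D) z (hdom D f) \<and> sbot D s = f)"

definition cokerarr where "cokerarr z f = srgt D (cokersq z f)"

text \<open>The filler is chosen for the left and bottom sides only. Its left side starts at
  \<open>z\<close>, hence so does its top, which is therefore the initial horizontal
  morphism.\<close>

lemma cokersq: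
  assumes z: "initial_obj (hcat D) z" "initial_obj (vcat D) z" and f: "f \<in> Hor D"
  shows "sq (initial_arrow (hcat D) z (vdom D (cokerarr z f))) (initial_arrow (vcat D) z (hdom D f))
    (cokerarr z f) f (cokersq z f)"
proof -
  have hd: "hdom D f \<in> Ob D" using f by (simp add: cell_simps)
  note i = vertical.initial_arrow_facts[OF z(2), simplified, OF hd]
  have *: "cokersq z f \<in> Sq D \<and> slft D (cokersq z f) = initial_arrow (vcat D) z (hdom D f)
      \<and> sbot D (cokersq z f) = f"
    unfolding cokersq_def by (rule someI_ex) (use fill_bl[OF i(1) f] i(3) in blast)
  then have "hdom D (stop D (cokersq z f)) = z" "hcod D (stop D (cokersq z f)) = vdom D (cokerarr z f)"
    using i by (auto simp: cell_simps cokerarr_def)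
  then have "stop D (cokersq z f) = initial_arrow (hcat D) z (vdom D (cokerarr z f))"
    using * horizontal.initial_arrow_unique[OF z(1), of "stop D (cokersq z f)"] by (simp add: cell_simps)
  with * show ?thesis by (simp add: square_with_def cokerarr_def)
qed

text \<open>The comparison square given by \<open>agree_bl\<close> has sides \<open>r\<close> and
  \<open>r'\<close>, trivial bottom and invertible top. Bending the top into its vertical companion
  turns the square into a commutative triangle.\<close>

lemma vertical_triangle_of_squares:
  assumes "sq t l r b s" "sq t' l r' b s'"
  obtains u where "iso_arrow (vcat D) u" "vdom D u = vdom D r" "vcod D u = vdom D r'" "r' \<cdot>v u = r"
proof -
  note bd = sq_boundary[OF assms(1)] sq_boundary[OF assms(2)]
  obtain w where w: "w \<in> Sq D" "slft D w = r" "srgt D w = r'" "sbot D w = hid D (hcod D b)"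
    "iso_arrow (hcat D) (stop D w)"
    using agree_bl[of s s'] assms by (auto simp: square_with_def)
  obtain u where u: "companion D (stop D w) u" using hor_iso_companion w by blast
  have ob: "hcod D b \<in> Ob D" using bd by (simp add: cell_simps)
  have "sq (stop D w) r r' (hid D (hcod D b)) w"
    using w by (simp add: square_with_def)
  from companion_square_bend_v[OF this u companion_hid[OF ob]] have "r' \<cdot>v u = r"
    using bd by (simp add: cell_simps)
  moreover have "hdom D (stop D w) = vdom D r" "hcod D (stop D w) = vdom D r'"
    using w by (auto simp: cell_simps)
  ultimately show thesis
    using that[of u] companion_iso[OF u w(5)] u by (simp add: companion_def)
qed

end

text \<open>The part of \<open>cgw_structure\<close> that concerns \<open>c\<close>, isolated so
  that \<open>k\<close> can be obtained as such a functor for \<open>transpose D\<close>.\<close>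

definition coker_fun where
  "coker_fun D z c \<longleftrightarrow> csrc c = vcat_hor D \<and> ctgt c = tri_cat (vcat D) \<and> cat_equivalence c
    \<and> (\<forall>f \<in> Hor D. vcod D (cobj c f) = hcod D f)
    \<and> (\<forall>q \<in> Sq D. \<forall>a b s t. cmor c q = (a, b, s, t) \<longrightarrow> t = srgt D q)
    \<and> (\<forall>f \<in> Hor D. \<exists>!q. square_with D (initial_arrow (hcat D) z (vdom D (cobj c f)))
             (initial_arrow (vcat D) z (hdom D f)) (cobj c f) f q)"

context cgw_local begin

text \<open>On a square the second component of the image has to be its right side; the first is the
  comparison of two fillers of one corner. Faithfulness is \<open>square_eqI\<close>. For fullness a
  filler is corrected by a comparison square; for essential surjectivity a filler of top and right
  is compared with the chosen filler of its left and bottom.\<close>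

lemma ex_coker_fun:
  assumes z: "initial_obj (hcat D) z" "initial_obj (vcat D) z"
  shows "\<exists>c. coker_fun D z c"
proof -
  let ?c = "cokerarr z"
  note K = cokersq[OF z]
  note Kb = sq_boundary[OF K]
  have K1: "?c f \<in> Ver D" "vcod D (?c f) = hcod D f" "vdom D (?c f) \<in> Ob D" "cokersq z f \<in> Sq D"
    if "f \<in> Hor D" for f
    using Kb(3,8)[OF that] K[OF that] by (simp_all add: cell_simps square_with_def)
  \<comment> \<open>Pasting the chosen filler for the top \<open>f\<close> above \<open>q\<close>
    yields another filler of the corner that defines the cokernel of the bottom \<open>g\<close>:
    its left side is again the initial morphism.\<close>
  have below: "sq (initial_arrow (hcat D) z (vdom D (?c f))) (initial_arrow (vcat D) z (hdom D g))
      (r \<cdot>v ?c f) g (sqvcmp D q (cokersq z f))" if q: "sq f l r g q" for f l r g q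
  proof -
    note bd = sq_boundary[OF q]
    note Kf = K[OF bd(1)] 
    have "vdom D (l \<cdot>v initial_arrow (vcat D) z (hdom D f)) = z"
      "vcod D (l \<cdot>v initial_arrow (vcat D) z (hdom D f)) = hdom D g"
      "l \<cdot>v initial_arrow (vcat D) z (hdom D f) \<in> Ver D"
      using vertical.initial_arrow_facts[OF z(2), of "hdom D f"] bd by (simp_all add: cell_simps)
    then have "l \<cdot>v initial_arrow (vcat D) z (hdom D f) = initial_arrow (vcat D) z (hdom D g)"
      using vertical.initial_arrow_unique[OF z(2), of "l \<cdot>v initial_arrow (vcat D) z (hdom D f)"] by simp
    then show ?thesis using sq_vcmp[OF Kf q] by simp
  qed
  define P where "P q s \<longleftrightarrow> iso_arrow (vcat D) s \<and> vdom D s = vdom D (?c (stop D q))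
      \<and> vcod D s = vdom D (?c (sbot D q)) \<and> ?c (sbot D q) \<cdot>v s = srgt D q \<cdot>v ?c (stop D q)" for q s
  define th where "th q = (SOME s. P q s)" for q
  have P: "P q (th q)" if "q \<in> Sq D" for q
  proof -
    note s = sq_self[OF that]
    note bd = sq_boundary[OF s]
    from vertical_triangle_of_squares[OF below[OF s] K[OF bd(4)]]
    obtain u where "iso_arrow (vcat D) u" "vdom D u = vdom D (srgt D q \<cdot>v ?c (stop D q))"
      "vcod D u = vdom D (?c (sbot D q))" "?c (sbot D q) \<cdot>v u = srgt D q \<cdot>v ?c (stop D q)" .
    then have "P q u"
      using bd K1[OF bd(1)] by (simp add: P_def cell_simps)
    then show ?thesis unfolding th_def by (rule someI)
  qed
  have isoV: "s \<in> Ver D" if "iso_arrow (vcat D) s" for s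
    using vertical.inv_arrow_facts(1)[OF that] by simp
  \<comment> \<open>Monicity of \<open>cokerarr\<close> leaves no freedom in \<open>th\<close>, so
    preservation of identities and composites only needs a candidate satisfying
    \<open>P\<close>.\<close>
  have P_unique: "s = th q" if q: "q \<in> Sq D" and s: "P q s" for q s
  proof -
    note bd = sq_boundary[OF sq_self[OF q]]
    show ?thesis
      using vertical.mono_cancel[OF mono_ver[OF K1(1)[OF bd(4)]], of s "th q"] s P[OF q] isoV
      by (auto simp: P_def)
  qed
  define c where "c = \<lparr>csrc = vcat_hor D, ctgt = tri_cat (vcat D), cobj = ?c,
    cmor = (\<lambda>q. (?c (stop D q), ?c (sbot D q), th q, srgt D q))\<rparr>"
  have sel: "csrc c = vcat_hor D" "ctgt c = tri_cat (vcat D)" "cobj c = ?c"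
    "cmor c q = (?c (stop D q), ?c (sbot D q), th q, srgt D q)" for q
    by (simp_all add: c_def)
  have fun_c: "cat_functor c"
  proof (unfold cat_functor_def cat_functor_axioms_def sel, intro conjI allI impI)
    show "category (vcat_hor D)" by (rule squares_v.category_axioms)
    show "category (tri_cat (vcat D))" by (rule vertical.category_tri_cat)
  next
    fix q assume "q \<in> Mor (vcat_hor D)"
    then have q: "q \<in> Sq D" by simp
    show "(?c (stop D q), ?c (sbot D q), th q, srgt D q) \<in> Mor (tri_cat (vcat D))"
      using P[OF q] q K1 by (simp add: P_def cell_simps)
  next
    fix f assume "f \<in> Obj (vcat_hor D)"
    then have f: "f \<in> Hor D" by simp
    have "vid D (vdom D (?c f)) = th (sqvid D f)"
      using f K1[OF f] vertical.iso_Idn[of "vdom D (?c f)"]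
      by (intro P_unique) (simp_all add: P_def cell_simps)
    then show "(?c (stop D (Idn (vcat_hor D) f)), ?c (sbot D (Idn (vcat_hor D) f)), th (Idn (vcat_hor D) f),
        srgt D (Idn (vcat_hor D) f)) = Idn (tri_cat (vcat D)) (?c f)"
      using f K1[OF f] by (simp add: cell_simps)
  next
    fix p q assume "p \<in> Mor (vcat_hor D)" "q \<in> Mor (vcat_hor D)" "Cod (vcat_hor D) p = Dom (vcat_hor D) q"
    then have pq: "p \<in> Sq D" "q \<in> Sq D" "sbot D p = stop D q" by simp_all
    note bp = sq_boundary[OF sq_self[OF pq(1)]] and bq = sq_boundary[OF sq_self[OF pq(2)]]
    note kp = K1[OF bp(1)] K1[OF bp(4)] K1[OF bq(4)]
    note Pp = P[OF pq(1), unfolded P_def] and Pq = P[OF pq(2), unfolded P_def]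
    have V: "th p \<in> Ver D" "th q \<in> Ver D" using Pp Pq isoV by auto
    have "?c (sbot D q) \<cdot>v (th q \<cdot>v th p) = (?c (sbot D q) \<cdot>v th q) \<cdot>v th p"
      using V Pp Pq kp pq by (intro vcmp_assoc) simp_all
    also have "\<dots> = (srgt D q \<cdot>v ?c (stop D q)) \<cdot>v th p"
      using Pq by simp
    also have "\<dots> = srgt D q \<cdot>v (?c (sbot D p) \<cdot>v th p)"
      unfolding pq(3) using V Pp Pq kp pq bp bq
      by (intro vcmp_assoc[symmetric]) simp_all
    also have "\<dots> = srgt D q \<cdot>v (srgt D p \<cdot>v ?c (stop D p))"
      using Pp by simp
    also have "\<dots> = (srgt D q \<cdot>v srgt D p) \<cdot>v ?c (stop D p)"
      using kp pq bp bq by (intro vcmp_assoc) simp_all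
    finally have "th q \<cdot>v th p = th (sqvcmp D q p)"
      using pq Pp Pq V vertical.iso_Cmp[of "th p" "th q"]
      by (intro P_unique) (simp_all add: P_def cell_simps)
    then show "(?c (stop D (Cmp (vcat_hor D) q p)), ?c (sbot D (Cmp (vcat_hor D) q p)), th (Cmp (vcat_hor D) q p),
        srgt D (Cmp (vcat_hor D) q p)) = Cmp (tri_cat (vcat D)) (?c (stop D q), ?c (sbot D q), th q, srgt D q)
          (?c (stop D p), ?c (sbot D p), th p, srgt D p)"
      using pq by (simp add: cell_simps)
  qed (use K1 in simp_all)
  have "faithful_fun c"
    unfolding faithful_fun_def sel using square_eqI by simp
  moreover have "full_fun c"
    unfolding full_fun_def sel
  proof (intro ballI impI, elim conjE)
    fix f g m assume "f \<in> Obj (vcat_hor D)" "g \<in> Obj (vcat_hor D)" and m: "m \<in> Mor (tri_cat (vcat D))"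
      "Dom (tri_cat (vcat D)) m = ?c f" "Cod (tri_cat (vcat D)) m = ?c g"
    then have f: "f \<in> Hor D" and g: "g \<in> Hor D" by simp_all
    obtain s r where m_eq: "m = (?c f, ?c g, s, r)" using m by (cases m) auto
    note m' = m(1)[unfolded m_eq, simplified]
    have s: "s \<in> Ver D" using m' isoV by blast
    obtain q0 where q0: "q0 \<in> Sq D" "stop D q0 = f" "srgt D q0 = r"
      using fill_tr[of f r] f m' K1[OF f] by auto
    have S0: "sq f (slft D q0) r (sbot D q0) q0"
      using q0 by (simp add: square_with_def)
    note B0 = below[OF S0]
    \<comment> \<open>A square with right side \<open>s\<close> between initial tops is needed above
      the filler of \<open>g\<close>. It exists because \<open>s\<close> has a companion
      \<open>sh\<close>, and \<open>sh\<close> carries one initial morphism to the other.\<close>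
    obtain sh where sh: "companion D sh s" using ver_iso_companion m' by blast
    have ob: "z \<in> Ob D" using horizontal.initial_obj_in[OF z(1)] by simp
    let ?if = "initial_arrow (hcat D) z (vdom D (?c f))" and ?ig = "initial_arrow (hcat D) z (vdom D (?c g))"
    note i = horizontal.initial_arrow_facts[OF z(1), simplified]
    have sh': "sh \<in> Hor D" "hdom D sh = vdom D (?c f)" "hcod D sh = vdom D (?c g)"
      using sh m' by (auto simp: companion_def)
    have "sh \<cdot>h ?if = ?ig"
      using horizontal.initial_arrow_unique[OF z(1), of "sh \<cdot>h ?if"] sh' i[OF K1(3)[OF f]]
      by (simp add: cell_simps)
    then obtain p where p: "sq ?if (vid D z) s ?ig p"
      using companion_square_exists[OF companion_hid[OF ob] sh, of ?if ?ig] i[OF K1(3)[OF f]] i[OF K1(3)[OF g]]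
        m' s ob by (auto simp: cell_simps)
    have iv: "initial_arrow (vcat D) z (hdom D g) \<cdot>v vid D z = initial_arrow (vcat D) z (hdom D g)"
      using vertical.initial_arrow_facts[OF z(2), of "hdom D g"] g by (simp add: cell_simps)
    have G0: "sq ?if (initial_arrow (vcat D) z (hdom D g)) (?c g \<cdot>v s) g (sqvcmp D (cokersq z g) p)"
      using sq_vcmp[OF p K[OF g]] iv by simp
    \<comment> \<open>Both squares have the same top and, as the triangle \<open>m\<close> commutes,
      the same right side. The comparison square replaces the accidental bottom of \<open>q0\<close>
      by \<open>g\<close> and leaves the right side \<open>r\<close> unchanged.\<close>
    obtain w where w: "w \<in> Sq D" "stop D w = sbot D q0" "sbot D w = g" "srgt D w = vid D (vcod D (r \<cdot>v ?c f))"
      using agree_tr[of "sqvcmp D q0 (cokersq z f)" "sqvcmp D (cokersq z g) p"] B0 G0 m'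
      unfolding square_with_def by metis
    let ?q = "sqvcmp D w q0"
    have cr: "vcod D (r \<cdot>v ?c f) = vcod D r"
      using m' K1[OF f] by (simp add: cell_simps)
    have q: "?q \<in> Sq D" "stop D ?q = f" "sbot D ?q = g" "srgt D ?q = r"
      using w q0 m' by (simp_all add: cell_simps cr)
    have "s = th ?q"
      using q m' by (intro P_unique) (simp_all add: P_def)
    then show "\<exists>q\<in>Mor (vcat_hor D). Dom (vcat_hor D) q = f \<and> Cod (vcat_hor D) q = g
        \<and> (?c (stop D q), ?c (sbot D q), th q, srgt D q) = m"
      using q m_eq by (intro bexI[of _ ?q]) simp_all
  qed
  moreover have "ess_surj c"
    unfolding ess_surj_def sel
  proof
    fix g assume "g \<in> Obj (tri_cat (vcat D))"
    then have g: "g \<in> Ver D" "vdom D g \<in> Ob D" "vcod D g \<in> Ob D" by (simp_all add: cell_simps)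
    note i = horizontal.initial_arrow_facts[OF z(1), simplified, OF g(2)]
    obtain q where q: "q \<in> Sq D" "stop D q = initial_arrow (hcat D) z (vdom D g)" "srgt D q = g"
      using fill_tr[OF i(1) g(1)] i by auto
    let ?b = "sbot D q"
    have b: "?b \<in> Hor D" using q by (simp add: cell_simps)
    have "vdom D (slft D q) = z" "vcod D (slft D q) = hdom D ?b"
      using q i corner_tl[OF q(1)] by (simp_all add: cell_simps)
    then have "slft D q = initial_arrow (vcat D) z (hdom D ?b)"
      using vertical.initial_arrow_unique[OF z(2), of "slft D q"] q by (simp add: cell_simps)
    then have S: "sq (stop D q) (initial_arrow (vcat D) z (hdom D ?b)) g ?b q"
      using q by (simp add: square_with_def)
    \<comment> \<open>The filler \<open>q\<close> of the initial top and \<open>g\<close> has the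
      same left and bottom sides as the chosen filler for its bottom, so \<open>g\<close> is
      isomorphic to the cokernel of that bottom.\<close>
    from vertical_triangle_of_squares[OF K[OF b] S] obtain u where u: "iso_arrow (vcat D) u"
      "vdom D u = vdom D (?c ?b)" "vcod D u = vdom D g" "g \<cdot>v u = ?c ?b" .
    have "vcod D (?c ?b) = vcod D g" using K1[OF b] q corner_br by simp
    then have "iso_arrow (tri_cat (vcat D)) (?c ?b, g, u, vid D (vcod D g))"
      using u g K1[OF b] vertical.iso_Idn[of "vcod D g"]
      by (intro vertical.iso_tri_cat) (simp_all add: cell_simps)
    then show "\<exists>x\<in>Obj (vcat_hor D). \<exists>e. iso_arrow (tri_cat (vcat D)) e
        \<and> Dom (tri_cat (vcat D)) e = ?c x \<and> Cod (tri_cat (vcat D)) e = g"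
      using b by (intro bexI[of _ ?b] exI[of _ "(?c ?b, g, u, vid D (vcod D g))"]) simp_all
  qed
  ultimately have "cat_equivalence c"
    using fun_c by (intro cat_equivalenceI)
  moreover have "\<exists>!q. sq (initial_arrow (hcat D) z (vdom D (?c f))) (initial_arrow (vcat D) z (hdom D f)) (?c f) f q"
    if "f \<in> Hor D" for f
    using K[OF that] square_eqI by (auto simp: square_with_def)
  ultimately show ?thesis
    unfolding coker_fun_def using K1 by (intro exI[of _ c]) (simp add: sel)
qed

text \<open>The cokernel functor of \<open>transpose D\<close> is the kernel functor of
  \<open>D\<close>, and \<open>phi\<close> sends an isomorphism to its companion.\<close>

lemma admits_cgw_structure:
  assumes z: "initial_obj (hcat D) z" "initial_obj (vcat D) z"
  shows "admits_cgw_structure D"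
proof -
  obtain c where c: "coker_fun D z c" using ex_coker_fun[OF z] ..
  obtain k where k: "coker_fun (transpose D) z k"
    using cgw_local.ex_coker_fun[OF cgw_local_transpose] z by fastforce
  have "cgw_structure D phi k c z"
  proof (intro cgw_structure.intro cgw_structure_axioms.intro)
    show "double_category D" by (rule double_category_axioms)
    show "bij_betw (cmor phi) (Mor (csrc phi)) (Mor (ctgt phi))"
      using phi_bij by (simp add: phi_def)
    show "\<lbrakk>q \<in> Sq D; cmor k q = (a, b, s, t)\<rbrakk> \<Longrightarrow> t = sbot D q" for q a b s t
      using k unfolding coker_fun_def by simp
    show "\<lbrakk>q \<in> Sq D; cmor c q = (a, b, s, t)\<rbrakk> \<Longrightarrow> t = srgt D q" for q a b s t
      using c unfolding coker_fun_def by simp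
      show "cat_functor phi" "\<And>f. iso_arrow (hcat D) f \<Longrightarrow> shared_iso D f (cmor phi f)"
      by (rule phi_functor, rule phi_shared_iso)
    show "csrc phi = iso_cat (hcat D)" "ctgt phi = iso_cat (vcat D)" "\<And>x. cobj phi x = x"
      by (simp_all add: phi_def)
  qed (use c k z mono_hor mono_ver in \<open>auto simp: coker_fun_def\<close>)
  then show ?thesis
    unfolding admits_cgw_structure_def by blast
qed

end

section \<open>Consequences of the equivalence \<open>c\<close>, applied to \<open>k\<close> in the
  transpose\<close>

locale coker_equivalence = double_category D
  for D :: "('o, 'h, 'v, 's) dblcat" and c :: "('h, 's, 'v, 'v \<times> 'v \<times> 'v \<times> 'v) cfun" +
  assumes mono_ver: "v \<in> Ver D \<Longrightarrow> mono_arrow (vcat D) v"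
    and c_boundary: "csrc c = vcat_hor D" "ctgt c = tri_cat (vcat D)"
    and c_equivalence: "cat_equivalence c"
    and c_cod: "f \<in> Hor D \<Longrightarrow> vcod D (cobj c f) = hcod D f"
    and c_srgt: "\<lbrakk>q \<in> Sq D; cmor c q = (a, b, s, t)\<rbrakk> \<Longrightarrow> t = srgt D q"
begin

lemma c_functor: "cat_functor c"
  using c_equivalence by (simp add: cat_equivalence_def)

lemma c_obj: "f \<in> Hor D \<Longrightarrow> cobj c f \<in> Ver D"
  using cat_functor.cobj_in[OF c_functor] by (simp add: c_boundary)

lemma c_mor:
  assumes "q \<in> Sq D"
  obtains s where "cmor c q = (cobj c (stop D q), cobj c (sbot D q), s, srgt D q)"
    "iso_arrow (vcat D) s" "vdom D s = vdom D (cobj c (stop D q))" "vcod D s = vdom D (cobj c (sbot D q))"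
    "cobj c (sbot D q) \<cdot>v s = srgt D q \<cdot>v cobj c (stop D q)" "s \<in> Ver D"
proof -
  obtain a b s t where m: "cmor c q = (a, b, s, t)" by (cases "cmor c q") auto
  have "(a, b, s, t) \<in> Mor (tri_cat (vcat D))" "a = cobj c (stop D q)" "b = cobj c (sbot D q)" "t = srgt D q"
    using cat_functor.cmor_in[OF c_functor, of q] cat_functor.Dom_cmor[OF c_functor, of q]
      cat_functor.Cod_cmor[OF c_functor, of q] c_srgt[OF assms m] assms m
    by (simp_all add: c_boundary)
  then show thesis
    using that[of s] m vertical.inv_arrow_facts(1)[of s] by simp
qed

lemma square_eqI:
  assumes "p \<in> Sq D" "q \<in> Sq D" "stop D p = stop D q" "srgt D p = srgt D q" "sbot D p = sbot D q"
  shows "p = q"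
proof -
  obtain s where s: "cmor c p = (cobj c (stop D p), cobj c (sbot D p), s, srgt D p)"
    "vdom D s = vdom D (cobj c (stop D p))" "vcod D s = vdom D (cobj c (sbot D p))"
    "cobj c (sbot D p) \<cdot>v s = srgt D p \<cdot>v cobj c (stop D p)" "s \<in> Ver D"
    using c_mor[OF assms(1)] by metis
  obtain s' where s': "cmor c q = (cobj c (stop D q), cobj c (sbot D q), s', srgt D q)"
    "vdom D s' = vdom D (cobj c (stop D q))" "vcod D s' = vdom D (cobj c (sbot D q))"
    "cobj c (sbot D q) \<cdot>v s' = srgt D q \<cdot>v cobj c (stop D q)" "s' \<in> Ver D"
    using c_mor[OF assms(2)] by metis
  have "cobj c (sbot D p) \<in> Ver D" using c_obj assms by (simp add: cell_simps)
  then have "s = s'"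
    using vertical.mono_cancel[OF mono_ver, of "cobj c (sbot D p)" s s'] s s' assms by simp
  then show ?thesis
    using cat_equivalence_imp(1)[OF c_equivalence] s s' assms
    unfolding faithful_fun_def c_boundary by simp
qed

text \<open>\<open>square_eqI\<close> compares top, right and bottom, so the unit is named by the
  right side; that the left side agrees is then a consequence.\<close>

lemma trunc_v: "\<lbrakk>s \<in> Sq D; x \<in> Ob D; y \<in> Ob D; stop D s = hid D x; sbot D s = hid D y\<rbrakk>
      \<Longrightarrow> s = sqhid D (srgt D s)"
  using corner_tr[of s] corner_br[of s] by (intro square_eqI) (simp_all add: cell_simps)

lemma full:
  assumes "f \<in> Hor D" "g \<in> Hor D" "(cobj c f, cobj c g, s, t) \<in> Mor (tri_cat (vcat D))"
  shows "\<exists>q \<in> Sq D. stop D q = f \<and> sbot D q = g \<and> srgt D q = t"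
proof -
  obtain q where "q \<in> Sq D" "stop D q = f" "sbot D q = g" "cmor c q = (cobj c f, cobj c g, s, t)"
    using cat_equivalence_imp(2)[OF c_equivalence] assms unfolding full_fun_def c_boundary by fastforce
  then show ?thesis using c_srgt by metis
qed

text \<open>The images of \<open>p\<close> and \<open>q\<close> under \<open>c\<close> are triangles
  with the same source and the same second component. Inverting the first component of one and
  composing gives a triangle over an identity, which fullness lifts to a square.\<close>

lemma agree_half:
  assumes p: "p \<in> Sq D" and q: "q \<in> Sq D" and eq: "stop D p = stop D q" "srgt D p = srgt D q"
  shows "\<exists>w\<in>Sq D. stop D w = sbot D p \<and> sbot D w = sbot D q \<and> srgt D w = vid D (vcod D (srgt D p))"
proof -
  obtain s where s: "iso_arrow (vcat D) s" "vdom D s = vdom D (cobj c (stop D p))" "vcod D s = vdom D (cobj c (sbot D p))"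
    "cobj c (sbot D p) \<cdot>v s = srgt D p \<cdot>v cobj c (stop D p)" "s \<in> Ver D"
    using c_mor[OF p] by metis
  obtain s' where s': "iso_arrow (vcat D) s'" "vdom D s' = vdom D (cobj c (stop D q))" "vcod D s' = vdom D (cobj c (sbot D q))"
    "cobj c (sbot D q) \<cdot>v s' = srgt D q \<cdot>v cobj c (stop D q)" "s' \<in> Ver D"
    using c_mor[OF q] by metis
  let ?b = "cobj c (sbot D p)" and ?b' = "cobj c (sbot D q)" and ?i = "inv_arrow (vcat D) s"
  have b: "?b \<in> Ver D" "?b' \<in> Ver D" "sbot D p \<in> Hor D" "sbot D q \<in> Hor D"
    "vcod D ?b = vcod D (srgt D p)" "vcod D ?b' = vcod D (srgt D p)" "vcod D (srgt D p) \<in> Ob D"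
    using p q eq c_obj c_cod by (simp_all add: cell_simps)
  note i = vertical.inv_arrow_facts[OF s(1), simplified]
  have "?b' \<cdot>v (s' \<cdot>v ?i) = (?b' \<cdot>v s') \<cdot>v ?i"
    using b i s s' eq by (intro vcmp_assoc) simp_all
  also have "\<dots> = (?b \<cdot>v s) \<cdot>v ?i"
    using s s' eq by simp
  also have "\<dots> = ?b \<cdot>v (s \<cdot>v ?i)"
    using b i s by (intro vcmp_assoc[symmetric]) simp_all
  also have "\<dots> = ?b"
    using b i s by (simp add: cell_simps)
  finally have "(?b, ?b', s' \<cdot>v ?i, vid D (vcod D (srgt D p))) \<in> Mor (tri_cat (vcat D))"
    using b i s s' eq vertical.iso_Cmp[of ?i s'] vertical.iso_inv_arrow[OF s(1)]
    by (simp add: cell_simps)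
  from full[OF b(3,4) this] show ?thesis by blast
qed

text \<open>The comparison squares in the two directions compose to units, since squares are
  determined by top, right and bottom. Reading off left sides shows that these are mutually
  inverse.\<close>

lemma agree_tr:
  assumes p: "p \<in> Sq D" and q: "q \<in> Sq D" and eq: "stop D p = stop D q" "srgt D p = srgt D q"
  shows "\<exists>w\<in>Sq D. stop D w = sbot D p \<and> sbot D w = sbot D q \<and> srgt D w = vid D (vcod D (srgt D p))
    \<and> iso_arrow (vcat D) (slft D w) \<and> sqvcmp D w p = q"
proof -
  obtain w where w: "w \<in> Sq D" "stop D w = sbot D p" "sbot D w = sbot D q" "srgt D w = vid D (vcod D (srgt D p))"
    using agree_half[OF p q eq] by blast
  obtain w' where w': "w' \<in> Sq D" "stop D w' = sbot D q" "sbot D w' = sbot D p" "srgt D w' = vid D (vcod D (srgt D p))"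
    using agree_half[OF q p eq[symmetric]] eq by auto
  have b: "sbot D p \<in> Hor D" "sbot D q \<in> Hor D" "hcod D (sbot D p) = vcod D (srgt D p)"
    "hcod D (sbot D q) = vcod D (srgt D p)" "vcod D (srgt D p) \<in> Ob D" "vcod D (srgt D q) = vcod D (srgt D p)"
    using p q eq by (simp_all add: cell_simps)
  have "sqvcmp D w' w = sqvid D (sbot D p)" "sqvcmp D w w' = sqvid D (sbot D q)"
    using w w' b by (auto intro!: square_eqI simp: cell_simps)
  then have "slft D w' \<cdot>v slft D w = vid D (hdom D (sbot D p))" "slft D w \<cdot>v slft D w' = vid D (hdom D (sbot D q))"
    using w w' b slft_sqvcmp[of w w'] slft_sqvcmp[of w' w] slft_sqvid by simp_all
  moreover have "vdom D (slft D w) = hdom D (sbot D p)" "vcod D (slft D w) = hdom D (sbot D q)"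
    "vdom D (slft D w') = hdom D (sbot D q)" "vcod D (slft D w') = hdom D (sbot D p)"
    using w w' corner_tl[of w] corner_tl[of w'] corner_bl[of w] corner_bl[of w'] by simp_all
  ultimately have "iso_arrow (vcat D) (slft D w)"
    unfolding iso_arrow_def inverse_arrows_def using w w'
    by (intro exI[of _ "slft D w'"]) (simp add: slft_in)
  moreover have "sqvcmp D w p = q"
    using w p q eq by (intro square_eqI) (simp_all add: cell_simps)
  ultimately show ?thesis using w by blast
qed

text \<open>If the image of \<open>f\<close> is followed by \<open>g\<close>, essential surjectivity
  makes the result isomorphic to some \<open>cobj c b\<close>, and fullness produces a square from
  \<open>f\<close> to \<open>b\<close>. The second component of the isomorphism remains on the right
  side.\<close>

lemma fill_tr_up_to_iso:
  assumes f: "f \<in> Hor D" and g: "g \<in> Ver D" and fg: "hcod D f = vdom D g"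
  obtains q u v where "q \<in> Sq D" "stop D q = f" "srgt D q = u \<cdot>v g" "inverse_arrows (vcat D) u v" "vdom D u = vcod D g"
proof -
  let ?v = "g \<cdot>v cobj c f"
  have v: "?v \<in> Ver D" "vdom D ?v = vdom D (cobj c f)" "vcod D ?v = vcod D g" "cobj c f \<in> Ver D"
    "vcod D (cobj c f) = vdom D g"
    using f g fg c_obj c_cod by (simp_all add: cell_simps)
  obtain b e where b: "b \<in> Hor D" and e: "iso_arrow (tri_cat (vcat D)) e" "Dom (tri_cat (vcat D)) e = cobj c b"
    "Cod (tri_cat (vcat D)) e = ?v"
    using cat_equivalence_imp(3)[OF c_equivalence] v unfolding ess_surj_def c_boundary by fastforce
  obtain s u where e_eq: "e = (cobj c b, ?v, s, u)" using e by (cases e) auto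
  obtain b2 v2 s' u' where e': "inverse_arrows (tri_cat (vcat D)) e (b2, v2, s', u')"
    using e(1) unfolding iso_arrow_def by auto
  note t = vertical.inverse_tri_cat[OF e'[unfolded e_eq]]
  \<comment> \<open>The inverse of \<open>e\<close> points from the composite of \<open>g\<close>
    and \<open>cobj c f\<close> to \<open>cobj c b\<close>, so its second component
    \<open>u'\<close> can be absorbed into the right side.\<close>
  have m: "(?v, cobj c b, s', u') \<in> Mor (tri_cat (vcat D))"
    using e' t(1,2) unfolding inverse_arrows_def by metis
  note m' = m[simplified]
  have "u' \<cdot>v ?v = (u' \<cdot>v g) \<cdot>v cobj c f"
    using m' v g by (intro vcmp_assoc) auto
  then have "(cobj c f, cobj c b, s', u' \<cdot>v g) \<in> Mor (tri_cat (vcat D))"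
    using m' v g by (simp add: cell_simps)
  from full[OF f b this] obtain q where "q \<in> Sq D" "stop D q = f" "srgt D q = u' \<cdot>v g" by blast
  moreover have "inverse_arrows (vcat D) u' u"
    using t vertical.inverse_arrows_sym by blast
  ultimately show thesis
    using that m' v by auto
qed

end

lemma (in iso_dbl) fill_tr_from_coker:
  assumes c: "coker_equivalence D c" and f: "f \<in> Hor D" "v \<in> Ver D" "hcod D f = vdom D v"
  shows "\<exists>s\<in>Sq D. stop D s = f \<and> srgt D s = v"
proof -
  interpret c: coker_equivalence D c by fact
  from c.fill_tr_up_to_iso[OF f] obtain q u u' where q: "q \<in> Sq D" "stop D q = f" "srgt D q = u \<cdot>v v"
    and u: "inverse_arrows (vcat D) u u'" "vdom D u = vcod D v" .
  note u' = u(1)[unfolded inverse_arrows_def, simplified]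
  have "iso_arrow (vcat D) u'"
    using u(1) vertical.inverse_arrows_sym iso_arrow_def by metis
  then obtain h where h: "companion D h u'" using ver_iso_companion by blast
  have h': "h \<in> Hor D" "hdom D h = vdom D u'" "hcod D h = vcod D u'"
    using h by (simp_all add: companion_def)
  let ?b = "sbot D q"
  have b: "?b \<in> Hor D" "hcod D ?b = vdom D u'" "hdom D ?b \<in> Ob D"
    using q u u' f by (simp_all add: cell_simps)
  obtain w where w: "sq ?b (vid D (hdom D ?b)) u' (h \<cdot>h ?b) w"
    using companion_square_exists[OF companion_hid[OF b(3)] h, of ?b "h \<cdot>h ?b"] b h' by (auto simp: cell_simps)
  have "srgt D (sqvcmp D w q) = u' \<cdot>v (u \<cdot>v v)"
    using w q by (simp add: square_with_def cell_simps)
  also have "\<dots> = (u' \<cdot>v u) \<cdot>v v"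
    using u u' f by (intro vcmp_assoc) auto
  also have "\<dots> = v"
    using u u' f by (simp add: cell_simps)
  finally show ?thesis
    using w q by (intro bexI[of _ "sqvcmp D w q"]) (simp_all add: square_with_def cell_simps)
qed

lemma cgw_local_if_cgw_structure:
  assumes "cgw_structure D \<phi> k c z"
  shows "cgw_local D"
proof -
  interpret S: cgw_structure D \<phi> k c z by fact
  interpret T: double_category "transpose D"
    by (rule double_category_transpose[OF S.double_category_axioms])
  have c: "coker_equivalence D c"
    using S.M(2) S.c_boundary S.c_equivalence S.C_cod by unfold_locales auto
  have k: "coker_equivalence (transpose D) k"
    using S.M(1) S.k_boundary S.k_equivalence S.K_cod by unfold_locales auto
  interpret c: coker_equivalence D c by (rule c)
  interpret k: coker_equivalence "transpose D" k by (rule k)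
  interpret phi: cat_functor \<phi> by (rule S.phi_functor)
  have trunc: "trunc_dbl D"
  proof
    fix s x y assume s: "s \<in> Sq D" "x \<in> Ob D" "y \<in> Ob D"
    show "s = sqvid D (stop D s)" if "slft D s = vid D x" "srgt D s = vid D y"
    proof -
      have "s = sqvid D (sbot D s)"
        using k.trunc_v[of s x y] s that by simp
      then show ?thesis
        using s S.stop_sqvid[of "sbot D s"] S.sbot_in[OF s(1)] by metis
    qed
    show "s = sqhid D (slft D s)" if "stop D s = hid D x" "sbot D s = hid D y"
    proof -
      have "s = sqhid D (srgt D s)"
        using c.trunc_v[of s x y] s that by simp
      then show ?thesis
        using s S.slft_sqhid[of "srgt D s"] S.srgt_in[OF s(1)] by metis
    qed
  qed
  \<comment> \<open>Two of the four squares of a shared isomorphism are the companion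
    squares.\<close>
  have comp: "companion D f (cmor \<phi> f)" if "iso_arrow (hcat D) f" for f
    using S.I[OF that] S.horizontal.inv_arrow_facts(1)[OF that]
      S.vertical.inv_arrow_facts(1)[of "cmor \<phi> f"]
    unfolding shared_iso_def companion_def Let_def by auto
  have iso: "iso_dbl D"
  proof -
    interpret trunc_dbl D by (rule trunc)
    show ?thesis
    proof
      show "\<exists>v. companion D f v" if "iso_arrow (hcat D) f" for f
        using comp[OF that] by blast
      show "\<exists>f. companion D f v" if "iso_arrow (vcat D) v" for v
      proof -
        \<comment> \<open>Surjectivity of \<phi> on isomorphisms provides companions for all
          vertical isomorphisms.\<close>
        have "v \<in> cmor \<phi> ` {f. iso_arrow (hcat D) f}"
          using S.phi_bij that S.phi_boundary by (simp add: bij_betw_def)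
        then show ?thesis using comp by blast
      qed
    qed
  qed
  interpret iso_dbl D by (rule iso)
  show ?thesis
  proof
    show "\<exists>s\<in>Sq D. stop D s = f \<and> srgt D s = v" if "f \<in> Hor D" "v \<in> Ver D" "hcod D f = vdom D v" for f v
      using fill_tr_from_coker[OF c that] .
    show "\<exists>s\<in>Sq D. slft D s = v \<and> sbot D s = f" if "v \<in> Ver D" "f \<in> Hor D" "vcod D v = hdom D f" for f v
      using iso_dbl.fill_tr_from_coker[OF iso_dbl_transpose k, of v f] that by simp
    show "\<exists>w\<in>Sq D. slft D w = srgt D s \<and> srgt D w = srgt D s' \<and> sbot D w = hid D (hcod D (sbot D s))
        \<and> iso_arrow (hcat D) (stop D w) \<and> sqhcmp D w s = s'"
      if "s \<in> Sq D" "s' \<in> Sq D" "slft D s = slft D s'" "sbot D s = sbot D s'" for s s'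
      using k.agree_tr[of s s'] that by simp
  qed (use S.M c.agree_tr in auto)
qed

section \<open>From locality to cells\<close>

declare One_nat_def [simp del]

lemma (in double_category) sqvcmp_identity:
  assumes "x \<in> Ob D"
  shows "sqvcmp D (sqhid D (vid D x)) (sqhid D (vid D x)) = sqhid D (vid D x)"
  using assms sqvid_hid[OF assms] sqvcmp_sqvid_left[of "sqhid D (vid D x)" "hid D x"]
  by (simp add: cell_simps)

lemma le_1_cases: "(x::nat) \<le> 1 \<longleftrightarrow> x = 0 \<or> x = 1"
  by auto

text \<open>Arguments for cells outside the full double subcategory on \<open>X\<close> are arbitrary.\<close>

definition square_fun where
  "square_fun D X ob t l r b q = \<lparr>dsrc = full_subdbl walking_square X, dtgt = D, onob = ob,
     onhor = (\<lambda>((x, x'), y). if x = x' then hid D (ob (x, y)) else if y = 0 then t else b),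
     onver = (\<lambda>(x, y, y'). if y = y' then vid D (ob (x, y)) else if x = 0 then l else r),
     onsq = (\<lambda>((x, x'), y, y').
        if x = x' then sqhid D (if y = y' then vid D (ob (x, y)) else if x = 0 then l else r)
        else if y = y' then sqvid D (if y = 0 then t else b) else q)\<rparr>"

text \<open>Each hypothesis on an edge is conditional on its ends lying in \<open>X\<close>, so one
  construction serves both corners and, with \<open>X = UNIV\<close>, the whole square.\<close>

lemma double_functor_square_fun:
  assumes "double_category D"
    and "\<And>p. p \<in> X \<Longrightarrow> ob p \<in> Ob D"
    and "\<lbrakk>(0, 0) \<in> X; (1, 0) \<in> X\<rbrakk> \<Longrightarrow> t \<in> Hor D \<and> hdom D t = ob (0, 0) \<and> hcod D t = ob (1, 0)"
    and "\<lbrakk>(0, 1) \<in> X; (1, 1) \<in> X\<rbrakk> \<Longrightarrow> b \<in> Hor D \<and> hdom D b = ob (0, 1) \<and> hcod D b = ob (1, 1)"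
    and "\<lbrakk>(0, 0) \<in> X; (0, 1) \<in> X\<rbrakk> \<Longrightarrow> l \<in> Ver D \<and> vdom D l = ob (0, 0) \<and> vcod D l = ob (0, 1)"
    and "\<lbrakk>(1, 0) \<in> X; (1, 1) \<in> X\<rbrakk> \<Longrightarrow> r \<in> Ver D \<and> vdom D r = ob (1, 0) \<and> vcod D r = ob (1, 1)"
    and "\<lbrakk>(0, 0) \<in> X; (1, 0) \<in> X; (0, 1) \<in> X; (1, 1) \<in> X\<rbrakk> \<Longrightarrow> square_with D t l r b q"
  shows "double_functor (square_fun D X ob t l r b q)"
proof -
  interpret D: double_category D by fact
  have left_unit: "sqvcmp D (sqhid D v) (sqhid D (vid D x)) = sqhid D v" if "v \<in> Ver D" "vdom D v = x" for v x
    using that D.sqhid_vcmp[of "vid D x" v] by (auto simp: D.cell_simps)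
  have right_unit: "sqvcmp D (sqhid D (vid D x)) (sqhid D v) = sqhid D v" if "v \<in> Ver D" "vcod D v = x" for v x
    using that D.sqhid_vcmp[of v "vid D x"] by (auto simp: D.cell_simps)
  show ?thesis
    by (rule double_functorI)
      (use assms(2-) in \<open>auto simp: square_fun_def walking_square_simps le_1_cases square_with_def D.cell_simps
        D.sqvcmp_identity left_unit right_unit D.sqvid_hid
        intro!: double_category_full_subdbl double_category_walking_square assms(1)\<close>)+
qed

lemma full_subdbl_UNIV [simp]: "full_subdbl D UNIV = D"
  by (simp add: full_subdbl_def)

lemma square_fun_simps [simp]:
  "dsrc (square_fun D X ob t l r b q) = full_subdbl walking_square X"
  "dtgt (square_fun D X ob t l r b q) = D"
  "onob (square_fun D X ob t l r b q) = ob"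
  "onhor (square_fun D X ob t l r b q) ((0, 1), 0) = t"
  "onhor (square_fun D X ob t l r b q) ((0, 1), 1) = b"
  "onver (square_fun D X ob t l r b q) (0, 0, 1) = l"
  "onver (square_fun D X ob t l r b q) (1, 0, 1) = r"
  "onsq (square_fun D X ob t l r b q) ((0, 1), 0, 1) = q"
  by (simp_all add: square_fun_def)

context double_category begin

text \<open>\<open>f\<close> and \<open>v\<close> form a double functor on the corner. The filler is
  the value of its extension on the generating square \<open>((0, 1), 0, 1)\<close>.\<close>

lemma fill_tr_if_local:
  assumes "local_wrt D trcor" "f \<in> Hor D" "v \<in> Ver D" "hcod D f = vdom D v"
  shows "\<exists>s\<in>Sq D. stop D s = f \<and> srgt D s = v"
proof -
  define ob :: "nat \<times> nat \<Rightarrow> _" where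
    "ob p = (if p = (0, 0) then hdom D f else if p = (1, 0) then hcod D f else vcod D v)" for p
  let ?F = "square_fun D {(0, 0), (1, 0), (1, 1)} ob f undefined v undefined undefined"
  have "double_functor ?F"
    by (rule double_functor_square_fun[OF double_category_axioms])
      (use assms in \<open>auto simp: ob_def cell_simps\<close>)
  then obtain G where G: "extends_along trcor ?F G"
    using assms(1) unfolding local_wrt_def by fastforce
  have GF: "double_functor G" "dsrc G = walking_square"
    using G by (simp_all add: extends_along_def)
  note e = dfun_eqD[OF conjunct2[OF conjunct2[OF G[unfolded extends_along_def]]]]
  have "onhor G ((0, 1), 0) = f" "onver G (1, 0, 1) = v" "dtgt G = D"
    using e(2) e(4)[of "((0, 1), 0)"] e(5)[of "(1, 0, 1)"] by (simp_all add: walking_square_simps)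
  then show ?thesis
    using double_functorD(14,15,18)[OF GF(1), of "((0, 1), 0, 1)"]
    by (intro bexI[of _ "onsq G ((0, 1), 0, 1)"]) (simp_all add: GF walking_square_simps)
qed

lemma fill_bl_if_local:
  assumes "local_wrt D blcor" "v \<in> Ver D" "f \<in> Hor D" "vcod D v = hdom D f"
  shows "\<exists>s\<in>Sq D. slft D s = v \<and> sbot D s = f"
proof -
  define ob :: "nat \<times> nat \<Rightarrow> _" where
    "ob p = (if p = (0, 0) then vdom D v else if p = (0, 1) then vcod D v else hcod D f)" for p
  let ?F = "square_fun D {(0, 0), (0, 1), (1, 1)} ob undefined v undefined f undefined"
  have "double_functor ?F"
    by (rule double_functor_square_fun[OF double_category_axioms])
      (use assms in \<open>auto simp: ob_def cell_simps\<close>)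
  then obtain G where G: "extends_along blcor ?F G"
    using assms(1) unfolding local_wrt_def by fastforce
  have GF: "double_functor G" "dsrc G = walking_square"
    using G by (simp_all add: extends_along_def)
  note e = dfun_eqD[OF conjunct2[OF conjunct2[OF G[unfolded extends_along_def]]]]
  have "onhor G ((0, 1), 1) = f" "onver G (0, 0, 1) = v" "dtgt G = D"
    using e(2) e(4)[of "((0, 1), 1)"] e(5)[of "(0, 0, 1)"] by (simp_all add: walking_square_simps)
  then show ?thesis
    using double_functorD(14,16,17)[OF GF(1), of "((0, 1), 0, 1)"]
    by (intro bexI[of _ "onsq G ((0, 1), 0, 1)"]) (simp_all add: GF walking_square_simps)
qed

lemma square_fun_of_square:
  assumes "sq t l r b q"
  obtains F where "double_functor F" "dsrc F = walking_square" "dtgt F = D"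
    "onob F (0, 0) = hdom D t" "onob F (1, 0) = hcod D t" "onob F (0, 1) = hdom D b" "onob F (1, 1) = hcod D b"
    "onhor F ((0, 1), 0) = t" "onhor F ((0, 1), 1) = b" "onver F (0, 0, 1) = l" "onver F (1, 0, 1) = r"
    "onsq F ((0, 1), 0, 1) = q"
proof -
  define ob :: "nat \<times> nat \<Rightarrow> _" where
    "ob p = (if p = (0, 0) then hdom D t else if p = (1, 0) then hcod D t
      else if p = (0, 1) then hdom D b else hcod D b)" for p
  note bd = sq_boundary[OF assms]
  have "double_functor (square_fun D UNIV ob t l r b q)"
    by (rule double_functor_square_fun[OF double_category_axioms])
      (use assms bd in \<open>auto simp: ob_def cell_simps\<close>)
  then show thesis
    by (rule that) (simp_all add: ob_def)
qed

text \<open>Units are preserved, so apart from the objects only the nondegenerate edges and the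
  generating square remain to be compared.\<close>

lemma walking_functor_eqI:
  assumes "double_functor F" "double_functor G" "dsrc F = full_subdbl walking_square X"
    "dsrc G = full_subdbl walking_square X" "dtgt F = D" "dtgt G = D"
    and o: "\<And>p. p \<in> X \<Longrightarrow> p \<in> {..1} \<times> {..1} \<Longrightarrow> onob F p = onob G p"
    and "\<lbrakk>(0, 0) \<in> X; (1, 0) \<in> X\<rbrakk> \<Longrightarrow> onhor F ((0, 1), 0) = onhor G ((0, 1), 0)"
    and "\<lbrakk>(0, 1) \<in> X; (1, 1) \<in> X\<rbrakk> \<Longrightarrow> onhor F ((0, 1), 1) = onhor G ((0, 1), 1)"
    and "\<lbrakk>(0, 0) \<in> X; (0, 1) \<in> X\<rbrakk> \<Longrightarrow> onver F (0, 0, 1) = onver G (0, 0, 1)"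
    and "\<lbrakk>(1, 0) \<in> X; (1, 1) \<in> X\<rbrakk> \<Longrightarrow> onver F (1, 0, 1) = onver G (1, 0, 1)"
    and "\<lbrakk>(0, 0) \<in> X; (1, 0) \<in> X; (0, 1) \<in> X; (1, 1) \<in> X\<rbrakk> \<Longrightarrow>
      onsq F ((0, 1), 0, 1) = onsq G ((0, 1), 0, 1)"
  shows "dfun_eq F G"
proof -
  note FD = double_functorD(3-)[OF assms(1), unfolded assms(3,5)]
  note GD = double_functorD(3-)[OF assms(2), unfolded assms(4,6)]
  have ids: "onhor F ((x, x), y) = onhor G ((x, x), y)" "onver F (x, y, y) = onver G (x, y, y)"
    "onob F (x, y) = onob G (x, y)" if "(x, y) \<in> X" "x \<le> 1" "y \<le> 1" for x y
    using that FD(5,10)[of "(x, y)"] GD(5,10)[of "(x, y)"] o by (simp_all add: walking_square_simps)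
  have h: "onhor F f = onhor G f" if "f \<in> Hor (full_subdbl walking_square X)" for f
    using that ids assms(8,9) by (auto simp: walking_square_simps le_1_cases)
  have v: "onver F f = onver G f" if "f \<in> Ver (full_subdbl walking_square X)" for f
    using that ids assms(10,11) by (auto simp: walking_square_simps le_1_cases)
  have hs: "onsq F ((x, x), y, y') = onsq G ((x, x), y, y')"
    if "(x, y) \<in> X" "(x, y') \<in> X" "x \<le> 1" "y \<le> y'" "y' \<le> 1" for x y y'
    using that FD(17)[of "(x, y, y')"] GD(17)[of "(x, y, y')"] v[of "(x, y, y')"]
    by (simp add: walking_square_simps)
  have vs: "onsq F ((x, x'), y, y) = onsq G ((x, x'), y, y)"
    if "(x, y) \<in> X" "(x', y) \<in> X" "y \<le> 1" "x \<le> x'" "x' \<le> 1" for x x' y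
    using that FD(18)[of "((x, x'), y)"] GD(18)[of "((x, x'), y)"] h[of "((x, x'), y)"]
    by (simp add: walking_square_simps)
  have s: "onsq F f = onsq G f" if "f \<in> Sq (full_subdbl walking_square X)" for f
  proof -
    obtain x x' y y' where f: "f = ((x, x'), y, y')" by (metis surj_pair)
    have *: "(x, y) \<in> X" "(x', y) \<in> X" "(x, y') \<in> X" "(x', y') \<in> X" "x \<le> x'" "x' \<le> 1" "y \<le> y'" "y' \<le> 1"
      using that by (simp_all add: f walking_square_simps)
    consider "x = x'" | "y = y'" | "x = 0" "x' = 1" "y = 0" "y' = 1"
      using * by linarith
    then show ?thesis
      by cases (use * hs[of x y y'] vs[of x y x'] assms(12) in \<open>simp_all add: f\<close>)
  qed
  show ?thesis
    unfolding dfun_eq_def assms(3-6) using h v s ids by (auto simp: walking_square_simps)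
qed

text \<open>A pair \<open>f\<close>, \<open>g\<close> equalised by \<open>m\<close> is a functor on
  \<open>parallel_cat\<close>. Its extension gives the two parallel arrows one common value.\<close>

lemma mono_if_local:
  assumes "local_wrt D (HH_fun mono_fun)" "m \<in> Hor D"
  shows "mono_arrow (hcat D) m"
  unfolding mono_arrow_def
proof (intro conjI ballI impI; (elim conjE)?)
  show "m \<in> Mor (hcat D)" using assms by simp
  fix f g assume "f \<in> Mor (hcat D)" "g \<in> Mor (hcat D)" "Dom (hcat D) f = Dom (hcat D) g"
    "Cod (hcat D) f = Dom (hcat D) m" "Cod (hcat D) g = Dom (hcat D) m"
    "Cmp (hcat D) m f = Cmp (hcat D) m g"
  then have fg: "f \<in> Hor D" "g \<in> Hor D" "hdom D g = hdom D f" "hcod D f = hdom D m" "hcod D g = hdom D m"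
    "m \<cdot>h g = m \<cdot>h f" by simp_all
  define ob :: "nat \<Rightarrow> _" where "ob x = (if x = 0 then hdom D f else if x = 1 then hdom D m else hcod D m)" for x
  \<comment> \<open>The Boolean selects \<open>g\<close> for the marked parallel arrow and
    \<open>f\<close> for the other; the arrow from 0 to 2 goes to the common composite.\<close>
  define mo :: "nat \<times> nat \<times> bool \<Rightarrow> _" where
    "mo = (\<lambda>(a, b, p). if a = b then hid D (ob a) else if a = 0 \<and> b = 1 then (if p then g else f)
      else if a = 0 then m \<cdot>h f else m)"
  let ?P = "\<lparr>csrc = parallel_cat, ctgt = hcat D, cobj = ob, cmor = mo\<rparr>"
  have le2: "x \<le> 2 \<longleftrightarrow> x = 0 \<or> x = 1 \<or> x = 2" for x :: nat by auto
  have "cat_functor ?P"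
    unfolding cat_functor_def cat_functor_axioms_def
    using category_parallel_cat horizontal.category_axioms fg assms(2)
    by (auto simp: parallel_cat_def ob_def mo_def le2 cell_simps)
  note F = double_functor_from_HH[OF category_parallel_cat double_category_axioms this]
  let ?F = "\<lparr>dsrc = HH parallel_cat, dtgt = D, onob = ob, onhor = mo,
    onver = (\<lambda>x. vid D (ob x)), onsq = (\<lambda>f. sqvid D (mo f))\<rparr>"
  have "double_functor ?F" using F by simp
  then obtain G where "extends_along (HH_fun mono_fun) ?F G"
    using assms(1) unfolding local_wrt_def by (fastforce simp: HH_fun_def mono_fun_def)
  then have "dfun_eq (comp_dfun G (HH_fun mono_fun)) ?F"
    by (simp add: extends_along_def)
  note e = dfun_eqD(4)[OF this]
  show "f = g"
    using e[of "(0, 1, False)"] e[of "(0, 1, True)"]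
    by (simp add: HH_fun_def mono_fun_def parallel_cat_def mo_def)
qed

text \<open>The square \<open>s\<close> is the image of the globe under a double functor. After
  extension it becomes the image of a unit square of \<open>HH (ordinal 1)\<close>.\<close>

lemma trunc_h_if_local:
  assumes loc: "local_wrt D trunc_h" and s: "s \<in> Sq D" "x \<in> Ob D" "y \<in> Ob D" "slft D s = vid D x" "srgt D s = vid D y"
  shows "s = sqvid D (stop D s)"
proof -
  have bd: "hdom D (stop D s) = x" "hcod D (stop D s) = y" "hdom D (sbot D s) = x" "hcod D (sbot D s) = y"
    using s by (simp_all add: cell_simps)
  define ob :: "nat \<Rightarrow> _" where "ob a = (if a = 0 then x else y)" for a
  define mo :: "nat \<times> nat \<times> bool \<Rightarrow> _" where
    "mo = (\<lambda>(a, b, p). if a = b then hid D (ob a) else if p then sbot D s else stop D s)"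
  \<comment> \<open>The case distinction compares the formal sides in \<open>globe_dbl\<close>, not
    their images, so it remains correct if \<open>s\<close> happens to have equal top and
    bottom.\<close>
  let ?F = "\<lparr>dsrc = globe_dbl, dtgt = D, onob = ob, onhor = mo, onver = (\<lambda>a. vid D (ob a)),
    onsq = (\<lambda>(f, g). if f = g then sqvid D (mo f) else s)\<rparr>"
  have "double_functor ?F"
    by (rule double_functorI)
      (use s bd double_category_globe double_category_axioms in
        \<open>auto simp: globe_dbl_simps globe_cat_def le_1_cases ob_def mo_def cell_simps sqvid_hid
          sqvcmp_identity\<close>)
  then obtain G where "extends_along trunc_h ?F G"
    using loc unfolding local_wrt_def by (fastforce simp: trunc_h_def)
  then have G: "double_functor G" "dsrc G = HH (ordinal 1)" "dfun_eq (comp_dfun G trunc_h) ?F"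
    by (simp_all add: extends_along_def trunc_h_def)
  have "onsq G (0, 1) = s" "dtgt G = D"
    using dfun_eqD(6)[OF G(3), of "((0, 1, False), (0, 1, True))"] dfun_eqD(2)[OF G(3)]
    by (simp_all add: trunc_h_def globe_dbl_simps)
  then have "s = sqvid D (onhor G (0, 1))" "onhor G (0, 1) \<in> Hor D"
    using double_functorD(4,20)[OF G(1), of "(0, 1)"] by (simp_all add: G ordinal_def)
  then show ?thesis
    using stop_sqvid by metis
qed

text \<open>The commutative squares \<open>(e; e; id; id)\<close> and \<open>(id; id; e; e)\<close>
  of \<open>EE\<close> are mapped to the two companion squares.\<close>

lemma EEsq_companion:
  assumes G: "double_functor G" "dsrc G = EEsq" "dtgt G = D" and e: "a \<le> 1" "b \<le> 1"
  shows "companion D (onhor G (a, b)) (onver G (a, b))"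
proof -
  note GD = double_functorD(3-)[OF G(1), unfolded G(2,3)]
  let ?s = "((a, b), (a, b), (b, b), (b, b))" and ?t = "((a, a), (a, a), (a, b), (a, b))"
  have "?s \<in> Sq EEsq" "?t \<in> Sq EEsq" "(a, b) \<in> Hor EEsq" "(a, b) \<in> Ver EEsq" "a \<in> Ob EEsq" "b \<in> Ob EEsq"
    using e by (simp_all add: EEsq_simps)
  moreover have "onhor G (b, b) = hid D (onob G b)" "onhor G (a, a) = hid D (onob G a)"
    "onver G (b, b) = vid D (onob G b)" "onver G (a, a) = vid D (onob G a)"
    using GD(5,10)[of a] GD(5,10)[of b] e by (simp_all add: EEsq_simps)
  ultimately have "sq (onhor G (a, b)) (onver G (a, b)) (vid D (onob G b)) (hid D (onob G b)) (onsq G ?s)"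
    "sq (hid D (onob G a)) (vid D (onob G a)) (onver G (a, b)) (onhor G (a, b)) (onsq G ?t)"
    using GD by (simp_all add: square_with_def EEsq_simps)
  then show ?thesis
    unfolding companion_def using GD(2-4,7-9)[of "(a, b)"] e by (auto simp: EEsq_simps)
qed

lemma iso_functor:
  assumes "inverse_arrows (hcat D) f g"
  obtains F where "double_functor F" "dsrc F = HH EE" "dtgt F = D" "onhor F (0, 1) = f"
proof -
  define ob :: "nat \<Rightarrow> _" where "ob a = (if a = 0 then hdom D f else hcod D f)" for a
  define mo :: "nat \<times> nat \<Rightarrow> _" where "mo = (\<lambda>(a, b). if a = b then hid D (ob a) else if a = 0 then f else g)"
  let ?P = "\<lparr>csrc = EE, ctgt = hcat D, cobj = ob, cmor = mo\<rparr>"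
  have "cat_functor ?P"
    unfolding cat_functor_def cat_functor_axioms_def
    using category_EE horizontal.category_axioms assms unfolding inverse_arrows_def
    by (auto simp: EE_def ob_def mo_def cell_simps)
  from double_functor_from_HH[OF category_EE double_category_axioms this] show thesis
    by (intro that[of "\<lparr>dsrc = HH EE, dtgt = D, onob = ob, onhor = mo, onver = (\<lambda>x. vid D (ob x)),
          onsq = (\<lambda>f. sqvid D (mo f))\<rparr>"]) (simp_all add: mo_def)
qed

lemma hor_iso_companion_if_local:
  assumes "local_wrt D hiso" "iso_arrow (hcat D) f"
  shows "\<exists>v. companion D f v"
proof -
  obtain g where "inverse_arrows (hcat D) f g" using assms by (auto simp: iso_arrow_def)
  from iso_functor[OF this] obtain F where F: "double_functor F" "dsrc F = HH EE" "dtgt F = D" "onhor F (0, 1) = f" .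
  then obtain G where "extends_along hiso F G"
    using assms(1) unfolding local_wrt_def by (fastforce simp: hiso_def)
  then have G: "double_functor G" "dsrc G = EEsq" "dfun_eq (comp_dfun G hiso) F"
    by (simp_all add: extends_along_def hiso_def)
  have "onhor G (0, 1) = f" "dtgt G = D"
    using dfun_eqD(2)[OF G(3)] dfun_eqD(4)[OF G(3), of "(0, 1)"] F by (simp_all add: hiso_def EE_def)
  then show ?thesis
    using EEsq_companion[OF G(1,2), of 0 1] by auto
qed

lemma ver_iso_companion_if_local:
  assumes "local_wrt D viso" "iso_arrow (vcat D) v"
  shows "\<exists>f. companion D f v"
proof -
  interpret T: double_category "transpose D"
    by (rule double_category_transpose[OF double_category_axioms])
  obtain g where "inverse_arrows (hcat (transpose D)) v g" using assms by (auto simp: iso_arrow_def)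
  from T.iso_functor[OF this] obtain F where F: "double_functor F" "dsrc F = HH EE" "dtgt F = transpose D" "onhor F (0, 1) = v" .
  then obtain G where "extends_along viso (transpose_dfun F) G"
    using assms(1) unfolding local_wrt_def by (fastforce simp: viso_def VV_def)
  then have G: "double_functor G" "dsrc G = EEsq" "dfun_eq (comp_dfun G viso) (transpose_dfun F)"
    by (simp_all add: extends_along_def viso_def)
  have "onver G (0, 1) = v" "dtgt G = D"
    using dfun_eqD(2)[OF G(3)] dfun_eqD(5)[OF G(3), of "(0, 1)"] F
    by (simp_all add: viso_def VV_def EE_def)
  then show ?thesis
    using EEsq_companion[OF G(1,2), of 0 1] by auto
qed

text \<open>\<open>s\<close> and \<open>s'\<close> are two double functors on the walking square
  which agree on the corner. The comparison square is the face of the cylinder between them that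
  lies over the bottom edge.\<close>

lemma agree_tr_if_agree_ext:
  assumes ext: "\<And>H K. \<lbrakk>double_functor H; dsrc H = walking_square; dtgt H = D; double_functor K;
      dsrc K = walking_square; dtgt K = D; dfun_eq (comp_dfun H trcor) (comp_dfun K trcor)\<rbrakk>
      \<Longrightarrow> \<exists>\<Phi>. agree_ext trcor H K \<Phi>"
    and s: "s \<in> Sq D" "s' \<in> Sq D" "stop D s = stop D s'" "srgt D s = srgt D s'"
  shows "\<exists>w\<in>Sq D. stop D w = sbot D s \<and> sbot D w = sbot D s' \<and> srgt D w = vid D (vcod D (srgt D s))
        \<and> iso_arrow (vcat D) (slft D w) \<and> sqvcmp D w s = s'"
proof -
  note bd = sq_boundary[OF sq_self[OF s(1)]] and bd' = sq_boundary[OF sq_self[OF s(2)]]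
  obtain H where H: "double_functor H" "dsrc H = walking_square" "dtgt H = D"
    "onob H (0, 0) = hdom D (stop D s)" "onob H (1, 0) = hcod D (stop D s)" "onob H (0, 1) = hdom D (sbot D s)"
    "onob H (1, 1) = hcod D (sbot D s)"
    "onhor H ((0, 1), 0) = stop D s" "onhor H ((0, 1), 1) = sbot D s" "onver H (0, 0, 1) = slft D s"
    "onver H (1, 0, 1) = srgt D s" "onsq H ((0, 1), 0, 1) = s"
    by (rule square_fun_of_square[OF sq_self[OF s(1)]])
  obtain K where K: "double_functor K" "dsrc K = walking_square" "dtgt K = D"
    "onob K (0, 0) = hdom D (stop D s')" "onob K (1, 0) = hcod D (stop D s')" "onob K (0, 1) = hdom D (sbot D s')"
    "onob K (1, 1) = hcod D (sbot D s')"
    "onhor K ((0, 1), 0) = stop D s'" "onhor K ((0, 1), 1) = sbot D s'" "onver K (0, 0, 1) = slft D s'"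
    "onver K (1, 0, 1) = srgt D s'" "onsq K ((0, 1), 0, 1) = s'"
    by (rule square_fun_of_square[OF sq_self[OF s(2)]])
  have comp: "double_functor (comp_dfun H trcor)" "double_functor (comp_dfun K trcor)"
    using H K by (auto intro: double_functor_comp[OF double_functor_corners(1)])
  have "hdom D (stop D s) = hdom D (stop D s') " "hcod D (stop D s) = hcod D (stop D s')" "hcod D (sbot D s) = hcod D (sbot D s')"
    using s bd bd' by metis+
  then have "dfun_eq (comp_dfun H trcor) (comp_dfun K trcor)"
    by (intro walking_functor_eqI[where X = "{(0, 0), (1, 0), (1, 1)}"])
      (use comp s(3,4) in \<open>auto simp: H K\<close>)
  from ext[OF H(1-3) K(1-3) this] obtain \<Phi> where "agree_ext trcor H K \<Phi>" ..
  then have \<Phi>: "double_functor \<Phi>" "dsrc \<Phi> = dbl_prod EEsq walking_square"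
    and \<Phi>0: "dfun_eq (comp_dfun \<Phi> (incl_at EEsq walking_square 0)) H"
    and \<Phi>1: "dfun_eq (comp_dfun \<Phi> (incl_at EEsq walking_square 1)) K"
    and \<Phi>A: "dfun_eq (comp_dfun \<Phi> (prod_dfun (id_dfun EEsq) trcor))
      (comp_dfun (comp_dfun H trcor) (prod_proj2 EEsq (dsrc trcor)))"
    by (simp_all add: agree_ext_def)
  have tgt: "dtgt \<Phi> = D"
    using dfun_eqD(2)[OF \<Phi>0] H(3) by simp
  note PD = double_functorD(3-)[OF \<Phi>(1), unfolded \<Phi>(2) tgt]
  \<comment> \<open>\<open>?E\<close> is the unit square of \<open>EEsq\<close> on the vertical
    morphism from 0 to 1. Paired with the unit on the bottom edge it has the bottoms of
    \<open>s\<close> and \<open>s'\<close> as top and bottom.\<close>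
  let ?E = "((0, 0), (0, 1), (0, 1), (1, 1)) :: (nat \<times> nat) \<times> (nat \<times> nat) \<times> (nat \<times> nat) \<times> (nat \<times> nat)"
  let ?id = "\<lambda>e::nat. ((e, e), (e, e), (e, e), (e, e))"
  let ?w = "onsq \<Phi> (?E, ((0, 1), 1, 1))"
  have E: "?E \<in> Sq EEsq" "?id 0 \<in> Sq EEsq" "?id 1 \<in> Sq EEsq" by (simp_all add: EEsq_simps)
  have w: "?w \<in> Sq D" "stop D ?w = onhor \<Phi> ((0, 0), ((0, 1), 1))" "sbot D ?w = onhor \<Phi> ((1, 1), ((0, 1), 1))"
    "slft D ?w = onver \<Phi> ((0, 1), (0, 1, 1))" "srgt D ?w = onver \<Phi> ((0, 1), (1, 1, 1))"
    using PD(12-16)[of "(?E, ((0, 1), 1, 1))"] E by (simp_all add: EEsq_simps walking_square_simps)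
  have bot: "onhor \<Phi> ((0, 0), ((0, 1), 1)) = sbot D s" "onhor \<Phi> ((1, 1), ((0, 1), 1)) = sbot D s'"
    using dfun_eqD(4)[OF \<Phi>0, of "((0, 1), 1)"] dfun_eqD(4)[OF \<Phi>1, of "((0, 1), 1)"] H K
    by (simp_all add: EEsq_simps walking_square_simps)
  have "onver H (1, 1, 1) = vid D (vcod D (srgt D s))"
    using double_functorD(12)[OF H(1), of "(1, 1)"] H bd by (simp add: walking_square_simps)
  \<comment> \<open>Over the corner the cylinder is constant, so its component at the bottom right
    object is an identity.\<close>
  then have r: "onver \<Phi> ((0, 1), (1, 1, 1)) = vid D (vcod D (srgt D s))"
    using dfun_eqD(5)[OF \<Phi>A, of "((0, 1), (1, 1, 1))"]
    by (simp add: EEsq_simps walking_square_simps)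
  have "inverse_arrows (vcat D) (onver \<Phi> ((0, 1), (0, 1, 1))) (onver \<Phi> ((1, 0), (0, 1, 1)))"
    using PD(7-9)[of "((0, 1), (0, 1, 1))"] PD(7-9)[of "((1, 0), (0, 1, 1))"]
      PD(10)[of "(0, 0, 1)"] PD(10)[of "(1, 0, 1)"]
      PD(11)[of "((0, 1), (0, 1, 1))" "((1, 0), (0, 1, 1))"] PD(11)[of "((1, 0), (0, 1, 1))" "((0, 1), (0, 1, 1))"]
    unfolding inverse_arrows_def by (simp add: EEsq_simps walking_square_simps)
  then have iso: "iso_arrow (vcat D) (slft D ?w)"
    unfolding w(4) iso_arrow_def by blast
  have q0: "onsq \<Phi> (?id 0, ((0, 1), 0, 1)) = s" and q1: "onsq \<Phi> (?id 1, ((0, 1), 0, 1)) = s'"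
    using dfun_eqD(6)[OF \<Phi>0, of "((0, 1), 0, 1)"] dfun_eqD(6)[OF \<Phi>1, of "((0, 1), 0, 1)"] H K
    by (simp_all add: EEsq_simps walking_square_simps)
  have top: "onsq \<Phi> (?E, ((0, 1), 0, 0)) = sqvid D (stop D s)"
    using dfun_eqD(6)[OF \<Phi>A, of "(?E, ((0, 1), 0, 0))"] double_functorD(20)[OF H(1), of "((0, 1), 0)"] H E
    by (simp add: walking_square_simps)
  \<comment> \<open>The cylinder square over the generating square factors in two ways:
    \<open>s\<close> followed by the face over the bottom edge, or the face over the top edge
    followed by \<open>s'\<close>. The top edge lies in the corner, so its face is a unit.\<close>
  have "sqvcmp D ?w s = onsq \<Phi> (?E, ((0, 1), 0, 1))"
    using PD(20)[of "(?id 0, ((0, 1), 0, 1))" "(?E, ((0, 1), 1, 1))"] E q0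
    by (simp add: EEsq_simps walking_square_simps)
  also have "\<dots> = sqvcmp D s' (sqvid D (stop D s))"
    using PD(20)[of "(?E, ((0, 1), 0, 0))" "(?id 1, ((0, 1), 0, 1))"] E q1 top
    by (simp add: EEsq_simps walking_square_simps)
  also have "\<dots> = s'"
    using s by (simp add: cell_simps)
  finally show ?thesis
    using w bot r iso by (intro bexI[of _ ?w]) simp_all
qed

lemma cgw_local_if_local:
  assumes "local_wrt D trcor" "local_wrt D blcor"
    and "local_wrt D (HH_fun mono_fun)" "local_wrt D (VV_fun mono_fun)"
    and "local_wrt D trunc_h" "local_wrt D Defs.trunc_v" "local_wrt D hiso" "local_wrt D viso"
    and "local_wrt D (agree trcor)" "local_wrt D (agree blcor)"
  shows "cgw_local D"
proof -
  interpret T: double_category "transpose D"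
    by (rule double_category_transpose[OF double_category_axioms])
  have T: "local_wrt (transpose D) (HH_fun mono_fun)" "local_wrt (transpose D) trunc_h"
    using assms(4,6) local_wrt_transpose[of "transpose D" "HH_fun mono_fun"]
      local_wrt_transpose[of "transpose D" trunc_h] by (simp_all add: VV_fun_def trunc_v_def)
  have swap_corners: "(x, y) \<in> {(0, 0), (1, 0), (1, 1)} \<longleftrightarrow> (y, x) \<in> {(0, 0), (0, 1), (1, 1)}" for x y :: nat
    by auto
  have "agree_fun trcor" "agree_fun blcor"
    by (simp_all add: agree_fun_def double_functor_corners)
  note ext = agree_fun.agree_ext_if_local[OF this(1) assms(9)] agree_fun.agree_ext_if_local[OF this(2) assms(10)]
  \<comment> \<open>The condition for \<open>blcor\<close> in \<open>D\<close> is reflected into the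
    one for \<open>trcor\<close> in the transpose, so the argument for top and right also yields
    \<open>agree_bl\<close>.\<close>
  have ext_v: "\<exists>\<Phi>. agree_ext trcor H K \<Phi>"
    if H: "double_functor H" "dsrc H = walking_square" "dtgt H = transpose D"
      and K: "double_functor K" "dsrc K = walking_square" "dtgt K = transpose D"
      and HK: "dfun_eq (comp_dfun H trcor) (comp_dfun K trcor)" for H K
  proof -
    have "dfun_eq (comp_dfun (flip H) blcor) (comp_dfun (flip K) blcor)"
      by (rule flip_restrict[OF trcor_def blcor_def _ HK]) (auto simp: swap_corners)
    then obtain \<Phi> where "agree_ext blcor (flip H) (flip K) \<Phi>"
      using ext(2)[of "flip H" "flip K"] double_functor_flip[OF H(1,2)] double_functor_flip[OF K(1,2)] H K by auto
    from flip_agree_ext[OF blcor_def trcor_def swap_corners _ _ this] show ?thesis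
      using flip_flip[OF H(2)] flip_flip[OF K(2)] by auto
  qed
  have agree_bl: "\<exists>w\<in>Sq D. slft D w = srgt D s \<and> srgt D w = srgt D s' \<and> sbot D w = hid D (hcod D (sbot D s))
        \<and> iso_arrow (hcat D) (stop D w) \<and> sqhcmp D w s = s'"
    if "s \<in> Sq D" "s' \<in> Sq D" "slft D s = slft D s'" "sbot D s = sbot D s'" for s s'
  proof -
    have "s \<in> Sq (transpose D)" "s' \<in> Sq (transpose D)" "stop (transpose D) s = stop (transpose D) s'"
      "srgt (transpose D) s = srgt (transpose D) s'" using that by simp_all
    then have "\<exists>w\<in>Sq (transpose D). stop (transpose D) w = sbot (transpose D) s
        \<and> sbot (transpose D) w = sbot (transpose D) s'
        \<and> srgt (transpose D) w = vid (transpose D) (vcod (transpose D) (srgt (transpose D) s))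
        \<and> iso_arrow (vcat (transpose D)) (slft (transpose D) w) \<and> sqvcmp (transpose D) w s = s'"
      by (rule T.agree_tr_if_agree_ext[rotated]) (rule ext_v)
    then show ?thesis by simp
  qed
  have agree_tr: "\<exists>w\<in>Sq D. stop D w = sbot D s \<and> sbot D w = sbot D s' \<and> srgt D w = vid D (vcod D (srgt D s))
        \<and> iso_arrow (vcat D) (slft D w) \<and> sqvcmp D w s = s'"
    if "s \<in> Sq D" "s' \<in> Sq D" "stop D s = stop D s'" "srgt D s = srgt D s'" for s s'
    by (rule agree_tr_if_agree_ext[OF _ that]) (use ext(1) in auto)
  show ?thesis
    by unfold_locales
      (use trunc_h_if_local[OF assms(5)] T.trunc_h_if_local[OF T(2)]
        hor_iso_companion_if_local[OF assms(7)] ver_iso_companion_if_local[OF assms(8)]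
        mono_if_local[OF assms(3)] T.mono_if_local[OF T(1)]
        fill_tr_if_local[OF assms(1)] fill_bl_if_local[OF assms(2)]
        agree_tr agree_bl in simp_all)
qed

end

section \<open>Locality of CGW categories\<close>

locale natural_isos = category C
  for C :: "('o, 'm) cat" +
  fixes A :: "('a, 'b) cat" and F0 F1 :: "('a, 'b, 'o, 'm) cfun" and \<theta> :: "'a \<Rightarrow> 'm"
  assumes F0: "cat_functor F0" "csrc F0 = A" "ctgt F0 = C"
    and F1: "cat_functor F1" "csrc F1 = A" "ctgt F1 = C"
    and theta_iso: "x \<in> Obj A \<Longrightarrow> iso_arrow C (\<theta> x)"
    and theta_dom: "x \<in> Obj A \<Longrightarrow> Dom C (\<theta> x) = cobj F0 x"
    and theta_cod: "x \<in> Obj A \<Longrightarrow> Cod C (\<theta> x) = cobj F1 x"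
    and theta_nat: "f \<in> Mor A \<Longrightarrow> Cmp C (cmor F1 f) (\<theta> (Dom A f)) = Cmp C (\<theta> (Cod A f)) (cmor F0 f)"
begin

definition end_obj where "end_obj e x = (if e = (0::nat) then cobj F0 x else cobj F1 x)"
definition end_mor where "end_mor e f = (if e = (0::nat) then cmor F0 f else cmor F1 f)"
text \<open>Only the ends 0 and 1 matter: the last case is the passage from 1 back to 0.\<close>

definition trans where
  "trans e e' x = (if e = e' then Idn C (end_obj e x) else if e = 0 then \<theta> x else inv_arrow C (\<theta> x))"

lemmas F0_rules = cat_functor.cobj_in[OF F0(1), unfolded F0] cat_functor.cmor_in[OF F0(1), unfolded F0]
  cat_functor.Dom_cmor[OF F0(1), unfolded F0] cat_functor.Cod_cmor[OF F0(1), unfolded F0]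
  cat_functor.cmor_Idn[OF F0(1), unfolded F0] cat_functor.cmor_Cmp[OF F0(1), unfolded F0]
lemmas F1_rules = cat_functor.cobj_in[OF F1(1), unfolded F1] cat_functor.cmor_in[OF F1(1), unfolded F1]
  cat_functor.Dom_cmor[OF F1(1), unfolded F1] cat_functor.Cod_cmor[OF F1(1), unfolded F1]
  cat_functor.cmor_Idn[OF F1(1), unfolded F1] cat_functor.cmor_Cmp[OF F1(1), unfolded F1]

sublocale A: category A
  using F0 by (simp add: cat_functor_def)

lemma end_rules:
  "x \<in> Obj A \<Longrightarrow> end_obj e x \<in> Obj C"
  "f \<in> Mor A \<Longrightarrow> end_mor e f \<in> Mor C"
  "f \<in> Mor A \<Longrightarrow> Dom C (end_mor e f) = end_obj e (Dom A f)"
  "f \<in> Mor A \<Longrightarrow> Cod C (end_mor e f) = end_obj e (Cod A f)"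
  "x \<in> Obj A \<Longrightarrow> end_mor e (Idn A x) = Idn C (end_obj e x)"
  "\<lbrakk>f \<in> Mor A; g \<in> Mor A; Cod A f = Dom A g\<rbrakk>
    \<Longrightarrow> end_mor e (Cmp A g f) = Cmp C (end_mor e g) (end_mor e f)"
  by (simp_all add: end_obj_def end_mor_def F0_rules F1_rules)

lemma trans_rules:
  assumes "x \<in> Obj A" "e \<le> 1" "e' \<le> 1"
  shows "trans e e' x \<in> Mor C" "Dom C (trans e e' x) = end_obj e x" "Cod C (trans e e' x) = end_obj e' x"
    "trans e e x = Idn C (end_obj e x)"
    "e'' \<le> 1 \<Longrightarrow> Cmp C (trans e' e'' x) (trans e e' x) = trans e e'' x"
    "iso_arrow C (trans e e' x)"
proof -
  let ?t = "\<theta> x" and ?a = "cobj F0 x" and ?b = "cobj F1 x"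
  let ?i = "inv_arrow C ?t"
  note i = inv_arrow_facts[OF theta_iso[OF assms(1)]] theta_iso[OF assms(1)] theta_dom[OF assms(1)]
    theta_cod[OF assms(1)] iso_inv_arrow[OF theta_iso[OF assms(1)]]
  have ob: "?a \<in> Obj C" "?b \<in> Obj C"
    using assms F0_rules(1) F1_rules(1) by auto
  note id = Idn_in[OF ob(1)] Idn_in[OF ob(2)] Dom_Idn[OF ob(1)] Dom_Idn[OF ob(2)] Cod_Idn[OF ob(1)]
    Cod_Idn[OF ob(2)] iso_Idn[OF ob(1)] iso_Idn[OF ob(2)]
  have units: "Cmp C ?t (Idn C ?a) = ?t" "Cmp C (Idn C ?b) ?t = ?t" "Cmp C ?i (Idn C ?b) = ?i"
    "Cmp C (Idn C ?a) ?i = ?i" "Cmp C (Idn C ?a) (Idn C ?a) = Idn C ?a" "Cmp C (Idn C ?b) (Idn C ?b) = Idn C ?b"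
    using Cmp_Idn_right[of ?t] Cmp_Idn_left[of ?t] Cmp_Idn_right[of ?i] Cmp_Idn_left[of ?i]
      Cmp_Idn_right[of "Idn C ?a"] Cmp_Idn_right[of "Idn C ?b"] i id by simp_all
  show "trans e e' x \<in> Mor C" "Dom C (trans e e' x) = end_obj e x" "Cod C (trans e e' x) = end_obj e' x"
    "trans e e x = Idn C (end_obj e x)" "iso_arrow C (trans e e' x)"
    using assms(2,3) i id by (auto simp: trans_def end_obj_def le_1_cases)
  show "Cmp C (trans e' e'' x) (trans e e' x) = trans e e'' x" if "e'' \<le> 1"
    using assms(2,3) that i id units by (auto simp: trans_def end_obj_def le_1_cases)
qed

lemma trans_nat:
  assumes f: "f \<in> Mor A" "e \<le> 1" "e' \<le> 1"
  shows "Cmp C (end_mor e' f) (trans e e' (Dom A f)) = Cmp C (trans e e' (Cod A f)) (end_mor e f)"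
proof -
  have x: "Dom A f \<in> Obj A" "Cod A f \<in> Obj A" using f A.Dom_in A.Cod_in by auto
  let ?i = "inv_arrow C (\<theta> (Dom A f))" and ?j = "inv_arrow C (\<theta> (Cod A f))"
  note i = inv_arrow_facts[OF theta_iso[OF x(1)]] and j = inv_arrow_facts[OF theta_iso[OF x(2)]]
  note m = F0_rules(2-4)[OF f(1)] F1_rules(2-4)[OF f(1)] theta_dom[OF x(1)] theta_dom[OF x(2)]
    theta_cod[OF x(1)] theta_cod[OF x(2)]
  consider "e = e'" | "e = 0" "e' = 1" | "e = 1" "e' = 0" using f by linarith
  then show ?thesis
  proof cases
    case 1
    then show ?thesis
      using end_rules(2-4)[OF f(1), of e] Cmp_Idn_left[of "end_mor e f"] Cmp_Idn_right[of "end_mor e f"]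
      by (simp add: trans_def)
  next
    case 2
    then show ?thesis using theta_nat[OF f(1)] by (simp add: trans_def end_mor_def)
  next
    case 3
    have "Cmp C (cmor F0 f) ?i = Cmp C (Cmp C (Cmp C ?j (\<theta> (Cod A f))) (cmor F0 f)) ?i"
      using Cmp_Idn_left[of "cmor F0 f"] m j by simp
    also have "\<dots> = Cmp C (Cmp C ?j (Cmp C (\<theta> (Cod A f)) (cmor F0 f))) ?i"
      using m i j by (simp add: Cmp_assoc)
    also have "\<dots> = Cmp C (Cmp C ?j (Cmp C (cmor F1 f) (\<theta> (Dom A f)))) ?i"
      using theta_nat[OF f(1)] by simp
    also have "\<dots> = Cmp C (Cmp C ?j (cmor F1 f)) (Cmp C (\<theta> (Dom A f)) ?i)"
      using m i(1-4) j(1-4) by (simp add: Cmp_assoc Cmp_in Dom_Cmp Cod_Cmp)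
    also have "\<dots> = Cmp C ?j (cmor F1 f)"
      using m i j Cmp_Idn_right[of "Cmp C ?j (cmor F1 f)"] by (simp add: Cmp_in Dom_Cmp)
    finally show ?thesis using 3 by (simp add: trans_def end_mor_def)
  qed
qed

text \<open>A morphism of the cylinder is factored as the passage between the ends at its domain,
  followed by the morphism at the target end. By \<open>trans_nat\<close> the opposite order gives
  the same, which is what functoriality needs.\<close>

definition cyl where
  "cyl = \<lparr>csrc = cat_prod EE A, ctgt = C, cobj = (\<lambda>(e, x). end_obj e x),
    cmor = (\<lambda>((e, e'), f). Cmp C (end_mor e' f) (trans e e' (Dom A f)))\<rparr>"

lemma cyl_simps [simp]:
  "csrc cyl = cat_prod EE A" "ctgt cyl = C" "cobj cyl (e, x) = end_obj e x"
  "cmor cyl ((e, e'), f) = Cmp C (end_mor e' f) (trans e e' (Dom A f))"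
  by (simp_all add: cyl_def)

lemma cyl_functor: "cat_functor cyl"
proof (unfold cat_functor_def cat_functor_axioms_def cyl_simps(1,2), intro conjI allI impI)
  show "category (cat_prod EE A)" by (intro category_cat_prod category_EE A.category_axioms)
  show "category C" by (rule category_axioms)
  fix p assume "p \<in> Obj (cat_prod EE A)"
  then obtain e x where p: "p = (e, x)" "e \<le> 1" "x \<in> Obj A" by (auto simp: cat_prod_def EE_simps)
  then show "cobj cyl p \<in> Obj C" "cmor cyl (Idn (cat_prod EE A) p) = Idn C (cobj cyl p)"
    using Cmp_Idn_right[OF Idn_in[OF end_rules(1)], of x e]
    by (simp_all add: end_rules cat_prod_def EE_simps A.Dom_Idn trans_rules Dom_Idn)
next
  fix m assume "m \<in> Mor (cat_prod EE A)"
  then obtain e e' f where m: "m = ((e, e'), f)" "e \<le> 1" "e' \<le> 1" "f \<in> Mor A"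
    by (auto simp: cat_prod_def EE_simps)
  then show "cmor cyl m \<in> Mor C" "Dom C (cmor cyl m) = cobj cyl (Dom (cat_prod EE A) m)"
    "Cod C (cmor cyl m) = cobj cyl (Cod (cat_prod EE A) m)"
    by (simp_all add: end_rules trans_rules A.Dom_in cat_prod_def EE_simps Cmp_in Dom_Cmp Cod_Cmp)
next
  fix m n assume "m \<in> Mor (cat_prod EE A)" "n \<in> Mor (cat_prod EE A)" "Cod (cat_prod EE A) m = Dom (cat_prod EE A) n"
  then obtain e e' e'' f g where m: "m = ((e, e'), f)" "n = ((e', e''), g)" "e \<le> 1" "e' \<le> 1" "e'' \<le> 1"
    "f \<in> Mor A" "g \<in> Mor A" "Cod A f = Dom A g"
    by (auto simp: cat_prod_def EE_simps)
  have x: "Dom A f \<in> Obj A" "Dom A g \<in> Obj A" using m A.Dom_in by auto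
  let ?t = "trans e e' (Dom A f)" and ?t' = "trans e' e'' (Dom A g)"
  note r = m end_rules(2-4)[OF m(6)] end_rules(2-4)[OF m(7)] trans_rules(1-3)[OF x(1) m(3,4)]
    trans_rules(1-3)[OF x(2) m(4,5)] trans_rules(1-3)[OF x(1) m(4,5)]
  have "Cmp C (Cmp C (end_mor e'' g) ?t') (Cmp C (end_mor e' f) ?t)
    = Cmp C (Cmp C (end_mor e'' g) (Cmp C ?t' (end_mor e' f))) ?t"
    using r by (simp add: Cmp_assoc Cmp_in Dom_Cmp Cod_Cmp)
  also have "\<dots> = Cmp C (Cmp C (end_mor e'' g) (Cmp C (end_mor e'' f) (trans e' e'' (Dom A f)))) ?t"
    using trans_nat[OF m(6,4,5)] m(8) by simp
  also have "\<dots> = Cmp C (Cmp C (end_mor e'' g) (end_mor e'' f)) (Cmp C (trans e' e'' (Dom A f)) ?t)"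
    using r by (simp add: Cmp_assoc Cmp_in Dom_Cmp Cod_Cmp)
  also have "\<dots> = Cmp C (end_mor e'' (Cmp A g f)) (trans e e'' (Dom A f))"
    using m x by (simp add: trans_rules end_rules)
  finally show "cmor cyl (Cmp (cat_prod EE A) n m) = Cmp C (cmor cyl n) (cmor cyl m)"
    using m by (simp add: cat_prod_def EE_simps prod_op_def A.Dom_Cmp)
qed

end

context cgw_local begin

text \<open>All laws for the chosen squares are equations between squares with equal boundary, so
  \<open>square_eqI\<close> settles them and any choice of squares works.\<close>

lemma square_functor:
  assumes A: "double_category A"
    and H: "cat_functor H" "csrc H = hcat A" "ctgt H = hcat D"
    and V: "cat_functor V" "csrc V = vcat A" "ctgt V = vcat D" "cobj V = cobj H"
    and ex: "\<And>s. s \<in> Sq A \<Longrightarrow>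
      \<exists>q. sq (cmor H (stop A s)) (cmor V (slft A s)) (cmor V (srgt A s)) (cmor H (sbot A s)) q"
  shows "\<exists>G. double_functor G \<and> dsrc G = A \<and> dtgt G = D \<and> onob G = cobj H \<and> onhor G = cmor H \<and> onver G = cmor V"
proof -
  interpret A: double_category A by fact
  define m where "m s = (SOME q. sq (cmor H (stop A s)) (cmor V (slft A s)) (cmor V (srgt A s)) (cmor H (sbot A s)) q)" for s
  have m: "sq (cmor H (stop A s)) (cmor V (slft A s)) (cmor V (srgt A s)) (cmor H (sbot A s)) (m s)"
    if "s \<in> Sq A" for s
    unfolding m_def by (rule someI_ex) (rule ex[OF that])
  note m' = m[unfolded square_with_def]
  note HR = cat_functor.cobj_in[OF H(1)] cat_functor.cmor_in[OF H(1)] cat_functor.Dom_cmor[OF H(1)]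
    cat_functor.Cod_cmor[OF H(1)] cat_functor.cmor_Idn[OF H(1)] cat_functor.cmor_Cmp[OF H(1)]
  note VR = cat_functor.cobj_in[OF V(1)] cat_functor.cmor_in[OF V(1)] cat_functor.Dom_cmor[OF V(1)]
    cat_functor.Cod_cmor[OF V(1)] cat_functor.cmor_Idn[OF V(1)] cat_functor.cmor_Cmp[OF V(1)]
  note R = HR[unfolded H hcat_simps] VR[unfolded V vcat_simps]
  let ?G = "\<lparr>dsrc = A, dtgt = D, onob = cobj H, onhor = cmor H, onver = cmor V, onsq = m\<rparr>"
  have "double_functor ?G"
  proof (rule double_functorI)
    fix v assume v: "v \<in> Ver (dsrc ?G)"
    then have "m (sqhid A v) = sqhid D (cmor V v)"
      using m[of "sqhid A v"] by (intro square_eqI) (simp_all add: square_with_def A.cell_simps R cell_simps)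
    then show "onsq ?G (sqhid (dsrc ?G) v) = sqhid (dtgt ?G) (onver ?G v)" by simp
  next
    fix v assume v: "v \<in> Hor (dsrc ?G)"
    then have "m (sqvid A v) = sqvid D (cmor H v)"
      using m[of "sqvid A v"] by (intro square_eqI) (simp_all add: square_with_def A.cell_simps R cell_simps)
    then show "onsq ?G (sqvid (dsrc ?G) v) = sqvid (dtgt ?G) (onhor ?G v)" by simp
  next
    fix s t assume s: "s \<in> Sq (dsrc ?G)" "t \<in> Sq (dsrc ?G)" "srgt (dsrc ?G) s = slft (dsrc ?G) t"
    then have "hcod A (stop A s) = hdom A (stop A t)" "hcod A (sbot A s) = hdom A (sbot A t)"
      by (simp_all add: A.cell_simps)
    then have "m (sqhcmp A t s) = sqhcmp D (m t) (m s)"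
      using s m[of "sqhcmp A t s"] m[of t] m[of s]
      by (intro square_eqI) (simp_all add: square_with_def A.cell_simps R cell_simps)
    then show "onsq ?G (sqhcmp (dsrc ?G) t s) = sqhcmp (dtgt ?G) (onsq ?G t) (onsq ?G s)" by simp
  next
    fix s t assume s: "s \<in> Sq (dsrc ?G)" "t \<in> Sq (dsrc ?G)" "sbot (dsrc ?G) s = stop (dsrc ?G) t"
    then have "vcod A (slft A s) = vdom A (slft A t)" "vcod A (srgt A s) = vdom A (srgt A t)"
      using A.edge_vcmp(1,2)[of s t] by simp_all
    then have "m (sqvcmp A t s) = sqvcmp D (m t) (m s)"
      using s m[of "sqvcmp A t s"] m[of t] m[of s]
      by (intro square_eqI) (simp_all add: square_with_def A.cell_simps R cell_simps)
    then show "onsq ?G (sqvcmp (dsrc ?G) t s) = sqvcmp (dtgt ?G) (onsq ?G t) (onsq ?G s)" by simp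
  qed (use A double_category_axioms m' R in simp_all)
  then show ?thesis by (intro exI[of _ ?G]) simp
qed

lemma functor_eqI:
  assumes F: "double_functor F" "dtgt F = D" and G: "double_functor G" "dtgt G = D" "dsrc G = dsrc F"
    and "\<And>x. x \<in> Ob (dsrc F) \<Longrightarrow> onob F x = onob G x"
    and h: "\<And>f. f \<in> Hor (dsrc F) \<Longrightarrow> onhor F f = onhor G f"
    and v: "\<And>f. f \<in> Ver (dsrc F) \<Longrightarrow> onver F f = onver G f"
  shows "dfun_eq F G"
proof -
  interpret A: double_category "dsrc F" by (rule double_functorD(1)[OF F(1)])
  have "onsq F s = onsq G s" if "s \<in> Sq (dsrc F)" for s
    using that double_functorD(14-18)[OF F(1), of s] double_functorD(14-18)[OF G(1), of s] h v F G
    by (intro square_eqI) (simp_all add: A.cell_simps)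
  then show ?thesis using assms by (simp add: dfun_eq_def)
qed

lemma local_trcor: "local_wrt D trcor"
  unfolding local_wrt_def
proof (intro allI impI, elim conjE)
  fix F assume F: "double_functor F" "dsrc F = dsrc trcor" "dtgt F = D"
  let ?X = "{(0, 0), (1, 0), (1, 1)} :: (nat \<times> nat) set"
  have F': "dsrc F = full_subdbl walking_square ?X" using F by simp
  note FD = double_functorD(3-)[OF F(1), unfolded F' F(3)]
  let ?f = "onhor F ((0, 1), 0)" and ?v = "onver F (1, 0, 1)"
  have f: "?f \<in> Hor D" "hdom D ?f = onob F (0, 0)" "hcod D ?f = onob F (1, 0)"
    "?v \<in> Ver D" "vdom D ?v = onob F (1, 0)" "vcod D ?v = onob F (1, 1)"
    using FD(2-4)[of "((0, 1), 0)"] FD(7-9)[of "(1, 0, 1)"] by (simp_all add: walking_square_simps)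
  then obtain s where s: "s \<in> Sq D" "stop D s = ?f" "srgt D s = ?v"
    using fill_tr[of ?f ?v] by auto
  obtain G where G: "double_functor G" "dsrc G = walking_square" "dtgt G = D"
    "onob G (0, 0) = hdom D (stop D s)" "onob G (1, 0) = hcod D (stop D s)" "onob G (0, 1) = hdom D (sbot D s)"
    "onob G (1, 1) = hcod D (sbot D s)"
    "onhor G ((0, 1), 0) = stop D s" "onhor G ((0, 1), 1) = sbot D s" "onver G (0, 0, 1) = slft D s"
    "onver G (1, 0, 1) = srgt D s"
    by (rule square_fun_of_square[OF sq_self[OF s(1)]])
  have "double_functor (comp_dfun G trcor)"
    by (rule double_functor_comp[OF double_functor_corners(1) G(1)]) (simp add: G)
  moreover have "hcod D (sbot D s) = onob F (1, 1)"
    using s f by (simp add: cell_simps)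
  ultimately have "dfun_eq (comp_dfun G trcor) F"
    by (intro walking_functor_eqI[where X = ?X]) (use F f s G in auto)
  then show "\<exists>G. extends_along trcor F G"
    using G by (intro exI[of _ G]) (simp add: extends_along_def)
qed

lemma local_blcor: "local_wrt D blcor"
  unfolding local_wrt_def
proof (intro allI impI, elim conjE)
  fix F assume F: "double_functor F" "dsrc F = dsrc blcor" "dtgt F = D"
  let ?X = "{(0, 0), (0, 1), (1, 1)} :: (nat \<times> nat) set"
  have F': "dsrc F = full_subdbl walking_square ?X" using F by simp
  note FD = double_functorD(3-)[OF F(1), unfolded F' F(3)]
  let ?f = "onhor F ((0, 1), 1)" and ?v = "onver F (0, 0, 1)"
  have f: "?f \<in> Hor D" "hdom D ?f = onob F (0, 1)" "hcod D ?f = onob F (1, 1)"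
    "?v \<in> Ver D" "vdom D ?v = onob F (0, 0)" "vcod D ?v = onob F (0, 1)"
    using FD(2-4)[of "((0, 1), 1)"] FD(7-9)[of "(0, 0, 1)"] by (simp_all add: walking_square_simps)
  then obtain s where s: "s \<in> Sq D" "sbot D s = ?f" "slft D s = ?v"
    using fill_bl[of ?v ?f] by auto
  obtain G where G: "double_functor G" "dsrc G = walking_square" "dtgt G = D"
    "onob G (0, 0) = hdom D (stop D s)" "onob G (1, 0) = hcod D (stop D s)" "onob G (0, 1) = hdom D (sbot D s)"
    "onob G (1, 1) = hcod D (sbot D s)"
    "onhor G ((0, 1), 0) = stop D s" "onhor G ((0, 1), 1) = sbot D s" "onver G (0, 0, 1) = slft D s"
    "onver G (1, 0, 1) = srgt D s"
    by (rule square_fun_of_square[OF sq_self[OF s(1)]])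
  have "double_functor (comp_dfun G blcor)"
    by (rule double_functor_comp[OF double_functor_corners(2) G(1)]) (simp add: G)
  moreover have "hdom D (stop D s) = onob F (0, 0)"
    using s f by (simp add: cell_simps)
  ultimately have "dfun_eq (comp_dfun G blcor) F"
    by (intro walking_functor_eqI[where X = ?X]) (use F f s G in auto)
  then show "\<exists>G. extends_along blcor F G"
    using G by (intro exI[of _ G]) (simp add: extends_along_def)
qed

lemma HH_functor_cells:
  assumes F: "double_functor F" "dsrc F = HH C" "dtgt F = D"
  shows "x \<in> Obj C \<Longrightarrow> onver F x = vid D (onob F x)" "f \<in> Mor C \<Longrightarrow> onsq F f = sqvid D (onhor F f)"
  using double_functorD(12,20)[OF F(1)] by (simp_all add: F)

lemma ordinal_functor:
  assumes ob: "\<And>a. a \<le> n \<Longrightarrow> ob a \<in> Ob D"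
    and m: "\<And>a b. a \<le> b \<Longrightarrow> b \<le> n \<Longrightarrow> m (a, b) \<in> Hor D \<and> hdom D (m (a, b)) = ob a \<and> hcod D (m (a, b)) = ob b"
    and id: "\<And>a. a \<le> n \<Longrightarrow> m (a, a) = hid D (ob a)"
    and comp: "\<And>a b c. a \<le> b \<Longrightarrow> b \<le> c \<Longrightarrow> c \<le> n \<Longrightarrow> m (a, c) = m (b, c) \<cdot>h m (a, b)"
  shows "double_functor \<lparr>dsrc = HH (ordinal n), dtgt = D, onob = ob, onhor = m,
      onver = \<lambda>x. vid D (ob x), onsq = \<lambda>f. sqvid D (m f)\<rparr>"
proof -
  have sel: "Obj (ordinal n) = {..n}" "Mor (ordinal n) = {(a, b). a \<le> b \<and> b \<le> n}"
    "Dom (ordinal n) = fst" "Cod (ordinal n) = snd" "Idn (ordinal n) a = (a, a)"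
    "Cmp (ordinal n) g f = (fst f, snd g)" for a f g
    by (simp_all add: ordinal_def)
  let ?P = "\<lparr>csrc = ordinal n, ctgt = hcat D, cobj = ob, cmor = m\<rparr>"
  have "cat_functor ?P"
  proof (unfold cat_functor_def cat_functor_axioms_def cfun.simps, intro conjI allI impI)
    fix f g assume "f \<in> Mor (ordinal n)" "g \<in> Mor (ordinal n)" "Cod (ordinal n) f = Dom (ordinal n) g"
    then show "m (Cmp (ordinal n) g f) = Cmp (hcat D) (m g) (m f)"
      using comp[of "fst f" "fst g" "snd g"] by (auto simp: sel)
  qed (use ob m id category_ordinal horizontal.category_axioms in \<open>auto simp: sel\<close>)
  from double_functor_from_HH[OF category_ordinal double_category_axioms this] show ?thesis by simp
qed

text \<open>The image of \<open>(1, 2, False)\<close> is monic, hence the two parallel arrows have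
  equal images and the double functor factors through \<open>ordinal 2\<close>.\<close>

lemma local_mono: "local_wrt D (HH_fun mono_fun)"
  unfolding local_wrt_def
proof (intro allI impI, elim conjE)
  fix F assume F: "double_functor F" "dsrc F = dsrc (HH_fun mono_fun)" "dtgt F = D"
  then have F': "dsrc F = HH parallel_cat" by (simp add: HH_fun_def mono_fun_def)
  note FD = double_functorD(3-)[OF F(1), unfolded F' F(3) HH_simps]
  let ?m = "\<lambda>(a, b). onhor F (a, b, False)"
  have le2: "x \<le> 2 \<longleftrightarrow> x = 0 \<or> x = 1 \<or> x = 2" for x :: nat by auto
  have P: "(a, b, False) \<in> Mor parallel_cat" if "a \<le> b" "b \<le> 2" for a b
    using that by (simp add: parallel_cat_def)
  have M: "(0, 1, True) \<in> Mor parallel_cat" "(0, 1, False) \<in> Mor parallel_cat" "(1, 2, False) \<in> Mor parallel_cat"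
    by (simp_all add: parallel_cat_def)
  have "onhor F (1, 2, False) \<cdot>h onhor F (0, 1, True) = onhor F (1, 2, False) \<cdot>h onhor F (0, 1, False)"
    using FD(6)[OF M(1,3)] FD(6)[OF M(2,3)] by (simp add: parallel_cat_def)
  then have "onhor F (0, 1, True) = onhor F (0, 1, False)"
    using horizontal.mono_cancel[OF mono_hor, of "onhor F (1, 2, False)" "onhor F (0, 1, True)" "onhor F (0, 1, False)"]
      FD(2-4)[OF M(1)] FD(2-4)[OF M(2)] FD(2-4)[OF M(3)] by (simp add: parallel_cat_def)
  then have m: "onhor F (a, b, p) = onhor F (a, b, False)" if "(a, b, p) \<in> Mor parallel_cat" for a b p
    using that by (cases p) (auto simp: parallel_cat_def)
  have G: "double_functor \<lparr>dsrc = HH (ordinal 2), dtgt = D, onob = onob F, onhor = ?m,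
      onver = \<lambda>x. vid D (onob F x), onsq = \<lambda>f. sqvid D (?m f)\<rparr>" (is "double_functor ?G")
  proof (rule ordinal_functor)
    fix a b c :: nat assume "a \<le> b" "b \<le> c" "c \<le> 2"
    then show "?m (a, c) = ?m (b, c) \<cdot>h ?m (a, b)"
      using FD(6)[of "(a, b, False)" "(b, c, False)"] by (simp add: parallel_cat_def)
  next
    fix a b :: nat assume "a \<le> b" "b \<le> 2"
    then show "?m (a, b) \<in> Hor D \<and> hdom D (?m (a, b)) = onob F a \<and> hcod D (?m (a, b)) = onob F b"
      using FD(2-4)[OF P[of a b]] by (simp add: parallel_cat_def)
  qed (use FD(1,5) in \<open>simp_all add: parallel_cat_def\<close>)
  have "dfun_eq (comp_dfun ?G (HH_fun mono_fun)) F"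
  proof (unfold dfun_eq_def, intro conjI ballI)
    let ?L = "comp_dfun ?G (HH_fun mono_fun)"
    have L: "dsrc ?L = HH parallel_cat" by (simp add: HH_fun_def mono_fun_def)
    show "dsrc ?L = dsrc F" "dtgt ?L = dtgt F" using L F' F(3) by simp_all
    show "onob ?L x = onob F x" for x by (simp add: HH_fun_def mono_fun_def)
    show "onver ?L x = onver F x" if "x \<in> Ver (dsrc ?L)" for x
      using that HH_functor_cells(1)[OF F(1) F' F(3), of x] L by (simp add: HH_fun_def mono_fun_def)
    have h: "onhor ?L f = onhor F f" if "f \<in> Mor parallel_cat" for f
      using that m[of "fst f" "fst (snd f)" "snd (snd f)"] by (simp add: HH_fun_def mono_fun_def split_beta)
    then show "onhor ?L f = onhor F f" if "f \<in> Hor (dsrc ?L)" for f using that L by simp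
    show "onsq ?L f = onsq F f" if "f \<in> Sq (dsrc ?L)" for f
      using that h[of f] HH_functor_cells(2)[OF F(1) F' F(3), of f] L
      by (simp add: HH_fun_def mono_fun_def split_beta)
  qed
  then show "\<exists>G. extends_along (HH_fun mono_fun) F G"
    using G by (intro exI[of _ ?G]) (simp add: extends_along_def HH_fun_def mono_fun_def)
qed

text \<open>The image of the globe has trivial vertical sides and so is a unit, which identifies the
  images of its top and bottom. Uniqueness holds because \<open>trunc_h\<close> hits every object
  and every horizontal morphism, and the other cells are units.\<close>

lemma strictly_local_trunc_h: "strictly_local_wrt D trunc_h"
proof (rule strictly_local_wrtI)
  fix F assume F: "double_functor F" "dsrc F = dsrc trunc_h" "dtgt F = D"
  then have F': "dsrc F = globe_dbl" by (simp add: trunc_h_def)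
  note FD = double_functorD(3-)[OF F(1), unfolded F' F(3)]
  have ver: "onver F x = vid D (onob F x)" if "x \<le> 1" for x
    using FD(10)[of x] that by (simp add: globe_dbl_simps)
  have ob: "onob F x \<in> Ob D" if "x \<le> 1" for x
    using FD(1)[of x] that by (simp add: globe_dbl_simps)
  have sqv: "onsq F (f, f) = sqvid D (onhor F f)" if "f \<in> Mor globe_cat" for f
    using FD(18)[of f] that by (simp add: globe_dbl_simps)
  let ?s = "onsq F ((0, 1, False), (0, 1, True))"
  have s: "?s \<in> Sq D" "stop D ?s = onhor F (0, 1, False)" "sbot D ?s = onhor F (0, 1, True)"
    "slft D ?s = vid D (onob F 0)" "srgt D ?s = vid D (onob F 1)"
    using FD(12-16)[of "((0, 1, False), (0, 1, True))"] ver by (simp_all add: globe_dbl_simps)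
  then have s_eq: "?s = sqvid D (onhor F (0, 1, False))"
    using trunc_h[of ?s "onob F 0" "onob F 1"] ob by simp
  have al: "onhor F (0, 1, True) = onhor F (0, 1, False)"
    using s s_eq sbot_sqvid[of "onhor F (0, 1, False)"] stop_in[OF s(1)] by metis
  have m: "onhor F (a, b, p) = onhor F (a, b, False)" if "(a, b, p) \<in> Mor globe_cat" for a b p
    using that al by (cases p) (auto simp: globe_cat_def)
  let ?m = "\<lambda>(a, b). onhor F (a, b, False)"
  have P: "(a, b, False) \<in> Hor globe_dbl" if "a \<le> b" "b \<le> 1" for a b
    using that by (simp add: globe_dbl_simps globe_cat_def)
  have G: "double_functor \<lparr>dsrc = HH (ordinal 1), dtgt = D, onob = onob F, onhor = ?m,
      onver = \<lambda>x. vid D (onob F x), onsq = \<lambda>f. sqvid D (?m f)\<rparr>" (is "double_functor ?G")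
  proof (rule ordinal_functor)
    fix a b c :: nat assume "a \<le> b" "b \<le> c" "c \<le> 1"
    then show "?m (a, c) = ?m (b, c) \<cdot>h ?m (a, b)"
      using FD(6)[of "(a, b, False)" "(b, c, False)"] P by (simp add: globe_dbl_simps)
  next
    fix a b :: nat assume "a \<le> b" "b \<le> 1"
    then show "?m (a, b) \<in> Hor D \<and> hdom D (?m (a, b)) = onob F a \<and> hcod D (?m (a, b)) = onob F b"
      using FD(2-4)[OF P[of a b]] by (simp add: globe_dbl_simps)
  next
    fix a :: nat assume "a \<le> 1"
    then show "?m (a, a) = hid D (onob F a)" using FD(5)[of a] by (simp add: globe_dbl_simps)
  qed (rule ob)
  have "dfun_eq (comp_dfun ?G trunc_h) F"
    unfolding dfun_eq_def using F F' ver sqv s_eq m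
    by (auto simp: trunc_h_def globe_dbl_simps split: prod.splits)
  then show "\<exists>G. extends_along trunc_h F G"
    using G by (intro exI[of _ ?G]) (simp add: extends_along_def trunc_h_def)
next
  fix F G G' assume F: "double_functor F" "dsrc F = dsrc trunc_h" "dtgt F = D"
    and G: "extends_along trunc_h F G" "extends_along trunc_h F G'"
  have gg: "double_functor G" "double_functor G'" "dsrc G = HH (ordinal 1)" "dsrc G' = HH (ordinal 1)"
    and e: "dfun_eq (comp_dfun G trunc_h) F" and e': "dfun_eq (comp_dfun G' trunc_h) F"
    using G by (simp_all add: extends_along_def trunc_h_def)
  have tg: "dtgt G = D" "dtgt G' = D"
    using dfun_eqD(2)[OF e] dfun_eqD(2)[OF e'] F by simp_all
  have src: "dsrc trunc_h = globe_dbl" by (simp add: trunc_h_def)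
  have o: "onob G x = onob G' x" if "x \<le> 1" for x
    using that dfun_eqD(3)[OF e, of x] dfun_eqD(3)[OF e', of x] by (simp add: trunc_h_def globe_dbl_simps)
  have h: "onhor G f = onhor G' f" if "f \<in> Mor (ordinal 1)" for f
    using that dfun_eqD(4)[OF e, of "(fst f, snd f, False)"] dfun_eqD(4)[OF e', of "(fst f, snd f, False)"]
    by (auto simp: trunc_h_def globe_dbl_simps globe_cat_def ordinal_def)
  show "dfun_eq G G'"
    using gg tg o h HH_functor_cells[OF gg(1,3) tg(1)] HH_functor_cells[OF gg(2,4) tg(2)]
    by (simp add: dfun_eq_def ordinal_def)
qed

end

lemma hfun_vfun_simps [simp]:
  "csrc (hfun F) = hcat (dsrc F)" "ctgt (hfun F) = hcat (dtgt F)"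
  "cobj (hfun F) = onob F" "cmor (hfun F) = onhor F"
  "csrc (vfun F) = vcat (dsrc F)" "ctgt (vfun F) = vcat (dtgt F)"
  "cobj (vfun F) = onob F" "cmor (vfun F) = onver F"
  by (simp_all add: hfun_def vfun_def)

lemma EEsq_cats: "hcat EEsq = EE" "vcat EEsq = EE"
  by (simp_all add: comm_squares_def hcat_def vcat_def)

lemma dbl_prod_cats:
  "hcat (dbl_prod B C) = cat_prod (hcat B) (hcat C)" "vcat (dbl_prod B C) = cat_prod (vcat B) (vcat C)"
  by (simp_all add: hcat_def vcat_def cat_prod_def dbl_prod_def)

section \<open>Double functors on commutative squares of the walking isomorphism\<close>

context cgw_local begin

text \<open>A square of \<open>EEsq\<close> commutes, and commutation of the images under
  \<open>h\<close> is exactly the condition of \<open>companion_square_exists\<close>.\<close>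

lemma EEsq_functor:
  assumes h: "cat_functor h" "csrc h = EE" "ctgt h = hcat D"
    and v: "cat_functor v" "csrc v = EE" "ctgt v = vcat D" "cobj v = cobj h"
    and c: "\<And>e. e \<in> Mor EE \<Longrightarrow> companion D (cmor h e) (cmor v e)"
  shows "\<exists>G. double_functor G \<and> dsrc G = EEsq \<and> dtgt G = D \<and> onob G = cobj h \<and> onhor G = cmor h \<and> onver G = cmor v"
proof (rule square_functor)
  show "double_category EEsq" by (rule double_category_EEsq)
  fix s assume s: "s \<in> Sq EEsq"
  obtain t l r b where s_eq: "s = (t, l, r, b)" by (metis surj_pair)
  have m: "t \<in> Mor EE" "l \<in> Mor EE" "r \<in> Mor EE" "b \<in> Mor EE"
    "fst t = fst l" "snd t = fst r" "fst b = snd l" "snd b = snd r"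
    using s by (auto simp: s_eq EEsq_simps EE_simps)
  have "Cmp EE r t = Cmp EE b l" using m by (simp add: EE_simps)
  then have "cmor h r \<cdot>h cmor h t = cmor h b \<cdot>h cmor h l"
    using cat_functor.cmor_Cmp[OF h(1), of t r] cat_functor.cmor_Cmp[OF h(1), of l b] m
    by (simp add: h EE_simps(3,4))
  then have "\<exists>q. sq (cmor h t) (cmor v l) (cmor v r) (cmor h b) q"
    using m cat_functor.cmor_in[OF h(1)] cat_functor.Dom_cmor[OF h(1)] cat_functor.Cod_cmor[OF h(1)]
      cat_functor.Dom_cmor[OF v(1)] cat_functor.Cod_cmor[OF v(1)]
    by (intro companion_square_exists[OF c[OF m(2)] c[OF m(3)]])
      (simp_all add: h v(2,3,4) EE_simps(3,4))
  then show "\<exists>q. sq (cmor h (stop EEsq s)) (cmor v (slft EEsq s)) (cmor v (srgt EEsq s)) (cmor h (sbot EEsq s)) q"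
    by (simp add: s_eq EEsq_simps)
qed (use h v in \<open>simp_all add: EEsq_cats\<close>)

text \<open>The vertical image of an arrow is the companion of its horizontal image. As companions
  are unique in both directions, either half determines the other.\<close>

lemma EEsq_functor_eqI:
  assumes "double_functor G" "dsrc G = EEsq" "dtgt G = D" "double_functor G'" "dsrc G' = EEsq" "dtgt G' = D"
    and "\<And>x. x \<in> Ob EEsq \<Longrightarrow> onob G x = onob G' x"
    and hv: "(\<forall>e \<in> Hor EEsq. onhor G e = onhor G' e) \<or> (\<forall>e \<in> Ver EEsq. onver G e = onver G' e)"
  shows "dfun_eq G G'"
proof -
  have "companion D (onhor G e) (onver G e)" "companion D (onhor G' e) (onver G' e)" if "e \<in> Mor EE" for e
    using EEsq_companion[OF assms(1-3), of "fst e" "snd e"] EEsq_companion[OF assms(4-6), of "fst e" "snd e"] that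
    by (auto simp: EE_simps)
  then have "onhor G e = onhor G' e \<and> onver G e = onver G' e" if "e \<in> Mor EE" for e
    using that hv companion_unique companion_unique' by (metis EEsq_cats hcat_simps(2) vcat_simps(2))
  then show ?thesis
    by (intro functor_eqI) (use assms in \<open>auto simp: EEsq_simps EE_simps\<close>)
qed

lemma iso_image:
  assumes "cat_functor h" "csrc h = EE" "ctgt h = hcat D" "e \<in> Mor EE"
  shows "iso_arrow (hcat D) (cmor h e)"
proof -
  have "inverse_arrows EE e (snd e, fst e)"
    using assms by (auto simp: inverse_arrows_def EE_simps)
  then show ?thesis
    using cat_functor.iso_cmor[OF assms(1), of e "(snd e, fst e)"] assms(2,3) unfolding iso_arrow_def
    by metis
qed

text \<open>Functors on \<open>EE\<close> take values in isomorphisms, where \<open>phi\<close> is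
  defined, and companions respect composition and identities.\<close>

lemma phi_comp:
  assumes h: "cat_functor h" "csrc h = EE" "ctgt h = hcat D"
  defines "v \<equiv> \<lparr>csrc = EE, ctgt = vcat D, cobj = cobj h, cmor = (\<lambda>e. cmor phi (cmor h e))\<rparr>"
  shows "cat_functor v" "e \<in> Mor EE \<Longrightarrow> companion D (cmor h e) (cmor v e)"
proof -
  note c = phi_companion[OF iso_image[OF h]]
  show "companion D (cmor h e) (cmor v e)" if "e \<in> Mor EE"
    using c[OF that] by (simp add: v_def)
  note hR = cat_functor.cobj_in[OF h(1)] cat_functor.cmor_in[OF h(1)] cat_functor.Dom_cmor[OF h(1)]
    cat_functor.Cod_cmor[OF h(1)] cat_functor.cmor_Idn[OF h(1)] cat_functor.cmor_Cmp[OF h(1)]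
  note R = hR[unfolded h hcat_simps]
  show "cat_functor v"
  proof (unfold cat_functor_def cat_functor_axioms_def, intro conjI allI impI)
    show "category (csrc v)" "category (ctgt v)"
      by (simp_all add: v_def category_EE vertical.category_axioms)
    fix x assume "x \<in> Obj (csrc v)"
    then have x: "x \<in> Obj EE" by (simp add: v_def)
    then show "cobj v x \<in> Obj (ctgt v)" using R by (simp add: v_def)
    show "cmor v (Idn (csrc v) x) = Idn (ctgt v) (cobj v x)"
      using x R phi_eq[OF companion_hid] by (simp add: v_def)
  next
    fix e assume "e \<in> Mor (csrc v)"
    then have e: "e \<in> Mor EE" by (simp add: v_def)
    show "cmor v e \<in> Mor (ctgt v)" "Dom (ctgt v) (cmor v e) = cobj v (Dom (csrc v) e)"
      "Cod (ctgt v) (cmor v e) = cobj v (Cod (csrc v) e)"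
      using c[OF e] R(3,4)[OF e] by (simp_all add: v_def companion_def)
  next
    fix e e' assume "e \<in> Mor (csrc v)" "e' \<in> Mor (csrc v)" "Cod (csrc v) e = Dom (csrc v) e'"
    then have e: "e \<in> Mor EE" "e' \<in> Mor EE" "Cod EE e = Dom EE e'" by (simp_all add: v_def)
    have "companion D (cmor h e' \<cdot>h cmor h e) (cmor phi (cmor h e') \<cdot>v cmor phi (cmor h e))"
      using companion_cmp[OF c[OF e(1)] c[OF e(2)]] R(3,4)[OF e(1)] R(3,4)[OF e(2)] e(3) by simp
    then show "cmor v (Cmp (csrc v) e' e) = Cmp (ctgt v) (cmor v e') (cmor v e)"
      using R(6)[OF e] phi_eq by (simp add: v_def)
  qed
qed

lemma EEsq_functor_extending:
  assumes F: "double_functor F" "dsrc F = HH EE" "dtgt F = D"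
  shows "\<exists>G. double_functor G \<and> dsrc G = EEsq \<and> dtgt G = D \<and> onob G = onob F \<and> onhor G = onhor F"
proof -
  let ?h = "\<lparr>csrc = EE, ctgt = hcat D, cobj = onob F, cmor = onhor F\<rparr>"
  have eq: "hcat (HH EE) = EE" by (simp add: hcat_def HH_def)
  have "cat_functor (hfun F)" using F(1) by (simp add: double_functor_def)
  then have h: "cat_functor ?h" unfolding hfun_def F(2,3) eq .
  from phi_comp[OF h] show ?thesis
    using EEsq_functor[OF h _ _ phi_comp(1)[OF h]] by fastforce
qed

lemma strictly_local_hiso: "strictly_local_wrt D hiso"
proof (rule strictly_local_wrtI)
  fix F assume F: "double_functor F" "dsrc F = dsrc hiso" "dtgt F = D"
  then have F': "dsrc F = HH EE" by (simp add: hiso_def)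
  obtain G where G: "double_functor G" "dsrc G = EEsq" "dtgt G = D" "onob G = onob F" "onhor G = onhor F"
    using EEsq_functor_extending[OF F(1) F' F(3)] by blast
  have "dfun_eq (comp_dfun G hiso) F"
    unfolding dfun_eq_def
    using F F' G HH_functor_cells[OF F(1) F' F(3)] double_functorD(12,20)[OF G(1)]
    by (simp add: hiso_def EEsq_simps EE_simps)
  then show "\<exists>G. extends_along hiso F G"
    using G by (intro exI[of _ G]) (simp add: extends_along_def hiso_def)
next
  fix F G G' assume F: "double_functor F" "dsrc F = dsrc hiso" "dtgt F = D"
    and G: "extends_along hiso F G" "extends_along hiso F G'"
  have gg: "double_functor G" "double_functor G'" "dsrc G = EEsq" "dsrc G' = EEsq"
    and e: "dfun_eq (comp_dfun G hiso) F" and e': "dfun_eq (comp_dfun G' hiso) F"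
    using G by (simp_all add: extends_along_def hiso_def)
  have tg: "dtgt G = D" "dtgt G' = D"
    using dfun_eqD(2)[OF e] dfun_eqD(2)[OF e'] F by simp_all
  have o: "onob G x = onob G' x" if "x \<in> Ob EEsq" for x
    using that dfun_eqD(3)[OF e, of x] dfun_eqD(3)[OF e', of x] by (simp add: hiso_def EEsq_simps EE_simps)
  have "onhor G f = onhor G' f" if "f \<in> Hor EEsq" for f
    using that dfun_eqD(4)[OF e, of f] dfun_eqD(4)[OF e', of f] by (simp add: hiso_def EEsq_simps EE_simps)
  then show "dfun_eq G G'"
    using EEsq_functor_eqI[OF gg(1,3) tg(1) gg(2,4) tg(2) o] by blast
qed

text \<open>Here the vertical half is given, and the map \<open>phi\<close> of the transpose
  supplies the horizontal companions.\<close>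

lemma EEsq_functor_extending_v:
  assumes F: "double_functor F" "dsrc F = VV EE" "dtgt F = D"
  shows "\<exists>G. double_functor G \<and> dsrc G = EEsq \<and> dtgt G = D \<and> onob G = onob F \<and> onver G = onver F"
proof -
  interpret T: cgw_local "transpose D" by (rule cgw_local_transpose)
  let ?h = "\<lparr>csrc = EE, ctgt = vcat D, cobj = onob F, cmor = onver F\<rparr>"
  let ?v = "\<lparr>csrc = EE, ctgt = hcat D, cobj = onob F, cmor = (\<lambda>e. cmor T.phi (onver F e))\<rparr>"
  have eq: "vcat (VV EE) = EE" by (simp add: hcat_def HH_def VV_def)
  have "cat_functor (vfun F)" using F(1) by (simp add: double_functor_def)
  then have h: "cat_functor ?h" unfolding vfun_def F(2,3) eq .
  have v: "cat_functor ?v" "\<And>e. e \<in> Mor EE \<Longrightarrow> companion D (cmor ?v e) (cmor ?h e)"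
    using T.phi_comp[of ?h] h by simp_all
  show ?thesis
    using EEsq_functor[OF v(1) _ _ h _ _ _ v(2)] by auto
qed

lemma VV_functor_cells:
  assumes F: "double_functor F" "dsrc F = VV C" "dtgt F = D"
  shows "x \<in> Obj C \<Longrightarrow> onhor F x = hid D (onob F x)" "f \<in> Mor C \<Longrightarrow> onsq F f = sqhid D (onver F f)"
  using double_functorD(7,19)[OF F(1)] by (simp_all add: F VV_def)

lemma strictly_local_viso: "strictly_local_wrt D viso"
proof (rule strictly_local_wrtI)
  fix F assume F: "double_functor F" "dsrc F = dsrc viso" "dtgt F = D"
  then have F': "dsrc F = VV EE" by (simp add: viso_def)
  obtain G where G: "double_functor G" "dsrc G = EEsq" "dtgt G = D" "onob G = onob F" "onver G = onver F"
    using EEsq_functor_extending_v[OF F(1) F' F(3)] by blast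
  have "dfun_eq (comp_dfun G viso) F"
    unfolding dfun_eq_def
    using F F' G VV_functor_cells[OF F(1) F' F(3)] double_functorD(7,19)[OF G(1)]
    by (simp add: viso_def VV_def EEsq_simps EE_simps)
  then show "\<exists>G. extends_along viso F G"
    using G by (intro exI[of _ G]) (simp add: extends_along_def viso_def)
next
  fix F G G' assume F: "double_functor F" "dsrc F = dsrc viso" "dtgt F = D"
    and G: "extends_along viso F G" "extends_along viso F G'"
  have gg: "double_functor G" "double_functor G'" "dsrc G = EEsq" "dsrc G' = EEsq"
    and e: "dfun_eq (comp_dfun G viso) F" and e': "dfun_eq (comp_dfun G' viso) F"
    using G by (simp_all add: extends_along_def viso_def)
  have tg: "dtgt G = D" "dtgt G' = D"
    using dfun_eqD(2)[OF e] dfun_eqD(2)[OF e'] F by simp_all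
  have o: "onob G x = onob G' x" if "x \<in> Ob EEsq" for x
    using that dfun_eqD(3)[OF e, of x] dfun_eqD(3)[OF e', of x] by (simp add: viso_def VV_def EEsq_simps EE_simps)
  have "onver G f = onver G' f" if "f \<in> Ver EEsq" for f
    using that dfun_eqD(5)[OF e, of f] dfun_eqD(5)[OF e', of f] by (simp add: viso_def VV_def EEsq_simps EE_simps)
  then show "dfun_eq G G'"
    using EEsq_functor_eqI[OF gg(1,3) tg(1) gg(2,4) tg(2) o] by blast
qed

text \<open>\<theta> and its companions \<theta>' give cylinder functors on the horizontal and the
  vertical category. By \<open>square_functor\<close> it only remains to fill the boundary of each
  square of the product.\<close>

lemma cylinder_functor:
  assumes H: "double_functor H" "dsrc H = W" "dtgt H = D"
    and K: "double_functor K" "dsrc K = W" "dtgt K = D"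
    and \<theta>: "\<And>x. x \<in> Ob W \<Longrightarrow> iso_arrow (hcat D) (\<theta> x)"
      "\<And>x. x \<in> Ob W \<Longrightarrow> hdom D (\<theta> x) = onob H x" "\<And>x. x \<in> Ob W \<Longrightarrow> hcod D (\<theta> x) = onob K x"
    and c: "\<And>x. x \<in> Ob W \<Longrightarrow> companion D (\<theta> x) (\<theta>' x)"
    and nat: "\<And>f. f \<in> Hor W \<Longrightarrow> onhor K f \<cdot>h \<theta> (hdom W f) = \<theta> (hcod W f) \<cdot>h onhor H f"
    and nat': "\<And>v. v \<in> Ver W \<Longrightarrow> onver K v \<cdot>v \<theta>' (vdom W v) = \<theta>' (vcod W v) \<cdot>v onver H v"
  shows "\<exists>\<Phi>. double_functor \<Phi> \<and> dsrc \<Phi> = dbl_prod EEsq W \<and> dtgt \<Phi> = D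
    \<and> (\<forall>x. onob \<Phi> (0, x) = onob H x \<and> onob \<Phi> (1, x) = onob K x)
    \<and> (\<forall>f \<in> Hor W. onhor \<Phi> ((0, 0), f) = onhor H f \<and> onhor \<Phi> ((1, 1), f) = onhor K f
      \<and> onhor \<Phi> ((0, 1), f) = onhor K f \<cdot>h \<theta> (hdom W f)
      \<and> onhor \<Phi> ((1, 0), f) = onhor H f \<cdot>h inv_arrow (hcat D) (\<theta> (hdom W f)))
    \<and> (\<forall>v \<in> Ver W. onver \<Phi> ((0, 0), v) = onver H v \<and> onver \<Phi> ((1, 1), v) = onver K v
      \<and> onver \<Phi> ((0, 1), v) = onver K v \<cdot>v \<theta>' (vdom W v)
      \<and> onver \<Phi> ((1, 0), v) = onver H v \<cdot>v inv_arrow (vcat D) (\<theta>' (vdom W v)))"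
proof -
  interpret W: double_category W using double_functorD(1)[OF H(1)] H by simp
  note HD = double_functorD(3-)[OF H(1), unfolded H(2,3)]
  note KD = double_functorD(3-)[OF K(1), unfolded K(2,3)]
  have c': "hdom D (\<theta> x) = vdom D (\<theta>' x)" "hcod D (\<theta> x) = vcod D (\<theta>' x)" if "x \<in> Ob W" for x
    using c[OF that] by (simp_all add: companion_def)
  interpret h: natural_isos "hcat D" "hcat W" "hfun H" "hfun K" \<theta>
    by (intro natural_isos.intro natural_isos_axioms.intro horizontal.category_axioms)
      (use H K \<theta> nat in \<open>simp_all add: double_functor_def\<close>)
  interpret v: natural_isos "vcat D" "vcat W" "vfun H" "vfun K" \<theta>'
    by (intro natural_isos.intro natural_isos_axioms.intro vertical.category_axioms)
      (use H K \<theta> nat' c' companion_iso[OF c] in \<open>simp_all add: double_functor_def\<close>)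
  have ob: "v.end_obj = h.end_obj"
    by (intro ext) (simp add: v.end_obj_def h.end_obj_def)
  have comp: "companion D (h.trans e e' x) (v.trans e e' x)" if x: "x \<in> Ob W" "e \<le> 1" "e' \<le> 1" for e e' x
  proof -
    have "companion D (inv_arrow (hcat D) (\<theta> x)) (inv_arrow (vcat D) (\<theta>' x))"
      using companion_inverse[OF c[OF x(1)] horizontal.inverse_inv_arrow[OF \<theta>(1)[OF x(1)]]]
        vertical.inv_arrow_eq by metis
    moreover have "h.end_obj e x \<in> Ob D" using h.end_rules(1)[of x e] x by simp
    ultimately show ?thesis
      using c[OF x(1)] companion_hid[of "h.end_obj e x"] by (auto simp: h.trans_def v.trans_def ob)
  qed
  have "\<exists>\<Phi>. double_functor \<Phi> \<and> dsrc \<Phi> = dbl_prod EEsq W \<and> dtgt \<Phi> = D \<and> onob \<Phi> = cobj h.cyl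
      \<and> onhor \<Phi> = cmor h.cyl \<and> onver \<Phi> = cmor v.cyl"
  proof (rule square_functor)
    show "double_category (dbl_prod EEsq W)"
      by (rule double_category_dbl_prod[OF double_category_EEsq W.double_category_axioms])
    show "cat_functor h.cyl" "cat_functor v.cyl" by (rule h.cyl_functor v.cyl_functor)+
    show "csrc h.cyl = hcat (dbl_prod EEsq W)" "csrc v.cyl = vcat (dbl_prod EEsq W)"
      by (simp_all add: dbl_prod_cats EEsq_cats)
    show "cobj v.cyl = cobj h.cyl" by (simp add: h.cyl_def v.cyl_def ob)
    fix p assume p: "p \<in> Sq (dbl_prod EEsq W)"
    \<comment> \<open>A square of \<open>EEsq\<close> is given by its four corners: \<open>a\<close>
      top left, \<open>b\<close> top right, \<open>d\<close> bottom left, \<open>e\<close> bottom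
      right.\<close>
    then obtain a b d e s where p_eq: "p = (((a, b), (a, d), (b, e), (d, e)), s)"
      and le: "a \<le> 1" "b \<le> 1" "d \<le> 1" "e \<le> 1" and s: "s \<in> Sq W"
      by (auto simp: EEsq_simps)
    let ?f = "stop W s" and ?g = "sbot W s" and ?u = "slft W s" and ?v = "srgt W s"
    let ?x = "vdom W ?u" and ?y = "vdom W ?v" and ?z = "vcod W ?u"
    have cells: "?f \<in> Hor W" "?g \<in> Hor W" "?u \<in> Ver W" "?v \<in> Ver W" "?x \<in> Ob W" "?y \<in> Ob W" "?z \<in> Ob W"
      "hdom W ?f = ?x" "hcod W ?f = ?y" "hdom W ?g = ?z" "hcod W ?g = vcod W ?v"
      using s by (simp_all add: W.cell_simps)
    note hr = h.end_rules(2-4)[simplified] v.end_rules(2-4)[simplified, unfolded ob]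
      h.trans_rules(1-3)[simplified] v.trans_rules(1-3)[simplified, unfolded ob]
    \<comment> \<open>The filler has three rows. The middle one is the image of \<open>s\<close> at
      the end \<open>e\<close>; the first passes from the ends \<open>a\<close>, \<open>b\<close> to
      \<open>e\<close>; the third passes from \<open>e\<close> to \<open>d\<close> on the left and
      is trivial on the right. Outer rows exist because passages between ends have
      companions.\<close>
    have row2: "\<exists>q. sq (h.end_mor e ?f) (v.end_mor e ?u) (v.end_mor e ?v) (h.end_mor e ?g) q"
    proof -
      have "sq (onhor H ?f) (onver H ?u) (onver H ?v) (onhor H ?g) (onsq H s)"
        "sq (onhor K ?f) (onver K ?u) (onver K ?v) (onhor K ?g) (onsq K s)"
        using HD(12-16)[OF s] KD(12-16)[OF s] by (simp_all add: square_with_def)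
      then show ?thesis
        by (auto simp: h.end_mor_def v.end_mor_def)
    qed
    let ?t = "h.end_mor b ?f \<cdot>h h.trans a b ?x"
    have "h.trans b e ?y \<cdot>h ?t = (h.trans b e ?y \<cdot>h h.end_mor b ?f) \<cdot>h h.trans a b ?x"
      using cells le by (intro hcmp_assoc) (simp_all add: hr)
    also have "\<dots> = (h.end_mor e ?f \<cdot>h h.trans b e ?x) \<cdot>h h.trans a b ?x"
      using h.trans_nat[of ?f b e] cells le by simp
    also have "\<dots> = h.end_mor e ?f \<cdot>h (h.trans b e ?x \<cdot>h h.trans a b ?x)"
      using cells le by (intro hcmp_assoc[symmetric]) (simp_all add: hr)
    also have "\<dots> = h.end_mor e ?f \<cdot>h h.trans a e ?x"
      using h.trans_rules(5)[of ?x a b e] cells le by simp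
    finally have row1: "\<exists>q. sq ?t (v.trans a e ?x) (v.trans b e ?y) (h.end_mor e ?f) q"
      using cells le
      by (intro companion_square_exists[OF comp comp]) (simp_all add: hr cell_simps)
    let ?b = "h.end_mor e ?g \<cdot>h h.trans d e ?z"
    have eo: "h.end_obj e (vcod W ?v) \<in> Ob D"
      using h.end_rules(1)[of "vcod W ?v" e] s by (simp add: W.cell_simps)
    have "?b \<cdot>h h.trans e d ?z = h.end_mor e ?g \<cdot>h (h.trans d e ?z \<cdot>h h.trans e d ?z)"
      using cells le by (intro hcmp_assoc[symmetric]) (simp_all add: hr)
    also have "\<dots> = hid D (h.end_obj e (vcod W ?v)) \<cdot>h h.end_mor e ?g"
      using h.trans_rules(5)[of ?z e d e] h.trans_rules(4)[of ?z e e] cells le by (simp add: hr cell_simps)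
    finally have row3: "\<exists>q. sq (h.end_mor e ?g) (v.trans e d ?z) (vid D (h.end_obj e (vcod W ?v))) ?b q"
      using cells le eo
      by (intro companion_square_exists[OF comp companion_hid]) (simp_all add: hr cell_simps)
    \<comment> \<open>The left sides of the three rows go through \<open>e\<close>. Naturality moves
      the passages together, and they compose to the direct passage from \<open>a\<close> to
      \<open>d\<close>, as the boundary demands.\<close>
    have "v.trans e d ?z \<cdot>v (v.end_mor e ?u \<cdot>v v.trans a e ?x) = (v.trans e d ?z \<cdot>v v.end_mor e ?u) \<cdot>v v.trans a e ?x"
      using cells le by (intro vcmp_assoc) (simp_all add: hr)
    also have "\<dots> = (v.end_mor d ?u \<cdot>v v.trans e d ?x) \<cdot>v v.trans a e ?x"
      using v.trans_nat[of ?u e d] cells le by simp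
    also have "\<dots> = v.end_mor d ?u \<cdot>v (v.trans e d ?x \<cdot>v v.trans a e ?x)"
      using cells le by (intro vcmp_assoc[symmetric]) (simp_all add: hr)
    also have "\<dots> = v.end_mor d ?u \<cdot>v v.trans a d ?x"
      using v.trans_rules(5)[of ?x a e d] cells le by simp
    finally have left: "v.trans e d ?z \<cdot>v (v.end_mor e ?u \<cdot>v v.trans a e ?x) = v.end_mor d ?u \<cdot>v v.trans a d ?x" .
    have right: "vid D (h.end_obj e (vcod W ?v)) \<cdot>v (v.end_mor e ?v \<cdot>v v.trans b e ?y) = v.end_mor e ?v \<cdot>v v.trans b e ?y"
      using cells le by (intro vcmp_vid_left) (simp_all add: hr cell_simps)
    obtain q1 q2 q3 where "sq ?t (v.trans a e ?x) (v.trans b e ?y) (h.end_mor e ?f) q1"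
      "sq (h.end_mor e ?f) (v.end_mor e ?u) (v.end_mor e ?v) (h.end_mor e ?g) q2"
      "sq (h.end_mor e ?g) (v.trans e d ?z) (vid D (h.end_obj e (vcod W ?v))) ?b q3"
      using row1 row2 row3 by blast
    from sq_vcmp[OF sq_vcmp[OF this(1,2)] this(3)]
    show "\<exists>q. sq (cmor h.cyl (stop (dbl_prod EEsq W) p)) (cmor v.cyl (slft (dbl_prod EEsq W) p))
        (cmor v.cyl (srgt (dbl_prod EEsq W) p)) (cmor h.cyl (sbot (dbl_prod EEsq W) p)) q"
      using cells by (auto simp: p_eq EEsq_simps left right)
  qed simp_all
  then obtain \<Phi> where \<Phi>: "double_functor \<Phi>" "dsrc \<Phi> = dbl_prod EEsq W" "dtgt \<Phi> = D"
    "onob \<Phi> = cobj h.cyl" "onhor \<Phi> = cmor h.cyl" "onver \<Phi> = cmor v.cyl" by blast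
  show ?thesis
    using \<Phi>(1-3) by (intro exI[of _ \<Phi>])
      (simp add: \<Phi> h.end_obj_def h.end_mor_def v.end_mor_def h.trans_def v.trans_def
        v.end_obj_def HD KD W.cell_simps cell_simps)
qed

end

section \<open>The cylinder between two fillers of a corner\<close>

context cgw_local begin

text \<open>Components that are identities on \<open>X\<close> make the cylinder constant there.
  Since squares are determined by boundaries, the required equalities of double functors are checked
  on objects and edges only.\<close>

lemma agree_ext_exists:
  assumes W: "double_category W" and i: "i = (id_dfun W)\<lparr>dsrc := full_subdbl W X\<rparr>"
    and H: "double_functor H" "dsrc H = W" "dtgt H = D"
    and K: "double_functor K" "dsrc K = W" "dtgt K = D"
    and HK: "dfun_eq (comp_dfun H i) (comp_dfun K i)"
    and \<theta>: "\<And>x. x \<in> Ob W \<Longrightarrow> iso_arrow (hcat D) (\<theta> x)"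
      "\<And>x. x \<in> Ob W \<Longrightarrow> hdom D (\<theta> x) = onob H x" "\<And>x. x \<in> Ob W \<Longrightarrow> hcod D (\<theta> x) = onob K x"
    and c: "\<And>x. x \<in> Ob W \<Longrightarrow> companion D (\<theta> x) (\<theta>' x)"
    and nat: "\<And>f. f \<in> Hor W \<Longrightarrow> onhor K f \<cdot>h \<theta> (hdom W f) = \<theta> (hcod W f) \<cdot>h onhor H f"
    and nat': "\<And>v. v \<in> Ver W \<Longrightarrow> onver K v \<cdot>v \<theta>' (vdom W v) = \<theta>' (vcod W v) \<cdot>v onver H v"
    and X: "\<And>x. x \<in> X \<Longrightarrow> \<theta> x = hid D (onob H x)" "\<And>x. x \<in> X \<Longrightarrow> \<theta>' x = vid D (onob H x)"
  shows "\<exists>\<Phi>. agree_ext i H K \<Phi>"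
proof -
  interpret W: double_category W by (rule W)
  note HD = double_functorD(3-)[OF H(1), unfolded H(2,3)]
  obtain \<Phi> where \<Phi>: "double_functor \<Phi>" "dsrc \<Phi> = dbl_prod EEsq W" "dtgt \<Phi> = D"
    and o: "\<And>x. onob \<Phi> (0, x) = onob H x" "\<And>x. onob \<Phi> (1, x) = onob K x"
    and h: "\<And>f. f \<in> Hor W \<Longrightarrow> onhor \<Phi> ((0, 0), f) = onhor H f"
      "\<And>f. f \<in> Hor W \<Longrightarrow> onhor \<Phi> ((1, 1), f) = onhor K f"
      "\<And>f. f \<in> Hor W \<Longrightarrow> onhor \<Phi> ((0, 1), f) = onhor K f \<cdot>h \<theta> (hdom W f)"
      "\<And>f. f \<in> Hor W \<Longrightarrow> onhor \<Phi> ((1, 0), f) = onhor H f \<cdot>h inv_arrow (hcat D) (\<theta> (hdom W f))"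
    and v: "\<And>f. f \<in> Ver W \<Longrightarrow> onver \<Phi> ((0, 0), f) = onver H f"
      "\<And>f. f \<in> Ver W \<Longrightarrow> onver \<Phi> ((1, 1), f) = onver K f"
      "\<And>f. f \<in> Ver W \<Longrightarrow> onver \<Phi> ((0, 1), f) = onver K f \<cdot>v \<theta>' (vdom W f)"
      "\<And>f. f \<in> Ver W \<Longrightarrow> onver \<Phi> ((1, 0), f) = onver H f \<cdot>v inv_arrow (vcat D) (\<theta>' (vdom W f))"
    using cylinder_functor[OF H K \<theta> c nat nat'] by blast
  have isel: "dsrc i = full_subdbl W X" "dtgt i = W" "onob i x = x" "onhor i f = f" "onver i u = u" for x f u
    by (simp_all add: i id_dfun_def)
  have fi: "double_functor i" unfolding i by (rule double_functor_full_incl[OF W])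
  have KH: "x \<in> Ob W \<Longrightarrow> x \<in> X \<Longrightarrow> onob K x = onob H x"
    "f \<in> Hor W \<Longrightarrow> hdom W f \<in> X \<Longrightarrow> hcod W f \<in> X \<Longrightarrow> onhor K f = onhor H f"
    "u \<in> Ver W \<Longrightarrow> vdom W u \<in> X \<Longrightarrow> vcod W u \<in> X \<Longrightarrow> onver K u = onver H u" for x f u
    using dfun_eqD(3-5)[OF HK] by (simp_all add: isel)
  have inv: "inv_arrow (hcat D) (hid D y) = hid D y" "inv_arrow (vcat D) (vid D y) = vid D y" if "y \<in> Ob D" for y
    using horizontal.inv_arrow_eq[OF horizontal.inverse_Idn, of y] vertical.inv_arrow_eq[OF vertical.inverse_Idn, of y] that
    by simp_all
  have at: "double_functor (comp_dfun \<Phi> (incl_at EEsq W e))" if "e \<le> 1" for e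
    by (rule double_functor_comp[OF double_functor_incl_at[OF double_category_EEsq W] \<Phi>(1)])
      (use that \<Phi> in \<open>simp_all add: EEsq_simps\<close>)
  have pi: "double_functor (prod_dfun (id_dfun EEsq) i)" "double_functor (prod_proj2 EEsq (dsrc i))"
    by (intro double_functor_prod_dfun double_functor_prod_proj2 double_functor_id double_category_EEsq fi
        double_functorD(1)[OF fi])+
  have f1: "double_functor (comp_dfun \<Phi> (prod_dfun (id_dfun EEsq) i))"
    by (rule double_functor_comp[OF pi(1) \<Phi>(1)]) (simp add: \<Phi> isel)
  have f2: "double_functor (comp_dfun (comp_dfun H i) (prod_proj2 EEsq (dsrc i)))"
    by (rule double_functor_comp[OF pi(2) double_functor_comp[OF fi H(1)]]) (simp_all add: H isel)
  have 3: "dfun_eq (comp_dfun \<Phi> (prod_dfun (id_dfun EEsq) i)) (comp_dfun (comp_dfun H i) (prod_proj2 EEsq (dsrc i)))"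
    by (rule functor_eqI[OF f1 _ f2])
      (auto simp: \<Phi> H isel EEsq_simps le_1_cases o h v KH X inv HD W.cell_simps cell_simps)
  have "dfun_eq (comp_dfun \<Phi> (incl_at EEsq W 0)) H"
    by (rule functor_eqI[OF at]) (use H in \<open>simp_all add: \<Phi> o h v EEsq_simps\<close>)
  moreover have "dfun_eq (comp_dfun \<Phi> (incl_at EEsq W 1)) K"
    by (rule functor_eqI[OF at]) (use K in \<open>simp_all add: \<Phi> o h v EEsq_simps\<close>)
  ultimately show ?thesis
    using \<Phi> 3 isel unfolding agree_ext_def by (intro exI[of _ \<Phi>]) simp
qed

text \<open>Every edge of the cylinder factors through its component
  \<open>((e, e'), hid W x)\<close> or \<open>((e, e'), vid W x)\<close>, at the domain and also at
  the codomain. The components are isomorphisms with companions, so a cylinder is recovered from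
  \<open>H\<close>, \<open>K\<close> and these.\<close>

lemma agree_ext_cells:
  assumes W: "double_category W" and i: "i = (id_dfun W)\<lparr>dsrc := full_subdbl W X\<rparr>"
    and H: "double_functor H" "dsrc H = W" "dtgt H = D" and K: "dtgt K = D"
    and \<Phi>: "agree_ext i H K \<Phi>"
  shows "double_functor \<Phi>" "dsrc \<Phi> = dbl_prod EEsq W" "dtgt \<Phi> = D"
    "x \<in> Ob W \<Longrightarrow> onob \<Phi> (0, x) = onob H x" "x \<in> Ob W \<Longrightarrow> onob \<Phi> (1, x) = onob K x"
    "f \<in> Hor W \<Longrightarrow> onhor \<Phi> ((0, 0), f) = onhor H f" "f \<in> Hor W \<Longrightarrow> onhor \<Phi> ((1, 1), f) = onhor K f"
    "v \<in> Ver W \<Longrightarrow> onver \<Phi> ((0, 0), v) = onver H v" "v \<in> Ver W \<Longrightarrow> onver \<Phi> ((1, 1), v) = onver K v"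
    "\<lbrakk>x \<in> Ob W; x \<in> X; e \<le> 1; e' \<le> 1\<rbrakk> \<Longrightarrow> onhor \<Phi> ((e, e'), hid W x) = hid D (onob H x)"
    "\<lbrakk>x \<in> Ob W; x \<in> X; e \<le> 1; e' \<le> 1\<rbrakk> \<Longrightarrow> onver \<Phi> ((e, e'), vid W x) = vid D (onob H x)"
    "\<lbrakk>f \<in> Hor W; e \<le> 1; e' \<le> 1\<rbrakk> \<Longrightarrow>
      onhor \<Phi> ((e, e'), f) = onhor \<Phi> ((e', e'), f) \<cdot>h onhor \<Phi> ((e, e'), hid W (hdom W f))"
    "\<lbrakk>f \<in> Hor W; e \<le> 1; e' \<le> 1\<rbrakk> \<Longrightarrow>
      onhor \<Phi> ((e, e'), f) = onhor \<Phi> ((e, e'), hid W (hcod W f)) \<cdot>h onhor \<Phi> ((e, e), f)"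
    "\<lbrakk>v \<in> Ver W; e \<le> 1; e' \<le> 1\<rbrakk> \<Longrightarrow>
      onver \<Phi> ((e, e'), v) = onver \<Phi> ((e', e'), v) \<cdot>v onver \<Phi> ((e, e'), vid W (vdom W v))"
    "\<lbrakk>v \<in> Ver W; e \<le> 1; e' \<le> 1\<rbrakk> \<Longrightarrow>
      onver \<Phi> ((e, e'), v) = onver \<Phi> ((e, e'), vid W (vcod W v)) \<cdot>v onver \<Phi> ((e, e), v)"
    "\<lbrakk>x \<in> Ob W; e \<le> 1; e' \<le> 1\<rbrakk> \<Longrightarrow>
      companion D (onhor \<Phi> ((e, e'), hid W x)) (onver \<Phi> ((e, e'), vid W x))"
    "\<lbrakk>x \<in> Ob W; e \<le> 1; e' \<le> 1\<rbrakk> \<Longrightarrow>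
      inverse_arrows (hcat D) (onhor \<Phi> ((e, e'), hid W x)) (onhor \<Phi> ((e', e), hid W x))"
    "\<lbrakk>x \<in> Ob W; e \<le> 1; e' \<le> 1\<rbrakk> \<Longrightarrow> onhor \<Phi> ((e, e'), hid W x) \<in> Hor D
      \<and> hdom D (onhor \<Phi> ((e, e'), hid W x)) = onob \<Phi> (e, x)
      \<and> hcod D (onhor \<Phi> ((e, e'), hid W x)) = onob \<Phi> (e', x)"
    "\<lbrakk>x \<in> Ob W; e \<le> 1; e' \<le> 1\<rbrakk> \<Longrightarrow> onver \<Phi> ((e, e'), vid W x) \<in> Ver D
      \<and> vdom D (onver \<Phi> ((e, e'), vid W x)) = onob \<Phi> (e, x)
      \<and> vcod D (onver \<Phi> ((e, e'), vid W x)) = onob \<Phi> (e', x)"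
proof -
  interpret W: double_category W by (rule W)
  have isel: "dsrc i = full_subdbl W X" "dtgt i = W" "onob i x = x" "onhor i f = f" "onver i u = u" for x f u
    by (simp_all add: i id_dfun_def)
  have \<Phi>': "double_functor \<Phi>" "dsrc \<Phi> = dbl_prod EEsq W"
    and \<Phi>0: "dfun_eq (comp_dfun \<Phi> (incl_at EEsq W 0)) H"
    and \<Phi>1: "dfun_eq (comp_dfun \<Phi> (incl_at EEsq W 1)) K"
    and \<Phi>A: "dfun_eq (comp_dfun \<Phi> (prod_dfun (id_dfun EEsq) i)) (comp_dfun (comp_dfun H i) (prod_proj2 EEsq (dsrc i)))"
    using \<Phi> by (simp_all add: agree_ext_def isel)
  then show "double_functor \<Phi>" "dsrc \<Phi> = dbl_prod EEsq W" by simp_all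
  show tgt: "dtgt \<Phi> = D" using dfun_eqD(2)[OF \<Phi>0] H by simp
  note PD = double_functorD(3-)[OF \<Phi>'(1), unfolded \<Phi>'(2) tgt]
  note HD = double_functorD(3-)[OF H(1), unfolded H(2,3)]
  show "x \<in> Ob W \<Longrightarrow> onob \<Phi> (0, x) = onob H x" "x \<in> Ob W \<Longrightarrow> onob \<Phi> (1, x) = onob K x"
    "f \<in> Hor W \<Longrightarrow> onhor \<Phi> ((0, 0), f) = onhor H f" "f \<in> Hor W \<Longrightarrow> onhor \<Phi> ((1, 1), f) = onhor K f"
    "v \<in> Ver W \<Longrightarrow> onver \<Phi> ((0, 0), v) = onver H v" "v \<in> Ver W \<Longrightarrow> onver \<Phi> ((1, 1), v) = onver K v"
    using dfun_eqD(3-5)[OF \<Phi>0] dfun_eqD(3-5)[OF \<Phi>1] by (simp_all add: EEsq_simps)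
  show "\<lbrakk>x \<in> Ob W; x \<in> X; e \<le> 1; e' \<le> 1\<rbrakk> \<Longrightarrow> onhor \<Phi> ((e, e'), hid W x) = hid D (onob H x)"
    "\<lbrakk>x \<in> Ob W; x \<in> X; e \<le> 1; e' \<le> 1\<rbrakk> \<Longrightarrow> onver \<Phi> ((e, e'), vid W x) = vid D (onob H x)"
    using dfun_eqD(4)[OF \<Phi>A, of "((e, e'), hid W x)"] dfun_eqD(5)[OF \<Phi>A, of "((e, e'), vid W x)"]
    by (simp_all add: EEsq_simps isel HD W.cell_simps)
  show "\<lbrakk>f \<in> Hor W; e \<le> 1; e' \<le> 1\<rbrakk> \<Longrightarrow>
      onhor \<Phi> ((e, e'), f) = onhor \<Phi> ((e', e'), f) \<cdot>h onhor \<Phi> ((e, e'), hid W (hdom W f))"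
    "\<lbrakk>f \<in> Hor W; e \<le> 1; e' \<le> 1\<rbrakk> \<Longrightarrow>
      onhor \<Phi> ((e, e'), f) = onhor \<Phi> ((e, e'), hid W (hcod W f)) \<cdot>h onhor \<Phi> ((e, e), f)"
    using PD(6)[of "((e, e'), hid W (hdom W f))" "((e', e'), f)"] PD(6)[of "((e, e), f)" "((e, e'), hid W (hcod W f))"]
    by (simp_all add: EEsq_simps W.cell_simps)
  show "\<lbrakk>v \<in> Ver W; e \<le> 1; e' \<le> 1\<rbrakk> \<Longrightarrow>
      onver \<Phi> ((e, e'), v) = onver \<Phi> ((e', e'), v) \<cdot>v onver \<Phi> ((e, e'), vid W (vdom W v))"
    "\<lbrakk>v \<in> Ver W; e \<le> 1; e' \<le> 1\<rbrakk> \<Longrightarrow>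
      onver \<Phi> ((e, e'), v) = onver \<Phi> ((e, e'), vid W (vcod W v)) \<cdot>v onver \<Phi> ((e, e), v)"
    using PD(11)[of "((e, e'), vid W (vdom W v))" "((e', e'), v)"] PD(11)[of "((e, e), v)" "((e, e'), vid W (vcod W v))"]
    by (simp_all add: EEsq_simps W.cell_simps)
  show hx: "onhor \<Phi> ((e, e'), hid W x) \<in> Hor D
      \<and> hdom D (onhor \<Phi> ((e, e'), hid W x)) = onob \<Phi> (e, x)
      \<and> hcod D (onhor \<Phi> ((e, e'), hid W x)) = onob \<Phi> (e', x)" if "x \<in> Ob W" "e \<le> 1" "e' \<le> 1"
    using PD(2-4)[of "((e, e'), hid W x)"] that by (simp add: EEsq_simps W.cell_simps)
  show vx: "onver \<Phi> ((e, e'), vid W x) \<in> Ver D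
      \<and> vdom D (onver \<Phi> ((e, e'), vid W x)) = onob \<Phi> (e, x)
      \<and> vcod D (onver \<Phi> ((e, e'), vid W x)) = onob \<Phi> (e', x)" if "x \<in> Ob W" "e \<le> 1" "e' \<le> 1"
    using PD(7-9)[of "((e, e'), vid W x)"] that by (simp add: EEsq_simps W.cell_simps)
  have hd: "onhor \<Phi> ((e, e), hid W x) = hid D (onob \<Phi> (e, x))"
    "onver \<Phi> ((e, e), vid W x) = vid D (onob \<Phi> (e, x))" if "x \<in> Ob W" "e \<le> 1" for e x
    using PD(5,10)[of "(e, x)"] that by (simp_all add: EEsq_simps)
  show "inverse_arrows (hcat D) (onhor \<Phi> ((e, e'), hid W x)) (onhor \<Phi> ((e', e), hid W x))"
    if "x \<in> Ob W" "e \<le> 1" "e' \<le> 1"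
    using that hx PD(2-4)[of "((e', e), hid W x)"] hd[of x e] hd[of x e']
      PD(6)[of "((e, e'), hid W x)" "((e', e), hid W x)"] PD(6)[of "((e', e), hid W x)" "((e, e'), hid W x)"]
    unfolding inverse_arrows_def by (simp add: EEsq_simps W.cell_simps)
  show "companion D (onhor \<Phi> ((e, e'), hid W x)) (onver \<Phi> ((e, e'), vid W x))"
    if x: "x \<in> Ob W" "e \<le> 1" "e' \<le> 1"
  proof -
    let ?s = "(((e, e'), (e, e'), (e', e'), (e', e')), sqhid W (vid W x))"
      and ?t = "(((e, e), (e, e), (e, e'), (e, e')), sqhid W (vid W x))"
    have "?s \<in> Sq (dbl_prod EEsq W)" "?t \<in> Sq (dbl_prod EEsq W)"
      using x by (simp_all add: EEsq_simps W.cell_simps)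
    from PD(12-16)[OF this(1)] PD(12-16)[OF this(2)]
    have "sq (onhor \<Phi> ((e, e'), hid W x)) (onver \<Phi> ((e, e'), vid W x)) (vid D (onob \<Phi> (e', x))) (hid D (onob \<Phi> (e', x))) (onsq \<Phi> ?s)"
      "sq (hid D (onob \<Phi> (e, x))) (vid D (onob \<Phi> (e, x))) (onver \<Phi> ((e, e'), vid W x)) (onhor \<Phi> ((e, e'), hid W x)) (onsq \<Phi> ?t)"
      using x hd by (simp_all add: square_with_def EEsq_simps W.cell_simps)
    then show ?thesis
      unfolding companion_def using hx[OF x] vx[OF x] by auto
  qed
qed

text \<open>An object outside \<open>X\<close> has an edge into \<open>X\<close>, where the
  component is an identity. Naturality along this edge and monicity of its image under
  \<open>K\<close> fix the component; a vertical edge fixes the vertical component, and thereby its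
  horizontal companion.\<close>

lemma agree_ext_unique:
  assumes W: "double_category W" and i: "i = (id_dfun W)\<lparr>dsrc := full_subdbl W X\<rparr>"
    and H: "double_functor H" "dsrc H = W" "dtgt H = D" and K: "double_functor K" "dsrc K = W" "dtgt K = D"
    and \<Phi>: "agree_ext i H K \<Phi>" and \<Phi>': "agree_ext i H K \<Phi>'"
    and X: "\<And>x. x \<in> Ob W \<Longrightarrow> x \<notin> X \<Longrightarrow> (\<exists>f \<in> Hor W. hdom W f = x \<and> hcod W f \<in> X)
      \<or> (\<exists>v \<in> Ver W. vdom W v = x \<and> vcod W v \<in> X)"
  shows "dfun_eq \<Phi> \<Phi>'"
proof -
  interpret W: double_category W by (rule W)
  note HD = double_functorD(3-)[OF H(1), unfolded H(2,3)]
  note KD = double_functorD(3-)[OF K(1), unfolded K(2,3)]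
  note c = agree_ext_cells[OF W i H K(3) \<Phi>] and c' = agree_ext_cells[OF W i H K(3) \<Phi>']
  have h01: "onhor \<Phi> ((0, 1), hid W x) = onhor \<Phi>' ((0, 1), hid W x)" if x: "x \<in> Ob W" for x
  proof (cases "x \<in> X")
    case True
    then show ?thesis using c(10) c'(10) x by simp
  next
    case False
    consider f where "f \<in> Hor W" "hdom W f = x" "hcod W f \<in> X" | v where "v \<in> Ver W" "vdom W v = x" "vcod W v \<in> X"
      using X[OF x False] by blast
    then show ?thesis
    proof cases
      case 1
      have cod: "hcod W f \<in> Ob W" using 1 by (simp add: W.cell_simps)
      \<comment> \<open>By naturality both sides equal \<open>onhor H f\<close>, the component at
        the codomain being an identity.\<close>
      have "onhor K f \<cdot>h onhor \<Phi> ((0, 1), hid W x) = onhor K f \<cdot>h onhor \<Phi>' ((0, 1), hid W x)"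
        using c(12)[OF 1(1), of 0 1] c(13)[OF 1(1), of 0 1] c'(12)[OF 1(1), of 0 1] c'(13)[OF 1(1), of 0 1]
          c(10)[OF cod 1(3), of 0 1] c'(10)[OF cod 1(3), of 0 1] c(6,7)[OF 1(1)] c'(6,7)[OF 1(1)] 1(2)
        by simp
      then show ?thesis
        using horizontal.mono_cancel[OF mono_hor[OF KD(2)[OF 1(1)]], of "onhor \<Phi> ((0, 1), hid W x)" "onhor \<Phi>' ((0, 1), hid W x)"]
          c(18)[OF x, of 0 1] c'(18)[OF x, of 0 1] c(4,5)[OF x] c'(4,5)[OF x] KD(3)[OF 1(1)] 1(2) by simp
    next
      case 2
      have cod: "vcod W v \<in> Ob W" using 2 by (simp add: W.cell_simps)
      have "onver K v \<cdot>v onver \<Phi> ((0, 1), vid W x) = onver K v \<cdot>v onver \<Phi>' ((0, 1), vid W x)"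
        using c(14)[OF 2(1), of 0 1] c(15)[OF 2(1), of 0 1] c'(14)[OF 2(1), of 0 1] c'(15)[OF 2(1), of 0 1]
          c(11)[OF cod 2(3), of 0 1] c'(11)[OF cod 2(3), of 0 1] c(8,9)[OF 2(1)] c'(8,9)[OF 2(1)] 2(2)
        by simp
      then have "onver \<Phi> ((0, 1), vid W x) = onver \<Phi>' ((0, 1), vid W x)"
        using vertical.mono_cancel[OF mono_ver[OF KD(7)[OF 2(1)]], of "onver \<Phi> ((0, 1), vid W x)" "onver \<Phi>' ((0, 1), vid W x)"]
          c(19)[OF x, of 0 1] c'(19)[OF x, of 0 1] c(4,5)[OF x] c'(4,5)[OF x] KD(8)[OF 2(1)] 2(2) by simp
      then show ?thesis
        using c(16)[OF x, of 0 1] c'(16)[OF x, of 0 1] companion_unique' by simp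
    qed
  qed
  have hid: "onhor \<Phi> ((e, e'), hid W x) = onhor \<Phi>' ((e, e'), hid W x)" if x: "x \<in> Ob W" and e: "e \<le> 1" "e' \<le> 1" for e e' x
  proof -
    have "onhor \<Phi> ((1, 0), hid W x) = onhor \<Phi>' ((1, 0), hid W x)"
      using c(17)[OF x, of 0 1] c'(17)[OF x, of 0 1] h01[OF x] horizontal.inverse_arrows_unique by simp
    moreover have "hid W x \<in> Hor W" using x by (simp add: W.cell_simps)
    ultimately show ?thesis
      using e h01[OF x] c(6,7) c'(6,7) by (auto simp: le_1_cases)
  qed
  have hor: "onhor \<Phi> ((e, e'), f) = onhor \<Phi>' ((e, e'), f)" if f: "f \<in> Hor W" and e: "e \<le> 1" "e' \<le> 1" for e e' f
  proof -
    have "onhor \<Phi> ((e', e'), f) = onhor \<Phi>' ((e', e'), f)"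
      using e(2) c(6,7)[OF f] c'(6,7)[OF f] by (auto simp: le_1_cases)
    then show ?thesis
      using c(12)[OF f e] c'(12)[OF f e] hid[OF _ e, of "hdom W f"] f by (simp add: W.cell_simps)
  qed
  have ver: "onver \<Phi> ((e, e'), v) = onver \<Phi>' ((e, e'), v)" if v: "v \<in> Ver W" and e: "e \<le> 1" "e' \<le> 1" for e e' v
  proof -
    have x: "vdom W v \<in> Ob W" using v by (simp add: W.cell_simps)
    have "onver \<Phi> ((e, e'), vid W (vdom W v)) = onver \<Phi>' ((e, e'), vid W (vdom W v))"
      using c(16)[OF x e] c'(16)[OF x e] hid[OF x e] companion_unique by simp
    moreover have "onver \<Phi> ((e', e'), v) = onver \<Phi>' ((e', e'), v)"
      using e(2) c(8,9)[OF v] c'(8,9)[OF v] by (auto simp: le_1_cases)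
    ultimately show ?thesis
      using c(14)[OF v e] c'(14)[OF v e] by simp
  qed
  show ?thesis
  proof (rule functor_eqI)
    show "onob \<Phi> p = onob \<Phi>' p" if "p \<in> Ob (dsrc \<Phi>)" for p
      using that c(2,4,5) c'(4,5) by (auto simp: EEsq_simps le_1_cases)
    show "onhor \<Phi> p = onhor \<Phi>' p" if "p \<in> Hor (dsrc \<Phi>)" for p
      using that c(2) hor by (auto simp: EEsq_simps)
    show "onver \<Phi> p = onver \<Phi>' p" if "p \<in> Ver (dsrc \<Phi>)" for p
      using that c(2) ver by (auto simp: EEsq_simps)
  qed (use c(1-3) c'(1-3) in simp_all)
qed

lemma corner_agree_cells:
  assumes HK: "dfun_eq (comp_dfun H ((id_dfun W)\<lparr>dsrc := full_subdbl W X\<rparr>)) (comp_dfun K ((id_dfun W)\<lparr>dsrc := full_subdbl W X\<rparr>))"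
  shows "x \<in> Ob W \<Longrightarrow> x \<in> X \<Longrightarrow> onob K x = onob H x"
    "f \<in> Hor W \<Longrightarrow> hdom W f \<in> X \<Longrightarrow> hcod W f \<in> X \<Longrightarrow> onhor K f = onhor H f"
    "u \<in> Ver W \<Longrightarrow> vdom W u \<in> X \<Longrightarrow> vcod W u \<in> X \<Longrightarrow> onver K u = onver H u"
  using dfun_eqD(3-5)[OF HK] by (simp_all add: id_dfun_def)

text \<open>The square \<open>w\<close> comparing the two fillers has an invertible left side with a
  companion. These are the components at the bottom left object; all other components are
  identities.\<close>

lemma agree_ext_trcor_exists:
  assumes H: "double_functor H" "dsrc H = walking_square" "dtgt H = D"
    and K: "double_functor K" "dsrc K = walking_square" "dtgt K = D"
    and HK: "dfun_eq (comp_dfun H trcor) (comp_dfun K trcor)"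
  shows "\<exists>\<Phi>. agree_ext trcor H K \<Phi>"
proof -
  let ?W = walking_square and ?X = "{(0, 0), (1, 0), (1, 1)} :: (nat \<times> nat) set"
  note W = double_category_walking_square
  note KH = corner_agree_cells[OF HK[unfolded trcor_def]]
  note HD = double_functorD(3-)[OF H(1), unfolded H(2) H(3)]
  note KD = double_functorD(3-)[OF K(1), unfolded K(2) K(3)]
  let ?s = "onsq H ((0, 1), 0, 1)" and ?s' = "onsq K ((0, 1), 0, 1)"
  have s: "?s \<in> Sq D" "stop D ?s = onhor H ((0, 1), 0)" "sbot D ?s = onhor H ((0, 1), 1)"
    "slft D ?s = onver H (0, 0, 1)" "srgt D ?s = onver H (1, 0, 1)"
    and s': "?s' \<in> Sq D" "stop D ?s' = onhor K ((0, 1), 0)" "sbot D ?s' = onhor K ((0, 1), 1)"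
    "slft D ?s' = onver K (0, 0, 1)" "srgt D ?s' = onver K (1, 0, 1)"
    using HD(12-16)[of "((0, 1), 0, 1)"] KD(12-16)[of "((0, 1), 0, 1)"] by (simp_all add: walking_square_simps)
  have eq: "onhor K ((0, 1), 0) = onhor H ((0, 1), 0)" "onver K (1, 0, 1) = onver H (1, 0, 1)"
    using KH(2)[of "((0, 1), 0)"] KH(3)[of "(1, 0, 1)"] by (simp_all add: walking_square_simps)
  obtain w where w: "w \<in> Sq D" "stop D w = sbot D ?s" "sbot D w = sbot D ?s'" "srgt D w = vid D (vcod D (srgt D ?s))"
    "iso_arrow (vcat D) (slft D w)" "sqvcmp D w ?s = ?s'"
    using agree_tr[OF s(1) s'(1)] s s' eq by auto
  obtain u where u: "companion D u (slft D w)" using ver_iso_companion w by blast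
  have ob: "onob H (x, y) \<in> Ob D" if "x \<le> 1" "y \<le> 1" for x y
    using HD(1)[of "(x, y)"] that by (simp add: walking_square_simps)
  have ends: "hdom D (sbot D ?s) = onob H (0, 1)" "hdom D (sbot D ?s') = onob K (0, 1)"
    "vcod D (srgt D ?s) = onob H (1, 1)" "hcod D (sbot D ?s) = onob H (1, 1)"
    using HD(3,4)[of "((0, 1), 1)"] KD(3)[of "((0, 1), 1)"] HD(9)[of "(1, 0, 1)"] s s'
    by (simp_all add: walking_square_simps)
  have wl: "vdom D (slft D w) = onob H (0, 1)" "vcod D (slft D w) = onob K (0, 1)"
    using corner_tl[OF w(1)] corner_bl[OF w(1)] w ends by simp_all
  have wsq: "sq (onhor H ((0, 1), 1)) (slft D w) (vid D (onob H (1, 1))) (onhor K ((0, 1), 1)) w"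
    using w s s' ends by (simp add: square_with_def)
  \<comment> \<open>Naturality along the bottom edge is the equation obtained by bending
    \<open>w\<close>.\<close>
  have bot: "onhor K ((0, 1), 1) \<cdot>h u = onhor H ((0, 1), 1)"
    using companion_square_bend(1)[OF wsq u companion_hid] ob ends s sbot_in[OF s(1)] by (simp add: cell_simps)
  \<comment> \<open>Naturality along the left edge is read off from the left side of the equation
    saying that \<open>w\<close> below the first filler is the second.\<close>
  have left: "slft D w \<cdot>v onver H (0, 0, 1) = onver K (0, 0, 1)"
    using w s s' slft_sqvcmp[of ?s w] by simp
  define \<theta> where "\<theta> x = (if x = (0, 1) then u else hid D (onob H x))" for x
  define \<theta>' where "\<theta>' x = (if x = (0, 1) then slft D w else vid D (onob H x))" for x
  have u': "hdom D u = onob H (0, 1)" "hcod D u = onob K (0, 1)" "u \<in> Hor D"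
    using u wl by (simp_all add: companion_def)
  have Wob: "x = (0, 0) \<or> x = (1, 0) \<or> x = (0, 1) \<or> x = (1, 1)" if "x \<in> Ob ?W" for x
    using that by (auto simp: walking_square_simps le_1_cases)
  have K_ob: "onob K (0, 0) = onob H (0, 0)" "onob K (1, 0) = onob H (1, 0)" "onob K (1, 1) = onob H (1, 1)"
    using KH(1) by (simp_all add: walking_square_simps)
  show ?thesis
  proof (rule agree_ext_exists[OF W trcor_def H(1) H(2) H(3) K(1) K(2) K(3) HK, where \<theta> = \<theta> and \<theta>' = \<theta>'])
    have th: "iso_arrow (hcat D) (\<theta> x) \<and> hdom D (\<theta> x) = onob H x \<and> hcod D (\<theta> x) = onob K x
      \<and> companion D (\<theta> x) (\<theta>' x)" if x: "x \<in> Ob ?W" for x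
    proof (cases "x = (0, 1)")
      case True
      then show ?thesis using u u' companion_iso'[OF u w(5)] by (simp add: \<theta>_def \<theta>'_def)
    next
      case False
      then have "onob K x = onob H x" "onob H x \<in> Ob D"
        using Wob[OF x] K_ob HD(1)[OF x] by auto
      then show ?thesis
        using False companion_hid[of "onob H x"] horizontal.iso_Idn[of "onob H x"]
        by (simp add: \<theta>_def \<theta>'_def cell_simps)
    qed
    then show "iso_arrow (hcat D) (\<theta> x)" "hdom D (\<theta> x) = onob H x" "hcod D (\<theta> x) = onob K x"
      "companion D (\<theta> x) (\<theta>' x)" if "x \<in> Ob ?W" for x
      using that by simp_all
    have X: "x \<noteq> (0, 1)" if "x \<in> ?X" for x
      using that by (elim insertE emptyE) simp_all
    show "\<theta> x = hid D (onob H x)" if "x \<in> ?X" for x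
      using X[OF that] by (simp add: \<theta>_def)
    show "\<theta>' x = vid D (onob H x)" if "x \<in> ?X" for x
      using X[OF that] by (simp add: \<theta>'_def)
    have thv: "\<theta>' x \<in> Ver D \<and> vdom D (\<theta>' x) = onob H x \<and> vcod D (\<theta>' x) = onob K x \<and> \<theta> x \<in> Hor D"
      if "x \<in> Ob ?W" for x
      using th[OF that] unfolding companion_def by metis
    show "onhor K f \<cdot>h \<theta> (hdom ?W f) = \<theta> (hcod ?W f) \<cdot>h onhor H f" if f: "f \<in> Hor ?W" for f
    proof -
      obtain a b y where f_eq: "f = ((a, b), y)" by (metis surj_pair)
      consider "a = b" "(a, y) \<in> Ob ?W" | "f = ((0, 1), 0)" | "f = ((0, 1), 1)"
        using f by (auto simp: f_eq walking_square_simps le_1_cases)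
      then show ?thesis
      proof cases
        case 1
        then show ?thesis
          using HD(5)[OF 1(2)] KD(5)[OF 1(2)] th[OF 1(2)] thv[OF 1(2)]
          by (simp add: f_eq walking_square_simps(5-12) cell_simps)
      next
        case 2
        then show ?thesis
          using eq ob HD(2-4)[of "((0, 1), 0)"]
          by (simp add: walking_square_simps \<theta>_def cell_simps)
      next
        case 3
        then show ?thesis
          using bot ob HD(2-4)[of "((0, 1), 1)"]
          by (simp add: walking_square_simps \<theta>_def cell_simps)
      qed
    qed
    show "onver K f \<cdot>v \<theta>' (vdom ?W f) = \<theta>' (vcod ?W f) \<cdot>v onver H f" if f: "f \<in> Ver ?W" for f
    proof -
      obtain x a b where f_eq: "f = (x, a, b)" by (metis surj_pair)
      consider "a = b" "(x, a) \<in> Ob ?W" | "f = (0, 0, 1)" | "f = (1, 0, 1)"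
        using f by (auto simp: f_eq walking_square_simps le_1_cases)
      then show ?thesis
      proof cases
        case 1
        then show ?thesis
          using HD(10)[OF 1(2)] KD(10)[OF 1(2)] thv[OF 1(2)]
          by (simp add: f_eq walking_square_simps(5-12) cell_simps)
      next
        case 2
        then show ?thesis
          using left wl K_ob slft_in[OF w(1)] ob KD(7-9)[of "(0, 0, 1)"]
          by (simp add: walking_square_simps \<theta>'_def cell_simps)
      next
        case 3
        then show ?thesis
          using eq ob HD(7-9)[of "(1, 0, 1)"]
          by (simp add: walking_square_simps \<theta>'_def cell_simps)
      qed
    qed
  qed
qed

lemma agree_ext_trcor_unique:
  assumes H: "double_functor H" "dsrc H = walking_square" "dtgt H = D"
    and K: "double_functor K" "dsrc K = walking_square" "dtgt K = D"
    and "agree_ext trcor H K \<Phi>" "agree_ext trcor H K \<Phi>'"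
  shows "dfun_eq \<Phi> \<Phi>'"
proof (rule agree_ext_unique[OF double_category_walking_square trcor_def H K assms(7,8)])
  let ?W = walking_square and ?X = "{(0, 0), (1, 0), (1, 1)} :: (nat \<times> nat) set"
  fix x assume "x \<in> Ob ?W" "x \<notin> ?X"
  then have "x = (0, 1)" by (auto simp: walking_square_simps le_1_cases)
  \<comment> \<open>The bottom edge leads from the only object outside the corner into the
    corner.\<close>
  then show "(\<exists>f\<in>Hor ?W. hdom ?W f = x \<and> hcod ?W f \<in> ?X) \<or> (\<exists>v\<in>Ver ?W. vdom ?W v = x \<and> vcod ?W v \<in> ?X)"
    by (intro disjI1 bexI[of _ "((0, 1), 1)"]) (simp_all add: walking_square_simps)
qed

lemma strictly_local_agree_trcor: "strictly_local_wrt D (agree trcor)"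
  by (rule agree_fun.strictly_local_if_agree_ext)
    (auto simp: agree_fun_def double_functor_corners intro: agree_ext_trcor_exists agree_ext_trcor_unique)

text \<open>Reflection along the diagonal turns the data into data for \<open>trcor\<close> in the
  transpose, which again satisfies \<open>cgw_local\<close>; the cylinder obtained there is
  reflected back.\<close>

lemma strictly_local_agree_blcor: "strictly_local_wrt D (agree blcor)"
proof (rule agree_fun.strictly_local_if_agree_ext)
  show "agree_fun blcor" by unfold_locales (rule double_functor_corners)
  interpret T: cgw_local "transpose D" by (rule cgw_local_transpose)
  have swap_corners: "(x, y) \<in> {(0, 0), (1, 0), (1, 1)} \<longleftrightarrow> (y, x) \<in> {(0, 0), (0, 1), (1, 1)}" for x y :: nat
    by auto
  have swap_corners': "(x, y) \<in> {(0, 0), (0, 1), (1, 1)} \<longleftrightarrow> (y, x) \<in> {(0, 0), (1, 0), (1, 1)}" for x y :: nat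
    by auto
  fix H K :: "(nat \<times> nat, (nat \<times> nat) \<times> nat, nat \<times> (nat \<times> nat), (nat \<times> nat) \<times> (nat \<times> nat), 'a, 'b, 'c, 'd) dblfun"
  assume H: "double_functor H" "dsrc H = dtgt blcor" "dtgt H = D"
    and K: "double_functor K" "dsrc K = dtgt blcor" "dtgt K = D"
    and HK: "dfun_eq (comp_dfun H blcor) (comp_dfun K blcor)"
  have HW: "dsrc H = walking_square" and KW: "dsrc K = walking_square" using H K by simp_all
  note flips = double_functor_flip[OF H(1) HW] flip_simps(1) double_functor_flip[OF K(1) KW] flip_simps(1)
  have tgt: "dtgt (flip H) = transpose D" "dtgt (flip K) = transpose D" using H K by simp_all
  show "\<exists>\<Phi>. agree_ext blcor H K \<Phi>"
  proof -
    obtain \<Phi> where "agree_ext trcor (flip H) (flip K) \<Phi>"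
      using T.agree_ext_trcor_exists[OF flips(1,2) tgt(1) flips(3,4) tgt(2)
        flip_restrict[OF blcor_def trcor_def swap_corners HK]] by blast
    from flip_agree_ext[OF trcor_def blcor_def swap_corners' _ _ this] show ?thesis
      using flip_flip[OF HW] flip_flip[OF KW] by auto
  qed
  fix \<Phi> \<Phi>' assume \<Phi>: "agree_ext blcor H K \<Phi>" "agree_ext blcor H K \<Phi>'"
  note f = flip_agree_ext[OF blcor_def trcor_def swap_corners HW KW]
  have "dfun_eq (flip_cyl \<Phi>) (flip_cyl \<Phi>')"
    by (rule T.agree_ext_trcor_unique[OF flips(1,2) tgt(1) flips(3,4) tgt(2) f[OF \<Phi>(1)] f[OF \<Phi>(2)]])
  \<comment> \<open>Reflection is an involution, so equality of the reflected cylinders is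
    transported back by reflecting once more.\<close>
  then have "dfun_eq (flip_cyl (flip_cyl \<Phi>)) (flip_cyl (flip_cyl \<Phi>'))"
    unfolding flip_cyl_def[of "flip_cyl _"]
    by (intro dfun_eq_comp double_functor_prod_dfun double_functor_swap dfun_eq_refl)
      (simp_all add: transpose_dbl_prod)
  then show "dfun_eq \<Phi> \<Phi>'"
    using \<Phi> by (simp add: agree_ext_def flip_cyl_flip_cyl)
qed

end

theorem corollary5p18:
  fixes D :: "('o, 'h, 'v, 's) dblcat"
  assumes "double_category D"
    and "left_pointed D"
  shows "admits_cgw_structure D \<longleftrightarrow>
     (local_wrt D trcor \<and> local_wrt D blcor
      \<and> local_wrt D (HH_fun mono_fun) \<and> local_wrt D (VV_fun mono_fun))
   \<and> (strictly_local_wrt D trunc_h \<and> strictly_local_wrt D trunc_v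
      \<and> strictly_local_wrt D hiso \<and> strictly_local_wrt D viso
      \<and> strictly_local_wrt D (agree trcor) \<and> strictly_local_wrt D (agree blcor))"
  (is "_ \<longleftrightarrow> ?local")
proof
  assume "admits_cgw_structure D"
  then have "cgw_local D"
    using cgw_local_if_cgw_structure unfolding admits_cgw_structure_def by metis
  then interpret cgw_local D .
  interpret T: cgw_local "transpose D" by (rule cgw_local_transpose)
  \<comment> \<open>These two test functors are transposes of horizontal ones, so their locality is
    that of the horizontal ones in \<open>transpose D\<close>.\<close>
  have "local_wrt D (VV_fun mono_fun)" "strictly_local_wrt D trunc_v"
    using T.local_mono T.strictly_local_trunc_h local_wrt_transpose[of "transpose D" "HH_fun mono_fun"]
      strictly_local_wrt_transpose[of "transpose D" trunc_h] by (simp_all add: VV_fun_def trunc_v_def)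
  then show ?local
    using local_trcor local_blcor local_mono strictly_local_trunc_h strictly_local_hiso strictly_local_viso
      strictly_local_agree_trcor strictly_local_agree_blcor by blast
next
  assume ?local
  then have "cgw_local D"
    using double_category.cgw_local_if_local[OF assms(1)] unfolding strictly_local_wrt_def by blast
  then interpret cgw_local D .
  show "admits_cgw_structure D"
    using assms(2) admits_cgw_structure unfolding left_pointed_def by blast
qed

end
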